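(* (1) Let $(A,G,\alpha)$ and $(B,G,\beta)$ be continuous $C^*$-dynamical systems. Every continuous strict positive equivariant $C^*$-correspondence from $(A,G,\alpha)$ to $(B,G,\beta)$ determines and is determined by (i.e. the two kinds of data are in one-to-one correspondence, in the manner specified in the context) a unitary valued topological functor $\mathcal{F}:BG\to\mathrm{PosCor}_{*\text{-alg}}(A)$ such that (a) $\mathcal{F}(\mathrm{pt})=(E,\phi)$ is a strict positive $C^*$-correspondence from $A$ to $B$; (b) for all $g\in G$, $\mathcal{F}(g)=(\mathrm{inc}\circ\beta_g,(\eta_g,\alpha_g))$. (2) Let $(A,G,\alpha)$ and $(B,G,\beta)$ be $C^*$-dynamical systems. Every strict positive equivariant $C^*$-correspondence from $(A,G,\alpha)$ to $(B,G,\beta)$ determines and is determined by (in the same sense) a unitary valued functor $\mathcal{F}:BG\to\mathrm{PosCor}_{*\text{-alg}}(A)$ such that (a) $\mathcal{F}(\mathrm{pt})=(E,\phi)$ is a strict positive $C^*$-correspondence from $A$ to $B$; (b) for all $g\in G$, $\mathcal{F}(g)=(\mathrm{inc}\circ\beta_g,(\eta_g,\alpha_g))$.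
   Context: Hilbert modules are right modules with inner product linear in the second variable; $\mathcal{L}(E_1,E_2)$ is the set of adjointable maps, $\mathcal{L}(E)=\mathcal{L}(E,E)$, and $\mathcal{B}(E_1,E_2)$ the bounded $\mathbb{C}$-linear maps. A completely positive map $\phi:A\to\mathcal{L}(E)$ is strict if there is an approximate unit $(a_\lambda)$ of $A$ such that $(\phi(a_\lambda))$ is Cauchy in the topology on $\mathcal{L}(E)$ generated by the seminorms $T\mapsto\|Tx\|$ and $T\mapsto\|T^*x\|$. A strict positive $C^*$-correspondence from $A$ to $B$ is $(E,\phi)$ with $E$ a Hilbert $B$-module and $\phi:A\to\mathcal{L}(E)$ strict completely positive. $M(C)=\mathcal{L}(C)$ is the multiplier algebra, $\mathrm{inc}:B\to M(B)$ the inclusion; $\rho:B\to M(C)$ is non-degenerate if $\rho(B)C$ spans a dense subspace of $C$, and then $\tilde\rho:M(B)\to M(C)$ is its unique extension. Interior tensor product: $E\otimes_\rho C$ is the completion of $(E\otimes_{\mathrm{alg}}C)/\langle xb\otimes c-x\otimes\rho(b)c\rangle$ for $\langle x_1\dot\otimes c_1,x_2\dot\otimes c_2\rangle=c_1^*\rho(\langle x_1,x_2\rangle)c_2$; $x\dot\otimes c$ is the class of $x\otimes c$; $(\phi\otimes_\rho 1_C)(a)(x\dot\otimes c)=\phi(a)x\dot\otimes c$. The category $\mathrm{PosCor}_{*\text{-alg}}(A)$: objects are pairs $(E_B,\phi)$ with $E_B$ a Hilbert $B$-module for some $C^*$-algebra $B$ and $\phi:A\to\mathcal{L}(E_B)$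 strict completely positive. A morphism $(E_B,\phi)\to(E_C,\psi)$ is $(\rho,(\eta,\alpha))$ with $\rho:B\to M(C)$ a non-degenerate $*$-homomorphism satisfying $\rho(B)\subset C$, $\eta\in\mathcal{L}(E_B\otimes_\rho C,E_C)$ and $\alpha$ a $*$-automorphism of $A$ with $\psi(\alpha(a))\circ\eta=\eta\circ(\phi\otimes_\rho 1_C)(a)$ for all $a\in A$. Composition: $(\rho_2,(\eta_2,\alpha_2))\circ(\rho_1,(\eta_1,\alpha_1))=(\tilde\rho_2\circ\rho_1,(\eta_2\circ\hat\eta_1\circ U^{-1},\alpha_2\circ\alpha_1))$, where $\hat\eta_1(z\dot\otimes b_3)=\eta_1(z)\dot\otimes b_3$ and $U:(E_{B_1}\otimes_{\rho_1}B_2)\otimes_{\rho_2}B_3\to E_{B_1}\otimes_{\tilde\rho_2\circ\rho_1}B_3$ is the unitary $U((x\dot\otimes b_2)\dot\otimes b_3)=x\dot\otimes\rho_2(b_2)b_3$. The identity of $(E_B,\phi)$ is $(\mathrm{inc},(\iota,1_A))$ with $\iota(x\dot\otimes b)=xb$. Topology on hom-sets: for non-degenerate $\rho:B\to M(C)$ with $\rho(B)\subset C$, $V_\rho:E_B\to E_B\otimes_\rho C$ is the $\mathbb{C}$-linear contraction $V_\rho(x)=\lim_\lambda x\dot\otimes c_\lambda$ for any approximate unit $(c_\lambda)$ of $C$. $\mathrm{Hom}((E_B,\phi),(E_C,\psi))$ in $\mathrm{PosCor}_{*\text{-alg}}(A)$ has the topology generated by the pseudo-metrics ($b\in B$, $x\in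 E_B$, $a\in A$) $$d_{b,x,a}((\rho,(\eta,\alpha)),(\rho',(\xi,\alpha')))=\|\rho(b)-\rho'(b)\|+\|\eta V_\rho x-\xi V_{\rho'}x\|+\|\alpha(a)-\alpha'(a)\|.$$ $C^*$-dynamical systems: $(A,G,\alpha)$ with $G$ a group and $\alpha:G\to\mathrm{Aut}_{*\text{-alg}}(A)$ a group homomorphism into the $*$-automorphisms of $A$; it is continuous if $G$ is a topological group and $\alpha$ is continuous for the point-norm topology. (No local compactness or Hausdorff assumption on $G$.) $\beta$-adjointable maps: for $\beta\in\mathrm{Aut}_{*\text{-alg}}(B)$ and Hilbert $B$-modules $E_1,E_2$, a bounded $\mathbb{C}$-linear $f:E_1\to E_2$ is $\beta$-linear if $f(xb)=f(x)\beta(b)$; it is $\beta$-adjointable if it is $\beta$-linear and there is a $\beta^{-1}$-linear $f^*:E_2\to E_1$ with $\langle f(x),y\rangle_{E_2}=\beta(\langle x,f^*(y)\rangle_{E_1})$; it is unitary if moreover $ff^*=1$ and $f^*f=1$. A strict positive equivariant $C^*$-correspondence from $(A,G,\alpha)$ to $(B,G,\beta)$ is $((E,\phi),W)$ with $(E,\phi)$ a strict positive $C^*$-correspondence from $A$ to $B$ and $W:G\to\mathcal{B}(E)$ a group homomorphism (into invertible operators) such that each $W_g$ is a $\beta_g$-adjointable unitary on $E$ and $W_g\circ\phi(a)=\phi(\alpha_g(a))\circ W_g$ for all $g\in G$, $a\in A$. For continuous systems, it is continuous if $W$ is strongly continuous. $BG$ is the category with one object $\mathrm{pt}$, morphisms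 $G$, composition the group law; if $G$ is a topological group, the hom-set carries the topology of $G$, and a functor from $BG$ is topological if it is continuous on hom-sets. A functor $\mathcal{F}:BG\to\mathrm{PosCor}_{*\text{-alg}}(A)$ is unitary valued if $\eta_g$ is unitary for every $g$, where $\mathcal{F}(g)=(\rho_g,(\eta_g,\alpha_g))$. Manner of correspondence: $\mathcal{F}$ and $((E,\phi),W)$ share the same $(E,\phi)$, and $W_g=\eta_g\circ V_{\mathrm{inc}\circ\beta_g}$; conversely $\eta_g=W_g\circ U_{\beta_g}$ where $U_{\beta_g}:E\otimes_{\mathrm{inc}\circ\beta_g}B\to E$, $U_{\beta_g}(x\dot\otimes b)=x\beta_g^{-1}(b)$. *)

theory Defs
  imports "HOL-Analysis.Analysis" "HOL-Algebra.Ring" "HOL-Algebra.Bij" "HOL-Library.Poly_Mapping"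
begin

section \<open>C*-algebras\<close>

class cstar_algebra = real_normed_algebra + banach +
  fixes scaleC :: "complex \<Rightarrow> 'a \<Rightarrow> 'a"  (infixr "*\<^sub>C" 75)
    and star :: "'a \<Rightarrow> 'a"
  assumes scaleC_add_right: "k *\<^sub>C (x + y) = k *\<^sub>C x + k *\<^sub>C y"
    and scaleC_add_left: "(k + l) *\<^sub>C x = k *\<^sub>C x + l *\<^sub>C x"
    and scaleC_scaleC: "k *\<^sub>C (l *\<^sub>C x) = (k * l) *\<^sub>C x"
    and scaleC_of_real: "complex_of_real r *\<^sub>C x = r *\<^sub>R x"
    and mult_scaleC_left: "(k *\<^sub>C x) * y = k *\<^sub>C (x * y)"
    and mult_scaleC_right: "x * (k *\<^sub>C y) = k *\<^sub>C (x * y)"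
    and norm_scaleC: "norm (k *\<^sub>C x) = cmod k * norm x"
    and star_add: "star (x + y) = star x + star y"
    and star_scaleC: "star (k *\<^sub>C x) = cnj k *\<^sub>C star x"
    and star_mult: "star (x * y) = star y * star x"
    and star_star: "star (star x) = x"
    and cstar_identity: "norm (star x * x) = (norm x)\<^sup>2"

instantiation complex :: cstar_algebra
begin
definition "scaleC_complex = ((*) :: complex \<Rightarrow> complex \<Rightarrow> complex)"
definition "star_complex = cnj"
instance
  by standard (auto simp: scaleC_complex_def star_complex_def algebra_simps norm_mult
      scaleR_conv_of_real power2_eq_square)
end

interpretation complex_vector: vector_space "scaleC :: complex \<Rightarrow> 'a \<Rightarrow> 'a::cstar_algebra"
proof
  show "1 *\<^sub>C x = x" for x :: 'a
    using scaleC_of_real[of 1 x] by simp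
qed (simp_all add: scaleC_add_right scaleC_add_left scaleC_scaleC)

text \<open>
  A C*-algebra is a norm-closed *-subalgebra of some type of class
  \<^class>\<open>cstar_algebra\<close>.  Every C*-algebra arises in this way (take \<^term>\<open>UNIV\<close>), and
  working with sets lets one type hold many different C*-algebras, which is needed for the
  coefficient algebras of the objects of a category of Hilbert modules.
\<close>

definition cstar_alg :: "'b::cstar_algebra set \<Rightarrow> bool" where
  "cstar_alg B \<longleftrightarrow> closed B \<and> 0 \<in> B \<and> (\<forall>x\<in>B. \<forall>y\<in>B. x + y \<in> B \<and> x * y \<in> B) \<and>
     (\<forall>x\<in>B. star x \<in> B \<and> (\<forall>k. k *\<^sub>C x \<in> B))"

definition cpos :: "'b::cstar_algebra set \<Rightarrow> 'b \<Rightarrow> bool" where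
  "cpos B a \<longleftrightarrow> (\<exists>c\<in>B. a = star c * c)"

text \<open>
  A net is represented by its image filter (all sets that contain a tail of the net);
  convergence and the Cauchy property depend only on this filter, and every proper filter on
  \<open>B\<close> comes from a net.
\<close>

definition approx_unit :: "'b::cstar_algebra set \<Rightarrow> 'b filter \<Rightarrow> bool" where
  "approx_unit B F \<longleftrightarrow> F \<noteq> bot \<and> (\<forall>\<^sub>F u in F. u \<in> B \<and> cpos B u \<and> norm u \<le> 1) \<and>
     (\<forall>b\<in>B. ((\<lambda>u. u * b) \<longlongrightarrow> b) F \<and> ((\<lambda>u. b * u) \<longlongrightarrow> b) F)"

subsection \<open>Homomorphisms and complete positivity\<close>

text \<open>The field \<^const>\<open>one\<close> of the ring record carries no meaning for non-unital algebras.\<close>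

record 'a star_algebra = "'a ring" +
  sa_scale :: "complex \<Rightarrow> 'a \<Rightarrow> 'a"
  sa_star :: "'a \<Rightarrow> 'a"

definition alg :: "'b::cstar_algebra set \<Rightarrow> 'b star_algebra" where
  "alg B = \<lparr>carrier = B, mult = (*), one = undefined, zero = 0, add = (+),
            sa_scale = scaleC, sa_star = star\<rparr>"

definition star_linear :: "'a star_algebra \<Rightarrow> 'c star_algebra \<Rightarrow> ('a \<Rightarrow> 'c) \<Rightarrow> bool" where
  "star_linear S T f \<longleftrightarrow> f \<in> carrier S \<rightarrow>\<^sub>E carrier T \<and>
     (\<forall>x\<in>carrier S. \<forall>y\<in>carrier S. f (x \<oplus>\<^bsub>S\<^esub> y) = f x \<oplus>\<^bsub>T\<^esub> f y) \<and>
     (\<forall>x\<in>carrier S. \<forall>k. f (sa_scale S k x) = sa_scale T k (f x))"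

definition star_hom :: "'a star_algebra \<Rightarrow> 'c star_algebra \<Rightarrow> ('a \<Rightarrow> 'c) set" where
  "star_hom S T = {f. star_linear S T f \<and>
     (\<forall>x\<in>carrier S. \<forall>y\<in>carrier S. f (x \<otimes>\<^bsub>S\<^esub> y) = f x \<otimes>\<^bsub>T\<^esub> f y) \<and>
     (\<forall>x\<in>carrier S. f (sa_star S x) = sa_star T (f x))}"

definition star_aut :: "'b::cstar_algebra set \<Rightarrow> ('b \<Rightarrow> 'b) set" where
  "star_aut B = Bij B \<inter> star_hom (alg B) (alg B)"

text \<open>Positivity in the algebra of \<open>n \<times> n\<close> matrices over \<open>S\<close>: \<open>M = X\<^sup>* X\<close>.\<close>

definition mat_positive :: "'a star_algebra \<Rightarrow> nat \<Rightarrow> (nat \<Rightarrow> nat \<Rightarrow> 'a) \<Rightarrow> bool" where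
  "mat_positive S n M \<longleftrightarrow> (\<exists>X. (\<forall>i<n. \<forall>j<n. X i j \<in> carrier S) \<and>
     (\<forall>i<n. \<forall>j<n. M i j = (\<Oplus>\<^bsub>S\<^esub>k\<in>{..<n}. sa_star S (X k i) \<otimes>\<^bsub>S\<^esub> X k j)))"

definition completely_positive :: "'a star_algebra \<Rightarrow> 'c star_algebra \<Rightarrow> ('a \<Rightarrow> 'c) \<Rightarrow> bool" where
  "completely_positive S T f \<longleftrightarrow> star_linear S T f \<and>
     (\<forall>n M. mat_positive S n M \<longrightarrow> mat_positive T n (\<lambda>i j. f (M i j)))"

section \<open>Hilbert modules\<close>

text \<open>
  As in the library's record for modules over a ring, the additive group is taken from the ring
  record, whose fields \<^const>\<open>mult\<close> and \<^const>\<open>one\<close> carry no meaning here.  The coefficient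
  algebra is part of the structure.
\<close>

record ('b, 'e) hmodule = "'e ring" +
  base :: "'b set"
  hscale :: "complex \<Rightarrow> 'e \<Rightarrow> 'e"
  hact :: "'e \<Rightarrow> 'b \<Rightarrow> 'e"
  hinner :: "'e \<Rightarrow> 'e \<Rightarrow> 'b"

definition hnorm :: "('b::cstar_algebra, 'e) hmodule \<Rightarrow> 'e \<Rightarrow> real" where
  "hnorm E x = sqrt (norm (hinner E x x))"

definition hdist :: "('b::cstar_algebra, 'e) hmodule \<Rightarrow> 'e \<Rightarrow> 'e \<Rightarrow> real" where
  "hdist E x y = hnorm E (x \<ominus>\<^bsub>E\<^esub> y)"

definition norm_topology :: "('b::cstar_algebra, 'e) hmodule \<Rightarrow> 'e topology" where
  "norm_topology E =
     topology_generated_by {{y \<in> carrier E. hdist E x y < r} |x r. x \<in> carrier E \<and> 0 < r}"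

definition hCauchy :: "('b::cstar_algebra, 'e) hmodule \<Rightarrow> (nat \<Rightarrow> 'e) \<Rightarrow> bool" where
  "hCauchy E s \<longleftrightarrow> range s \<subseteq> carrier E \<and>
     (\<forall>e>0. \<exists>N. \<forall>m\<ge>N. \<forall>n\<ge>N. hdist E (s m) (s n) < e)"

definition hilbert_module :: "('b::cstar_algebra, 'e) hmodule \<Rightarrow> bool" where
  "hilbert_module E \<longleftrightarrow> cstar_alg (base E) \<and> abelian_group E \<and>
     (\<forall>x\<in>carrier E. \<forall>y\<in>carrier E. \<forall>k l.
        hscale E k x \<in> carrier E \<and> hscale E 1 x = x \<and>
        hscale E k (hscale E l x) = hscale E (k * l) x \<and>
        hscale E (k + l) x = hscale E k x \<oplus>\<^bsub>E\<^esub> hscale E l x \<and>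
        hscale E k (x \<oplus>\<^bsub>E\<^esub> y) = hscale E k x \<oplus>\<^bsub>E\<^esub> hscale E k y) \<and>
     (\<forall>x\<in>carrier E. \<forall>y\<in>carrier E. \<forall>b\<in>base E. \<forall>c\<in>base E. \<forall>k.
        hact E x b \<in> carrier E \<and>
        hact E (x \<oplus>\<^bsub>E\<^esub> y) b = hact E x b \<oplus>\<^bsub>E\<^esub> hact E y b \<and>
        hact E x (b + c) = hact E x b \<oplus>\<^bsub>E\<^esub> hact E x c \<and>
        hact E x (b * c) = hact E (hact E x b) c \<and>
        hact E (hscale E k x) b = hscale E k (hact E x b) \<and>
        hact E x (k *\<^sub>C b) = hscale E k (hact E x b)) \<and>
     (\<forall>x\<in>carrier E. \<forall>y\<in>carrier E. \<forall>z\<in>carrier E. \<forall>b\<in>base E. \<forall>k.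
        hinner E x y \<in> base E \<and>
        hinner E x (y \<oplus>\<^bsub>E\<^esub> z) = hinner E x y + hinner E x z \<and>
        hinner E x (hscale E k y) = k *\<^sub>C hinner E x y \<and>
        hinner E x (hact E y b) = hinner E x y * b \<and>
        star (hinner E x y) = hinner E y x \<and>
        cpos (base E) (hinner E x x) \<and>
        (hinner E x x = 0 \<longrightarrow> x = \<zero>\<^bsub>E\<^esub>)) \<and>
     (\<forall>s. hCauchy E s \<longrightarrow> (\<exists>x\<in>carrier E. (\<lambda>n. hdist E (s n) x) \<longlonglongrightarrow> 0))"

subsection \<open>Operators\<close>

text \<open>
  All maps are extensional (undefined outside their domain), so that equality of maps is
  equality of functions.
\<close>

definition bounded_maps ::
  "('b::cstar_algebra, 'e) hmodule \<Rightarrow> ('c::cstar_algebra, 'f) hmodule \<Rightarrow> ('e \<Rightarrow> 'f) set" where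
  "bounded_maps E F = {f. f \<in> carrier E \<rightarrow>\<^sub>E carrier F \<and>
     (\<forall>x\<in>carrier E. \<forall>y\<in>carrier E. f (x \<oplus>\<^bsub>E\<^esub> y) = f x \<oplus>\<^bsub>F\<^esub> f y) \<and>
     (\<forall>x\<in>carrier E. \<forall>k. f (hscale E k x) = hscale F k (f x)) \<and>
     (\<exists>K. \<forall>x\<in>carrier E. hnorm F (f x) \<le> K * hnorm E x)}"

definition is_adjoint ::
  "('b, 'e) hmodule \<Rightarrow> ('b, 'f) hmodule \<Rightarrow> ('e \<Rightarrow> 'f) \<Rightarrow> ('f \<Rightarrow> 'e) \<Rightarrow> bool" where
  "is_adjoint E F T S \<longleftrightarrow> S \<in> carrier F \<rightarrow>\<^sub>E carrier E \<and>
     (\<forall>x\<in>carrier E. \<forall>y\<in>carrier F. hinner F (T x) y = hinner E x (S y))"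

definition adjointable ::
  "('b::cstar_algebra, 'e) hmodule \<Rightarrow> ('b, 'f) hmodule \<Rightarrow> ('e \<Rightarrow> 'f) set" where
  "adjointable E F = {T. T \<in> carrier E \<rightarrow>\<^sub>E carrier F \<and> (\<exists>S. is_adjoint E F T S)}"

definition adjoint_of ::
  "('b::cstar_algebra, 'e) hmodule \<Rightarrow> ('b, 'f) hmodule \<Rightarrow> ('e \<Rightarrow> 'f) \<Rightarrow> 'f \<Rightarrow> 'e" where
  "adjoint_of E F T = (THE S. is_adjoint E F T S)"

definition unitary_op ::
  "('b::cstar_algebra, 'e) hmodule \<Rightarrow> ('b, 'f) hmodule \<Rightarrow> ('e \<Rightarrow> 'f) \<Rightarrow> bool" where
  "unitary_op E F T \<longleftrightarrow> T \<in> adjointable E F \<and>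
     (\<forall>x\<in>carrier E. adjoint_of E F T (T x) = x) \<and>
     (\<forall>y\<in>carrier F. T (adjoint_of E F T y) = y)"

definition opnorm :: "('b::cstar_algebra, 'e) hmodule \<Rightarrow> ('e \<Rightarrow> 'e) \<Rightarrow> real" where
  "opnorm E T = (SUP x \<in> {x \<in> carrier E. hnorm E x \<le> 1}. hnorm E (T x))"

definition op_alg :: "('b::cstar_algebra, 'e) hmodule \<Rightarrow> ('e \<Rightarrow> 'e) star_algebra" where
  "op_alg E = \<lparr>carrier = adjointable E E,
     mult = compose (carrier E), one = (\<lambda>x\<in>carrier E. x),
     zero = (\<lambda>x\<in>carrier E. \<zero>\<^bsub>E\<^esub>), add = (\<lambda>S T. \<lambda>x\<in>carrier E. S x \<oplus>\<^bsub>E\<^esub> T x),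
     sa_scale = (\<lambda>k T. \<lambda>x\<in>carrier E. hscale E k (T x)), sa_star = adjoint_of E E\<rparr>"

subsection \<open>Multiplier algebras\<close>

definition self_module :: "'b::cstar_algebra set \<Rightarrow> ('b, 'b) hmodule" where
  "self_module B = \<lparr>carrier = B, mult = undefined, one = undefined, zero = 0, add = (+),
     base = B, hscale = scaleC, hact = (*), hinner = (\<lambda>x y. star x * y)\<rparr>"

definition multiplier_alg :: "'b::cstar_algebra set \<Rightarrow> ('b \<Rightarrow> 'b) star_algebra" where
  "multiplier_alg B = op_alg (self_module B)"

definition inc :: "'b::cstar_algebra set \<Rightarrow> 'b \<Rightarrow> 'b \<Rightarrow> 'b" where
  "inc B = (\<lambda>b\<in>B. \<lambda>c\<in>B. b * c)"

definition nondegenerate ::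
  "'b::cstar_algebra set \<Rightarrow> 'c::cstar_algebra set \<Rightarrow> ('b \<Rightarrow> 'c \<Rightarrow> 'c) \<Rightarrow> bool" where
  "nondegenerate B C \<rho> \<longleftrightarrow> C \<subseteq> closure (complex_vector.span {\<rho> b c |b c. b \<in> B \<and> c \<in> C})"

definition multiplier_ext ::
  "'b::cstar_algebra set \<Rightarrow> 'c::cstar_algebra set \<Rightarrow> ('b \<Rightarrow> 'c \<Rightarrow> 'c) \<Rightarrow> ('b \<Rightarrow> 'b) \<Rightarrow> 'c \<Rightarrow> 'c" where
  "multiplier_ext B C \<rho> = (THE \<sigma>. \<sigma> \<in> star_hom (multiplier_alg B) (multiplier_alg C) \<and>
     (\<forall>b\<in>B. \<sigma> (inc B b) = \<rho> b))"

subsection \<open>Completion\<close>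

text \<open>
  The completion of a pre-Hilbert module: Cauchy sequences modulo null sequences, with the
  operations given by representatives.
\<close>

definition completion_class ::
  "('b::cstar_algebra, 'e) hmodule \<Rightarrow> (nat \<Rightarrow> 'e) \<Rightarrow> (nat \<Rightarrow> 'e) set" where
  "completion_class P s = {t. hCauchy P t \<and> (\<lambda>n. hdist P (t n) (s n)) \<longlonglongrightarrow> 0}"

definition rep :: "'x set \<Rightarrow> 'x" where
  "rep p = (SOME u. u \<in> p)"

definition completion :: "('b::cstar_algebra, 'e) hmodule \<Rightarrow> ('b, (nat \<Rightarrow> 'e) set) hmodule" where
  "completion P = \<lparr>carrier = completion_class P ` {s. hCauchy P s},
     mult = undefined, one = undefined,
     zero = completion_class P (\<lambda>_. \<zero>\<^bsub>P\<^esub>),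
     add = (\<lambda>p q. completion_class P (\<lambda>n. rep p n \<oplus>\<^bsub>P\<^esub> rep q n)),
     base = base P,
     hscale = (\<lambda>k p. completion_class P (\<lambda>n. hscale P k (rep p n))),
     hact = (\<lambda>p b. completion_class P (\<lambda>n. hact P (rep p n) b)),
     hinner = (\<lambda>p q. lim (\<lambda>n. hinner P (rep p n) (rep q n)))\<rparr>"

subsection \<open>Interior tensor product\<close>

text \<open>
  Finitely supported functions on \<open>E \<times> C\<close> are the formal linear combinations of symbols
  \<open>x \<otimes> c\<close>.
\<close>

type_synonym ('e, 'c) formal = "('e \<times> 'c) \<Rightarrow>\<^sub>0 complex"
type_synonym ('e, 'c) tensor = "(nat \<Rightarrow> ('e, 'c) formal set) set"

definition formal_scale :: "complex \<Rightarrow> ('x \<Rightarrow>\<^sub>0 complex) \<Rightarrow> ('x \<Rightarrow>\<^sub>0 complex)" where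
  "formal_scale k u = Poly_Mapping.map ((*) k) u"

lemma lookup_formal_scale: "Poly_Mapping.lookup (formal_scale k u) x = k * Poly_Mapping.lookup u x"
  by (simp add: formal_scale_def Poly_Mapping.map.rep_eq when_def)

interpretation formal_vector: vector_space "formal_scale :: complex \<Rightarrow> ('x \<Rightarrow>\<^sub>0 complex) \<Rightarrow> _"
  by standard (auto intro!: poly_mapping_eqI simp: lookup_formal_scale lookup_add algebra_simps)

abbreviation symb :: "'e \<Rightarrow> 'c \<Rightarrow> ('e, 'c) formal" where
  "symb x c \<equiv> Poly_Mapping.single (x, c) 1"

definition formal_sums :: "('b, 'e) hmodule \<Rightarrow> 'c set \<Rightarrow> ('e, 'c) formal set" where
  "formal_sums E C = {u. Poly_Mapping.keys u \<subseteq> carrier E \<times> C}"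

definition tensor_null ::
  "('b, 'e) hmodule \<Rightarrow> ('b \<Rightarrow> 'c \<Rightarrow> 'c) \<Rightarrow> 'c::cstar_algebra set \<Rightarrow> ('e, 'c) formal set" where
  "tensor_null E \<rho> C = formal_vector.span
    ({symb (x \<oplus>\<^bsub>E\<^esub> y) c - symb x c - symb y c |x y c. x \<in> carrier E \<and> y \<in> carrier E \<and> c \<in> C} \<union>
     {symb x (c + d) - symb x c - symb x d |x c d. x \<in> carrier E \<and> c \<in> C \<and> d \<in> C} \<union>
     {symb (hscale E k x) c - formal_scale k (symb x c) |k x c. x \<in> carrier E \<and> c \<in> C} \<union>
     {symb x (k *\<^sub>C c) - formal_scale k (symb x c) |k x c. x \<in> carrier E \<and> c \<in> C} \<union>
     {symb (hact E x b) c - symb x (\<rho> b c) |x b c. x \<in> carrier E \<and> b \<in> base E \<and> c \<in> C})"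

definition formal_act :: "('e, 'c::times) formal \<Rightarrow> 'c \<Rightarrow> ('e, 'c) formal" where
  "formal_act u d =
     (\<Sum>(x, c)\<in>Poly_Mapping.keys u. Poly_Mapping.single (x, c * d) (Poly_Mapping.lookup u (x, c)))"

definition formal_inner ::
  "('b, 'e) hmodule \<Rightarrow> ('b \<Rightarrow> 'c \<Rightarrow> 'c) \<Rightarrow> ('e, 'c) formal \<Rightarrow> ('e, 'c) formal \<Rightarrow> 'c::cstar_algebra"
  where
  "formal_inner E \<rho> u v =
     (\<Sum>(x, c)\<in>Poly_Mapping.keys u. \<Sum>(y, d)\<in>Poly_Mapping.keys v.
        (cnj (Poly_Mapping.lookup u (x, c)) * Poly_Mapping.lookup v (y, d)) *\<^sub>C
        (star c * \<rho> (hinner E x y) d))"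

definition tensor_class ::
  "('b, 'e) hmodule \<Rightarrow> ('b \<Rightarrow> 'c \<Rightarrow> 'c) \<Rightarrow> 'c::cstar_algebra set \<Rightarrow> ('e, 'c) formal \<Rightarrow> ('e, 'c) formal set"
  where
  "tensor_class E \<rho> C u = (+) u ` tensor_null E \<rho> C"

definition algebraic_tensor ::
  "('b, 'e) hmodule \<Rightarrow> ('b \<Rightarrow> 'c \<Rightarrow> 'c) \<Rightarrow> 'c::cstar_algebra set \<Rightarrow> ('c, ('e, 'c) formal set) hmodule"
  where
  "algebraic_tensor E \<rho> C = \<lparr>carrier = tensor_class E \<rho> C ` formal_sums E C,
     mult = undefined, one = undefined,
     zero = tensor_class E \<rho> C 0,
     add = (\<lambda>p q. tensor_class E \<rho> C (rep p + rep q)),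
     base = C,
     hscale = (\<lambda>k p. tensor_class E \<rho> C (formal_scale k (rep p))),
     hact = (\<lambda>p d. tensor_class E \<rho> C (formal_act (rep p) d)),
     hinner = (\<lambda>p q. formal_inner E \<rho> (rep p) (rep q))\<rparr>"

definition interior_tensor ::
  "('b, 'e) hmodule \<Rightarrow> ('b \<Rightarrow> 'c \<Rightarrow> 'c) \<Rightarrow> 'c::cstar_algebra set \<Rightarrow> ('c, ('e, 'c) tensor) hmodule" where
  "interior_tensor E \<rho> C = completion (algebraic_tensor E \<rho> C)"

definition dot ::
  "('b, 'e) hmodule \<Rightarrow> ('b \<Rightarrow> 'c \<Rightarrow> 'c) \<Rightarrow> 'c::cstar_algebra set \<Rightarrow> 'e \<Rightarrow> 'c \<Rightarrow> ('e, 'c) tensor" where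
  "dot E \<rho> C x c =
     completion_class (algebraic_tensor E \<rho> C) (\<lambda>_. tensor_class E \<rho> C (symb x c))"

text \<open>
  \<open>T \<otimes> 1\<close> for an adjointable map \<open>T : E \<rightarrow> F\<close> of Hilbert modules over the same algebra.
\<close>

definition amplify ::
  "('b, 'e) hmodule \<Rightarrow> ('b, 'f) hmodule \<Rightarrow> ('b \<Rightarrow> 'c \<Rightarrow> 'c) \<Rightarrow> 'c::cstar_algebra set \<Rightarrow>
   ('e \<Rightarrow> 'f) \<Rightarrow> ('e, 'c) tensor \<Rightarrow> ('f, 'c) tensor" where
  "amplify E F \<rho> C T =
     (THE S. S \<in> adjointable (interior_tensor E \<rho> C) (interior_tensor F \<rho> C) \<and>
        (\<forall>x\<in>carrier E. \<forall>c\<in>C. S (dot E \<rho> C x c) = dot F \<rho> C (T x) c))"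

text \<open>The unitary \<open>(E \<otimes> B\<^sub>2) \<otimes> B\<^sub>3 \<rightarrow> E \<otimes> B\<^sub>3\<close>.\<close>

definition tensor_assoc ::
  "('b::cstar_algebra, 'e) hmodule \<Rightarrow> ('b \<Rightarrow> 'c \<Rightarrow> 'c) \<Rightarrow> 'c::cstar_algebra set \<Rightarrow>
   ('c \<Rightarrow> 'd \<Rightarrow> 'd) \<Rightarrow> 'd::cstar_algebra set \<Rightarrow> (('e, 'c) tensor, 'd) tensor \<Rightarrow> ('e, 'd) tensor" where
  "tensor_assoc E \<rho>1 B2 \<rho>2 B3 =
     (let E2 = interior_tensor E \<rho>1 B2; \<rho> = compose (base E) (multiplier_ext B2 B3 \<rho>2) \<rho>1
      in THE U. U \<in> adjointable (interior_tensor E2 \<rho>2 B3) (interior_tensor E \<rho> B3) \<and>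
           (\<forall>x\<in>carrier E. \<forall>b2\<in>B2. \<forall>b3\<in>B3.
              U (dot E2 \<rho>2 B3 (dot E \<rho>1 B2 x b2) b3) = dot E \<rho> B3 x (\<rho>2 b2 b3)))"

definition tensor_unit :: "('b::cstar_algebra, 'e) hmodule \<Rightarrow> ('e, 'b) tensor \<Rightarrow> 'e" where
  "tensor_unit E =
     (let B = base E
      in THE i. i \<in> adjointable (interior_tensor E (inc B) B) E \<and>
           (\<forall>x\<in>carrier E. \<forall>b\<in>B. i (dot E (inc B) B x b) = hact E x b))"

definition tensor_V ::
  "('b, 'e) hmodule \<Rightarrow> ('b \<Rightarrow> 'c \<Rightarrow> 'c) \<Rightarrow> 'c::cstar_algebra set \<Rightarrow> 'e \<Rightarrow> ('e, 'c) tensor" where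
  "tensor_V E \<rho> C =
     (\<lambda>x\<in>carrier E. THE z. z \<in> carrier (interior_tensor E \<rho> C) \<and>
        (\<forall>F. approx_unit C F \<longrightarrow>
           ((\<lambda>c. hdist (interior_tensor E \<rho> C) (dot E \<rho> C x c) z) \<longlongrightarrow> 0) F))"

section \<open>Categories and functors\<close>

record ('o, 'm) category =
  Ob :: "'o set"
  Hom :: "'o \<Rightarrow> 'o \<Rightarrow> 'm set"
  Comp :: "'o \<Rightarrow> 'o \<Rightarrow> 'o \<Rightarrow> 'm \<Rightarrow> 'm \<Rightarrow> 'm"  \<comment> \<open>\<open>Comp X Y Z g f = g \<circ> f\<close> for \<open>f : X \<rightarrow> Y\<close>, \<open>g : Y \<rightarrow> Z\<close>\<close>
  Ident :: "'o \<Rightarrow> 'm"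

record ('o, 'm) top_category = "('o, 'm) category" +
  homtop :: "'o \<Rightarrow> 'o \<Rightarrow> 'm topology"

type_synonym ('o, 'm, 'p, 'n) functor_data = "('o \<Rightarrow> 'p) \<times> ('o \<Rightarrow> 'o \<Rightarrow> 'm \<Rightarrow> 'n)"

definition is_functor ::
  "('o, 'm, 'x) category_scheme \<Rightarrow> ('p, 'n, 'y) category_scheme \<Rightarrow> ('o, 'm, 'p, 'n) functor_data \<Rightarrow> bool"
  where
  "is_functor \<C> \<D> = (\<lambda>(Fo, Fm).
     Fo \<in> Ob \<C> \<rightarrow>\<^sub>E Ob \<D> \<and>
     (\<forall>X\<in>Ob \<C>. \<forall>Y\<in>Ob \<C>. Fm X Y \<in> Hom \<C> X Y \<rightarrow>\<^sub>E Hom \<D> (Fo X) (Fo Y)) \<and>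
     (\<forall>X\<in>Ob \<C>. Fm X X (Ident \<C> X) = Ident \<D> (Fo X)) \<and>
     (\<forall>X\<in>Ob \<C>. \<forall>Y\<in>Ob \<C>. \<forall>Z\<in>Ob \<C>. \<forall>f\<in>Hom \<C> X Y. \<forall>g\<in>Hom \<C> Y Z.
        Fm X Z (Comp \<C> X Y Z g f) = Comp \<D> (Fo X) (Fo Y) (Fo Z) (Fm Y Z g) (Fm X Y f)))"

definition is_topological_functor ::
  "('o, 'm) top_category \<Rightarrow> ('p, 'n) top_category \<Rightarrow> ('o, 'm, 'p, 'n) functor_data \<Rightarrow> bool" where
  "is_topological_functor \<C> \<D> F \<longleftrightarrow> is_functor \<C> \<D> F \<and>
     (\<forall>X\<in>Ob \<C>. \<forall>Y\<in>Ob \<C>.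
        continuous_map (homtop \<C> X Y) (homtop \<D> (fst F X) (fst F Y)) (snd F X Y))"

definition BG :: "('g, 'z) monoid_scheme \<Rightarrow> (unit, 'g) category" where
  "BG G = \<lparr>Ob = {()}, Hom = (\<lambda>_ _. carrier G), Comp = (\<lambda>_ _ _ g h. g \<otimes>\<^bsub>G\<^esub> h),
           Ident = (\<lambda>_. \<one>\<^bsub>G\<^esub>)\<rparr>"

definition BG_top :: "('g, 'z) monoid_scheme \<Rightarrow> 'g topology \<Rightarrow> (unit, 'g) top_category" where
  "BG_top G \<T> = category.extend (BG G) (top_category.fields (\<lambda>_ _. \<T>))"

section \<open>The category of strict positive C*-correspondences out of a C*-algebra\<close>

type_synonym ('a, 'b, 'e) corr = "('b, 'e) hmodule \<times> ('a \<Rightarrow> 'e \<Rightarrow> 'e)"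

type_synonym ('a, 'b, 'e, 'c, 'f) corr_mor =
  "('b \<Rightarrow> 'c \<Rightarrow> 'c) \<times> (('e, 'c) tensor \<Rightarrow> 'f) \<times> ('a \<Rightarrow> 'a)"

definition strict_map ::
  "'a::cstar_algebra set \<Rightarrow> ('b::cstar_algebra, 'e) hmodule \<Rightarrow> ('a \<Rightarrow> 'e \<Rightarrow> 'e) \<Rightarrow> bool" where
  "strict_map A E \<phi> \<longleftrightarrow> (\<exists>F. approx_unit A F \<and>
     (\<forall>x\<in>carrier E. \<forall>e>0. \<forall>\<^sub>F (a, a') in F \<times>\<^sub>F F.
        hdist E (\<phi> a x) (\<phi> a' x) < e \<and>
        hdist E (adjoint_of E E (\<phi> a) x) (adjoint_of E E (\<phi> a') x) < e))"

definition strict_pos_corr ::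
  "'a::cstar_algebra set \<Rightarrow> 'b::cstar_algebra set \<Rightarrow> ('a, 'b, 'e) corr \<Rightarrow> bool" where
  "strict_pos_corr A B = (\<lambda>(E, \<phi>). cstar_alg A \<and> hilbert_module E \<and> base E = B \<and>
     completely_positive (alg A) (op_alg E) \<phi> \<and> strict_map A E \<phi>)"

definition poscor_hom ::
  "'a::cstar_algebra set \<Rightarrow> ('a, 'b::cstar_algebra, 'e) corr \<Rightarrow> ('a, 'c::cstar_algebra, 'f) corr \<Rightarrow>
   ('a, 'b, 'e, 'c, 'f) corr_mor set" where
  "poscor_hom A = (\<lambda>(E, \<phi>) (F, \<psi>). {(\<rho>, \<eta>, \<alpha>).
     \<rho> \<in> star_hom (alg (base E)) (multiplier_alg (base F)) \<and>
     nondegenerate (base E) (base F) \<rho> \<and>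
     \<rho> ` base E \<subseteq> inc (base F) ` base F \<and>
     \<eta> \<in> adjointable (interior_tensor E \<rho> (base F)) F \<and>
     \<alpha> \<in> star_aut A \<and>
     (\<forall>a\<in>A. \<forall>z\<in>carrier (interior_tensor E \<rho> (base F)).
        \<psi> (\<alpha> a) (\<eta> z) = \<eta> (amplify E E \<rho> (base F) (\<phi> a) z))})"

definition poscor_comp ::
  "'a::cstar_algebra set \<Rightarrow> ('a, 'b::cstar_algebra, 'e) corr \<Rightarrow> ('a, 'c::cstar_algebra, 'f) corr \<Rightarrow>
   ('a, 'd::cstar_algebra, 'h) corr \<Rightarrow> ('a, 'c, 'f, 'd, 'h) corr_mor \<Rightarrow> ('a, 'b, 'e, 'c, 'f) corr_mor \<Rightarrow>
   ('a, 'b, 'e, 'd, 'h) corr_mor" where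
  "poscor_comp A = (\<lambda>(E1, \<phi>1) (E2, \<phi>2) (E3, \<phi>3) (\<rho>2, \<eta>2, \<alpha>2) (\<rho>1, \<eta>1, \<alpha>1).
     let B2 = base E2; B3 = base E3;
         \<rho> = compose (base E1) (multiplier_ext B2 B3 \<rho>2) \<rho>1;
         E12 = interior_tensor E1 \<rho>1 B2;
         U = tensor_assoc E1 \<rho>1 B2 \<rho>2 B3;
         U_inv = inv_into (carrier (interior_tensor E12 \<rho>2 B3)) U
     in (\<rho>,
         (\<lambda>z\<in>carrier (interior_tensor E1 \<rho> B3). \<eta>2 (amplify E12 E2 \<rho>2 B3 \<eta>1 (U_inv z))),
         compose A \<alpha>2 \<alpha>1))"

definition poscor_id ::
  "'a set \<Rightarrow> ('a, 'b::cstar_algebra, 'e) corr \<Rightarrow> ('a, 'b, 'e, 'b, 'e) corr_mor" where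
  "poscor_id A = (\<lambda>(E, \<phi>). (inc (base E), tensor_unit E, (\<lambda>a\<in>A. a)))"

definition poscor_dist ::
  "('a::cstar_algebra, 'b, 'e) corr \<Rightarrow> ('a, 'c::cstar_algebra, 'f) corr \<Rightarrow> 'b \<Rightarrow> 'e \<Rightarrow> 'a \<Rightarrow>
   ('a, 'b, 'e, 'c, 'f) corr_mor \<Rightarrow> ('a, 'b, 'e, 'c, 'f) corr_mor \<Rightarrow> real" where
  "poscor_dist = (\<lambda>(E, \<phi>) (F, \<psi>) b x a (\<rho>, \<eta>, \<alpha>) (\<rho>', \<xi>, \<alpha>').
     opnorm (self_module (base F)) (\<lambda>c\<in>base F. \<rho> b c - \<rho>' b c) +
     hdist F (\<eta> (tensor_V E \<rho> (base F) x)) (\<xi> (tensor_V E \<rho>' (base F) x)) +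
     norm (\<alpha> a - \<alpha>' a))"

definition poscor_top ::
  "'a::cstar_algebra set \<Rightarrow> ('a, 'b::cstar_algebra, 'e) corr \<Rightarrow> ('a, 'c::cstar_algebra, 'f) corr \<Rightarrow>
   ('a, 'b, 'e, 'c, 'f) corr_mor topology" where
  "poscor_top A X Y = topology_generated_by
     {{f \<in> poscor_hom A X Y. poscor_dist X Y b x a f0 f < r} |b x a f0 r.
        b \<in> base (fst X) \<and> x \<in> carrier (fst X) \<and> a \<in> A \<and> f0 \<in> poscor_hom A X Y \<and> 0 < r}"

text \<open>
  The hom-sets, composition, identities and topologies above are polymorphic in the types that
  carry the coefficient algebras and the modules.  An object of the category below is a module
  with carrier in \<open>'e\<close> over any C*-algebra with carrier in \<open>'b\<close>, for arbitrary types
  \<open>'b\<close> and \<open>'e\<close>, which play the role of a universe.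
\<close>

definition PosCor ::
  "'a::cstar_algebra set \<Rightarrow>
   (('a, 'b::cstar_algebra, 'e) corr, ('a, 'b, 'e, 'b, 'e) corr_mor) top_category" where
  "PosCor A = \<lparr>Ob = {X. \<exists>B. strict_pos_corr A B X}, Hom = poscor_hom A, Comp = poscor_comp A,
     Ident = poscor_id A, homtop = poscor_top A\<rparr>"

section \<open>Dynamical systems and equivariant correspondences\<close>

definition topological_group :: "('g, 'z) monoid_scheme \<Rightarrow> 'g topology \<Rightarrow> bool" where
  "topological_group G \<T> \<longleftrightarrow> group G \<and> topspace \<T> = carrier G \<and>
     continuous_map (prod_topology \<T> \<T>) \<T> (\<lambda>(g, h). g \<otimes>\<^bsub>G\<^esub> h) \<and>
     continuous_map \<T> \<T> (\<lambda>g. inv\<^bsub>G\<^esub> g)"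

definition dynamical_system ::
  "'a::cstar_algebra set \<Rightarrow> ('g, 'z) monoid_scheme \<Rightarrow> ('g \<Rightarrow> 'a \<Rightarrow> 'a) \<Rightarrow> bool" where
  "dynamical_system A G \<alpha> \<longleftrightarrow> cstar_alg A \<and> group G \<and>
     \<alpha> \<in> hom G (BijGroup A) \<and> \<alpha> ` carrier G \<subseteq> star_aut A"

definition continuous_system ::
  "'a::cstar_algebra set \<Rightarrow> ('g, 'z) monoid_scheme \<Rightarrow> 'g topology \<Rightarrow> ('g \<Rightarrow> 'a \<Rightarrow> 'a) \<Rightarrow> bool" where
  "continuous_system A G \<T> \<alpha> \<longleftrightarrow> dynamical_system A G \<alpha> \<and> topological_group G \<T> \<and>
     (\<forall>a\<in>A. continuous_map \<T> euclidean (\<lambda>g. \<alpha> g a))"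

definition twisted_linear ::
  "('b::cstar_algebra \<Rightarrow> 'b) \<Rightarrow> ('b, 'e) hmodule \<Rightarrow> ('b, 'f) hmodule \<Rightarrow> ('e \<Rightarrow> 'f) \<Rightarrow> bool" where
  "twisted_linear \<beta> E F f \<longleftrightarrow> f \<in> bounded_maps E F \<and>
     (\<forall>x\<in>carrier E. \<forall>b\<in>base E. f (hact E x b) = hact F (f x) (\<beta> b))"

definition is_twisted_adjoint ::
  "('b::cstar_algebra \<Rightarrow> 'b) \<Rightarrow> ('b, 'e) hmodule \<Rightarrow> ('b, 'f) hmodule \<Rightarrow> ('e \<Rightarrow> 'f) \<Rightarrow> ('f \<Rightarrow> 'e) \<Rightarrow> bool"
  where
  "is_twisted_adjoint \<beta> E F f f' \<longleftrightarrow> twisted_linear (inv_into (base E) \<beta>) F E f' \<and>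
     (\<forall>x\<in>carrier E. \<forall>y\<in>carrier F. hinner F (f x) y = \<beta> (hinner E x (f' y)))"

definition twisted_unitary ::
  "('b::cstar_algebra \<Rightarrow> 'b) \<Rightarrow> ('b, 'e) hmodule \<Rightarrow> ('b, 'f) hmodule \<Rightarrow> ('e \<Rightarrow> 'f) \<Rightarrow> bool" where
  "twisted_unitary \<beta> E F f \<longleftrightarrow> twisted_linear \<beta> E F f \<and>
     (\<exists>f'. is_twisted_adjoint \<beta> E F f f' \<and>
        (\<forall>x\<in>carrier E. f' (f x) = x) \<and> (\<forall>y\<in>carrier F. f (f' y) = y))"

definition equivariant_corr ::
  "'a::cstar_algebra set \<Rightarrow> 'b::cstar_algebra set \<Rightarrow> ('g, 'z) monoid_scheme \<Rightarrow> ('g \<Rightarrow> 'a \<Rightarrow> 'a) \<Rightarrow>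
   ('g \<Rightarrow> 'b \<Rightarrow> 'b) \<Rightarrow> (('a, 'b, 'e) corr \<times> ('g \<Rightarrow> 'e \<Rightarrow> 'e)) set" where
  "equivariant_corr A B G \<alpha> \<beta> = {((E, \<phi>), W). strict_pos_corr A B (E, \<phi>) \<and>
     W \<in> hom G (BijGroup (carrier E)) \<inter> extensional (carrier G) \<and>
     (\<forall>g\<in>carrier G. twisted_unitary (\<beta> g) E E (W g)) \<and>
     (\<forall>g\<in>carrier G. \<forall>a\<in>A. \<forall>x\<in>carrier E. W g (\<phi> a x) = \<phi> (\<alpha> g a) (W g x))}"

definition continuous_equivariant_corr ::
  "'a::cstar_algebra set \<Rightarrow> 'b::cstar_algebra set \<Rightarrow> ('g, 'z) monoid_scheme \<Rightarrow> 'g topology \<Rightarrow>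
   ('g \<Rightarrow> 'a \<Rightarrow> 'a) \<Rightarrow> ('g \<Rightarrow> 'b \<Rightarrow> 'b) \<Rightarrow> (('a, 'b, 'e) corr \<times> ('g \<Rightarrow> 'e \<Rightarrow> 'e)) set" where
  "continuous_equivariant_corr A B G \<T> \<alpha> \<beta> = {((E, \<phi>), W). ((E, \<phi>), W) \<in> equivariant_corr A B G \<alpha> \<beta> \<and>
     (\<forall>x\<in>carrier E. continuous_map \<T> (norm_topology E) (\<lambda>g. W g x))}"

section \<open>The correspondence between functors and equivariant correspondences\<close>

type_synonym ('a, 'b, 'e, 'g) poscor_functor =
  "(unit, 'g, ('a, 'b, 'e) corr, ('a, 'b, 'e, 'b, 'e) corr_mor) functor_data"

definition unitary_valued ::
  "('g, 'z) monoid_scheme \<Rightarrow> ('a, 'b::cstar_algebra, 'e, 'g) poscor_functor \<Rightarrow> bool" where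
  "unitary_valued G = (\<lambda>(Fo, Fm). \<forall>g\<in>carrier G.
     (case (Fo (), Fm () () g) of ((E, \<phi>), (\<rho>, \<eta>, \<alpha>)) \<Rightarrow>
        unitary_op (interior_tensor E \<rho> (base E)) E \<eta>))"

text \<open>Conditions (a) and (b) on a functor.\<close>

definition compatible_functor ::
  "'a::cstar_algebra set \<Rightarrow> 'b::cstar_algebra set \<Rightarrow> ('g, 'z) monoid_scheme \<Rightarrow> ('g \<Rightarrow> 'a \<Rightarrow> 'a) \<Rightarrow>
   ('g \<Rightarrow> 'b \<Rightarrow> 'b) \<Rightarrow> ('a, 'b, 'e, 'g) poscor_functor \<Rightarrow> bool" where
  "compatible_functor A B G \<alpha> \<beta> = (\<lambda>(Fo, Fm). strict_pos_corr A B (Fo ()) \<and>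
     (\<forall>g\<in>carrier G. \<exists>\<eta>. Fm () () g = (compose B (inc B) (\<beta> g), \<eta>, \<alpha> g)))"

definition twist_U ::
  "('b::cstar_algebra, 'e) hmodule \<Rightarrow> ('b \<Rightarrow> 'b) \<Rightarrow> ('e, 'b) tensor \<Rightarrow> 'e" where
  "twist_U E \<beta> =
     (let B = base E; \<rho> = compose B (inc B) \<beta>
      in THE u. u \<in> bounded_maps (interior_tensor E \<rho> B) E \<and>
           (\<forall>x\<in>carrier E. \<forall>b\<in>B. u (dot E \<rho> B x b) = hact E x (inv_into B \<beta> b)))"

definition functor_of_corr ::
  "('g, 'z) monoid_scheme \<Rightarrow> ('g \<Rightarrow> 'a \<Rightarrow> 'a) \<Rightarrow> ('g \<Rightarrow> 'b::cstar_algebra \<Rightarrow> 'b) \<Rightarrow>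
   ('a, 'b, 'e) corr \<times> ('g \<Rightarrow> 'e \<Rightarrow> 'e) \<Rightarrow> ('a, 'b, 'e, 'g) poscor_functor" where
  "functor_of_corr G \<alpha> \<beta> = (\<lambda>((E, \<phi>), W).
     ((\<lambda>_. (E, \<phi>)),
      (\<lambda>_ _. \<lambda>g\<in>carrier G.
         let B = base E; \<rho> = compose B (inc B) (\<beta> g)
         in (\<rho>, compose (carrier (interior_tensor E \<rho> B)) (W g) (twist_U E (\<beta> g)), \<alpha> g))))"

definition corr_of_functor ::
  "('g, 'z) monoid_scheme \<Rightarrow> ('g \<Rightarrow> 'b \<Rightarrow> 'b) \<Rightarrow> ('a, 'b::cstar_algebra, 'e, 'g) poscor_functor \<Rightarrow>
   ('a, 'b, 'e) corr \<times> ('g \<Rightarrow> 'e \<Rightarrow> 'e)" where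
  "corr_of_functor G \<beta> = (\<lambda>(Fo, Fm).
     (Fo (),
      (\<lambda>g\<in>carrier G.
         let E = fst (Fo ()); B = base E; \<eta> = fst (snd (Fm () () g))
         in compose (carrier E) \<eta> (tensor_V E (compose B (inc B) (\<beta> g)) B))))"

end

theory Submission
  imports Defs
begin

text \<open>
  The map \<open>x \<otimes> b \<mapsto> x \<beta>\<^sub>g\<inverse>(b)\<close> identifies the interior tensor product of \<open>E\<close> and \<open>B\<close>
  along \<open>\<beta>\<^sub>g\<close> with \<open>E\<close> carrying the module structure twisted by \<open>\<beta>\<^sub>g\<close>; its inverse is
  \<open>V\<^sub>g\<close>, the canonical map of \<open>E\<close> into the tensor product.  Under this identification a
  \<open>\<beta>\<^sub>g\<close>-adjointable unitary \<open>W\<^sub>g\<close> is the same thing as a unitary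
  \<open>\<eta>\<^sub>g\<close> with \<open>W\<^sub>g = \<eta>\<^sub>g \<circ> V\<^sub>g\<close>, and the amplification, the associativity unitary and the
  composition of morphisms become composition of maps on \<open>E\<close>.  For the topology, the distance of a
  morphism \<open>f\<^sub>0\<close> from the image of \<open>g\<close> equals
  \<open>\<parallel>b\<^sub>0 - \<beta>\<^sub>g b\<parallel> + \<parallel>y\<^sub>0 - W\<^sub>g x\<parallel> + \<parallel>a\<^sub>0 - \<alpha>\<^sub>g a\<parallel>\<close> with elements that depend only on \<open>f\<^sub>0\<close>,
  so the functor is continuous iff \<open>W\<close> is strongly continuous.

  The homomorphism of \<open>f\<^sub>0\<close> need not be an automorphism, so the inner product on
  \<open>E \<otimes> C\<close> has to be shown positive in general.  An approximate Gram-Schmidt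
  process writes a Gram matrix, up to a small error, as a sum of matrices with entries
  \<open>v\<^sub>i\<^sup>* v\<^sub>j\<close>, a form that *-homomorphisms preserve.
\<close>

section \<open>Positivity in C*-algebras\<close>

text \<open>Two obstacles shape the proof. First, the operators of the category are specified by
  definite descriptions on completions of quotients, so each must be shown to exist and to be unique
  before it can be computed; uniqueness rests on the elementary tensors being total. Second,
  Cauchy-Schwarz, contractivity of homomorphisms, positivity on tensor products and the existence of
  approximate units are all required, while a C*-algebra here is only a closed subset of a normed
  algebra, possibly without unit. The positive cone is therefore developed from norm estimates and a
  square root iteration, in place of spectra and functional calculus. Approximate units and
  approximate inverses both come from one estimate: the norm of \<open>a * (1 - a) ^ n\<close> is at
  most \<open>1 / (n + 1)\<close> for a positive contraction \<open>a\<close>. The approximate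
  Gram-Schmidt process keeps the positivity argument inside the coefficient algebra and avoids norms
  on matrix algebras over it.\<close>

lemma star_zero [simp]: "star 0 = (0::'a::cstar_algebra)"
  using star_add[of 0 "0::'a"] by simp

lemma star_minus: "star (- x) = - star (x::'a::cstar_algebra)"
  using star_add[of x "- x"] by (simp add: eq_neg_iff_add_eq_0 add.commute)

lemma star_diff: "star (x - y) = star x - star (y::'a::cstar_algebra)"
  using star_add[of x "- y"] by (simp add: star_minus)

lemma star_scaleR: "star (r *\<^sub>R x) = r *\<^sub>R star (x::'a::cstar_algebra)"
  using star_scaleC[of "complex_of_real r" x] by (simp add: scaleC_of_real)

text \<open>The C*-identity and submultiplicativity bound the square of \<open>norm y\<close> by
  \<open>norm (star y) * norm y\<close>; cancelling one factor and exchanging \<open>y\<close> with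
  its adjoint gives equality.\<close>

lemma norm_star [simp]: "norm (star x) = norm (x::'a::cstar_algebra)"
proof -
  have le: "norm y \<le> norm (star y)" for y :: 'a
  proof (cases "y = 0")
    case False
    have "(norm y)\<^sup>2 \<le> norm (star y) * norm y"
      using norm_mult_ineq[of "star y" y] by (simp add: cstar_identity)
    with False show ?thesis by (simp add: power2_eq_square)
  qed simp
  show ?thesis using le[of x] le[of "star x"] by (simp add: star_star)
qed

lemma norm_mult_star: "norm (x * star x) = (norm (x::'a::cstar_algebra))\<^sup>2"
  using cstar_identity[of "star x"] by (simp add: star_star)

lemma bounded_linear_star: "bounded_linear (star :: 'a::cstar_algebra \<Rightarrow> 'a)"
  by (rule bounded_linear_intro[of _ 1]) (auto simp: star_add star_scaleR)

lemmas tendsto_star [tendsto_intros] = bounded_linear.tendsto[OF bounded_linear_star]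

lemma star_sum: "star (sum f S) = (\<Sum>i\<in>S. star (f i :: 'a::cstar_algebra))"
  by (induction S rule: infinite_finite_induct) (auto simp: star_add)

lemma bounded_linear_scaleC: "bounded_linear (scaleC k :: 'a::cstar_algebra \<Rightarrow> 'a)"
  by (rule bounded_linear_intro[of _ "cmod k"])
    (auto simp: scaleC_add_right norm_scaleC scaleC_scaleC mult.commute simp flip: scaleC_of_real)

lemmas tendsto_scaleC [tendsto_intros] = bounded_linear.tendsto[OF bounded_linear_scaleC]

lemma scaleC_minus1: "- 1 *\<^sub>C x = - (x::'a::cstar_algebra)"
  using complex_vector.scale_minus_left[of 1 x] by simp

lemma mult_self_adjoint_eq_0_iff:
  assumes "star (x::'a::cstar_algebra) = x"
  shows "x * x = 0 \<longleftrightarrow> x = 0"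
  using cstar_identity[of x] assms by auto

text \<open>By the C*-identity the norm of \<open>star u * u\<close> controls \<open>u\<close>, and
  with it the real part \<open>h\<close> and the imaginary part \<open>k\<close>. These formulas
  stand in for the functional calculus wherever two commuting square roots are compared.\<close>

lemma self_adjoint_real_imag:
  fixes h k :: "'a::cstar_algebra"
  assumes "star h = h" "star k = k" "h * k = k * h"
  defines "u \<equiv> h + \<i> *\<^sub>C k"
  shows "star u * u = h * h + k * k" "2 *\<^sub>R h = u + star u" "2 *\<^sub>R k = - \<i> *\<^sub>C (u - star u)"
proof -
  have su: "star u = h - \<i> *\<^sub>C k"
    by (simp add: u_def star_add star_scaleC assms)
  show "star u * u = h * h + k * k"
    unfolding su by (simp add: u_def algebra_simps mult_scaleC_left mult_scaleC_right scaleC_scaleC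
        scaleC_minus1 assms scaleC_add_right)
  show "2 *\<^sub>R h = u + star u"
    unfolding su by (simp add: u_def scaleR_2)
  have "u - star u = (2 * \<i>) *\<^sub>C k"
    unfolding su by (simp add: u_def flip: scaleC_add_left)
  then show "2 *\<^sub>R k = - \<i> *\<^sub>C (u - star u)"
    using scaleC_of_real[of 2 k]
    by (simp add: scaleC_scaleC complex_vector.scale_minus_left mult.left_commute[of \<i>])
qed

text \<open>Only real scalars occur because the square root iteration is built from sums, products
  and real multiples. The predicate records that a root stays in every such set containing its
  argument, in particular in the unitization of a subalgebra.\<close>

definition closed_unital_subalgebra :: "'a::real_normed_algebra_1 set \<Rightarrow> bool" where
  "closed_unital_subalgebra S \<longleftrightarrow> closed S \<and> 1 \<in> S \<and>
     (\<forall>x\<in>S. \<forall>y\<in>S. x + y \<in> S \<and> x * y \<in> S) \<and> (\<forall>x\<in>S. \<forall>r. r *\<^sub>R x \<in> S)"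

lemma closed_unital_subalgebra_diff:
  "closed_unital_subalgebra S \<Longrightarrow> x \<in> S \<Longrightarrow> y \<in> S \<Longrightarrow> x - y \<in> S"
  unfolding closed_unital_subalgebra_def by (metis diff_conv_add_uminus scaleR_minus1_left)

text \<open>
  The iteration is the one for \<open>1 - sqrt (1 - z)\<close>; all its steps are polynomials in
  \<open>z\<close> with nonnegative coefficients, so it is dominated by its values at \<open>z = 1\<close>.
\<close>

fun sqrt_iter :: "'a::cstar_algebra \<Rightarrow> nat \<Rightarrow> 'a" where
  "sqrt_iter z 0 = 0"
| "sqrt_iter z (Suc n) = (1/2) *\<^sub>R (z + sqrt_iter z n * sqrt_iter z n)"

fun sqrt_iter_bound :: "nat \<Rightarrow> real" where
  "sqrt_iter_bound 0 = 0"
| "sqrt_iter_bound (Suc n) = (1 + sqrt_iter_bound n * sqrt_iter_bound n) / 2"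

lemma sqrt_iter_bound_bounds: "0 \<le> sqrt_iter_bound n" "sqrt_iter_bound n \<le> 1"
proof (induction n)
  case (Suc n)
  { case 1 show ?case by simp }
  { case 2
    have "sqrt_iter_bound n * sqrt_iter_bound n \<le> 1 * 1"
      using Suc by (intro mult_mono) auto
    then show ?case by simp }
qed auto

lemma sqrt_iter_bound_mono: "sqrt_iter_bound n \<le> sqrt_iter_bound (Suc n)"
proof (induction n)
  case (Suc n)
  then have "sqrt_iter_bound n * sqrt_iter_bound n \<le> sqrt_iter_bound (Suc n) * sqrt_iter_bound (Suc n)"
    using sqrt_iter_bound_bounds by (intro mult_mono)
  then show ?case by simp
qed simp

lemma convergent_sqrt_iter_bound: "convergent sqrt_iter_bound"
  by (rule Bseq_mono_convergent)
    (auto intro!: BseqI'[of _ 1] lift_Suc_mono_le[of sqrt_iter_bound, OF sqrt_iter_bound_mono]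
      simp: abs_of_nonneg sqrt_iter_bound_bounds)

lemma sqrt_iter_commute:
  "y * z = z * y \<Longrightarrow> y * sqrt_iter z n = sqrt_iter z n * y"
proof (induction n)
  case (Suc n)
  then have "y * (sqrt_iter z n * sqrt_iter z n) = (sqrt_iter z n * sqrt_iter z n) * y"
    by (metis mult.assoc)
  with Suc show ?case by (simp add: distrib_left distrib_right)
qed simp

lemma star_sqrt_iter: "star z = z \<Longrightarrow> star (sqrt_iter z n) = sqrt_iter z n"
  by (induction n) (auto simp: star_scaleR star_add star_mult)

lemma norm_sqrt_iter:
  assumes "norm z \<le> 1"
  shows "norm (sqrt_iter z n) \<le> sqrt_iter_bound n"
proof (induction n)
  case (Suc n)
  have "norm (sqrt_iter z n * sqrt_iter z n) \<le> sqrt_iter_bound n * sqrt_iter_bound n"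
    using Suc sqrt_iter_bound_bounds by (intro order_trans[OF norm_mult_ineq] mult_mono) auto
  then have "norm (z + sqrt_iter z n * sqrt_iter z n) \<le> 1 + sqrt_iter_bound n * sqrt_iter_bound n"
    using assms by (intro order_trans[OF norm_triangle_ineq] add_mono) auto
  then show ?case by simp
qed simp

text \<open>Consecutive iterates commute, so the difference of their squares factors, and both
  factors are dominated by the corresponding scalars; the scalar iteration satisfies the same
  recursion with equality.\<close>

lemma norm_sqrt_iter_step:
  assumes "norm z \<le> 1"
  shows "norm (sqrt_iter z (Suc n) - sqrt_iter z n) \<le> sqrt_iter_bound (Suc n) - sqrt_iter_bound n"
proof (induction n)
  case 0
  then show ?case using assms by simp
next
  case (Suc n)
  let ?h = "sqrt_iter z n" and ?h' = "sqrt_iter z (Suc n)"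
  let ?s = "sqrt_iter_bound n" and ?s' = "sqrt_iter_bound (Suc n)"
  have comm: "?h * ?h' = ?h' * ?h"
    using sqrt_iter_commute[of "?h" z "Suc n"] sqrt_iter_commute[of z z n] by simp
  have "sqrt_iter z (Suc (Suc n)) - ?h' = (1/2) *\<^sub>R (?h' * ?h' - ?h * ?h)"
    by (metis add_diff_cancel_left scaleR_diff_right sqrt_iter.simps(2))
  also have "?h' * ?h' - ?h * ?h = (?h' + ?h) * (?h' - ?h)"
    using comm by (simp add: algebra_simps del: sqrt_iter.simps)
  finally have "norm (sqrt_iter z (Suc (Suc n)) - ?h') \<le> (1/2) * (norm (?h' + ?h) * norm (?h' - ?h))"
    by (simp add: norm_mult_ineq del: sqrt_iter.simps)
  also have "\<dots> \<le> (1/2) * ((?s' + ?s) * (?s' - ?s))"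
    using Suc norm_sqrt_iter[OF assms] sqrt_iter_bound_bounds
    by (intro mult_left_mono mult_mono order_trans[OF norm_triangle_ineq] add_mono add_nonneg_nonneg)
      (auto simp del: sqrt_iter.simps sqrt_iter_bound.simps)
  also have "(?s' + ?s) * (?s' - ?s) = ?s' * ?s' - ?s * ?s"
    by (simp add: algebra_simps del: sqrt_iter_bound.simps)
  also have "(1/2) * (?s' * ?s' - ?s * ?s) = sqrt_iter_bound (Suc (Suc n)) - ?s'"
    unfolding sqrt_iter_bound.simps(2)[of "Suc n"]
    by (subst (5) sqrt_iter_bound.simps(2)) (simp add: diff_divide_distrib[symmetric] del: sqrt_iter_bound.simps)
  finally show ?case .
qed

text \<open>The increments telescope, so distances between iterates are at most those between the
  scalar bounds, which form a convergent sequence.\<close>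

lemma convergent_sqrt_iter:
  assumes "norm z \<le> 1"
  shows "convergent (sqrt_iter z)"
proof -
  have step: "norm (sqrt_iter z n - sqrt_iter z m) \<le> \<bar>sqrt_iter_bound n - sqrt_iter_bound m\<bar>" for m n
  proof (induction m n rule: linorder_wlog)
    case (le m n)
    then show ?case
    proof (induction rule: dec_induct)
      case (step k)
      have "norm (sqrt_iter z (Suc k) - sqrt_iter z m) \<le>
          norm (sqrt_iter z (Suc k) - sqrt_iter z k) + norm (sqrt_iter z k - sqrt_iter z m)"
        using norm_triangle_ineq[of "sqrt_iter z (Suc k) - sqrt_iter z k" "sqrt_iter z k - sqrt_iter z m"]
        by (simp del: sqrt_iter.simps)
      moreover have "sqrt_iter_bound m \<le> sqrt_iter_bound k"
        using step.hyps lift_Suc_mono_le[of sqrt_iter_bound] sqrt_iter_bound_mono by blast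
      ultimately show ?case
        using step.IH norm_sqrt_iter_step[OF assms, of k] sqrt_iter_bound_mono[of k]
        by (simp del: sqrt_iter.simps sqrt_iter_bound.simps)
    qed simp
  qed (simp add: norm_minus_commute abs_minus_commute)
  have C: "Cauchy sqrt_iter_bound"
    using convergent_sqrt_iter_bound by (simp add: Cauchy_convergent_iff)
  show ?thesis
    unfolding Cauchy_convergent_iff[symmetric]
  proof (rule CauchyI)
    fix e :: real assume "0 < e"
    then obtain N where "\<forall>m\<ge>N. \<forall>n\<ge>N. norm (sqrt_iter_bound m - sqrt_iter_bound n) < e"
      using CauchyD[OF C] by blast
    then show "\<exists>N. \<forall>m\<ge>N. \<forall>n\<ge>N. norm (sqrt_iter z m - sqrt_iter z n) < e"
      using step by (metis order_le_less_trans real_norm_def)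
  qed
qed

text \<open>The limit \<open>h\<close> of the iteration solves \<open>2 h = z + h * h\<close>, that
  is, \<open>(1 - h) * (1 - h) = 1 - z\<close>, and \<open>k\<close> is \<open>1 - h\<close>. The
  bound on \<open>norm (1 - k)\<close> says that \<open>k\<close> is positive in the sense
  introduced below; the clauses on commutation and on subalgebras pass from the iterates to the
  limit.\<close>

lemma ex_sqrt_one_minus:
  fixes z :: "'a::{cstar_algebra, real_normed_algebra_1}"
  assumes "norm z \<le> 1" "star z = z"
  shows "\<exists>k. star k = k \<and> k * k = 1 - z \<and> norm (1 - k) \<le> 1 \<and>
    (\<forall>y. y * z = z * y \<longrightarrow> y * k = k * y) \<and> (\<forall>S. closed_unital_subalgebra S \<longrightarrow> z \<in> S \<longrightarrow> k \<in> S)"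
proof -
  obtain h where h: "sqrt_iter z \<longlonglongrightarrow> h"
    using convergent_sqrt_iter[OF assms(1)] by (auto simp: convergent_def)
  have "(\<lambda>n. sqrt_iter z (Suc n)) \<longlonglongrightarrow> (1/2) *\<^sub>R (z + h * h)"
    unfolding sqrt_iter.simps by (intro tendsto_intros h)
  then have "h = (1/2) *\<^sub>R (z + h * h)"
    using LIMSEQ_Suc[OF h] LIMSEQ_unique by blast
  then have "2 *\<^sub>R h = 2 *\<^sub>R ((1/2) *\<^sub>R (z + h * h))"
    by (rule arg_cong)
  then have sq: "(1 - h) * (1 - h) = 1 - z"
    by (simp add: algebra_simps scaleR_2)
  have sa: "star h = h"
    using tendsto_star[OF h] h by (simp add: star_sqrt_iter[OF assms(2)] LIMSEQ_unique)
  have "star (1::'a) = 1"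
    by (metis mult.left_neutral mult.right_neutral star_mult star_star)
  moreover have "y * h = h * y" if "y * z = z * y" for y
  proof (rule LIMSEQ_unique)
    show "(\<lambda>n. y * sqrt_iter z n) \<longlonglongrightarrow> y * h" by (intro tendsto_intros h)
    show "(\<lambda>n. y * sqrt_iter z n) \<longlonglongrightarrow> h * y"
      unfolding sqrt_iter_commute[OF that] by (intro tendsto_intros h)
  qed
  then have "y * (1 - h) = (1 - h) * y" if "y * z = z * y" for y
    using that by (simp add: right_diff_distrib left_diff_distrib)
  moreover have "norm h \<le> 1"
    using order_trans[OF norm_sqrt_iter[OF assms(1)] sqrt_iter_bound_bounds(2)]
    by (intro Lim_norm_ubound[OF _ h]) auto
  then have "norm (1 - (1 - h)) \<le> 1" by simp
  moreover have "1 - h \<in> S" if S: "closed_unital_subalgebra S" "z \<in> S" for S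
  proof -
    have "sqrt_iter z n \<in> S" for n
    proof (induction n)
      case 0
      then show ?case using S(1) unfolding closed_unital_subalgebra_def by (metis scaleR_zero_left sqrt_iter.simps(1))
    next
      case (Suc n)
      then show ?case using S unfolding closed_unital_subalgebra_def by simp
    qed
    moreover have "closed S" using S(1) by (simp add: closed_unital_subalgebra_def)
    ultimately have "h \<in> S" using h closed_sequentially by blast
    then show ?thesis using S(1) closed_unital_subalgebra_diff by (metis closed_unital_subalgebra_def)
  qed
  ultimately show ?thesis
    using sa sq by (metis star_diff)
qed

lemma star_one [simp]: "star 1 = (1::'a::{cstar_algebra, real_normed_algebra_1})"
  by (metis mult.left_neutral mult.right_neutral star_mult star_star)

text \<open>
  The description of the positive cone by Kelley and Vaught, which makes it evident that the
  cone is closed under addition.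
\<close>

definition kv_positive :: "'a::{cstar_algebra, real_normed_algebra_1} \<Rightarrow> bool" where
  "kv_positive a \<longleftrightarrow> star a = a \<and> (\<exists>t\<ge>0. norm (t *\<^sub>R 1 - a) \<le> t)"

lemma kv_positive_self_adjoint: "kv_positive a \<Longrightarrow> star a = a"
  by (simp add: kv_positive_def)

lemma kv_positive_add: "kv_positive a \<Longrightarrow> kv_positive b \<Longrightarrow> kv_positive (a + b)"
proof -
  assume "kv_positive a" "kv_positive b"
  then obtain s t where st: "star a = a" "star b = b" "s \<ge> 0" "norm (s *\<^sub>R 1 - a) \<le> s"
      "t \<ge> 0" "norm (t *\<^sub>R 1 - b) \<le> t"
    by (auto simp: kv_positive_def)
  have "norm ((s + t) *\<^sub>R 1 - (a + b)) \<le> norm (s *\<^sub>R 1 - a) + norm (t *\<^sub>R 1 - b)"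
    by (rule norm_triangle_le[OF order_refl, THEN order_trans[rotated], OF order_refl, THEN order_trans[rotated]])
      (simp_all add: algebra_simps)
  with st show ?thesis
    by (auto simp: kv_positive_def star_add intro!: exI[of _ "s + t"])
qed

lemma kv_positive_scaleR:
  assumes "kv_positive a" "r \<ge> 0"
  shows "kv_positive (r *\<^sub>R a)"
proof -
  obtain t where t: "star a = a" "t \<ge> 0" "norm (t *\<^sub>R 1 - a) \<le> t"
    using assms by (auto simp: kv_positive_def)
  have "norm ((r * t) *\<^sub>R 1 - r *\<^sub>R a) = r * norm (t *\<^sub>R 1 - a)"
    using assms(2) by (metis abs_of_nonneg norm_scaleR scaleR_diff_right scaleR_scaleR)
  with t assms(2) show ?thesis
    by (auto simp: kv_positive_def star_scaleR mult_left_mono intro!: exI[of _ "r * t"])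
qed

text \<open>If \<open>norm (t *\<^sub>R 1 - a) \<le> t\<close> with \<open>t > 0\<close>, then
  \<open>z = 1 - a / t\<close> is a contraction and \<open>a = t (1 - z)\<close>, so the root of
  \<open>1 - z\<close> only has to be scaled by \<open>sqrt t\<close>. A radius \<open>t = 0\<close>
  forces \<open>a = 0\<close>.\<close>

lemma kv_positive_sqrt:
  fixes a :: "'a::{cstar_algebra, real_normed_algebra_1}"
  assumes "kv_positive a"
  shows "\<exists>k. kv_positive k \<and> star k = k \<and> k * k = a \<and> (\<forall>y. y * a = a * y \<longrightarrow> y * k = k * y) \<and>
    (\<forall>S. closed_unital_subalgebra S \<longrightarrow> a \<in> S \<longrightarrow> k \<in> S)"
proof -
  obtain t where t: "star a = a" "t \<ge> 0" "norm (t *\<^sub>R 1 - a) \<le> t"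
    using assms by (auto simp: kv_positive_def)
  show ?thesis
  proof (cases "t = 0")
    case True
    with t have "a = 0" by simp
    have "kv_positive (0::'a)" by (auto simp: kv_positive_def)
    then show ?thesis using \<open>a = 0\<close>
      by (intro exI[of _ 0]) simp
  next
    case False
    with t have t0: "t > 0" by simp
    define z where "z = 1 - (1/t) *\<^sub>R a"
    have "z = (1/t) *\<^sub>R (t *\<^sub>R 1 - a)"
      using False by (simp add: z_def scaleR_diff_right)
    then have "norm z \<le> 1"
      using t t0 by simp
    moreover have "star z = z"
      using t by (simp add: z_def star_diff star_scaleR)
    ultimately obtain k where k: "star k = k" "k * k = 1 - z"
        "norm (1 - k) \<le> 1" "\<And>y. y * z = z * y \<Longrightarrow> y * k = k * y"
        "\<forall>S. closed_unital_subalgebra S \<longrightarrow> z \<in> S \<longrightarrow> k \<in> S"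
      using ex_sqrt_one_minus[of z] by blast
    show ?thesis
    proof (intro exI[of _ "sqrt t *\<^sub>R k"] conjI allI impI)
      have "norm (sqrt t *\<^sub>R (1 - k)) \<le> sqrt t" using k(3) t0 by (simp add: mult_left_le)
      then show "kv_positive (sqrt t *\<^sub>R k)"
        using k(1) t0 by (auto simp: kv_positive_def star_scaleR scaleR_diff_right intro!: exI[of _ "sqrt t"])
      show "star (sqrt t *\<^sub>R k) = sqrt t *\<^sub>R k" using k(1,2) by (simp add: star_scaleR)
      show "sqrt t *\<^sub>R k * sqrt t *\<^sub>R k = a"
        using k(1,2) t0 by (simp add: z_def)
      show "y * sqrt t *\<^sub>R k = sqrt t *\<^sub>R k * y" if "y * a = a * y" for y
      proof -
        have "y * z = z * y" by (simp add: z_def right_diff_distrib left_diff_distrib that)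
        then show ?thesis by (simp add: k(4))
      qed
      show "sqrt t *\<^sub>R k \<in> S" if S: "closed_unital_subalgebra S" "a \<in> S" for S
      proof -
        have "z \<in> S"
          unfolding z_def using S by (intro closed_unital_subalgebra_diff) (auto simp: closed_unital_subalgebra_def)
        then show ?thesis using k(5) S(1) by (auto simp: closed_unital_subalgebra_def)
      qed
    qed
  qed
qed

text \<open>For \<open>norm h \<le> 1\<close> the element \<open>h + \<i> sqrt (1 - h\<^sup>2)\<close> is an isometry.\<close>

lemma norm_diff_square_le:
  fixes h :: "'a::{cstar_algebra, real_normed_algebra_1}"
  assumes "star h = h" "(norm h)\<^sup>2 \<le> t"
  shows "norm (t *\<^sub>R 1 - h * h) \<le> t"
proof -
  have unit: "norm (1 - h * h) \<le> 1" if "star h = h" "norm h \<le> 1" for h :: 'a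
  proof -
    have nhh: "norm (h * h) = (norm h)\<^sup>2" using that cstar_identity[of h] by simp
    then have "norm (h * h) \<le> 1" using that by (simp add: power_le_one)
    moreover have "star (h * h) = h * h" using that by (simp add: star_mult)
    ultimately obtain k where k: "star k = k" "k * k = 1 - h * h"
        "\<And>y. y * (h * h) = (h * h) * y \<Longrightarrow> y * k = k * y"
      using ex_sqrt_one_minus[of "h * h"] by blast
    have comm: "h * k = k * h" by (rule k(3)) (simp add: mult.assoc)
    define u where "u = h + \<i> *\<^sub>C k"
    note ri = self_adjoint_real_imag[OF that(1) k(1) comm, folded u_def]
    have "star u * u = 1" unfolding ri using k(1,2) by simp
    then have "norm u = 1" using cstar_identity[of u]
      by (metis norm_one norm_ge_zero power2_eq_1_iff abs_norm_cancel abs_1 abs_minus_cancel)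
    \<comment> \<open>Up to a factor of modulus 1, \<open>2 k\<close> is the difference of
      \<open>u\<close> and its adjoint, both of norm 1. Hence \<open>norm k \<le> 1\<close>, and
      \<open>k * k = 1 - h * h\<close> gives the bound.\<close>
    then have "norm (2 *\<^sub>R k) \<le> 2"
      unfolding ri using norm_triangle_ineq4[of u "star u"] by (simp add: norm_scaleC)
    then have "norm k \<le> 1" by simp
    moreover have "norm (k * k) = (norm k)\<^sup>2" using k(1,2) cstar_identity[of k] by simp
    ultimately show ?thesis using k(1,2) by (simp add: power_le_one)
  qed
  show ?thesis
  proof (cases "t = 0")
    case True
    then show ?thesis using assms by simp
  next
    case False
    with order_trans[OF zero_le_power2 assms(2)] have t0: "t > 0" by simp
    define h' where "h' = (1 / sqrt t) *\<^sub>R h"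
    have "norm h \<le> sqrt t" using assms(2) by (simp add: real_le_rsqrt)
    then have "norm h' \<le> 1" using t0 by (simp add: h'_def)
    moreover have "star h' = h'" using assms by (simp add: h'_def star_scaleR)
    ultimately have "norm (1 - h' * h') \<le> 1" by (rule unit[rotated])
    moreover have "t *\<^sub>R 1 - h * h = t *\<^sub>R (1 - h' * h')"
      using t0 by (simp add: h'_def scaleR_diff_right)
    ultimately show ?thesis using t0 by (simp add: mult_left_le)
  qed
qed

lemma kv_positive_square: "star h = h \<Longrightarrow> kv_positive (h * h)"
  using norm_diff_square_le[of h "(norm h)\<^sup>2"]
  by (auto simp: kv_positive_def star_mult intro!: exI[of _ "(norm h)\<^sup>2"])

text \<open>Any bound on the norm may serve as radius, whatever radius the definition provides.
  Limits need this, since they require one radius for all terms.\<close>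

lemma kv_positive_norm_bound:
  assumes "kv_positive a" "norm a \<le> t"
  shows "norm (t *\<^sub>R 1 - a) \<le> t"
proof -
  obtain k where "star k = k" "k * k = a" by (metis kv_positive_sqrt[OF assms(1)])
  then show ?thesis
    using norm_diff_square_le[of k t] cstar_identity[of k] assms(2) by simp
qed

lemma kv_positive_diff: "star a = a \<Longrightarrow> norm a \<le> t \<Longrightarrow> kv_positive (t *\<^sub>R 1 - a)"
  by (auto simp: kv_positive_def star_diff star_scaleR intro!: exI[of _ t])
    (use norm_ge_zero order_trans in blast)

text \<open>With commuting roots \<open>h\<close> of \<open>a\<close> and \<open>k\<close> of
  \<open>- a\<close>, the element \<open>u = h + i k\<close> satisfies
  \<open>star u * u = a + (- a) = 0\<close>, so \<open>u\<close> and its real part \<open>h\<close>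
  vanish.\<close>

lemma kv_positive_antisym:
  assumes "kv_positive a" "kv_positive (- a)"
  shows "a = 0"
proof -
  obtain h where h: "star h = h" "h * h = a" by (metis kv_positive_sqrt[OF assms(1)])
  obtain k where "kv_positive k" and k: "star k = k" "k * k = - a" "\<And>y. y * - a = - a * y \<Longrightarrow> y * k = k * y"
    using kv_positive_sqrt[OF assms(2)] by blast
  have "h * k = k * h" by (rule k(3)) (simp flip: h(2) add: mult.assoc)
  note ri = self_adjoint_real_imag[OF h(1) k(1) this]
  have "h + \<i> *\<^sub>C k = 0" using cstar_identity[of "h + \<i> *\<^sub>C k"] ri(1) h k(1,2) by simp
  with ri(2) have "h = 0" by simp
  with h show ?thesis by simp
qed

text \<open>Write \<open>a = star c * c\<close> as \<open>p - q\<close> with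
  \<open>p * q = 0\<close>, using the root \<open>m\<close> of \<open>a * a\<close> as absolute
  value. For \<open>d = c * q\<close> one gets \<open>star d * d = - (q * q * q)\<close>, and it
  must be shown that \<open>q = 0\<close>. The usual comparison of the spectra of
  \<open>star d * d\<close> and \<open>d * star d\<close> is replaced by a further element
  \<open>e = d * s\<close>, for which both \<open>star e * e\<close> and \<open>e * star e\<close>
  are negatives of squares.\<close>

lemma kv_positive_star_mult: "kv_positive (star c * c)"
proof -
  define a where "a = star c * c"
  have sa: "star a = a" by (simp add: a_def star_mult star_star)
  obtain m where mp: "kv_positive m" and m: "star m = m" "m * m = a * a" "\<And>y. y * (a * a) = (a * a) * y \<Longrightarrow> y * m = m * y"
    using kv_positive_sqrt[OF kv_positive_square[OF sa]] by blast
  define p where "p = (1/2) *\<^sub>R (m + a)"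
  define q where "q = (1/2) *\<^sub>R (m - a)"
  have am: "a * m = m * a" by (rule m(3)) (simp add: mult.assoc)
  have sq: "star q = q" "star p = p" by (simp_all add: p_def q_def star_scaleR star_add star_diff sa m(1))
  have apq: "a = p - q" by (simp add: p_def q_def flip: scaleR_diff_right)
  have pq: "p * q = 0" "q * p = 0"
    using am m(2) by (simp_all add: p_def q_def algebra_simps)
  \<comment> \<open>\<open>q\<close> is the negative part of \<open>a\<close>, but only \<open>q\<^sup>3\<close> is easily seen to be positive.\<close>
  obtain n where "kv_positive n" and n: "star n = n" "n * n = m" "\<And>y. y * m = m * y \<Longrightarrow> y * n = n * y"
    using kv_positive_sqrt[OF mp] by blast
  have qn: "q * n = n * q" by (rule n(3)) (simp add: q_def algebra_simps am)
  \<comment> \<open>A self-adjoint root of \<open>q * q * q\<close>: since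
    \<open>n * n = m = p + q\<close> and \<open>p * q = 0\<close>, the square of
    \<open>n * q\<close> is \<open>q * m * q\<close>.\<close>
  define s where "s = n * q"
  have ss: "star s = s" by (simp add: s_def star_mult n(1) sq qn)
  have mpq: "m = p + q" by (simp add: p_def q_def flip: scaleR_add_right)
  have s2: "s * s = q * q * q"
  proof -
    have "s * s = q * (n * n) * q" unfolding s_def by (metis qn mult.assoc)
    then show ?thesis by (simp add: n(2) mpq distrib_left distrib_right pq mult.assoc)
  qed
  define d where "d = c * q"
  have dd: "star d * d = - (s * s)"
  proof -
    have "star d * d = q * a * q" by (simp add: d_def a_def star_mult sq mult.assoc)
    then show ?thesis by (simp add: s2 apq right_diff_distrib left_diff_distrib pq mult.assoc)
  qed
  \<comment> \<open>The sum is half of \<open>h * h + k * k\<close> for the self-adjoint elements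
    \<open>h\<close> and \<open>k\<close> built from \<open>x\<close> and its adjoint, whether or
    not \<open>x\<close> is normal.\<close>
  have sum_pos: "kv_positive (star x * x + x * star x)" for x :: 'a
  proof -
    define h where "h = x + star x"
    define k where "k = \<i> *\<^sub>C (x - star x)"
    have "star h = h" "star k = k"
      by (simp_all add: h_def k_def star_add star_star star_scaleC star_diff complex_vector.scale_minus_left
          flip: complex_vector.scale_minus_right)
    then have "kv_positive ((1/2) *\<^sub>R (h * h + k * k))"
      by (intro kv_positive_scaleR kv_positive_add kv_positive_square) auto
    moreover have "h * h + k * k = 2 *\<^sub>R (star x * x + x * star x)"
      by (simp add: h_def k_def mult_scaleC_left mult_scaleC_right scaleC_scaleC scaleC_minus1
          algebra_simps scaleR_2)
    ultimately show ?thesis by simp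
  qed
  define r where "r = d * star d"
  have "r = (star d * d + d * star d) + s * s" by (simp add: dd r_def)
  then have "kv_positive r" using sum_pos[of d] kv_positive_square[OF ss] kv_positive_add by metis
  then have sr: "star r = r" by (rule kv_positive_self_adjoint)
  define e where "e = d * s"
  have "e * star e = d * (s * s) * star d" by (simp add: e_def star_mult ss mult.assoc)
  also have "s * s = - (star d * d)" by (simp add: dd)
  also have "d * - (star d * d) * star d = - (r * r)" by (simp add: r_def mult.assoc)
  finally have e1: "e * star e = - (r * r)" .
  have "star e * e = s * (star d * d) * s" by (simp add: e_def star_mult ss mult.assoc)
  then have e2: "star e * e = - ((s * s) * (s * s))" by (simp add: dd mult.assoc)
  \<comment> \<open>Applied to \<open>e\<close>, the sum of the two products is minus a sum of two
    squares. Antisymmetry makes that sum zero, and a second use of it kills the fourth power of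
    \<open>s\<close>.\<close>
  have "kv_positive (- (r * r + (s * s) * (s * s)))"
    using sum_pos[of e] by (simp add: e1 e2 add.commute)
  moreover have rr: "kv_positive (r * r)" by (rule kv_positive_square[OF sr])
  moreover have s4: "kv_positive ((s * s) * (s * s))" by (rule kv_positive_square) (simp add: star_mult ss)
  ultimately have "r * r + (s * s) * (s * s) = 0"
    by (intro kv_positive_antisym kv_positive_add)
  then have "- ((s * s) * (s * s)) = r * r" by (metis add_eq_0_iff minus_minus)
  with rr have "kv_positive (- ((s * s) * (s * s)))" by simp
  with s4 have "(s * s) * (s * s) = 0" by (intro kv_positive_antisym)
  then have "s * s = 0" using mult_self_adjoint_eq_0_iff[of "s * s"] ss by (simp add: star_mult)
  then have "(q * q) * (q * q) = 0" using s2 by (metis mult.assoc mult_zero_left)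
  then have "q * q = 0" using mult_self_adjoint_eq_0_iff[of "q * q"] sq by (simp add: star_mult)
  then have "q = 0" using mult_self_adjoint_eq_0_iff[of q] sq by simp
  then have "a = m" using apq mpq by simp
  then show ?thesis using mp a_def by simp
qed

lemma kv_positive_iff: "kv_positive a \<longleftrightarrow> (\<exists>c. a = star c * c)"
  using kv_positive_star_mult kv_positive_sqrt by metis

lemma kv_positive_conjugate:
  assumes "kv_positive a"
  shows "kv_positive (star c * a * c)"
proof -
  obtain d where "a = star d * d" using assms by (auto simp: kv_positive_iff)
  then have "star c * a * c = star (d * c) * (d * c)" by (simp add: star_mult mult.assoc)
  then show ?thesis by (simp only: kv_positive_star_mult)
qed

text \<open>The roots of commuting positive elements commute, so \<open>a * b\<close> is the square
  of their self-adjoint product.\<close>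

lemma kv_positive_mult:
  assumes "kv_positive a" "kv_positive b" "a * b = b * a"
  shows "kv_positive (a * b)"
proof -
  obtain h where h: "star h = h" "h * h = a" "\<forall>y. y * a = a * y \<longrightarrow> y * h = h * y"
    using kv_positive_sqrt[OF assms(1)] by blast
  obtain k where k: "star k = k" "k * k = b" "\<forall>y. y * b = b * y \<longrightarrow> y * k = k * y"
    using kv_positive_sqrt[OF assms(2)] by blast
  have "k * h = h * k" using h(3) k(3) assms(3) by metis
  then have "a * b = (h * k) * (h * k)" "star (h * k) = h * k"
    using h(1,2) k(1,2) by (metis mult.assoc, simp add: star_mult)
  then show ?thesis by (simp add: kv_positive_square)
qed

lemma kv_positive_one: "kv_positive 1"
  using kv_positive_star_mult[of 1] by simp

lemma kv_positive_power:
  assumes "kv_positive a"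
  shows "kv_positive (a ^ n)"
  by (induction n) (auto simp: kv_positive_one power_commutes intro!: kv_positive_mult assms)

lemma kv_positive_sum: "(\<And>i. i \<in> S \<Longrightarrow> kv_positive (f i)) \<Longrightarrow> kv_positive (sum f S)"
  by (induction S rule: infinite_finite_induct)
    (auto intro: kv_positive_add simp: kv_positive_scaleR[OF kv_positive_one, of 0, simplified])

text \<open>With \<open>t = norm b\<close> both \<open>a\<close> and \<open>t - a\<close> are
  positive. Their commuting roots \<open>h\<close> and \<open>k\<close> give
  \<open>u = h + i k\<close> with \<open>star u * u = t\<close>, and the real part satisfies
  \<open>norm h \<le> norm u = sqrt t\<close>.\<close>

lemma kv_positive_norm_mono:
  assumes "kv_positive a" "kv_positive (b - a)"
  shows "norm a \<le> norm b"
proof -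
  define t where "t = norm b"
  have "star b = b" using kv_positive_self_adjoint[OF kv_positive_add[OF assms]] by simp
  then have "kv_positive (t *\<^sub>R 1 - b)" by (simp add: t_def kv_positive_diff)
  from kv_positive_add[OF this assms(2)] have ta: "kv_positive (t *\<^sub>R 1 - a)" by simp
  obtain h where h: "star h = h" "h * h = a"
    using kv_positive_sqrt[OF assms(1)] by blast
  obtain k where k: "star k = k" "k * k = t *\<^sub>R 1 - a"
      "\<forall>y. y * (t *\<^sub>R 1 - a) = (t *\<^sub>R 1 - a) * y \<longrightarrow> y * k = k * y"
    using kv_positive_sqrt[OF ta] by blast
  have "h * (t *\<^sub>R 1 - a) = (t *\<^sub>R 1 - a) * h"
    by (simp add: algebra_simps flip: h(2))
  then have "h * k = k * h" using k(3) by blast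
  define u where "u = h + \<i> *\<^sub>C k"
  note ri = self_adjoint_real_imag[OF h(1) k(1) \<open>h * k = k * h\<close>, folded u_def]
  have "star u * u = t *\<^sub>R 1" unfolding ri(1) using h(2) k(2) by simp
  then have "(norm u)\<^sup>2 = t" using cstar_identity[of u] by (simp add: t_def)
  then have u: "norm u = sqrt t" by (metis norm_ge_zero real_sqrt_unique)
  have "norm (2 *\<^sub>R h) \<le> 2 * norm u"
    unfolding ri(2) using norm_triangle_ineq[of u "star u"] by simp
  then have "norm h \<le> sqrt t" by (simp add: u)
  then have "(norm h)\<^sup>2 \<le> t" by (metis norm_ge_zero power_mono real_sqrt_pow2 t_def)
  then show ?thesis using cstar_identity[of h] h by (simp add: t_def)
qed

text \<open>A convergent sequence is bounded, and its bound is a common radius for all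
  terms.\<close>

lemma kv_positive_limit:
  assumes "f \<longlonglongrightarrow> a" "\<And>n. kv_positive (f n)"
  shows "kv_positive a"
proof -
  obtain K where K: "K > 0" "\<And>n. norm (f n) \<le> K"
    using convergent_imp_Bseq[OF convergentI[OF assms(1)]] by (auto simp: Bseq_def)
  have "norm (K *\<^sub>R 1 - a) \<le> K"
    by (rule Lim_norm_ubound[OF _ tendsto_diff[OF tendsto_const assms(1)]])
      (auto simp: kv_positive_norm_bound[OF assms(2) K(2)])
  moreover have "star a = a"
    using tendsto_star[OF assms(1)] assms(1) kv_positive_self_adjoint[OF assms(2)]
    by (simp add: LIMSEQ_unique)
  ultimately show ?thesis using K(1) unfolding kv_positive_def by (intro conjI exI[of _ K]) auto
qed

section \<open>Geometric sums in a positive contraction\<close>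

lemma sum_mult_power_one_minus: "(\<Sum>k<n. a * (1 - a) ^ k) = 1 - (1 - a :: 'a::ring_1) ^ n"
  by (induction n) (simp_all add: algebra_simps)

lemma power_one_minus_commute: "a * (1 - a :: 'a::ring_1) ^ n = (1 - a) ^ n * a"
  by (rule power_commuting_commutes[symmetric]) (simp add: algebra_simps)

text \<open>The elements \<open>a * w ^ k\<close> with \<open>w = 1 - a\<close> decrease in
  \<open>k\<close>, so \<open>n + 1\<close> times the last of them is at most their sum, which
  telescopes to \<open>1 - w ^ (n + 1) \<le> 1\<close>. This rate makes the approximate units and
  approximate inverses below quantitative.\<close>

lemma norm_mult_power_one_minus_le:
  fixes a :: "'a::{cstar_algebra, real_normed_algebra_1}"
  assumes "kv_positive a" "norm a \<le> 1"
  shows "norm (a * (1 - a) ^ n) \<le> 1 / (n + 1)"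
proof -
  define w where "w = 1 - a"
  have w: "kv_positive w"
    using kv_positive_diff[OF kv_positive_self_adjoint[OF assms(1)] assms(2)] by (simp add: w_def)
  note comm = power_one_minus_commute[of a, folded w_def]
  have aw: "kv_positive (a * w ^ k)" for k
    by (intro kv_positive_mult kv_positive_power assms w comm)
  have dec: "kv_positive (a * w ^ k - a * w ^ n)" if "k \<le> n" for k
  proof -
    \<comment> \<open>The second factor is again a sum of terms \<open>a * w ^ j\<close>, so the
      difference is a sum of products of commuting positive elements.\<close>
    have "a * w ^ k - a * w ^ n = a * w ^ k * (1 - w ^ (n - k))"
      using that by (simp add: right_diff_distrib mult.assoc flip: power_add)
    also have "1 - w ^ (n - k) = (\<Sum>j<n - k. a * w ^ j)"
      unfolding w_def by (rule sum_mult_power_one_minus[symmetric])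
    also have "a * w ^ k * (\<Sum>j<n - k. a * w ^ j) = (\<Sum>j<n - k. (a * w ^ k) * (a * w ^ j))"
      by (rule sum_distrib_left)
    also have "kv_positive \<dots>"
    proof (rule kv_positive_sum, rule kv_positive_mult[OF aw aw])
      fix j
      have "(a * w ^ k) * (a * w ^ j) = a * a * w ^ (k + j)"
        using comm[of k] by (metis mult.assoc power_add)
      moreover have "(a * w ^ j) * (a * w ^ k) = a * a * w ^ (j + k)"
        using comm[of j] by (metis mult.assoc power_add)
      ultimately show "(a * w ^ k) * (a * w ^ j) = (a * w ^ j) * (a * w ^ k)"
        by (simp add: add.commute)
    qed
    finally show ?thesis .
  qed
  have "kv_positive (\<Sum>k<n+1. a * w ^ k - a * w ^ n)"
    by (intro kv_positive_sum dec) auto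
  also have "(\<Sum>k<n+1. a * w ^ k - a * w ^ n) = (1 - w ^ (n+1)) - (real n + 1) *\<^sub>R (a * w ^ n)"
    unfolding sum_subtractf w_def sum_mult_power_one_minus
    by (simp add: sum_constant_scaleR add.commute scaleR_conv_of_real del: sum.lessThan_Suc)
  finally have "kv_positive ((1 - w ^ (n+1)) - (real n + 1) *\<^sub>R (a * w ^ n) + w ^ (n+1))"
    by (rule kv_positive_add[OF _ kv_positive_power[OF w]])
  then have "kv_positive (1 - (real n + 1) *\<^sub>R (a * w ^ n))" by simp
  then have "norm ((real n + 1) *\<^sub>R (a * w ^ n)) \<le> norm (1::'a)"
    by (intro kv_positive_norm_mono kv_positive_scaleR aw) auto
  then have "(real n + 1) * norm (a * w ^ n) \<le> 1" by (simp only: norm_scaleR norm_one)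
  then show ?thesis by (simp add: w_def pos_le_divide_eq mult.commute)
qed

section \<open>Unitization\<close>

text \<open>The roots and norm estimates above need a unit of norm 1. One is always adjoined, even
  to an algebra that already has a unit, so that a single construction covers every algebra of the
  class.\<close>

datatype 'a unitization = Unitization (nonscalar: 'a) (scalar: complex)

instantiation unitization :: (cstar_algebra) real_normed_algebra_1
begin

definition "0 = Unitization 0 0"
definition "1 = Unitization 0 1"
definition "u + v = Unitization (nonscalar u + nonscalar v) (scalar u + scalar v)"
definition "u - v = Unitization (nonscalar u - nonscalar v) (scalar u - scalar v)"
definition "- u = Unitization (- nonscalar u) (- scalar u)"
definition "u * v = Unitization
  (nonscalar u * nonscalar v + scalar v *\<^sub>C nonscalar u + scalar u *\<^sub>C nonscalar v) (scalar u * scalar v)"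
definition "r *\<^sub>R u = Unitization (r *\<^sub>R nonscalar u) (r *\<^sub>R scalar u)"

text \<open>
  The operator norm of left multiplication is only a seminorm when the algebra already has a
  unit, hence the maximum with the absolute value of the scalar part.
\<close>

definition "norm u = max (onorm (\<lambda>x. nonscalar u * x + scalar u *\<^sub>C x)) (cmod (scalar u))"
definition "dist u v = norm (u - v :: 'a unitization)"
definition "sgn u = scaleR (inverse (norm u)) (u :: 'a unitization)"
definition "uniformity = (INF e\<in>{0<..}. principal {(u, v). dist (u :: 'a unitization) v < e})"
definition "open U = (\<forall>u\<in>U. \<forall>\<^sub>F (u', v) in uniformity. u' = u \<longrightarrow> v \<in> (U :: 'a unitization set))"

lemmas unitization_simps = zero_unitization_def one_unitization_def plus_unitization_def
  minus_unitization_def uminus_unitization_def times_unitization_def scaleR_unitization_def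

text \<open>The unitization acts on the original algebra, which is an ideal in it. This operator
  carries the norm, and later it turns elements with a scalar part into maps on the algebra
  itself.\<close>

definition left_mult :: "'a unitization \<Rightarrow> 'a \<Rightarrow> 'a" where
  "left_mult u x = nonscalar u * x + scalar u *\<^sub>C x"

lemma bounded_linear_left_mult: "bounded_linear (left_mult u)"
  unfolding left_mult_def[abs_def]
  by (intro bounded_linear_add bounded_linear_mult_right bounded_linear_scaleC)

lemma norm_unitization: "norm u = max (onorm (left_mult u)) (cmod (scalar u))"
  by (simp add: norm_unitization_def left_mult_def[abs_def])

lemma left_mult_mult: "left_mult (u * v) = left_mult u \<circ> left_mult v"
  by (rule ext) (simp add: left_mult_def unitization_simps algebra_simps scaleC_add_right
      mult_scaleC_left mult_scaleC_right scaleC_scaleC)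

lemma left_mult_add: "left_mult (u + v) = (\<lambda>x. left_mult u x + left_mult v x)"
  by (rule ext) (simp add: left_mult_def unitization_simps algebra_simps scaleC_add_left)

lemma left_mult_scaleR: "left_mult (r *\<^sub>R u) = (\<lambda>x. r *\<^sub>R left_mult u x)"
  by (rule ext) (simp add: left_mult_def unitization_simps scaleC_add_right
      mult_scaleC_left scaleC_scaleC scaleR_conv_of_real flip: scaleC_of_real)

lemma norm_left_mult_le: "norm (left_mult u x) \<le> norm u * norm x"
  using onorm[OF bounded_linear_left_mult, of u x]
  by (rule order_trans) (simp add: norm_unitization mult_right_mono)

lemma norm_scalar_le: "cmod (scalar u) \<le> norm (u :: 'a unitization)"
  by (simp add: norm_unitization)

text \<open>For \<open>a\<close> the nonscalar part, the multiplication operator takes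
  \<open>star a\<close> to \<open>a * star a\<close> plus a multiple of \<open>star a\<close>.
  Solving for \<open>a * star a\<close> leaves two terms, each at most
  \<open>norm u * norm a\<close>, hence the factor 2. The bound gives definiteness of the norm and
  completeness coordinate by coordinate.\<close>

lemma norm_nonscalar_le: "norm (nonscalar u) \<le> 2 * norm (u :: 'a unitization)"
proof (cases "nonscalar u = 0")
  case True
  then show ?thesis using norm_scalar_le[of u] by (simp add: order_trans[OF norm_ge_zero])
next
  case False
  let ?a = "nonscalar u"
  have "?a * star ?a = left_mult u (star ?a) - scalar u *\<^sub>C star ?a"
    by (simp add: left_mult_def)
  then have "(norm ?a)\<^sup>2 \<le> norm (left_mult u (star ?a)) + cmod (scalar u) * norm ?a"
    using norm_triangle_ineq4[of "left_mult u (star ?a)" "scalar u *\<^sub>C star ?a"]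
    by (simp add: norm_scaleC flip: norm_mult_star)
  also have "\<dots> \<le> norm u * norm ?a + norm u * norm ?a"
    using norm_left_mult_le[of u "star ?a"] norm_scalar_le[of u] by (intro add_mono mult_right_mono) auto
  finally show ?thesis using False by (simp add: power2_eq_square)
qed

lemma norm_unitization_leI:
  assumes "\<And>x. norm (left_mult u x) \<le> K * norm x" "cmod (scalar u) \<le> K"
  shows "norm (u :: 'a unitization) \<le> K"
  using onorm_bound[of K "left_mult u"] assms order_trans[OF norm_ge_zero assms(2)]
  by (simp add: norm_unitization)

instance
proof
  fix u v w :: "'a unitization" and r s :: real and k l :: complex
  have nn: "0 \<le> norm u" for u :: "'a unitization"
    by (rule order_trans[OF norm_ge_zero norm_scalar_le])
  show "u + v + w = u + (v + w)" "u + v = v + u" "0 + u = u" "- u + u = 0" "u - v = u + - v"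
    by (simp_all add: unitization_simps unitization.expand)
  show "u * v * w = u * (v * w)"
    by (simp add: unitization_simps algebra_simps scaleC_add_right
      mult_scaleC_left mult_scaleC_right scaleC_scaleC)
  show "(u + v) * w = u * w + v * w" "u * (v + w) = u * v + u * w"
    by (simp_all add: unitization_simps algebra_simps scaleC_add_right scaleC_add_left)
  show "1 * u = u" "u * 1 = u" "(0::'a unitization) \<noteq> 1"
    by (simp_all add: unitization_simps unitization.expand)
  show "r *\<^sub>R (u + v) = r *\<^sub>R u + r *\<^sub>R v" "(r + s) *\<^sub>R u = r *\<^sub>R u + s *\<^sub>R u"
      "r *\<^sub>R s *\<^sub>R u = (r * s) *\<^sub>R u" "1 *\<^sub>R u = u"
    by (simp_all add: unitization_simps unitization.expand algebra_simps)
  show "r *\<^sub>R u * v = r *\<^sub>R (u * v)" "u * r *\<^sub>R v = r *\<^sub>R (u * v)"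
    by (simp_all add: unitization_simps algebra_simps mult_scaleC_left mult_scaleC_right scaleC_scaleC
        scaleC_add_right scaleR_conv_of_real flip: scaleC_of_real)
  show "dist u v = norm (u - v)" "sgn u = inverse (norm u) *\<^sub>R u"
      "uniformity = (INF e\<in>{0<..}. principal {(u, v). dist (u :: 'a unitization) v < e})"
      "open U = (\<forall>u\<in>U. \<forall>\<^sub>F (u', v) in uniformity. u' = u \<longrightarrow> v \<in> U)" for U :: "'a unitization set"
    by (simp_all only: dist_unitization_def sgn_unitization_def uniformity_unitization_def open_unitization_def)
  show norm0: "norm u = 0 \<longleftrightarrow> u = 0"
  proof
    assume "norm u = 0"
    then have "nonscalar u = 0" "scalar u = 0"
      using norm_scalar_le[of u] norm_nonscalar_le[of u] by auto
    then show "u = 0" by (simp add: zero_unitization_def unitization.expand)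
  next
    assume "u = 0"
    then have "norm u \<le> 0"
      by (intro norm_unitization_leI) (simp_all add: left_mult_def unitization_simps)
    then show "norm u = 0" using nn[of u] by simp
  qed
  show "norm (u + v) \<le> norm u + norm v"
  proof (rule norm_unitization_leI)
    show "norm (left_mult (u + v) x) \<le> (norm u + norm v) * norm x" for x
      using norm_triangle_ineq[of "left_mult u x" "left_mult v x"] norm_left_mult_le[of u x] norm_left_mult_le[of v x]
      by (simp add: left_mult_add distrib_right)
    show "cmod (scalar (u + v)) \<le> norm u + norm v"
      using norm_triangle_ineq[of "scalar u" "scalar v"] norm_scalar_le[of u] norm_scalar_le[of v]
      by (simp add: unitization_simps)
  qed
  \<comment> \<open>An inequality valid for all scalars becomes an equality when it is also applied
    to the inverse scalar.\<close>
  have leR: "norm (r *\<^sub>R u) \<le> \<bar>r\<bar> * norm u" for r and u :: "'a unitization"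
    by (rule norm_unitization_leI)
      (simp_all add: left_mult_scaleR mult.assoc mult_left_mono norm_left_mult_le,
       simp add: unitization_simps mult_left_mono norm_scalar_le)
  show "norm (r *\<^sub>R u) = \<bar>r\<bar> * norm u"
  proof (cases "r = 0")
    case True
    then have "norm (r *\<^sub>R u) \<le> 0" using leR[of r u] by simp
    then show ?thesis using True nn[of "r *\<^sub>R u"] by simp
  next
    case False
    have "norm u = norm (inverse r *\<^sub>R r *\<^sub>R u)"
      using False by (simp add: unitization_simps unitization.expand)
    also have "\<dots> \<le> inverse \<bar>r\<bar> * norm (r *\<^sub>R u)" using leR[of "inverse r"] by simp
    finally have "\<bar>r\<bar> * norm u \<le> norm (r *\<^sub>R u)" using False by (simp add: field_simps)
    with leR[of r u] show ?thesis by simp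
  qed
  show mult: "norm (u * v) \<le> norm u * norm v" for u v :: "'a unitization"
  proof (rule norm_unitization_leI)
    fix x
    have "norm (left_mult u (left_mult v x)) \<le> norm u * (norm v * norm x)"
      by (rule order_trans[OF norm_left_mult_le]) (simp add: mult_left_mono norm_left_mult_le nn)
    then show "norm (left_mult (u * v) x) \<le> norm u * norm v * norm x"
      by (simp add: left_mult_mult mult.assoc)
    show "cmod (scalar (u * v)) \<le> norm u * norm v"
      by (simp add: unitization_simps norm_mult mult_mono norm_scalar_le nn)
  qed
  show "norm (1 :: 'a unitization) = 1"
  proof (rule antisym)
    show "norm (1 :: 'a unitization) \<le> 1"
      by (rule norm_unitization_leI) (simp_all add: left_mult_def unitization_simps)
    show "1 \<le> norm (1 :: 'a unitization)"
      using norm_scalar_le[of 1] by (simp add: unitization_simps)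
  qed
qed

end

lemma norm_unitization_le: "norm (u :: 'a::cstar_algebra unitization) \<le> norm (nonscalar u) + cmod (scalar u)"
proof (rule norm_unitization_leI)
  show "norm (left_mult u x) \<le> (norm (nonscalar u) + cmod (scalar u)) * norm x" for x
    unfolding left_mult_def distrib_right
    by (rule order_trans[OF norm_triangle_ineq]) (simp add: norm_mult_ineq norm_scaleC add_mono)
qed simp

lemma bounded_linear_nonscalar: "bounded_linear (nonscalar :: 'a::cstar_algebra unitization \<Rightarrow> 'a)"
  by (rule bounded_linear_intro[of _ 2])
    (use norm_nonscalar_le in \<open>auto simp: unitization_simps mult.commute\<close>)

lemma bounded_linear_scalar: "bounded_linear (scalar :: 'a::cstar_algebra unitization \<Rightarrow> complex)"
  by (rule bounded_linear_intro[of _ 1]) (auto simp: unitization_simps norm_scalar_le)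

instantiation unitization :: (cstar_algebra) cstar_algebra
begin

definition "k *\<^sub>C u = Unitization (k *\<^sub>C nonscalar u) (k * scalar u)"
definition "star u = Unitization (star (nonscalar u)) (cnj (scalar u))"

lemmas unitization_star_simps = unitization_simps scaleC_unitization_def star_unitization_def

lemma left_mult_scaleC: "left_mult (k *\<^sub>C u) = (\<lambda>x. k *\<^sub>C left_mult u x)"
  by (rule ext) (simp add: left_mult_def unitization_star_simps scaleC_add_right mult_scaleC_left scaleC_scaleC)

text \<open>For every \<open>x\<close> the C*-identity of the original algebra turns
  \<open>(norm (left_mult u x))\<^sup>2\<close> into the norm of
  \<open>star x * left_mult (star u * u) x\<close>, which is at most
  \<open>norm (star u * u) * (norm x)\<^sup>2\<close>. The scalar part is estimated
  separately.\<close>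

lemma norm_unitization_square_le: "(norm u)\<^sup>2 \<le> norm (star u * u :: 'a unitization)"
proof -
  have "norm u \<le> sqrt (norm (star u * u))"
  proof (rule norm_unitization_leI)
    fix x
    have "star (left_mult u x) * left_mult u x = star x * left_mult (star u * u) x"
      by (simp add: left_mult_def unitization_star_simps algebra_simps star_add star_mult star_scaleC
          mult_scaleC_left mult_scaleC_right scaleC_scaleC scaleC_add_right)
    then have "(norm (left_mult u x))\<^sup>2 = norm (star x * left_mult (star u * u) x)"
      by (simp flip: cstar_identity)
    also have "\<dots> \<le> norm x * (norm (star u * u) * norm x)"
      by (rule order_trans[OF norm_mult_ineq]) (simp add: mult_left_mono norm_left_mult_le)
    finally have "norm (left_mult u x) \<le> sqrt (norm x * (norm (star u * u) * norm x))"
      by (simp add: real_le_rsqrt)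
    then show "norm (left_mult u x) \<le> sqrt (norm (star u * u)) * norm x"
      by (simp add: real_sqrt_mult mult.assoc mult.commute[of "sqrt (norm x)"])
  next
    have "(cmod (scalar u))\<^sup>2 \<le> norm (star u * u)"
      using norm_scalar_le[of "star u * u"] by (simp add: unitization_star_simps norm_mult power2_eq_square)
    then show "cmod (scalar u) \<le> sqrt (norm (star u * u))" by (simp add: real_le_rsqrt)
  qed
  moreover have "0 \<le> norm (star u * u)" "0 \<le> norm u"
    by (auto intro: order_trans[OF norm_ge_zero norm_scalar_le])
  ultimately show ?thesis by (metis power_mono real_sqrt_pow2)
qed

instance
proof
  fix X :: "nat \<Rightarrow> 'a unitization"
  assume X: "Cauchy X"
  have "Cauchy (\<lambda>n. nonscalar (X n))" "Cauchy (\<lambda>n. scalar (X n))"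
    using bounded_linear.Cauchy[OF bounded_linear_nonscalar X]
      bounded_linear.Cauchy[OF bounded_linear_scalar X] by simp_all
  then obtain a l where al: "(\<lambda>n. nonscalar (X n)) \<longlonglongrightarrow> a" "(\<lambda>n. scalar (X n)) \<longlonglongrightarrow> l"
    by (auto simp: Cauchy_convergent_iff convergent_def)
  \<comment> \<open>The norm is at most the sum of the norms of the two parts, so convergence of
    both parts suffices.\<close>
  have "(\<lambda>n. norm (nonscalar (X n) - a) + cmod (scalar (X n) - l)) \<longlonglongrightarrow> 0"
    using tendsto_add[OF al(1)[THEN LIM_zero, THEN tendsto_norm_zero] al(2)[THEN LIM_zero, THEN tendsto_norm_zero]]
    by simp
  then have "(\<lambda>n. X n - Unitization a l) \<longlonglongrightarrow> 0"
    by (rule Lim_null_comparison[rotated])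
      (use norm_unitization_le[of "X _ - Unitization a l"] in \<open>auto simp: unitization_simps\<close>)
  then show "convergent X" using LIM_zero_cancel convergentI by blast
next
  fix u v w :: "'a unitization" and r :: real and k l :: complex
  show "k *\<^sub>C (u + v) = k *\<^sub>C u + k *\<^sub>C v" "(k + l) *\<^sub>C u = k *\<^sub>C u + l *\<^sub>C u"
      "k *\<^sub>C l *\<^sub>C u = (k * l) *\<^sub>C u" "complex_of_real r *\<^sub>C u = r *\<^sub>R u"
      "(k *\<^sub>C u) * v = k *\<^sub>C (u * v)" "u * (k *\<^sub>C v) = k *\<^sub>C (u * v)"
    by (simp_all add: unitization_star_simps algebra_simps scaleC_add_right scaleC_add_left scaleC_scaleC
      mult_scaleC_left mult_scaleC_right scaleC_of_real scaleR_conv_of_real)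
  show "star (u + v) = star u + star v" "star (k *\<^sub>C u) = cnj k *\<^sub>C star u"
      "star (u * v) = star v * star u" "star (star u) = u"
    by (simp_all add: unitization_star_simps unitization.expand star_add star_scaleC star_mult star_star algebra_simps)
  have leC: "norm (k *\<^sub>C u) \<le> cmod k * norm u" for k and u :: "'a unitization"
    by (rule norm_unitization_leI)
      (simp_all add: left_mult_scaleC norm_scaleC mult.assoc mult_left_mono norm_left_mult_le,
       simp add: unitization_star_simps norm_mult mult_left_mono norm_scalar_le)
  have CC: "k *\<^sub>C l *\<^sub>C u = (k * l) *\<^sub>C u" "1 *\<^sub>C u = u" "complex_of_real r *\<^sub>C u = r *\<^sub>R u"
    for k l r and u :: "'a unitization"
    by (simp_all add: unitization_star_simps scaleC_scaleC unitization.expand scaleC_of_real scaleR_conv_of_real)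
  show nC: "norm (k *\<^sub>C u) = cmod k * norm u" for k and u :: "'a unitization"
  proof (cases "k = 0")
    case True
    then have "norm (k *\<^sub>C u) \<le> 0" using leC[of k u] by simp
    then show ?thesis using True norm_ge_zero[of "k *\<^sub>C u"] by simp
  next
    case False
    have "norm u = norm (inverse k *\<^sub>C k *\<^sub>C u)" using False by (simp add: CC)
    also have "\<dots> \<le> inverse (cmod k) * norm (k *\<^sub>C u)" using leC[of "inverse k"] by (simp add: norm_inverse)
    finally have "cmod k * norm u \<le> norm (k *\<^sub>C u)" using False by (simp add: field_simps)
    with leC[of k u] show ?thesis by simp
  qed
  have st: "norm u \<le> norm (star u)" for u :: "'a unitization"
  proof (cases "norm u = 0")
    case True
    then show ?thesis by simp
  next
    case False
    have "norm u * norm u \<le> norm (star u) * norm u"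
      using norm_unitization_square_le[of u] norm_mult_ineq[of "star u" u] by (simp add: power2_eq_square)
    then show ?thesis using False norm_ge_zero[of u] by simp
  qed
  have "norm (star u) = norm u"
    using st[of u] st[of "star u"] by (simp add: unitization_star_simps star_star)
  then show "norm (star u * u) = (norm u)\<^sup>2"
    using norm_mult_ineq[of "star u" u] norm_unitization_square_le[of u] by (simp add: power2_eq_square)
qed

end

section \<open>Positive elements of a C*-algebra\<close>

definition unitize :: "'a \<Rightarrow> 'a unitization" where
  "unitize a = Unitization a 0"

lemma unitize_simps:
  "unitize (a + b) = unitize a + unitize (b :: 'a::cstar_algebra)"
  "unitize (a - b) = unitize a - unitize b"
  "unitize (a * b) = unitize a * unitize b"
  "unitize (star a) = star (unitize a)"
  "unitize (r *\<^sub>R a) = r *\<^sub>R unitize a"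
  "unitize 0 = 0"
  by (simp_all add: unitize_def unitization_star_simps)

lemma nonscalar_unitize [simp]: "nonscalar (unitize a) = a"
  and scalar_unitize [simp]: "scalar (unitize a) = 0"
  by (simp_all add: unitize_def)

lemma unitize_nonscalar: "scalar u = 0 \<Longrightarrow> unitize (nonscalar u) = u"
  by (simp add: unitize_def unitization.expand)

lemma unitize_eq_iff: "unitize a = unitize b \<longleftrightarrow> a = b"
  by (simp add: unitize_def)

text \<open>Testing left multiplication on \<open>star a\<close> recovers \<open>a * star a\<close>,
  whose norm is the square of \<open>norm a\<close>.\<close>

lemma norm_unitize [simp]: "norm (unitize a) = norm (a :: 'a::cstar_algebra)"
proof (rule antisym)
  show "norm (unitize a) \<le> norm a"
    using norm_unitization_le[of "unitize a"] by simp
  have "(norm a)\<^sup>2 \<le> norm (unitize a) * norm a"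
    using norm_left_mult_le[of "unitize a" "star a"]
    by (simp add: left_mult_def norm_mult_star)
  then show "norm a \<le> norm (unitize a)"
    by (cases "a = 0") (simp_all add: power2_eq_square)
qed

lemma cstar_alg_closed:
  assumes "cstar_alg B"
  shows "closed B" "0 \<in> B" "x \<in> B \<Longrightarrow> y \<in> B \<Longrightarrow> x + y \<in> B" "x \<in> B \<Longrightarrow> y \<in> B \<Longrightarrow> x * y \<in> B"
    "x \<in> B \<Longrightarrow> star x \<in> B" "x \<in> B \<Longrightarrow> k *\<^sub>C x \<in> B" "x \<in> B \<Longrightarrow> r *\<^sub>R x \<in> B"
    "x \<in> B \<Longrightarrow> - x \<in> B" "x \<in> B \<Longrightarrow> y \<in> B \<Longrightarrow> x - y \<in> B"
proof -
  have 1: "closed B" "0 \<in> B" "x \<in> B \<Longrightarrow> y \<in> B \<Longrightarrow> x + y \<in> B" "x \<in> B \<Longrightarrow> y \<in> B \<Longrightarrow> x * y \<in> B"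
    "x \<in> B \<Longrightarrow> star x \<in> B" and C: "\<And>k x. x \<in> B \<Longrightarrow> k *\<^sub>C x \<in> B" for x y
    using assms by (auto simp: cstar_alg_def)
  have m: "- x \<in> B" if "x \<in> B" for x using C[OF that, of "-1"] by (simp only: scaleC_minus1)
  show "closed B" "0 \<in> B" "x \<in> B \<Longrightarrow> y \<in> B \<Longrightarrow> x + y \<in> B" "x \<in> B \<Longrightarrow> y \<in> B \<Longrightarrow> x * y \<in> B"
    "x \<in> B \<Longrightarrow> star x \<in> B" "x \<in> B \<Longrightarrow> k *\<^sub>C x \<in> B" "x \<in> B \<Longrightarrow> - x \<in> B"
    by (fact 1 C m)+
  show "r *\<^sub>R x \<in> B" if "x \<in> B"
    using C[OF that, of "complex_of_real r"] by (simp only: scaleC_of_real)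
  show "x - y \<in> B" if "x \<in> B" "y \<in> B"
    using 1(3)[OF that(1) m[OF that(2)]] by simp
qed

lemma cstar_alg_sum: "cstar_alg B \<Longrightarrow> (\<And>i. i \<in> S \<Longrightarrow> f i \<in> B) \<Longrightarrow> sum f S \<in> B"
  by (induction S rule: infinite_finite_induct) (auto intro: cstar_alg_closed)

text \<open>Roots are taken in the unitization of the ambient type; by this lemma their nonscalar
  parts remain in \<open>B\<close>.\<close>

lemma closed_unital_subalgebra_unitization:
  assumes "cstar_alg B"
  shows "closed_unital_subalgebra {u. nonscalar u \<in> B}"
proof -
  have "closed (nonscalar -` B)"
    using assms by (intro closed_vimage cstar_alg_closed
      linear_continuous_on[OF bounded_linear_nonscalar, of UNIV])
  then show ?thesis
    using assms by (auto simp: closed_unital_subalgebra_def vimage_def unitization_simps cstar_alg_closed)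
qed

text \<open>If a root \<open>k\<close> squares to an element without scalar part, the scalar part of
  \<open>k\<close> squares to 0, so \<open>k\<close> itself comes from \<open>B\<close>. This
  transfers sums, limits and norm comparison of positive elements to subalgebras without
  unit.\<close>

lemma cpos_iff_kv_positive:
  assumes "cstar_alg B" "b \<in> B"
  shows "cpos B b \<longleftrightarrow> kv_positive (unitize b)"
proof
  assume "cpos B b"
  then show "kv_positive (unitize b)"
    by (auto simp: cpos_def unitize_simps kv_positive_star_mult)
next
  assume "kv_positive (unitize b)"
  then obtain k where k: "star k = k" "k * k = unitize b" "nonscalar k \<in> B"
    using kv_positive_sqrt[of "unitize b"] closed_unital_subalgebra_unitization[OF assms(1)] assms(2)
    by (metis (mono_tags, lifting) mem_Collect_eq nonscalar_unitize)
  have "scalar (k * k) = 0" using k(2) by simp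
  then have "scalar k = 0" by (simp add: unitization_simps)
  then have "k = unitize (nonscalar k)" by (simp add: unitize_nonscalar)
  then have "unitize b = unitize (star (nonscalar k) * nonscalar k)"
    using k(1,2) by (metis unitize_simps(3,4))
  then show "cpos B b" using k(3) by (auto simp: cpos_def unitize_eq_iff)
qed

lemma cpos_mem: "cstar_alg B \<Longrightarrow> cpos B b \<Longrightarrow> b \<in> B"
  by (auto simp: cpos_def intro: cstar_alg_closed)

lemma cpos_self_adjoint: "cpos B b \<Longrightarrow> star b = b"
  by (auto simp: cpos_def star_mult star_star)

lemma cpos_star_mult: "c \<in> B \<Longrightarrow> cpos B (star c * c)"
  by (auto simp: cpos_def)

lemma cpos_add: "cstar_alg B \<Longrightarrow> cpos B a \<Longrightarrow> cpos B b \<Longrightarrow> cpos B (a + b)"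
  by (metis cpos_iff_kv_positive cpos_mem cstar_alg_closed(3) kv_positive_add unitize_simps(1))

lemma cpos_0: "cstar_alg B \<Longrightarrow> cpos B 0"
  using cpos_star_mult[of 0 B] by (simp add: cstar_alg_closed)

lemma cpos_sum: "cstar_alg B \<Longrightarrow> (\<And>i. i \<in> S \<Longrightarrow> cpos B (f i)) \<Longrightarrow> cpos B (sum f S)"
  by (induction S rule: infinite_finite_induct) (auto intro: cpos_add cpos_0)

lemma cpos_scaleR: "cstar_alg B \<Longrightarrow> cpos B a \<Longrightarrow> r \<ge> 0 \<Longrightarrow> cpos B (r *\<^sub>R a)"
  by (metis cpos_iff_kv_positive cpos_mem cstar_alg_closed(7) kv_positive_scaleR unitize_simps(5))

lemma cpos_norm_mono: "cstar_alg B \<Longrightarrow> cpos B a \<Longrightarrow> cpos B (b - a) \<Longrightarrow> norm a \<le> norm b"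
  by (metis cpos_iff_kv_positive cpos_mem kv_positive_norm_mono norm_unitize unitize_simps(2))

lemma cpos_limit:
  assumes "cstar_alg B" "f \<longlonglongrightarrow> a" "\<And>n. cpos B (f n)"
  shows "cpos B a"
proof -
  have fB: "f n \<in> B" for n by (rule cpos_mem[OF assms(1,3)])
  then have "a \<in> B" using closed_sequentially[OF cstar_alg_closed(1)[OF assms(1)] _ assms(2)] by blast
  moreover have "(\<lambda>n. unitize (f n)) \<longlonglongrightarrow> unitize a"
  proof (rule LIM_zero_cancel)
    have "(\<lambda>n. norm (f n - a)) \<longlonglongrightarrow> 0" by (intro tendsto_norm_zero LIM_zero assms(2))
    then have "(\<lambda>n. norm (unitize (f n) - unitize a)) \<longlonglongrightarrow> 0"
      by (simp only: norm_unitize unitize_simps(2)[symmetric])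
    then show "(\<lambda>n. unitize (f n) - unitize a) \<longlonglongrightarrow> 0"
      by (rule tendsto_norm_zero_cancel)
  qed
  then have "kv_positive (unitize a)"
    by (rule kv_positive_limit) (use cpos_iff_kv_positive[OF assms(1) fB] assms(3) in simp)
  ultimately show ?thesis by (simp add: cpos_iff_kv_positive assms(1))
qed

text \<open>Conjugate the positive element \<open>t - a\<close> of the unitization by
  \<open>c\<close>: the unit becomes \<open>star c * c\<close>. This is the comparison behind the
  Cauchy-Schwarz inequality.\<close>

lemma cpos_norm_conjugate_diff:
  assumes "cstar_alg B" "cpos B a" "c \<in> B" "norm a \<le> t"
  shows "cpos B (t *\<^sub>R (star c * c) - star c * a * c)"
proof -
  have "kv_positive (t *\<^sub>R 1 - unitize a)"
    using assms by (intro kv_positive_diff) (simp_all add: cpos_self_adjoint flip: unitize_simps(4))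
  from kv_positive_conjugate[OF this, of "unitize c"]
  have "kv_positive (unitize (t *\<^sub>R (star c * c) - star c * a * c))"
    by (simp add: unitize_simps algebra_simps)
  then show ?thesis
    using assms by (subst cpos_iff_kv_positive) (auto intro!: cstar_alg_closed dest: cpos_mem)
qed

text \<open>
  The polynomials \<open>1 - (1 - a)\<^sup>m\<close> of a positive contraction \<open>a\<close> have no constant term
  and serve as approximate units for everything dominated by \<open>a\<close>.
\<close>

lemma nonscalar_power_mem:
  assumes "cstar_alg B" "nonscalar u \<in> B"
  shows "nonscalar (u ^ n) \<in> B"
  by (induction n) (auto simp: unitization_simps intro!: cstar_alg_closed assms)

lemma scalar_mult [simp]: "scalar (u * v) = scalar u * scalar (v :: 'a::cstar_algebra unitization)"
  and scalar_add [simp]: "scalar (u + v) = scalar u + scalar v"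
  and scalar_diff [simp]: "scalar (u - v) = scalar u - scalar v"
  and scalar_one [simp]: "scalar (1 :: 'a unitization) = 1"
  and scalar_scaleR [simp]: "scalar (r *\<^sub>R u) = r *\<^sub>R scalar u"
  by (simp_all add: unitization_simps)

lemma scalar_power [simp]: "scalar (u ^ n) = scalar (u :: 'a::cstar_algebra unitization) ^ n"
  by (induction n) simp_all

text \<open>For \<open>c\<close> with \<open>c * star c\<close> dominated by \<open>a0\<close>, the
  defect \<open>(1 - u) * c\<close> has squared norm at most that of \<open>p * a0 * p\<close> with
  \<open>p = 1 - u = (1 - a) ^ m\<close>, and the norm of \<open>a * (1 - a) ^ (2 * m)\<close> is at
  most of order \<open>1 / m\<close>.\<close>

lemma finite_approx_unit:
  assumes B: "cstar_alg B" and S: "finite S" "S \<subseteq> B" and "0 < e"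
  shows "\<exists>u. cpos B u \<and> norm u \<le> 1 \<and> (\<forall>b\<in>S. norm (u * b - b) < e \<and> norm (b * u - b) < e)"
proof -
  \<comment> \<open>Both products of each \<open>b\<close> with its adjoint are included, so that
    one \<open>u\<close> serves as a left and as a right unit.\<close>
  define a0 where "a0 = (\<Sum>b\<in>S. b * star b + star b * b)"
  have pos: "cpos B (b * star b)" "cpos B (star b * b)" if "b \<in> B" for b
    using cpos_star_mult[of "star b" B] cpos_star_mult[of b B] that B by (auto simp: star_star cstar_alg_closed)
  have a0: "cpos B a0"
    unfolding a0_def using S pos by (intro cpos_sum cpos_add B) auto
  have dom: "cpos B (a0 - (b * star b + star b * b))" if "b \<in> S" for b
  proof -
    have "a0 - (b * star b + star b * b) = (\<Sum>b\<in>S - {b}. b * star b + star b * b)"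
      unfolding a0_def using S(1) that by (simp add: sum.remove)
    also have "cpos B \<dots>"
      using S pos by (intro cpos_sum cpos_add B) auto
    finally show ?thesis .
  qed
  \<comment> \<open>The summand 1 keeps \<open>t\<close> positive when \<open>a0\<close> is 0, for
    example when \<open>S\<close> is empty.\<close>
  define t where "t = norm a0 + 1"
  have t: "t > 0" by (simp add: t_def add_nonneg_pos)
  define a where "a = unitize ((1/t) *\<^sub>R a0)"
  have aB: "(1/t) *\<^sub>R a0 \<in> B" by (intro cstar_alg_closed B cpos_mem[OF B a0])
  have ta: "t *\<^sub>R a = unitize a0" using t by (simp add: a_def unitize_simps)
  have a: "kv_positive a"
    unfolding a_def using t aB by (subst cpos_iff_kv_positive[symmetric, OF B]) (auto intro: cpos_scaleR B a0)
  have na: "norm a \<le> 1" using t by (simp add: a_def divide_le_eq_1, simp add: t_def)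
  \<comment> \<open>The squared norm of the defect will be bounded by \<open>t / (2 m + 1)\<close>,
    hence the choice of \<open>m\<close> through \<open>e\<^sup>2\<close>.\<close>
  obtain m :: nat where m: "t / e\<^sup>2 < real m" using reals_Archimedean2 by blast
  define w where "w = 1 - a"
  have w: "kv_positive w"
    using kv_positive_diff[OF kv_positive_self_adjoint[OF a] na] by (simp add: w_def)
  define p where "p = w ^ m"
  have p: "kv_positive p" unfolding p_def by (rule kv_positive_power[OF w])
  then have sp: "star p = p" by (rule kv_positive_self_adjoint)
  define u where "u = nonscalar (1 - p)"
  have s0: "scalar (1 - p) = 0" by (simp add: p_def w_def a_def)
  have uu: "unitize u = 1 - p" unfolding u_def by (rule unitize_nonscalar[OF s0])
  have "nonscalar w \<in> B" using aB by (auto simp: w_def a_def unitize_def unitization_simps intro: cstar_alg_closed B)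
  then have "nonscalar p \<in> B" unfolding p_def by (rule nonscalar_power_mem[OF B])
  then have uB: "u \<in> B" by (auto simp: u_def unitization_simps intro: cstar_alg_closed B)
  have "kv_positive (1 - p)"
    unfolding p_def w_def sum_mult_power_one_minus[symmetric]
    by (intro kv_positive_sum kv_positive_mult kv_positive_power a w[unfolded w_def] power_one_minus_commute)
  then have u: "cpos B u" using cpos_iff_kv_positive[OF B uB] uu by simp
  have "norm (1 - p) \<le> norm (1 :: 'a unitization)"
    by (rule kv_positive_norm_mono) (simp_all add: \<open>kv_positive (1 - p)\<close> p)
  then have nu: "norm u \<le> 1" using norm_unitize[of u] by (simp add: uu)
  have est: "norm (u * c - c) < e" if "c \<in> B" "cpos B (a0 - c * star c)" for c
  proof -
    have "kv_positive (p * unitize (a0 - c * star c) * p)"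
      using kv_positive_conjugate[of "unitize (a0 - c * star c)" p]
        cpos_iff_kv_positive[OF B cpos_mem[OF B that(2)]] that(2)
      by (simp add: sp)
    then have le: "kv_positive (p * unitize a0 * p - (p * unitize c) * star (p * unitize c))"
      by (simp add: unitize_simps algebra_simps star_mult sp)
    have "kv_positive ((p * unitize c) * star (p * unitize c))"
      using kv_positive_star_mult[of "star (p * unitize c)"] by (simp add: star_star)
    from kv_positive_norm_mono[OF this le]
    have "(norm (p * unitize c))\<^sup>2 \<le> norm (p * unitize a0 * p)"
      by (simp only: norm_mult_star)
    also have "p * unitize a0 * p = t *\<^sub>R (a * w ^ (2 * m))"
    proof -
      have "p * a = a * p" unfolding p_def w_def by (rule power_one_minus_commute[symmetric])
      then have "p * a * p = a * (p * p)" by (simp add: mult.assoc)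
      also have "p * p = w ^ (2 * m)" by (simp add: p_def mult_2 power_add)
      finally show ?thesis by (simp flip: ta)
    qed
    also have "norm \<dots> \<le> t * (1 / (real (2 * m) + 1))"
      using norm_mult_power_one_minus_le[OF a na, of "2 * m"] t by (simp add: w_def mult_left_mono del: mult_1_right times_divide_eq_right)
    also have "\<dots> < e\<^sup>2"
    proof -
      have "t < e\<^sup>2 * real m" using m \<open>0 < e\<close> by (simp add: divide_less_eq mult.commute)
      also have "\<dots> \<le> e\<^sup>2 * (real (2 * m) + 1)" by (intro mult_left_mono) auto
      finally show ?thesis by (simp add: divide_less_eq)
    qed
    finally have "norm (p * unitize c) < e"
      using \<open>0 < e\<close> by (simp add: power_less_imp_less_base)
    moreover have "p * unitize c = unitize (c - u * c)" by (simp add: unitize_simps uu algebra_simps)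
    ultimately show ?thesis by (simp add: norm_minus_commute)
  qed
  have "norm (u * b - b) < e \<and> norm (b * u - b) < e" if "b \<in> S" for b
  proof -
    have bB: "b \<in> B" using S(2) that by blast
    have 1: "cpos B (a0 - b * star b)"
      using cpos_add[OF B dom[OF that] pos(2)[OF bB]] by (simp add: algebra_simps)
    have 2: "cpos B (a0 - star b * star (star b))"
      using cpos_add[OF B dom[OF that] pos(1)[OF bB]] by (simp add: algebra_simps star_star)
    \<comment> \<open>As \<open>u\<close> is self-adjoint, passing to adjoints reduces the right
      unit property at \<open>b\<close> to the left one at \<open>star b\<close>.\<close>
    have "norm (b * u - b) = norm (star (b * u - b))" by simp
    also have "star (b * u - b) = u * star b - star b" by (simp add: star_diff star_mult cpos_self_adjoint[OF u])
    finally show ?thesis using est[OF bB 1] est[OF _ 2] bB B by (simp add: cstar_alg_closed)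
  qed
  with u nu show ?thesis by blast
qed

text \<open>The tails are indexed by a finite subset of \<open>B\<close> and a tolerance, directed
  by union and minimum. Having at least one approximate unit is what pins down the value of
  \<open>tensor_V\<close>.\<close>

lemma ex_approx_unit:
  assumes B: "cstar_alg B"
  shows "\<exists>F. approx_unit B F"
proof -
  define I where "I = {(S, e :: real). finite S \<and> S \<subseteq> B \<and> 0 < e}"
  define U where "U = (\<lambda>(S, e). {u. cpos B u \<and> norm u \<le> 1 \<and> (\<forall>b\<in>S. norm (u * b - b) < e \<and> norm (b * u - b) < (e :: real))})"
  define F where "F = (INF i\<in>I. principal (U i))"
  have ne: "I \<noteq> {}" by (auto simp: I_def intro!: exI[of _ "{}"] exI[of _ 1])
  have dir: "\<exists>k\<in>I. principal (U k) \<le> inf (principal (U i)) (principal (U j))" if ij: "i \<in> I" "j \<in> I" for i j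
  proof -
    obtain S e S' e' where *: "i = (S, e)" "j = (S', e')" by fastforce
    show ?thesis
      using ij unfolding * by (intro bexI[of _ "(S \<union> S', min e e')"]) (auto simp: I_def U_def)
  qed
  have ev: "eventually P F \<longleftrightarrow> (\<exists>i\<in>I. \<forall>u\<in>U i. P u)" for P
    unfolding F_def by (subst eventually_INF_base[OF ne dir]) (auto simp: eventually_principal)
  have "F \<noteq> bot"
    unfolding trivial_limit_def ev using finite_approx_unit[OF B] by (fastforce simp: I_def U_def)
  moreover have "\<forall>\<^sub>F u in F. u \<in> B \<and> cpos B u \<and> norm u \<le> 1"
    unfolding ev by (rule bexI[of _ "({}, 1)"]) (auto simp: I_def U_def intro: cpos_mem B)
  moreover have "((\<lambda>u. u * b) \<longlongrightarrow> b) F" "((\<lambda>u. b * u) \<longlongrightarrow> b) F" if "b \<in> B" for b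
  proof -
    have "\<exists>i\<in>I. \<forall>u\<in>U i. norm (u * b - b) < e \<and> norm (b * u - b) < e" if "0 < e" for e
      using that \<open>b \<in> B\<close> by (intro bexI[of _ "({b}, e)"]) (auto simp: I_def U_def)
    then show "((\<lambda>u. u * b) \<longlongrightarrow> b) F" "((\<lambda>u. b * u) \<longlongrightarrow> b) F"
      unfolding tendsto_iff ev dist_norm by blast+
  qed
  ultimately show ?thesis unfolding approx_unit_def by blast
qed

text \<open>
  A *-homomorphism \<open>r\<close> preserves the relation \<open>norm b\<^sup>2 \<cdot> 1 - b\<^sup>* b = k\<^sup>* k\<close>,
  where \<open>k\<close> is taken in the unitization.
\<close>

definition star_hom_on :: "'b::cstar_algebra set \<Rightarrow> 'c::cstar_algebra set \<Rightarrow> ('b \<Rightarrow> 'c) \<Rightarrow> bool" where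
  "star_hom_on B C r \<longleftrightarrow> cstar_alg B \<and> cstar_alg C \<and> (\<forall>x\<in>B. r x \<in> C) \<and>
     (\<forall>x\<in>B. \<forall>y\<in>B. r (x + y) = r x + r y \<and> r (x * y) = r x * r y) \<and>
     (\<forall>x\<in>B. r (star x) = star (r x) \<and> (\<forall>k. r (k *\<^sub>C x) = k *\<^sub>C r x))"

lemma star_hom_onD:
  assumes "star_hom_on B C r"
  shows "cstar_alg B" "cstar_alg C" "x \<in> B \<Longrightarrow> r x \<in> C" "x \<in> B \<Longrightarrow> y \<in> B \<Longrightarrow> r (x + y) = r x + r y"
    "x \<in> B \<Longrightarrow> y \<in> B \<Longrightarrow> r (x * y) = r x * r y" "x \<in> B \<Longrightarrow> r (star x) = star (r x)"
    "x \<in> B \<Longrightarrow> r (k *\<^sub>C x) = k *\<^sub>C r x" "x \<in> B \<Longrightarrow> r (t *\<^sub>R x) = t *\<^sub>R r x" "r 0 = 0"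
    "x \<in> B \<Longrightarrow> r (- x) = - r x" "x \<in> B \<Longrightarrow> y \<in> B \<Longrightarrow> r (x - y) = r x - r y"
proof -
  have 1: "cstar_alg B" "cstar_alg C" "x \<in> B \<Longrightarrow> r x \<in> C" "x \<in> B \<Longrightarrow> y \<in> B \<Longrightarrow> r (x + y) = r x + r y"
    "x \<in> B \<Longrightarrow> y \<in> B \<Longrightarrow> r (x * y) = r x * r y" "x \<in> B \<Longrightarrow> r (star x) = star (r x)"
    and C: "\<And>x k. x \<in> B \<Longrightarrow> r (k *\<^sub>C x) = k *\<^sub>C r x" for x y
    using assms by (auto simp: star_hom_on_def)
  have m: "r (- x) = - r x" if "x \<in> B" for x using C[OF that, of "-1"] by (simp only: scaleC_minus1)
  show "cstar_alg B" "cstar_alg C" "x \<in> B \<Longrightarrow> r x \<in> C" "x \<in> B \<Longrightarrow> y \<in> B \<Longrightarrow> r (x + y) = r x + r y"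
    "x \<in> B \<Longrightarrow> y \<in> B \<Longrightarrow> r (x * y) = r x * r y" "x \<in> B \<Longrightarrow> r (star x) = star (r x)"
    "x \<in> B \<Longrightarrow> r (k *\<^sub>C x) = k *\<^sub>C r x" "x \<in> B \<Longrightarrow> r (- x) = - r x"
    by (fact 1 C m)+
  show "r (t *\<^sub>R x) = t *\<^sub>R r x" if "x \<in> B"
    using C[OF that, of "complex_of_real t"] by (simp only: scaleC_of_real)
  show "r 0 = 0" using 1(4)[of 0 0] by (simp add: cstar_alg_closed 1(1))
  show "r (x - y) = r x - r y" if "x \<in> B" "y \<in> B"
    using 1(4)[OF that(1) cstar_alg_closed(8)[OF 1(1) that(2)]] m[OF that(2)] by simp
qed

lemma star_hom_on_contractive:
  assumes r: "star_hom_on B C r" and b: "b \<in> B"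
  shows "norm (r b) \<le> norm b"
proof -
  note r' = star_hom_onD[OF r]
  note clB = cstar_alg_closed[OF r'(1)] and clC = cstar_alg_closed[OF r'(2)]
  define t where "t = (norm b)\<^sup>2"
  define z where "z = t *\<^sub>R 1 - unitize (star b * b)"
  have "kv_positive z"
    unfolding z_def by (rule kv_positive_diff)
      (simp_all add: star_mult star_star t_def cstar_identity flip: unitize_simps(2,4))
  moreover have "nonscalar z \<in> B" using b by (auto simp: z_def unitize_def unitization_simps intro!: clB)
  ultimately obtain k where k: "star k = k" "k * k = z" "nonscalar k \<in> B"
    using kv_positive_sqrt[of z] closed_unital_subalgebra_unitization[OF r'(1)] by blast
  \<comment> \<open>The unital extension of \<open>r\<close> keeps the scalar part. It is
    multiplicative on elements whose nonscalar parts lie in \<open>B\<close>, which is why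
    \<open>k\<close> has to be found there.\<close>
  define R where "R u = Unitization (r (nonscalar u)) (scalar u)" for u
  have "R k * R k = R (k * k)" "star (R k) = R (star k)"
    using k(3) by (simp_all add: R_def unitization_star_simps r' clB)
  then have "kv_positive (R z)"
    using kv_positive_square[of "R k"] k(1,2) by simp
  also have "R z = t *\<^sub>R 1 - unitize (star (r b) * r b)"
    using b by (simp add: R_def z_def unitize_def unitization_simps r' clB)
  finally have "norm (unitize (star (r b) * r b)) \<le> norm (t *\<^sub>R (1 :: 'b unitization))"
    by (intro kv_positive_norm_mono) (auto simp: unitize_simps intro: kv_positive_star_mult)
  then have "(norm (r b))\<^sup>2 \<le> (norm b)\<^sup>2" by (simp add: cstar_identity t_def)
  then show ?thesis by (simp add: power2_le_iff_abs_le)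
qed

text \<open>
  In the lemma below \<open>f\<close> is left multiplication by an approximate inverse \<open>p\<close> of
  \<open>a\<close> in the unitization, and \<open>g\<close> is left multiplication by the square root of
  \<open>2 p - p a p\<close>.
\<close>

lemma ex_approx_inverse:
  assumes B: "cstar_alg B" and a: "cpos B a" and e: "0 < e"
  shows "\<exists>f g. (\<forall>x\<in>B. f x \<in> B \<and> g x \<in> B) \<and>
    (\<forall>x\<in>B. \<forall>y\<in>B. star x * f y = star (f x) * y \<and>
       star (g x) * g y = 2 *\<^sub>R (star x * f y) - star (f x) * a * f y) \<and>
    norm (a - a * f a - star (f a) * a + star (f a) * a * f a) < e"
proof -
  define t where "t = norm a + 1"
  have t: "t > 0" by (simp add: t_def add_nonneg_pos)
  have aB: "a \<in> B" by (rule cpos_mem[OF B a])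
  define c where "c = unitize ((1/t) *\<^sub>R a)"
  have cB: "(1/t) *\<^sub>R a \<in> B" by (intro cstar_alg_closed B aB)
  have ta: "unitize a = t *\<^sub>R c" using t by (simp add: c_def unitize_simps)
  have c: "kv_positive c"
    unfolding c_def using t cB by (subst cpos_iff_kv_positive[symmetric, OF B]) (auto intro: cpos_scaleR B a)
  have nc: "norm c \<le> 1" using t by (simp add: c_def divide_le_eq_1, simp add: t_def)
  obtain m :: nat where m: "t / e < real m" using reals_Archimedean2 by blast
  define w where "w = 1 - c"
  have w: "kv_positive w"
    using kv_positive_diff[OF kv_positive_self_adjoint[OF c] nc] by (simp add: w_def)
  \<comment> \<open>A truncated Neumann series: \<open>a\<close> corresponds to
    \<open>t (1 - w)\<close>, so the sums \<open>P n\<close> approximate an inverse of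
    \<open>a\<close>, and they are positive as sums of powers of \<open>w\<close>.\<close>
  define P where "P n = (1/t) *\<^sub>R (\<Sum>k<n. w ^ k)" for n
  have Ppos: "kv_positive (P n)" for n
    unfolding P_def using t by (intro kv_positive_scaleR kv_positive_sum kv_positive_power w) auto
  define p where "p = P m"
  have sp: "star p = p" unfolding p_def by (rule kv_positive_self_adjoint[OF Ppos])
  obtain q where q: "star q = q" "q * q = P (2 * m)" "\<forall>S. closed_unital_subalgebra S \<longrightarrow> P (2 * m) \<in> S \<longrightarrow> q \<in> S"
    using kv_positive_sqrt[OF Ppos] by blast
  have wB: "nonscalar (w ^ k) \<in> B" for k
    using cB by (intro nonscalar_power_mem B) (auto simp: w_def c_def unitize_def unitization_simps intro: cstar_alg_closed B)
  have "nonscalar (\<Sum>k<n. w ^ k) \<in> B" for n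
    by (induction n) (simp_all add: unitization_simps wB[unfolded unitization_simps] cstar_alg_closed B wB)
  then have PB: "nonscalar (P n) \<in> B" for n
    by (auto simp: P_def scaleR_unitization_def intro: cstar_alg_closed B)
  then have qB: "nonscalar q \<in> B"
    using q(3) closed_unital_subalgebra_unitization[OF B] by blast
  have lm: "unitize (left_mult u x) = u * unitize x" for u x
    by (simp add: left_mult_def unitize_def unitization_simps)
  have lmB: "left_mult u x \<in> B" if "nonscalar u \<in> B" "x \<in> B" for u x
    unfolding left_mult_def using that by (intro cstar_alg_closed B)
  have cw: "c * w ^ n = w ^ n * c" for n unfolding w_def by (rule power_one_minus_commute)
  \<comment> \<open>The geometric sum telescopes, so \<open>w ^ m\<close> measures how far
    \<open>p\<close> is from an exact inverse.\<close>
  have cp: "t *\<^sub>R (c * p) = 1 - w ^ m"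
    using t unfolding p_def P_def w_def sum_mult_power_one_minus[symmetric] by (simp add: sum_distrib_left)
  moreover have "c * p = p * c"
    by (simp add: p_def P_def sum_distrib_left sum_distrib_right cw)
  ultimately have pc: "t *\<^sub>R (p * c) = 1 - w ^ m" by simp
  \<comment> \<open>By telescoping, \<open>2 p - p a p\<close> equals \<open>p + w ^ m p\<close>,
    and this is the longer truncation \<open>P (2 * m)\<close>. Its positivity is what provides the
    root \<open>q\<close>.\<close>
  have qq: "q * q = 2 *\<^sub>R p - p * (t *\<^sub>R c) * p"
  proof -
    have "p * (t *\<^sub>R c) * p = p - w ^ m * p" using pc by (simp add: left_diff_distrib)
    moreover have "(\<Sum>k<m+n. w ^ k) = (\<Sum>k<m. w ^ k) + w ^ m * (\<Sum>k<n. w ^ k)" for n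
      by (induction n) (simp_all add: power_add distrib_left add.assoc)
    from this[of m] have "P (2 * m) = p + w ^ m * p"
      by (simp add: P_def p_def scaleR_add_right mult_2)
    ultimately show ?thesis by (simp add: q(2) scaleR_2)
  qed
  show ?thesis
  proof (rule exI[of _ "left_mult p"], rule exI[of _ "left_mult q"], intro conjI ballI)
    show "left_mult p x \<in> B" if "x \<in> B" for x
      using that by (intro lmB) (simp_all add: p_def PB)
    show "left_mult q x \<in> B" if "x \<in> B" for x
      using that by (intro lmB qB)
    show "star x * left_mult p y = star (left_mult p x) * y" for x y
      by (simp add: lm unitize_simps star_mult sp mult.assoc flip: unitize_eq_iff)
    show "star (left_mult q x) * left_mult q y =
        2 *\<^sub>R (star x * left_mult p y) - star (left_mult p x) * a * left_mult p y" for x y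
    proof -
      have "unitize (star (left_mult q x) * left_mult q y) = star (unitize x) * (q * q) * unitize y"
        by (simp add: unitize_simps lm star_mult q(1) mult.assoc)
      also have "\<dots> = unitize (2 *\<^sub>R (star x * left_mult p y) - star (left_mult p x) * a * left_mult p y)"
        unfolding qq by (simp add: unitize_simps lm star_mult sp ta mult.assoc algebra_simps)
      finally show ?thesis by (simp add: unitize_eq_iff)
    qed
    \<comment> \<open>The error is \<open>a\<close> multiplied on both sides by
      \<open>w ^ m\<close>, that is \<open>t c w ^ (2 * m)\<close>, so the bound for a positive
      contraction applies.\<close>
    have "unitize (a - a * left_mult p a - star (left_mult p a) * a + star (left_mult p a) * a * left_mult p a) =
        (1 - t *\<^sub>R (c * p)) * (t *\<^sub>R c) * (1 - t *\<^sub>R (p * c))"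
      using kv_positive_self_adjoint[OF c]
      by (simp add: unitize_simps lm star_mult sp ta star_scaleR algebra_simps)
    also have "\<dots> = t *\<^sub>R (c * w ^ (2 * m))"
      unfolding cp pc using cw[of m] by (simp add: mult_2 power_add mult.assoc[symmetric])
    also have "norm \<dots> \<le> t * (1 / (real (2 * m) + 1))"
      using norm_mult_power_one_minus_le[OF c nc, of "2 * m"] t by (simp add: w_def mult_left_mono del: mult_1_right times_divide_eq_right)
    also have "\<dots> < e"
    proof -
      have "t < e * real m" using m e by (simp add: divide_less_eq mult.commute)
      also have "\<dots> \<le> e * (real (2 * m) + 1)" using e by (intro mult_left_mono) auto
      finally show ?thesis by (simp add: divide_less_eq)
    qed
    finally show "norm (a - a * left_mult p a - star (left_mult p a) * a + star (left_mult p a) * a * left_mult p a) < e"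
      by simp
  qed
qed

section \<open>Pre-Hilbert modules\<close>

text \<open>Definiteness of the inner product and completeness are left to \<open>hilbert\<close>,
  because for the algebraic tensor product only the properties collected here are
  established.\<close>

locale pre_hilbert = abelian_group E
  for E :: "('b::cstar_algebra, 'e) hmodule" (structure) +
  assumes cstar_base: "cstar_alg (base E)"
    and hscale_closed [simp, intro]: "x \<in> carrier E \<Longrightarrow> hscale E k x \<in> carrier E"
    and hscale_one [simp]: "x \<in> carrier E \<Longrightarrow> hscale E 1 x = x"
    and hscale_hscale: "x \<in> carrier E \<Longrightarrow> hscale E k (hscale E l x) = hscale E (k * l) x"
    and hscale_add_left: "x \<in> carrier E \<Longrightarrow> hscale E (k + l) x = hscale E k x \<oplus> hscale E l x"
    and hscale_add: "x \<in> carrier E \<Longrightarrow> y \<in> carrier E \<Longrightarrow> hscale E k (x \<oplus> y) = hscale E k x \<oplus> hscale E k y"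
    and hact_closed [simp, intro]: "x \<in> carrier E \<Longrightarrow> b \<in> base E \<Longrightarrow> hact E x b \<in> carrier E"
    and hact_add: "x \<in> carrier E \<Longrightarrow> y \<in> carrier E \<Longrightarrow> b \<in> base E \<Longrightarrow>
      hact E (x \<oplus> y) b = hact E x b \<oplus> hact E y b"
    and hact_add_right: "x \<in> carrier E \<Longrightarrow> b \<in> base E \<Longrightarrow> c \<in> base E \<Longrightarrow>
      hact E x (b + c) = hact E x b \<oplus> hact E x c"
    and hact_mult: "x \<in> carrier E \<Longrightarrow> b \<in> base E \<Longrightarrow> c \<in> base E \<Longrightarrow>
      hact E x (b * c) = hact E (hact E x b) c"
    and hact_hscale: "x \<in> carrier E \<Longrightarrow> b \<in> base E \<Longrightarrow> hact E (hscale E k x) b = hscale E k (hact E x b)"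
    and hact_scaleC: "x \<in> carrier E \<Longrightarrow> b \<in> base E \<Longrightarrow> hact E x (k *\<^sub>C b) = hscale E k (hact E x b)"
    and hinner_closed [simp, intro]: "x \<in> carrier E \<Longrightarrow> y \<in> carrier E \<Longrightarrow> hinner E x y \<in> base E"
    and hinner_add_right: "x \<in> carrier E \<Longrightarrow> y \<in> carrier E \<Longrightarrow> z \<in> carrier E \<Longrightarrow>
      hinner E x (y \<oplus> z) = hinner E x y + hinner E x z"
    and hinner_scale_right: "x \<in> carrier E \<Longrightarrow> y \<in> carrier E \<Longrightarrow>
      hinner E x (hscale E k y) = k *\<^sub>C hinner E x y"
    and hinner_act_right: "x \<in> carrier E \<Longrightarrow> y \<in> carrier E \<Longrightarrow> b \<in> base E \<Longrightarrow>
      hinner E x (hact E y b) = hinner E x y * b"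
    and star_hinner: "x \<in> carrier E \<Longrightarrow> y \<in> carrier E \<Longrightarrow> star (hinner E x y) = hinner E y x"
    and cpos_hinner: "x \<in> carrier E \<Longrightarrow> cpos (base E) (hinner E x x)"
begin

lemmas clB = cstar_alg_closed[OF cstar_base]

lemma hinner_add_left: "x \<in> carrier E \<Longrightarrow> y \<in> carrier E \<Longrightarrow> z \<in> carrier E \<Longrightarrow>
    hinner E (x \<oplus> y) z = hinner E x z + hinner E y z"
  by (subst star_hinner[of z "x \<oplus> y", symmetric]) (simp_all add: hinner_add_right star_add star_hinner)

lemma hinner_scale_left: "x \<in> carrier E \<Longrightarrow> y \<in> carrier E \<Longrightarrow>
    hinner E (hscale E k x) y = cnj k *\<^sub>C hinner E x y"
  by (subst star_hinner[of y "hscale E k x", symmetric]) (simp_all add: hinner_scale_right star_scaleC star_hinner)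

lemma hinner_act_left: "x \<in> carrier E \<Longrightarrow> y \<in> carrier E \<Longrightarrow> b \<in> base E \<Longrightarrow>
    hinner E (hact E x b) y = star b * hinner E x y"
  by (subst star_hinner[of y "hact E x b", symmetric]) (simp_all add: hinner_act_right star_mult star_hinner)

lemma hinner_zero_right [simp]: "x \<in> carrier E \<Longrightarrow> hinner E x \<zero> = 0"
  using hinner_add_right[of x \<zero> \<zero>] by simp

lemma hinner_zero_left [simp]: "x \<in> carrier E \<Longrightarrow> hinner E \<zero> x = 0"
  using hinner_add_left[of \<zero> \<zero> x] by simp

lemma hinner_minus_right: "x \<in> carrier E \<Longrightarrow> y \<in> carrier E \<Longrightarrow> hinner E x (\<ominus> y) = - hinner E x y"
  using hinner_add_right[of x y "\<ominus> y"] by (simp add: r_neg eq_neg_iff_add_eq_0 add.commute)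

lemma hinner_minus_left: "x \<in> carrier E \<Longrightarrow> y \<in> carrier E \<Longrightarrow> hinner E (\<ominus> x) y = - hinner E x y"
  using hinner_add_left[of x "\<ominus> x" y] by (simp add: r_neg eq_neg_iff_add_eq_0 add.commute)

lemma hinner_diff_right: "x \<in> carrier E \<Longrightarrow> y \<in> carrier E \<Longrightarrow> z \<in> carrier E \<Longrightarrow>
    hinner E x (y \<ominus> z) = hinner E x y - hinner E x z"
  by (simp add: a_minus_def hinner_add_right hinner_minus_right)

lemma hinner_diff_left: "x \<in> carrier E \<Longrightarrow> y \<in> carrier E \<Longrightarrow> z \<in> carrier E \<Longrightarrow>
    hinner E (x \<ominus> y) z = hinner E x z - hinner E y z"
  by (simp add: a_minus_def hinner_add_left hinner_minus_left)

lemmas hinner_simps = hinner_add_right hinner_add_left hinner_scale_right hinner_scale_left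
  hinner_act_right hinner_act_left hinner_diff_right hinner_diff_left hinner_minus_right hinner_minus_left

lemma add_self_eq_zero: "x \<in> carrier E \<Longrightarrow> x \<oplus> x = x \<Longrightarrow> x = \<zero>"
  using add.r_cancel_one by blast

lemma minus_zero [simp]: "\<ominus> \<zero> = \<zero>"
  by (rule minus_equality) auto

lemma hscale_0 [simp]: "x \<in> carrier E \<Longrightarrow> hscale E 0 x = \<zero>"
  using hscale_add_left[of x 0 0] by (intro add_self_eq_zero) auto

lemma hscale_minus1: "x \<in> carrier E \<Longrightarrow> hscale E (- 1) x = \<ominus> x"
proof (rule minus_equality[symmetric])
  show "hscale E (- 1) x \<oplus> x = \<zero>" if "x \<in> carrier E"
    using hscale_add_left[OF that, of "-1" 1] that by simp
qed auto

lemma hscale_zero [simp]: "hscale E k \<zero> = \<zero>"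
  using hscale_add[of \<zero> \<zero> k] by (intro add_self_eq_zero) auto

lemma hscale_minus: "x \<in> carrier E \<Longrightarrow> hscale E k (\<ominus> x) = \<ominus> hscale E k x"
  by (simp add: hscale_hscale flip: hscale_minus1)

lemma hscale_diff: "x \<in> carrier E \<Longrightarrow> y \<in> carrier E \<Longrightarrow>
    hscale E k (x \<ominus> y) = hscale E k x \<ominus> hscale E k y"
  by (simp add: a_minus_def hscale_add hscale_minus)

lemma hact_minus: "x \<in> carrier E \<Longrightarrow> b \<in> base E \<Longrightarrow> hact E (\<ominus> x) b = \<ominus> hact E x b"
  by (simp add: hact_hscale flip: hscale_minus1)

lemma hact_diff: "x \<in> carrier E \<Longrightarrow> y \<in> carrier E \<Longrightarrow> b \<in> base E \<Longrightarrow>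
    hact E (x \<ominus> y) b = hact E x b \<ominus> hact E y b"
  by (simp add: a_minus_def hact_add hact_minus)

lemma hnorm_nonneg [simp]: "0 \<le> hnorm E x"
  by (simp add: hnorm_def)

lemma hnorm_square: "(hnorm E x)\<^sup>2 = norm (hinner E x x)"
  by (simp add: hnorm_def)

lemma hnorm_zero [simp]: "hnorm E \<zero> = 0"
  by (simp add: hnorm_def)

text \<open>The inner square of \<open>s y - x a\<close> with \<open>a = hinner E x y\<close> is
  positive. Once \<open>s\<close> dominates the norm of \<open>hinner E x x\<close>, the term
  \<open>star a * hinner E x x * a\<close> is at most \<open>s (star a * a)\<close>. What remains is
  \<open>s (star a * a) \<le> s\<^sup>2 hinner E y y\<close>, and norms are monotone on the
  cone.\<close>

lemma norm_hinner_le: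
  assumes x: "x \<in> carrier E" and y: "y \<in> carrier E"
  shows "norm (hinner E x y) \<le> hnorm E x * hnorm E y"
proof -
  define a where "a = hinner E x y"
  have aB: "a \<in> base E" by (simp add: a_def x y)
  have sa: "star a = hinner E y x" by (simp add: a_def star_hinner x y)
  have le: "(norm a)\<^sup>2 \<le> s * norm (hinner E y y)" if s: "s > 0" "s \<ge> norm (hinner E x x)" for s
  proof -
    define z where "z = hscale E (complex_of_real s) y \<ominus> hact E x a"
    have zE: "z \<in> carrier E" using x y aB by (simp add: z_def)
    have "hinner E z z = s\<^sup>2 *\<^sub>R hinner E y y - s *\<^sub>R (star a * a) - s *\<^sub>R (star a * a) + star a * hinner E x x * a"
      using x y aB
      by (simp add: z_def hinner_simps sa[symmetric] a_def[symmetric] mult_scaleC_left mult_scaleC_right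
          scaleC_of_real power2_eq_square algebra_simps)
    with cpos_hinner[OF zE]
    have "cpos (base E) (s\<^sup>2 *\<^sub>R hinner E y y - s *\<^sub>R (star a * a) - s *\<^sub>R (star a * a) + star a * hinner E x x * a)" by simp
    from cpos_add[OF cstar_base this cpos_norm_conjugate_diff[OF cstar_base cpos_hinner[OF x] aB s(2)]]
    have "cpos (base E) (s\<^sup>2 *\<^sub>R hinner E y y - s *\<^sub>R (star a * a))"
      by (simp add: algebra_simps)
    then have "norm (s *\<^sub>R (star a * a)) \<le> norm (s\<^sup>2 *\<^sub>R hinner E y y)"
      using aB s by (intro cpos_norm_mono[OF cstar_base] cpos_scaleR cstar_base cpos_star_mult) auto
    then show ?thesis using s by (simp add: cstar_identity power2_eq_square)
  qed
  have "(norm a)\<^sup>2 \<le> norm (hinner E x x) * norm (hinner E y y)"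
  proof (cases "norm (hinner E x x) = 0")
    case False
    then show ?thesis by (intro le) auto
  next
    case True
    \<comment> \<open>With \<open>hinner E x x\<close> of norm 0 every positive \<open>s\<close> is
      admissible, and arbitrarily small ones force \<open>a = 0\<close>.\<close>
    have "(norm a)\<^sup>2 \<le> e" if "e > 0" for e
    proof -
      have "(norm a)\<^sup>2 \<le> (e / (1 + norm (hinner E y y))) * norm (hinner E y y)"
        using that True by (intro le) (auto intro!: divide_pos_pos add_pos_nonneg)
      also have "\<dots> \<le> e"
        using that by (simp add: divide_le_eq add_pos_nonneg mult_left_mono)
      finally show ?thesis .
    qed
    then have "(norm a)\<^sup>2 \<le> 0" by (meson dense_ge)
    with True show ?thesis by simp
  qed
  also have "\<dots> = (hnorm E x * hnorm E y)\<^sup>2" by (simp add: power_mult_distrib hnorm_square)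
  finally show ?thesis by (simp add: a_def power2_le_iff_abs_le)
qed

lemma hnorm_triangle:
  assumes x: "x \<in> carrier E" and y: "y \<in> carrier E"
  shows "hnorm E (x \<oplus> y) \<le> hnorm E x + hnorm E y"
proof -
  have "(hnorm E (x \<oplus> y))\<^sup>2 = norm ((hinner E x x + hinner E y y) + (hinner E x y + hinner E y x))"
    using x y by (simp add: hnorm_square hinner_simps algebra_simps)
  also have "\<dots> \<le> (norm (hinner E x x) + norm (hinner E y y)) + (norm (hinner E x y) + norm (hinner E y x))"
    by (intro order_trans[OF norm_triangle_ineq] add_mono norm_triangle_ineq)
  also have "\<dots> \<le> ((hnorm E x)\<^sup>2 + (hnorm E y)\<^sup>2) + (hnorm E x * hnorm E y + hnorm E y * hnorm E x)"
    using x y by (intro add_mono norm_hinner_le) (auto simp: hnorm_square)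
  also have "\<dots> = (hnorm E x + hnorm E y)\<^sup>2" by (simp add: power2_eq_square algebra_simps)
  finally show ?thesis by (simp add: power2_le_iff_abs_le)
qed

lemma hnorm_scale: "x \<in> carrier E \<Longrightarrow> hnorm E (hscale E k x) = cmod k * hnorm E x"
  by (simp add: hnorm_def hinner_simps norm_scaleC norm_mult real_sqrt_mult)

lemma hnorm_minus [simp]: "x \<in> carrier E \<Longrightarrow> hnorm E (\<ominus> x) = hnorm E x"
  by (simp add: hnorm_def hinner_simps)

lemma hnorm_act_le:
  assumes "x \<in> carrier E" "b \<in> base E"
  shows "hnorm E (hact E x b) \<le> hnorm E x * norm b"
proof -
  have "norm (star b * (hinner E x x * b)) \<le> norm b * (norm (hinner E x x) * norm b)"
    by (rule order_trans[OF norm_mult_ineq]) (simp add: mult_left_mono norm_mult_ineq)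
  then have "(hnorm E (hact E x b))\<^sup>2 \<le> (hnorm E x * norm b)\<^sup>2"
    using assms by (simp add: hnorm_square hinner_simps power_mult_distrib power2_eq_square[of "norm b"] ac_simps)
  then show ?thesis by (simp add: power2_le_iff_abs_le)
qed

lemma hdist_nonneg [simp]: "0 \<le> hdist E x y"
  by (simp add: hdist_def)

lemma hdist_self [simp]: "x \<in> carrier E \<Longrightarrow> hdist E x x = 0"
  by (simp add: hdist_def a_minus_def r_neg)

lemma hdist_sym: "x \<in> carrier E \<Longrightarrow> y \<in> carrier E \<Longrightarrow> hdist E x y = hdist E y x"
proof -
  assume xy: "x \<in> carrier E" "y \<in> carrier E"
  then have "y \<ominus> x = \<ominus> (x \<ominus> y)" by (simp add: a_minus_def minus_add a_comm)
  with xy show ?thesis by (simp add: hdist_def)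
qed

lemma diff_add_diff: "x \<in> carrier E \<Longrightarrow> y \<in> carrier E \<Longrightarrow> z \<in> carrier E \<Longrightarrow> (x \<ominus> y) \<oplus> (y \<ominus> z) = x \<ominus> z"
  by (simp add: a_minus_def a_assoc r_neg1)

lemma add_diff_add: "x \<in> carrier E \<Longrightarrow> y \<in> carrier E \<Longrightarrow> x' \<in> carrier E \<Longrightarrow> y' \<in> carrier E \<Longrightarrow>
    (x \<oplus> y) \<ominus> (x' \<oplus> y') = (x \<ominus> x') \<oplus> (y \<ominus> y')"
  by (simp add: a_minus_def minus_add a_ac)

lemma hdist_triangle: "x \<in> carrier E \<Longrightarrow> y \<in> carrier E \<Longrightarrow> z \<in> carrier E \<Longrightarrow>
    hdist E x z \<le> hdist E x y + hdist E y z"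
  using hnorm_triangle[of "x \<ominus> y" "y \<ominus> z"] by (simp add: hdist_def diff_add_diff)

lemma hdist_add: "x \<in> carrier E \<Longrightarrow> y \<in> carrier E \<Longrightarrow> x' \<in> carrier E \<Longrightarrow> y' \<in> carrier E \<Longrightarrow>
    hdist E (x \<oplus> y) (x' \<oplus> y') \<le> hdist E x x' + hdist E y y'"
  using hnorm_triangle[of "x \<ominus> x'" "y \<ominus> y'"] by (simp add: hdist_def add_diff_add)

lemma hdist_scale: "x \<in> carrier E \<Longrightarrow> y \<in> carrier E \<Longrightarrow>
    hdist E (hscale E k x) (hscale E k y) = cmod k * hdist E x y"
  using hnorm_scale[of "x \<ominus> y" k] by (simp add: hdist_def hscale_diff)

lemma hdist_act: "x \<in> carrier E \<Longrightarrow> y \<in> carrier E \<Longrightarrow> b \<in> base E \<Longrightarrow>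
    hdist E (hact E x b) (hact E y b) \<le> hdist E x y * norm b"
  using hnorm_act_le[of "x \<ominus> y" b] by (simp add: hdist_def hact_diff)

lemma hdist_minus: "x \<in> carrier E \<Longrightarrow> y \<in> carrier E \<Longrightarrow> hdist E (\<ominus> x) (\<ominus> y) = hdist E x y"
  using hdist_scale[of x y "-1"] by (simp add: hscale_minus1)

lemma abs_hnorm_diff_le: "x \<in> carrier E \<Longrightarrow> y \<in> carrier E \<Longrightarrow> \<bar>hnorm E x - hnorm E y\<bar> \<le> hdist E x y"
proof -
  have "hnorm E x \<le> hnorm E y + hdist E x y" if "x \<in> carrier E" "y \<in> carrier E" for x y
  proof -
    have "y \<oplus> (x \<ominus> y) = x" using that by (simp add: a_minus_def a_lcomm[of y x] r_neg)
    then show ?thesis using hnorm_triangle[of y "x \<ominus> y"] that by (simp add: hdist_def)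
  qed
  from this[of x y] this[of y x] show "x \<in> carrier E \<Longrightarrow> y \<in> carrier E \<Longrightarrow> ?thesis"
    by (simp add: abs_le_iff hdist_sym)
qed

lemma norm_hinner_diff_le:
  assumes "x \<in> carrier E" "y \<in> carrier E" "x' \<in> carrier E" "y' \<in> carrier E"
  shows "norm (hinner E x y - hinner E x' y') \<le> hdist E x x' * hnorm E y + hnorm E x' * hdist E y y'"
proof -
  have "hinner E x y - hinner E x' y' = hinner E (x \<ominus> x') y + hinner E x' (y \<ominus> y')"
    using assms by (simp add: hinner_simps)
  also have "norm \<dots> \<le> hnorm E (x \<ominus> x') * hnorm E y + hnorm E x' * hnorm E (y \<ominus> y')"
    using assms by (intro order_trans[OF norm_triangle_ineq] add_mono norm_hinner_le) auto
  finally show ?thesis by (simp add: hdist_def)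
qed

subsection \<open>Cauchy sequences\<close>

lemma hCauchy_mem: "hCauchy E s \<Longrightarrow> s n \<in> carrier E"
  by (auto simp: hCauchy_def)

lemma hCauchyI:
  assumes "\<And>n. s n \<in> carrier E" "\<And>e. e > 0 \<Longrightarrow> \<exists>N. \<forall>m\<ge>N. \<forall>n\<ge>N. hdist E (s m) (s n) < e"
  shows "hCauchy E s"
  using assms by (auto simp: hCauchy_def)

lemma hCauchyD: "hCauchy E s \<Longrightarrow> e > 0 \<Longrightarrow> \<exists>N. \<forall>m\<ge>N. \<forall>n\<ge>N. hdist E (s m) (s n) < e"
  by (auto simp: hCauchy_def)

lemma hCauchy_const: "x \<in> carrier E \<Longrightarrow> hCauchy E (\<lambda>_. x)"
  by (rule hCauchyI) auto

lemma hCauchy_add: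
  assumes "hCauchy E s" "hCauchy E t"
  shows "hCauchy E (\<lambda>n. s n \<oplus> t n)"
proof (rule hCauchyI)
  note [simp] = assms[THEN hCauchy_mem]
  show "s n \<oplus> t n \<in> carrier E" for n by simp
  fix e :: real assume "e > 0"
  then obtain N M where *: "\<forall>m\<ge>N. \<forall>n\<ge>N. hdist E (s m) (s n) < e/2" "\<forall>m\<ge>M. \<forall>n\<ge>M. hdist E (t m) (t n) < e/2"
    using hCauchyD[OF assms(1), of "e/2"] hCauchyD[OF assms(2), of "e/2"] by auto
  have "hdist E (s m \<oplus> t m) (s n \<oplus> t n) < e" if "m \<ge> max N M" "n \<ge> max N M" for m n
  proof -
    have "hdist E (s m) (s n) < e/2" "hdist E (t m) (t n) < e/2" using * that by auto
    then show ?thesis using hdist_add[of "s m" "t m" "s n" "t n"] by simp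
  qed
  then show "\<exists>N. \<forall>m\<ge>N. \<forall>n\<ge>N. hdist E (s m \<oplus> t m) (s n \<oplus> t n) < e" by blast
qed

lemma hCauchy_bounded_map:
  assumes "hCauchy E s" "\<And>n. f (s n) \<in> carrier E"
    "\<And>m n. hdist E (f (s m)) (f (s n)) \<le> K * hdist E (s m) (s n)"
  shows "hCauchy E (\<lambda>n. f (s n))"
proof (rule hCauchyI)
  show "f (s n) \<in> carrier E" for n by (rule assms)
  fix e :: real assume e: "e > 0"
  have pos: "0 < \<bar>K\<bar> + 1" by simp
  then obtain N where N: "\<forall>m\<ge>N. \<forall>n\<ge>N. hdist E (s m) (s n) < e / (\<bar>K\<bar> + 1)"
    using hCauchyD[OF assms(1), of "e / (\<bar>K\<bar> + 1)"] e by auto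
  have "hdist E (f (s m)) (f (s n)) < e" if "m \<ge> N" "n \<ge> N" for m n
  proof -
    have "hdist E (f (s m)) (f (s n)) \<le> (\<bar>K\<bar> + 1) * hdist E (s m) (s n)"
      by (rule order_trans[OF assms(3)]) (simp add: mult_right_mono)
    also have "\<dots> < e" using N that pos by (simp add: less_divide_eq mult.commute)
    finally show ?thesis .
  qed
  then show "\<exists>N. \<forall>m\<ge>N. \<forall>n\<ge>N. hdist E (f (s m)) (f (s n)) < e" by blast
qed

lemma hCauchy_scale: "hCauchy E s \<Longrightarrow> hCauchy E (\<lambda>n. hscale E k (s n))"
  by (rule hCauchy_bounded_map[where K = "cmod k"]) (auto simp: hdist_scale hCauchy_mem)

lemma hCauchy_act: "hCauchy E s \<Longrightarrow> b \<in> base E \<Longrightarrow> hCauchy E (\<lambda>n. hact E (s n) b)"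
  by (rule hCauchy_bounded_map[where K = "norm b"])
    (auto simp: hdist_act hCauchy_mem mult.commute[of "norm b"])

lemma hCauchy_minus: "hCauchy E s \<Longrightarrow> hCauchy E (\<lambda>n. \<ominus> s n)"
  by (rule hCauchy_bounded_map[where K = 1]) (auto simp: hdist_minus hCauchy_mem)

lemma hCauchy_bounded:
  assumes "hCauchy E s"
  shows "\<exists>K\<ge>0. \<forall>n. hnorm E (s n) \<le> K"
proof -
  note [simp] = hCauchy_mem[OF assms]
  have "Cauchy (\<lambda>n. hnorm E (s n))"
  proof (rule CauchyI)
    fix e :: real assume "e > 0"
    then obtain M where M: "\<forall>m\<ge>M. \<forall>n\<ge>M. hdist E (s m) (s n) < e" using hCauchyD[OF assms] by blast
    have "norm (hnorm E (s m) - hnorm E (s n)) < e" if "m \<ge> M" "n \<ge> M" for m n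
      using M that abs_hnorm_diff_le[of "s m" "s n"] by (auto intro: le_less_trans)
    then show "\<exists>M. \<forall>m\<ge>M. \<forall>n\<ge>M. norm (hnorm E (s m) - hnorm E (s n)) < e" by blast
  qed
  then obtain K where "K > 0" "\<forall>n. norm (hnorm E (s n)) \<le> K"
    using Cauchy_Bseq BseqE by blast
  then show ?thesis by (intro exI[of _ K]) auto
qed

lemma convergent_hinner:
  assumes s: "hCauchy E s" and t: "hCauchy E t"
  shows "convergent (\<lambda>n. hinner E (s n) (t n))"
proof -
  note [simp] = hCauchy_mem[OF s] hCauchy_mem[OF t]
  obtain K L where K: "K \<ge> 0" "\<And>n. hnorm E (s n) \<le> K" and L: "L \<ge> 0" "\<And>n. hnorm E (t n) \<le> L"
    using hCauchy_bounded[OF s] hCauchy_bounded[OF t] by blast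
  have "Cauchy (\<lambda>n. hinner E (s n) (t n))"
  proof (rule CauchyI)
    fix e :: real assume e: "e > 0"
    define d where "d = e / (K + L + 1)"
    have d: "d > 0" using e K L by (simp add: d_def)
    obtain N M where *: "\<forall>m\<ge>N. \<forall>n\<ge>N. hdist E (s m) (s n) < d" "\<forall>m\<ge>M. \<forall>n\<ge>M. hdist E (t m) (t n) < d"
      using hCauchyD[OF s d] hCauchyD[OF t d] by auto
    have "norm (hinner E (s m) (t m) - hinner E (s n) (t n)) < e" if "m \<ge> max N M" "n \<ge> max N M" for m n
    proof -
      have "hdist E (s m) (s n) \<le> d" "hdist E (t m) (t n) \<le> d" using * that by (auto intro: less_imp_le)
      then have "norm (hinner E (s m) (t m) - hinner E (s n) (t n)) \<le> d * L + K * d"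
        using K L d by (intro order_trans[OF norm_hinner_diff_le] add_mono mult_mono) auto
      also have "\<dots> < d * (K + L + 1)" using d by (simp add: algebra_simps)
      also have "\<dots> = e" using K L by (simp add: d_def)
      finally show ?thesis .
    qed
    then show "\<exists>M. \<forall>m\<ge>M. \<forall>n\<ge>M. norm (hinner E (s m) (t m) - hinner E (s n) (t n)) < e" by blast
  qed
  then show ?thesis by (simp add: Cauchy_convergent_iff)
qed

text \<open>This is why the inner product of the completion does not depend on the chosen
  representatives.\<close>

lemma hinner_limit_unique:
  assumes "hCauchy E s" "hCauchy E t" "hCauchy E s'" "hCauchy E t'"
    "(\<lambda>n. hdist E (s n) (s' n)) \<longlonglongrightarrow> 0" "(\<lambda>n. hdist E (t n) (t' n)) \<longlonglongrightarrow> 0"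
  shows "(\<lambda>n. hinner E (s n) (t n) - hinner E (s' n) (t' n)) \<longlonglongrightarrow> 0"
proof -
  note [simp] = assms(1-4)[THEN hCauchy_mem]
  obtain K L where K: "K \<ge> 0" "\<And>n. hnorm E (s' n) \<le> K" and L: "L \<ge> 0" "\<And>n. hnorm E (t n) \<le> L"
    using hCauchy_bounded[OF assms(3)] hCauchy_bounded[OF assms(2)] by blast
  have "(\<lambda>n. hdist E (s n) (s' n) * L + K * hdist E (t n) (t' n)) \<longlonglongrightarrow> 0 * L + K * 0"
    by (intro tendsto_intros assms)
  then have "(\<lambda>n. hdist E (s n) (s' n) * L + K * hdist E (t n) (t' n)) \<longlonglongrightarrow> 0" by simp
  then show ?thesis
  proof (rule Lim_null_comparison[rotated], intro always_eventually allI)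
    show "norm (hinner E (s n) (t n) - hinner E (s' n) (t' n)) \<le>
        hdist E (s n) (s' n) * L + K * hdist E (t n) (t' n)" for n
      using K L by (intro order_trans[OF norm_hinner_diff_le] add_mono mult_left_mono mult_right_mono) auto
  qed
qed

end

locale hilbert = pre_hilbert +
  assumes hinner_eq_0D: "x \<in> carrier E \<Longrightarrow> hinner E x x = 0 \<Longrightarrow> x = \<zero>"
    and complete: "hCauchy E s \<Longrightarrow> \<exists>x\<in>carrier E. (\<lambda>n. hdist E (s n) x) \<longlonglongrightarrow> 0"
begin

lemma diff_eq_zeroD:
  assumes "x \<in> carrier E" "y \<in> carrier E" "x \<ominus> y = \<zero>"
  shows "x = y"
proof -
  have "x \<oplus> \<ominus> y = \<zero>" using assms(3) by (simp only: a_minus_def)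
  then have "\<ominus> (\<ominus> y) = x" by (rule minus_equality) (use assms(1,2) in simp_all)
  then show ?thesis using minus_minus[OF assms(2)] by simp
qed

lemma hdist_eq_0D:
  assumes "x \<in> carrier E" "y \<in> carrier E" "hdist E x y = 0"
  shows "x = y"
proof (rule diff_eq_zeroD[OF assms(1,2)])
  show "x \<ominus> y = \<zero>"
    using assms by (intro hinner_eq_0D) (simp_all add: hdist_def hnorm_def)
qed

lemma hinner_eqI:
  assumes "x \<in> carrier E" "y \<in> carrier E" "\<And>z. z \<in> carrier E \<Longrightarrow> hinner E z x = hinner E z y"
  shows "x = y"
proof (rule diff_eq_zeroD[OF assms(1,2)])
  show "x \<ominus> y = \<zero>"
    using assms(3)[of "x \<ominus> y"] assms(1,2) by (intro hinner_eq_0D) (simp_all add: hinner_diff_right)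
qed

lemma limit_unique:
  assumes "\<And>n. s n \<in> carrier E" "x \<in> carrier E" "y \<in> carrier E"
    "((\<lambda>n. hdist E (s n) x) \<longlongrightarrow> 0) F" "((\<lambda>n. hdist E (s n) y) \<longlongrightarrow> 0) F" "F \<noteq> bot"
  shows "x = y"
proof -
  have "((\<lambda>n. hdist E (s n) x + hdist E (s n) y) \<longlongrightarrow> 0 + 0) F"
    by (intro tendsto_add assms)
  moreover have "hdist E x y \<le> hdist E (s n) x + hdist E (s n) y" for n
    using hdist_triangle[of x "s n" y] assms(1-3) hdist_sym[of x "s n"] by simp
  ultimately have "hdist E x y \<le> 0 + 0"
    using assms(6) by (intro tendsto_lowerbound) (auto intro!: always_eventually)
  then show ?thesis using hdist_eq_0D[OF assms(2,3)] hdist_nonneg[of x y] by simp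
qed

end

lemma hilbert_module_iff: "hilbert_module E \<longleftrightarrow> hilbert E"
proof
  assume E: "hilbert_module E"
  then have G: "abelian_group E" and B: "cstar_alg (base E)" by (simp_all add: hilbert_module_def)
  \<comment> \<open>The axioms of \<open>hilbert_module\<close> quantify jointly over vectors and
    coefficients; the coefficient 0 is the witness for those clauses that mention no
    coefficient.\<close>
  have 0: "0 \<in> base E" using B by (simp add: cstar_alg_closed)
  have 1: "hscale E k x \<in> carrier E \<and> hscale E 1 x = x \<and> hscale E k (hscale E l x) = hscale E (k * l) x \<and>
        hscale E (k + l) x = hscale E k x \<oplus>\<^bsub>E\<^esub> hscale E l x \<and>
        hscale E k (x \<oplus>\<^bsub>E\<^esub> y) = hscale E k x \<oplus>\<^bsub>E\<^esub> hscale E k y"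
    if "x \<in> carrier E" "y \<in> carrier E" for x y k l
    using E that unfolding hilbert_module_def by blast
  have 2: "hact E x b \<in> carrier E \<and> hact E (x \<oplus>\<^bsub>E\<^esub> y) b = hact E x b \<oplus>\<^bsub>E\<^esub> hact E y b \<and>
        hact E x (b + c) = hact E x b \<oplus>\<^bsub>E\<^esub> hact E x c \<and> hact E x (b * c) = hact E (hact E x b) c \<and>
        hact E (hscale E k x) b = hscale E k (hact E x b) \<and> hact E x (k *\<^sub>C b) = hscale E k (hact E x b)"
    if "x \<in> carrier E" "y \<in> carrier E" "b \<in> base E" "c \<in> base E" for x y b c k
    using E that unfolding hilbert_module_def by blast
  have 3: "hinner E x y \<in> base E \<and> hinner E x (y \<oplus>\<^bsub>E\<^esub> z) = hinner E x y + hinner E x z \<and>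
        hinner E x (hscale E k y) = k *\<^sub>C hinner E x y \<and> hinner E x (hact E y b) = hinner E x y * b \<and>
        star (hinner E x y) = hinner E y x \<and> cpos (base E) (hinner E x x) \<and> (hinner E x x = 0 \<longrightarrow> x = \<zero>\<^bsub>E\<^esub>)"
    if "x \<in> carrier E" "y \<in> carrier E" "z \<in> carrier E" "b \<in> base E" for x y z b k
    using E that unfolding hilbert_module_def by blast
  have 4: "hCauchy E s \<Longrightarrow> \<exists>x\<in>carrier E. (\<lambda>n. hdist E (s n) x) \<longlonglongrightarrow> 0" for s
    using E unfolding hilbert_module_def by blast
  show "hilbert E"
    by (intro hilbert.intro pre_hilbert.intro pre_hilbert_axioms.intro hilbert_axioms.intro G B,
        metis 1, metis 1, metis 1, metis 1, metis 1,
        metis 0 2, metis 2, metis 2, metis 2, metis 0 2, metis 0 2,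
        metis 0 3, metis 0 3, metis 0 3, metis 3, metis 0 3, metis 0 3, metis 0 3, metis 4)
next
  assume "hilbert E"
  then interpret hilbert E .
  show "hilbert_module E"
    unfolding hilbert_module_def
    by (auto simp: cstar_base abelian_group_axioms hscale_hscale hscale_add_left hscale_add hact_add hact_add_right
        hact_mult hact_hscale hact_scaleC hinner_add_right hinner_scale_right hinner_act_right star_hinner
        cpos_hinner hinner_eq_0D complete)
qed

section \<open>Completion\<close>

context pre_hilbert
begin

abbreviation "cls \<equiv> completion_class E"
abbreviation "H \<equiv> completion E"

lemma mem_clsD: "t \<in> cls s \<Longrightarrow> hCauchy E t" "t \<in> cls s \<Longrightarrow> (\<lambda>n. hdist E (t n) (s n)) \<longlonglongrightarrow> 0"
  by (auto simp: completion_class_def)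

lemma hdist_lim_sym:
  assumes "\<And>n. s n \<in> carrier E" "\<And>n. t n \<in> carrier E" "(\<lambda>n. hdist E (s n) (t n)) \<longlonglongrightarrow> 0"
  shows "(\<lambda>n. hdist E (t n) (s n)) \<longlonglongrightarrow> 0"
  using assms by (simp add: hdist_sym)

lemma hdist_lim_trans:
  assumes "\<And>n. s n \<in> carrier E" "\<And>n. t n \<in> carrier E" "\<And>n. u n \<in> carrier E"
    "(\<lambda>n. hdist E (s n) (t n)) \<longlonglongrightarrow> 0" "(\<lambda>n. hdist E (t n) (u n)) \<longlonglongrightarrow> 0"
  shows "(\<lambda>n. hdist E (s n) (u n)) \<longlonglongrightarrow> 0"
proof (rule Lim_null_comparison[where g = "\<lambda>n. hdist E (s n) (t n) + hdist E (t n) (u n)"])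
  show "(\<lambda>n. hdist E (s n) (t n) + hdist E (t n) (u n)) \<longlonglongrightarrow> 0"
    using tendsto_add[OF assms(4,5)] by simp
qed (use assms(1-3) hdist_triangle in auto)

lemma cls_eq_iff:
  assumes "hCauchy E s" "hCauchy E t"
  shows "cls s = cls t \<longleftrightarrow> (\<lambda>n. hdist E (s n) (t n)) \<longlonglongrightarrow> 0"
proof
  note [simp] = assms[THEN hCauchy_mem]
  assume "cls s = cls t"
  moreover have "s \<in> cls s" using assms by (simp add: completion_class_def)
  ultimately show "(\<lambda>n. hdist E (s n) (t n)) \<longlonglongrightarrow> 0" using mem_clsD by blast
next
  note [simp] = assms[THEN hCauchy_mem]
  assume "(\<lambda>n. hdist E (s n) (t n)) \<longlonglongrightarrow> 0"
  moreover from this have "(\<lambda>n. hdist E (t n) (s n)) \<longlonglongrightarrow> 0" by (rule hdist_lim_sym[rotated 2]) auto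
  ultimately show "cls s = cls t"
    by (auto simp: completion_class_def hCauchy_mem intro: hdist_lim_trans[rotated 3])
qed

lemma rep_cls:
  assumes "hCauchy E s"
  shows "hCauchy E (rep (cls s))" "(\<lambda>n. hdist E (rep (cls s) n) (s n)) \<longlonglongrightarrow> 0"
proof -
  have "s \<in> cls s" using assms by (simp add: completion_class_def hCauchy_mem[OF assms])
  then have "rep (cls s) \<in> cls s" unfolding rep_def by (rule someI[of "\<lambda>u. u \<in> cls s"])
  then show "hCauchy E (rep (cls s))" "(\<lambda>n. hdist E (rep (cls s) n) (s n)) \<longlonglongrightarrow> 0"
    using mem_clsD by blast+
qed

lemma carrier_completion: "carrier H = {cls s |s. hCauchy E s}"
  by (auto simp: completion_def)

lemma base_completion [simp]: "base H = base E"
  by (simp add: completion_def)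

lemma cls_closed [simp]: "hCauchy E s \<Longrightarrow> cls s \<in> carrier H"
  by (auto simp: carrier_completion)

lemma completion_zero: "\<zero>\<^bsub>H\<^esub> = cls (\<lambda>_. \<zero>)"
  by (simp add: completion_def)

lemma completion_add:
  assumes "hCauchy E s" "hCauchy E t"
  shows "cls s \<oplus>\<^bsub>H\<^esub> cls t = cls (\<lambda>n. s n \<oplus> t n)"
proof -
  note r = rep_cls[OF assms(1)] rep_cls[OF assms(2)]
  note [simp] = assms[THEN hCauchy_mem] r(1,3)[THEN hCauchy_mem]
  have "(\<lambda>n. hdist E (rep (cls s) n) (s n) + hdist E (rep (cls t) n) (t n)) \<longlonglongrightarrow> 0"
    using tendsto_add[OF r(2,4)] by simp
  then have "(\<lambda>n. hdist E (rep (cls s) n \<oplus> rep (cls t) n) (s n \<oplus> t n)) \<longlonglongrightarrow> 0"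
    by (rule Lim_null_comparison[rotated]) (auto simp: hdist_add)
  then show ?thesis
    using assms r by (simp add: completion_def cls_eq_iff hCauchy_add)
qed

lemma completion_scale:
  assumes "hCauchy E s"
  shows "hscale H k (cls s) = cls (\<lambda>n. hscale E k (s n))"
proof -
  note r = rep_cls[OF assms(1)]
  note [simp] = assms[THEN hCauchy_mem] r(1)[THEN hCauchy_mem]
  have "(\<lambda>n. cmod k * hdist E (rep (cls s) n) (s n)) \<longlonglongrightarrow> 0"
    by (rule tendsto_mult_right_zero[OF r(2)])
  then show ?thesis
    using assms r by (simp add: completion_def cls_eq_iff hCauchy_scale hdist_scale)
qed

lemma completion_act:
  assumes "hCauchy E s" "b \<in> base E"
  shows "hact H (cls s) b = cls (\<lambda>n. hact E (s n) b)"
proof -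
  note r = rep_cls[OF assms(1)]
  note [simp] = assms(1)[THEN hCauchy_mem] r(1)[THEN hCauchy_mem]
  have "(\<lambda>n. hdist E (rep (cls s) n) (s n) * norm b) \<longlonglongrightarrow> 0"
    by (rule tendsto_mult_left_zero[OF r(2)])
  then have "(\<lambda>n. hdist E (hact E (rep (cls s) n) b) (hact E (s n) b)) \<longlonglongrightarrow> 0"
    by (rule Lim_null_comparison[rotated]) (auto simp: hdist_act assms)
  then show ?thesis
    using assms r by (simp add: completion_def cls_eq_iff hCauchy_act)
qed

lemma completion_inner:
  assumes "hCauchy E s" "hCauchy E t"
  shows "(\<lambda>n. hinner E (s n) (t n)) \<longlonglongrightarrow> hinner H (cls s) (cls t)"
proof -
  note r = rep_cls[OF assms(1)] rep_cls[OF assms(2)]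
  have 1: "(\<lambda>n. hinner E (rep (cls s) n) (rep (cls t) n)) \<longlonglongrightarrow> hinner H (cls s) (cls t)"
    using convergent_hinner[OF r(1,3)] by (simp add: completion_def convergent_LIMSEQ_iff)
  have "(\<lambda>n. hinner E (rep (cls s) n) (rep (cls t) n) - hinner E (s n) (t n)) \<longlonglongrightarrow> 0"
    by (rule hinner_limit_unique) (use r assms in auto)
  from tendsto_diff[OF 1 this] show ?thesis by simp
qed

lemma abelian_group_completion: "abelian_group H"
proof (rule abelian_groupI)
  note intros = hCauchy_add hCauchy_minus hCauchy_const hCauchy_mem
  show "\<zero>\<^bsub>H\<^esub> \<in> carrier H" by (simp add: completion_zero hCauchy_const)
  fix p assume "p \<in> carrier H"
  then obtain s where s: "p = cls s" "hCauchy E s" by (auto simp: carrier_completion)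
  note [simp] = hCauchy_mem[OF s(2)]
  show "\<zero>\<^bsub>H\<^esub> \<oplus>\<^bsub>H\<^esub> p = p" by (simp add: s completion_zero completion_add hCauchy_const)
  show "\<exists>q\<in>carrier H. q \<oplus>\<^bsub>H\<^esub> p = \<zero>\<^bsub>H\<^esub>"
    by (rule bexI[of _ "cls (\<lambda>n. \<ominus> s n)"]) (simp_all add: s completion_zero completion_add hCauchy_minus l_neg)
  fix q assume "q \<in> carrier H"
  then obtain t where t: "q = cls t" "hCauchy E t" by (auto simp: carrier_completion)
  note [simp] = hCauchy_mem[OF t(2)]
  show "p \<oplus>\<^bsub>H\<^esub> q \<in> carrier H" by (simp add: s t completion_add hCauchy_add)
  show "p \<oplus>\<^bsub>H\<^esub> q = q \<oplus>\<^bsub>H\<^esub> p" by (simp add: s t completion_add a_comm)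
  fix r assume "r \<in> carrier H"
  then obtain u where u: "r = cls u" "hCauchy E u" by (auto simp: carrier_completion)
  note [simp] = hCauchy_mem[OF u(2)]
  show "p \<oplus>\<^bsub>H\<^esub> q \<oplus>\<^bsub>H\<^esub> r = p \<oplus>\<^bsub>H\<^esub> (q \<oplus>\<^bsub>H\<^esub> r)"
    by (simp add: s t u completion_add hCauchy_add a_assoc)
qed

lemma completion_diff:
  assumes "hCauchy E s" "hCauchy E t"
  shows "cls s \<ominus>\<^bsub>H\<^esub> cls t = cls (\<lambda>n. s n \<ominus> t n)"
proof -
  interpret HG: abelian_group H by (rule abelian_group_completion)
  note [simp] = assms[THEN hCauchy_mem]
  have "\<ominus>\<^bsub>H\<^esub> cls t = cls (\<lambda>n. \<ominus> t n)"
    by (rule HG.minus_equality)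
      (simp_all add: completion_add completion_zero assms hCauchy_minus l_neg)
  then show ?thesis
    using assms by (simp add: a_minus_def completion_add hCauchy_minus)
qed

lemma pre_hilbert_completion: "pre_hilbert H"
proof -
  interpret HG: abelian_group H by (rule abelian_group_completion)
  show ?thesis
  proof (intro pre_hilbert.intro abelian_group_completion pre_hilbert_axioms.intro)
    show "cstar_alg (base H)" by (simp add: cstar_base)
    fix p assume "p \<in> carrier H"
    then obtain s where s: "p = cls s" "hCauchy E s" by (auto simp: carrier_completion)
    note [simp] = s(2) hCauchy_mem[OF s(2)] hCauchy_scale[OF s(2)] hCauchy_act[OF s(2)]
    show "hscale H k p \<in> carrier H" "hscale H 1 p = p"
      "hscale H k (hscale H l p) = hscale H (k * l) p"
      "hscale H (k + l) p = hscale H k p \<oplus>\<^bsub>H\<^esub> hscale H l p" for k l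
      by (simp_all add: s(1) completion_scale hscale_hscale completion_add hscale_add_left)
    { fix b c assume bc: "b \<in> base H" "c \<in> base H"
      then show "hact H p (b + c) = hact H p b \<oplus>\<^bsub>H\<^esub> hact H p c" "hact H p (b * c) = hact H (hact H p b) c"
        by (simp_all add: s(1) completion_act clB completion_add hact_add_right hact_mult hCauchy_act) }
    { fix b k assume b: "b \<in> base H"
      then show "hact H p b \<in> carrier H"
        "hact H (hscale H k p) b = hscale H k (hact H p b)" "hact H p (k *\<^sub>C b) = hscale H k (hact H p b)"
        by (simp_all add: s(1) completion_act completion_scale clB hact_hscale hact_scaleC) }
    have "(\<lambda>n. hinner E (s n) (s n)) \<longlonglongrightarrow> hinner H p p" unfolding s(1) by (intro completion_inner s)
    then show "cpos (base H) (hinner H p p)"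
      unfolding base_completion by (rule cpos_limit[OF cstar_base]) (simp add: cpos_hinner)
    fix q assume "q \<in> carrier H"
    then obtain t where t: "q = cls t" "hCauchy E t" by (auto simp: carrier_completion)
    note [simp] = t(2) hCauchy_mem[OF t(2)] hCauchy_scale[OF t(2)] hCauchy_act[OF t(2)]
    show "hscale H k (p \<oplus>\<^bsub>H\<^esub> q) = hscale H k p \<oplus>\<^bsub>H\<^esub> hscale H k q" for k
      by (simp add: s(1) t(1) completion_scale completion_add hCauchy_add hscale_add)
    have st: "(\<lambda>n. hinner E (s n) (t n)) \<longlonglongrightarrow> hinner H p q" unfolding s(1) t(1) by (intro completion_inner s t)
    show "hinner H p q \<in> base H"
      using closed_sequentially[OF clB(1) _ st] by simp
    have "(\<lambda>n. hinner E (t n) (s n)) \<longlonglongrightarrow> hinner H q p" unfolding s(1) t(1) by (intro completion_inner s t)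
    moreover have "(\<lambda>n. hinner E (t n) (s n)) \<longlonglongrightarrow> star (hinner H p q)"
      using tendsto_star[OF st] by (simp add: star_hinner)
    ultimately show "star (hinner H p q) = hinner H q p" using LIMSEQ_unique by blast
    have "(\<lambda>n. hinner E (s n) (hscale E k (t n))) \<longlonglongrightarrow> hinner H p (hscale H k q)" for k
      unfolding s(1) t(1) by (simp add: completion_scale completion_inner)
    moreover have "(\<lambda>n. hinner E (s n) (hscale E k (t n))) \<longlonglongrightarrow> k *\<^sub>C hinner H p q" for k
      using tendsto_scaleC[OF st] by (simp add: hinner_scale_right)
    ultimately show "hinner H p (hscale H k q) = k *\<^sub>C hinner H p q" for k using LIMSEQ_unique by blast
    { fix b assume b: "b \<in> base H"
      then show "hact H (p \<oplus>\<^bsub>H\<^esub> q) b = hact H p b \<oplus>\<^bsub>H\<^esub> hact H q b"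
        by (simp add: s(1) t(1) completion_act completion_add hCauchy_add hact_add)
      have "(\<lambda>n. hinner E (s n) (hact E (t n) b)) \<longlonglongrightarrow> hinner H p (hact H q b)"
        unfolding s(1) t(1) using b by (simp add: completion_act completion_inner)
      moreover have "(\<lambda>n. hinner E (s n) (hact E (t n) b)) \<longlonglongrightarrow> hinner H p q * b"
        using tendsto_mult[OF st tendsto_const[of b]] b by (simp add: hinner_act_right)
      ultimately show "hinner H p (hact H q b) = hinner H p q * b" using LIMSEQ_unique by blast }
    fix r assume "r \<in> carrier H"
    then obtain u where u: "r = cls u" "hCauchy E u" by (auto simp: carrier_completion)
    note [simp] = u(2) hCauchy_mem[OF u(2)]
    have su: "(\<lambda>n. hinner E (s n) (u n)) \<longlonglongrightarrow> hinner H p r" unfolding s(1) u(1) by (intro completion_inner s u)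
    have "(\<lambda>n. hinner E (s n) (t n \<oplus> u n)) \<longlonglongrightarrow> hinner H p (q \<oplus>\<^bsub>H\<^esub> r)"
      unfolding s(1) t(1) u(1) by (simp add: completion_add completion_inner hCauchy_add)
    moreover have "(\<lambda>n. hinner E (s n) (t n \<oplus> u n)) \<longlonglongrightarrow> hinner H p q + hinner H p r"
      using tendsto_add[OF st su] by (simp add: hinner_add_right)
    ultimately show "hinner H p (q \<oplus>\<^bsub>H\<^esub> r) = hinner H p q + hinner H p r" using LIMSEQ_unique by blast
  qed
qed

lemma completion_norm:
  assumes "hCauchy E s"
  shows "(\<lambda>n. hnorm E (s n)) \<longlonglongrightarrow> hnorm H (cls s)"
  unfolding hnorm_def by (intro tendsto_intros completion_inner assms)

lemma hCauchy_diff: "hCauchy E s \<Longrightarrow> hCauchy E t \<Longrightarrow> hCauchy E (\<lambda>n. s n \<ominus> t n)"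
  unfolding a_minus_def by (intro hCauchy_add hCauchy_minus)

lemma completion_dist:
  assumes "hCauchy E s" "hCauchy E t"
  shows "(\<lambda>n. hdist E (s n) (t n)) \<longlonglongrightarrow> hdist H (cls s) (cls t)"
  unfolding hdist_def completion_diff[OF assms] by (intro completion_norm hCauchy_diff assms)

text \<open>A Cauchy sequence, read term by term as constant sequences, approaches its own class, so
  the constants are dense.\<close>

lemma completion_const_dense:
  assumes "hCauchy E s"
  shows "(\<lambda>n. hdist H (cls (\<lambda>_. s n)) (cls s)) \<longlonglongrightarrow> 0"
proof (rule LIMSEQ_I)
  note [simp] = hCauchy_mem[OF assms]
  interpret PH: pre_hilbert H by (rule pre_hilbert_completion)
  fix e :: real assume e: "e > 0"
  then obtain N where N: "\<forall>m\<ge>N. \<forall>n\<ge>N. hdist E (s m) (s n) < e/2"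
    using hCauchyD[OF assms, of "e/2"] by auto
  have "hdist H (cls (\<lambda>_. s n)) (cls s) \<le> e/2" if "n \<ge> N" for n
  proof (rule LIMSEQ_le_const2[OF completion_dist[OF hCauchy_const assms]])
    show "\<exists>M. \<forall>m\<ge>M. hdist E (s n) (s m) \<le> e/2" using N that by (intro exI[of _ N]) (auto intro: less_imp_le)
  qed simp
  then have "norm (hdist H (cls (\<lambda>_. s n)) (cls s) - 0) < e" if "n \<ge> N" for n
    using e that by (force simp: field_simps)
  then show "\<exists>N. \<forall>n\<ge>N. norm (hdist H (cls (\<lambda>_. s n)) (cls s) - 0) < e" by blast
qed

text \<open>For completeness, each term \<open>P k\<close> is replaced by a constant class within
  \<open>inverse (Suc k)\<close> of it. The embedding by constants is isometric, so the chosen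
  elements form a Cauchy sequence, and its class is the limit.\<close>

lemma hilbert_completion: "hilbert H"
proof (intro hilbert.intro pre_hilbert_completion hilbert_axioms.intro)
  interpret PH: pre_hilbert H by (rule pre_hilbert_completion)
  fix p assume p: "p \<in> carrier H" "hinner H p p = 0"
  then obtain s where s: "p = cls s" "hCauchy E s" by (auto simp: carrier_completion)
  note [simp] = hCauchy_mem[OF s(2)]
  have "(\<lambda>n. hnorm E (s n)) \<longlonglongrightarrow> 0"
    using completion_norm[OF s(2)] p(2) by (simp add: hnorm_def[of H] s(1))
  then show "p = \<zero>\<^bsub>H\<^esub>"
    unfolding s(1) completion_zero
    by (subst cls_eq_iff) (simp_all add: s(2) hCauchy_const hdist_def a_minus_def)
next
  interpret PH: pre_hilbert H by (rule pre_hilbert_completion)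
  fix P assume P: "hCauchy H P"
  note [simp] = PH.hCauchy_mem[OF P]
  have "\<exists>s. hCauchy E s \<and> P k = cls s" for k
    using PH.hCauchy_mem[OF P, of k] by (auto simp: carrier_completion)
  then obtain s where s: "hCauchy E (s k)" "P k = cls (s k)" for k by metis
  have "\<exists>n. hdist H (cls (\<lambda>_. s k n)) (P k) < inverse (Suc k)" for k
  proof -
    have "\<forall>\<^sub>F n in sequentially. hdist H (cls (\<lambda>_. s k n)) (P k) < inverse (Suc k)"
      using order_tendstoD(2)[OF completion_const_dense[OF s(1)], of "inverse (Suc k)" k] by (simp add: s(2))
    then show ?thesis using eventually_happens trivial_limit_sequentially by blast
  qed
  then obtain n where n: "hdist H (cls (\<lambda>_. s k (n k))) (P k) < inverse (Suc k)" for k by metis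
  define t where "t k = s k (n k)" for k
  have tE [simp]: "t k \<in> carrier E" for k by (simp add: t_def hCauchy_mem[OF s(1)])
  define T where "T k = cls (\<lambda>_. t k)" for k
  have T [simp]: "T k \<in> carrier H" for k by (simp add: T_def hCauchy_const)
  have TP: "hdist H (T k) (P k) < inverse (Suc k)" for k using n by (simp add: T_def t_def)
  have Tt: "hdist H (T k) (T l) = hdist E (t k) (t l)" for k l
    using completion_dist[OF hCauchy_const hCauchy_const, of "t k" "t l"] tE
    by (simp add: T_def LIMSEQ_const_iff)
  have "hCauchy E t"
  proof (rule hCauchyI)
    fix e :: real assume e: "e > 0"
    obtain N where N: "\<forall>m\<ge>N. \<forall>n\<ge>N. hdist H (P m) (P n) < e/3"
      using PH.hCauchyD[OF P, of "e/3"] e by auto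
    obtain M where M: "inverse (real (Suc M)) < e/3" using reals_Archimedean[of "e/3"] e by auto
    have inv: "inverse (real (Suc k)) < e/3" if "k \<ge> M" for k
      by (rule le_less_trans[OF _ M]) (simp add: that le_imp_inverse_le)
    have "hdist E (t k) (t l) < e" if kl: "k \<ge> max N M" "l \<ge> max N M" for k l
    proof -
      have "hdist H (T k) (T l) \<le> hdist H (T k) (P k) + (hdist H (P k) (P l) + hdist H (P l) (T l))"
        by (intro order_trans[OF PH.hdist_triangle[of _ "P k"]] add_mono PH.hdist_triangle) auto
      moreover have "hdist H (P l) (T l) = hdist H (T l) (P l)" by (rule PH.hdist_sym) auto
      moreover have "hdist H (P k) (P l) < e/3" using N kl by auto
      ultimately show ?thesis using TP[of k] TP[of l] inv[of k] inv[of l] kl by (simp add: Tt)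
    qed
    then show "\<exists>N. \<forall>m\<ge>N. \<forall>n\<ge>N. hdist E (t m) (t n) < e" by blast
  qed (rule tE)
  then have t: "cls t \<in> carrier H" "(\<lambda>k. hdist H (T k) (cls t)) \<longlonglongrightarrow> 0"
    unfolding T_def by (rule cls_closed, rule completion_const_dense)
  have "(\<lambda>k. hdist H (T k) (P k)) \<longlonglongrightarrow> 0"
    by (rule Lim_null_comparison[OF _ LIMSEQ_inverse_real_of_nat])
      (use less_imp_le[OF TP] in \<open>simp add: always_eventually\<close>)
  then have "(\<lambda>k. hdist H (P k) (T k)) \<longlonglongrightarrow> 0" by (rule PH.hdist_lim_sym[rotated 2]) auto
  then have "(\<lambda>k. hdist H (P k) (cls t)) \<longlonglongrightarrow> 0"
    by (rule PH.hdist_lim_trans[OF _ _ _ _ t(2), rotated 3]) (use t(1) in auto)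
  then show "\<exists>x\<in>carrier H. (\<lambda>n. hdist H (P n) x) \<longlonglongrightarrow> 0" using t(1) by blast
qed

end

section \<open>Interior tensor products\<close>

text \<open>In the morphisms considered here \<rho> takes values in left multiplications by elements
  of \<open>C\<close>. The locale names the underlying homomorphism \<open>r\<close> into
  \<open>C\<close>, so that computations take place in \<open>C\<close> and not among its
  multipliers.\<close>

locale tensor = hilbert E
  for E :: "('b::cstar_algebra, 'e) hmodule" (structure) +
  fixes C :: "'c::cstar_algebra set" and r :: "'b \<Rightarrow> 'c" and \<rho> :: "'b \<Rightarrow> 'c \<Rightarrow> 'c"
  assumes hom: "star_hom_on (base E) C r"
    and rho: "b \<in> base E \<Longrightarrow> c \<in> C \<Longrightarrow> \<rho> b c = r b * c"
begin

lemmas r = star_hom_onD[OF hom]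
lemmas clC = cstar_alg_closed[OF r(2)]

lemma norm_r_hinner_le: "x \<in> carrier E \<Longrightarrow> y \<in> carrier E \<Longrightarrow> norm (r (hinner E x y)) \<le> hnorm E x * hnorm E y"
  by (rule order_trans[OF star_hom_on_contractive[OF hom]]) (auto intro: norm_hinner_le)

text \<open>
  \<open>Y z = z - x\<^sub>0 f\<langle>x\<^sub>0, z\<rangle>\<close>, where \<open>f\<close> approximates multiplication by the inverse of
  \<open>\<langle>x\<^sub>0, x\<^sub>0\<rangle>\<close>.  This removes \<open>x\<^sub>0\<close> from a Gram matrix up to a small error.
\<close>

lemma gram_reduction:
  assumes x0: "x0 \<in> carrier E" and e: "0 < e"
  shows "\<exists>Y V. (\<forall>z\<in>carrier E. Y z \<in> carrier E \<and> V z \<in> base E \<and> hnorm E (Y z) \<le> hnorm E z) \<and>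
    hnorm E (Y x0) < e \<and>
    (\<forall>z\<in>carrier E. \<forall>w\<in>carrier E. hinner E z w = star (V z) * V w + hinner E (Y z) (Y w))"
proof -
  define a where "a = hinner E x0 x0"
  have a: "cpos (base E) a" "a \<in> base E" "star a = a" using x0 by (auto simp: a_def cpos_hinner star_hinner)
  \<comment> \<open>The tolerance is squared because the conclusion bounds \<open>hnorm\<close>, the
    square root of the norm of the inner product.\<close>
  obtain f g where fg: "\<And>b. b \<in> base E \<Longrightarrow> f b \<in> base E" "\<And>b. b \<in> base E \<Longrightarrow> g b \<in> base E"
      "\<And>b c. b \<in> base E \<Longrightarrow> c \<in> base E \<Longrightarrow> star b * f c = star (f b) * c"
      "\<And>b c. b \<in> base E \<Longrightarrow> c \<in> base E \<Longrightarrow> star (g b) * g c = 2 *\<^sub>R (star b * f c) - star (f b) * a * f c"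
      "norm (a - a * f a - star (f a) * a + star (f a) * a * f a) < e\<^sup>2"
    using ex_approx_inverse[OF cstar_base a(1), of "e\<^sup>2"] e by (metis zero_less_power)
  define Y where "Y z = z \<ominus> hact E x0 (f (hinner E x0 z))" for z
  define V where "V z = g (hinner E x0 z)" for z
  have Y: "Y z \<in> carrier E" "V z \<in> base E" if "z \<in> carrier E" for z
    using that x0 fg(1,2) by (auto simp: Y_def V_def)
  have gram: "hinner E z w = star (V z) * V w + hinner E (Y z) (Y w)"
    if zw: "z \<in> carrier E" "w \<in> carrier E" for z w
  proof -
    have "hinner E (Y z) (Y w) = hinner E z w - star (hinner E x0 z) * f (hinner E x0 w)
        - (star (f (hinner E x0 z)) * hinner E x0 w - star (f (hinner E x0 z)) * a * f (hinner E x0 w))"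
      using zw x0 fg(1) by (simp add: Y_def hinner_simps star_hinner a_def mult.assoc algebra_simps)
    also have "star (f (hinner E x0 z)) * hinner E x0 w = star (hinner E x0 z) * f (hinner E x0 w)"
      using zw x0 by (simp add: fg(3))
    finally show ?thesis using zw x0 by (simp add: V_def fg(4) scaleR_2)
  qed
  \<comment> \<open>In the decomposition for \<open>w = z\<close> the removed part is a positive
    square, so the inner product can only shrink.\<close>
  have le: "hnorm E (Y z) \<le> hnorm E z" if "z \<in> carrier E" for z
  proof -
    have "cpos (base E) (hinner E z z - hinner E (Y z) (Y z))"
      using gram[OF that that] Y[OF that] by (simp add: cpos_star_mult)
    then have "norm (hinner E (Y z) (Y z)) \<le> norm (hinner E z z)"
      using Y[OF that] by (intro cpos_norm_mono[OF cstar_base] cpos_hinner)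
    then show ?thesis by (simp add: hnorm_def)
  qed
  have "hinner E (Y x0) (Y x0) = a - a * f a - star (f a) * a + star (f a) * a * f a"
    using x0 fg(1) a by (simp add: Y_def hinner_simps mult.assoc algebra_simps flip: a_def)
  then have "(hnorm E (Y x0))\<^sup>2 < e\<^sup>2" using fg(5) by (simp add: hnorm_square)
  then have "hnorm E (Y x0) < e" using e by (simp add: power_less_imp_less_base)
  then show ?thesis
    by (rule_tac exI[of _ Y], rule_tac exI[of _ V], intro conjI ballI)
      (rule Y(1), assumption, rule Y(2), assumption, rule le, assumption, assumption, rule gram, assumption+)
qed

text \<open>Induction on the index set, with the vectors generalized since the reduction replaces
  all of them. After removing \<open>x k\<close>, the sum splits into a square
  \<open>star w * w\<close>, the row and column of \<open>k\<close>, which are small, and a sum over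
  \<open>I\<close> for the new vectors, which is positive by induction. Letting the error tend to 0
  uses that the cone is closed.\<close>

lemma cpos_gram:
  assumes "finite I" "\<And>i. i \<in> I \<Longrightarrow> x i \<in> carrier E" "\<And>i. i \<in> I \<Longrightarrow> c i \<in> C"
  shows "cpos C (\<Sum>i\<in>I. \<Sum>j\<in>I. star (c i) * r (hinner E (x i) (x j)) * c j)"
  using assms
proof (induction I arbitrary: x rule: finite_induct)
  case empty
  then show ?case by (simp add: cpos_0 r(2))
next
  case (insert k I)
  let ?F = "\<lambda>x i j. star (c i) * r (hinner E (x i) (x j)) * c j"
  have split: "(\<Sum>i\<in>insert k I. \<Sum>j\<in>insert k I. F i j) =
      (F k k + (\<Sum>j\<in>I. F k j + F j k)) + (\<Sum>i\<in>I. \<Sum>j\<in>I. F i j)" for F :: "_ \<Rightarrow> _ \<Rightarrow> 'c"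
    using insert.hyps by (simp add: sum.distrib algebra_simps)
  define S where "S = (\<Sum>i\<in>insert k I. \<Sum>j\<in>insert k I. ?F x i j)"
  \<comment> \<open>This bounds the row and column of \<open>k\<close>, up to the factor
    \<open>inverse (Suc n)\<close>; it is independent of \<open>n\<close> because the reduction does
    not increase norms.\<close>
  define M where "M = norm (c k) * hnorm E (x k) * norm (c k) + 2 * (\<Sum>j\<in>I. norm (c k) * hnorm E (x j) * norm (c j))"
  have M: "0 \<le> M" by (simp add: M_def sum_nonneg)
  have "\<exists>D. norm D \<le> M * inverse (Suc n) \<and> cpos C (S - D)" for n
  proof -
    have pos: "0 < inverse (real (Suc n))" by simp
    from gram_reduction[OF insert.prems(1)[OF insertI1] pos]
    obtain Y V where Y: "\<forall>z\<in>carrier E. Y z \<in> carrier E \<and> V z \<in> base E \<and> hnorm E (Y z) \<le> hnorm E z"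
        "hnorm E (Y (x k)) < inverse (real (Suc n))"
        "\<forall>z\<in>carrier E. \<forall>w\<in>carrier E. hinner E z w = star (V z) * V w + hinner E (Y z) (Y w)"
      by (elim exE conjE) (rule that)
    define y where "y i = Y (x i)" for i
    define v where "v i = V (x i)" for i
    have y: "y i \<in> carrier E" "v i \<in> base E" "hnorm E (y i) \<le> hnorm E (x i)" if "i \<in> insert k I" for i
      using bspec[OF Y(1) insert.prems(1)[OF that]] by (simp_all add: y_def v_def)
    have G: "hinner E (x i) (x j) = star (v i) * v j + hinner E (y i) (y j)"
      if "i \<in> insert k I" "j \<in> insert k I" for i j
      unfolding y_def v_def
      by (rule bspec[OF bspec[OF Y(3) insert.prems(1)[OF that(1)]] insert.prems(1)[OF that(2)]])
    define w where "w = (\<Sum>i\<in>insert k I. r (v i) * c i)"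
    have wC: "w \<in> C" unfolding w_def using y insert.prems by (intro cstar_alg_sum r clC) auto
    have "?F x i j = star (r (v i) * c i) * (r (v j) * c j) + ?F y i j"
      if "i \<in> insert k I" "j \<in> insert k I" for i j
      using that y by (simp add: G r clB star_mult distrib_left distrib_right mult.assoc)
    then have "S = (\<Sum>i\<in>insert k I. \<Sum>j\<in>insert k I. star (r (v i) * c i) * (r (v j) * c j)) +
        (\<Sum>i\<in>insert k I. \<Sum>j\<in>insert k I. ?F y i j)"
      unfolding S_def sum.distrib[symmetric] by (intro sum.cong refl)
    also have "(\<Sum>i\<in>insert k I. \<Sum>j\<in>insert k I. star (r (v i) * c i) * (r (v j) * c j)) = star w * w"
      unfolding w_def star_sum by (rule sum_product[symmetric])
    finally have S: "S = star w * w + (\<Sum>i\<in>insert k I. \<Sum>j\<in>insert k I. ?F y i j)" .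
    define D where "D = ?F y k k + (\<Sum>j\<in>I. ?F y k j + ?F y j k)"
    have "S - D = star w * w + (\<Sum>i\<in>I. \<Sum>j\<in>I. ?F y i j)"
      unfolding S split D_def by simp
    also have "cpos C \<dots>"
      using y insert.prems by (intro cpos_add r insert.IH cpos_star_mult wC) auto
    finally have pos: "cpos C (S - D)" .
    have F: "norm (?F y i j) \<le> norm (c i) * (hnorm E (y i) * hnorm E (y j)) * norm (c j)"
      if "i \<in> insert k I" "j \<in> insert k I" for i j
      using y that
      by (intro order_trans[OF norm_mult_ineq] mult_right_mono) (auto intro!: order_trans[OF norm_mult_ineq] mult_left_mono norm_r_hinner_le)
    have Fk: "norm (?F y k j) \<le> inverse (Suc n) * (norm (c k) * hnorm E (x j) * norm (c j))"
         "norm (?F y j k) \<le> inverse (Suc n) * (norm (c k) * hnorm E (x j) * norm (c j))"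
      if j: "j \<in> insert k I" for j
    proof -
      have yk: "hnorm E (y k) \<le> inverse (Suc n)" using Y(2) by (simp add: y_def)
      have "hnorm E (y k) * hnorm E (y j) \<le> inverse (Suc n) * hnorm E (x j)"
        using yk y[OF j] by (intro mult_mono) auto
      then have *: "norm (c k) * (hnorm E (y k) * hnorm E (y j)) * norm (c j) \<le> norm (c k) * (inverse (Suc n) * hnorm E (x j)) * norm (c j)"
        by (intro mult_right_mono mult_left_mono) auto
      show "norm (?F y k j) \<le> inverse (Suc n) * (norm (c k) * hnorm E (x j) * norm (c j))"
        using F[of k j] * j by (simp add: algebra_simps)
      show "norm (?F y j k) \<le> inverse (Suc n) * (norm (c k) * hnorm E (x j) * norm (c j))"
        using F[of j k] * j by (simp add: algebra_simps)
    qed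
    have "norm D \<le> norm (?F y k k) + (\<Sum>j\<in>I. norm (?F y k j) + norm (?F y j k))"
      unfolding D_def by (intro order_trans[OF norm_triangle_ineq] add_left_mono sum_norm_le norm_triangle_ineq)
    also have "\<dots> \<le> inverse (Suc n) * (norm (c k) * hnorm E (x k) * norm (c k)) +
        (\<Sum>j\<in>I. inverse (Suc n) * (norm (c k) * hnorm E (x j) * norm (c j)) + inverse (Suc n) * (norm (c k) * hnorm E (x j) * norm (c j)))"
      by (intro add_mono sum_mono Fk) auto
    also have "\<dots> = M * inverse (Suc n)"
      by (simp add: M_def sum.distrib sum_distrib_left algebra_simps)
    finally show ?thesis using pos by blast
  qed
  then obtain D where D: "\<And>n. norm (D n) \<le> M * inverse (Suc n)" "\<And>n. cpos C (S - D n)" by metis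
  have "(\<lambda>n. M * inverse (Suc n)) \<longlonglongrightarrow> 0"
    by (rule tendsto_mult_right_zero[OF LIMSEQ_inverse_real_of_nat])
  then have "D \<longlonglongrightarrow> 0"
    by (rule Lim_null_comparison[rotated]) (use D(1) in simp)
  from tendsto_diff[OF tendsto_const this, of S] have "(\<lambda>n. S - D n) \<longlonglongrightarrow> S" by simp
  from cpos_limit[OF r(2) this D(2)] show ?case unfolding S_def .
qed

end

section \<open>Formal linear combinations of symbols\<close>

lemma sum_keys_superset:
  assumes "finite S" "Poly_Mapping.keys u \<subseteq> S" "\<And>k. F k 0 = (0 :: 'z::comm_monoid_add)"
  shows "(\<Sum>k\<in>Poly_Mapping.keys u. F k (Poly_Mapping.lookup u k)) = (\<Sum>k\<in>S. F k (Poly_Mapping.lookup u k))"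
  using assms by (intro sum.mono_neutral_left) (auto simp: in_keys_iff)

text \<open>Scaling by 0 deletes all keys, so the sum is extended to the keys of \<open>u\<close>,
  where the additional terms vanish.\<close>

lemma sum_keys_formal_scale:
  assumes "\<And>k. F k 0 = (0 :: 'z::comm_monoid_add)"
  shows "(\<Sum>k\<in>Poly_Mapping.keys (formal_scale a u). F k (Poly_Mapping.lookup (formal_scale a u) k)) =
    (\<Sum>k\<in>Poly_Mapping.keys u. F k (a * Poly_Mapping.lookup u k))"
  by (subst sum_keys_superset[where S = "Poly_Mapping.keys u"])
    (auto simp: in_keys_iff lookup_formal_scale assms)

lemma formal_inner_eq:
  "formal_inner E \<rho> u v = (\<Sum>p\<in>Poly_Mapping.keys u. \<Sum>q\<in>Poly_Mapping.keys v.
     (cnj (Poly_Mapping.lookup u p) * Poly_Mapping.lookup v q) *\<^sub>C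
     (star (snd p) * \<rho> (hinner E (fst p) (fst q)) (snd q)))"
  by (simp add: formal_inner_def case_prod_unfold)

lemma formal_inner_add_right: "formal_inner E \<rho> u (v + w) = formal_inner E \<rho> u v + formal_inner E \<rho> u w"
  unfolding formal_inner_eq sum.distrib[symmetric]
  by (intro sum.cong refl setsum_keys_plus_distrib) (simp_all add: distrib_left scaleC_add_left)

lemma formal_inner_add_left: "formal_inner E \<rho> (u + v) w = formal_inner E \<rho> u w + formal_inner E \<rho> v w"
  unfolding formal_inner_eq
  by (intro setsum_keys_plus_distrib) (simp_all add: distrib_right scaleC_add_left sum.distrib)

lemma formal_inner_scale_right: "formal_inner E \<rho> u (formal_scale k v) = k *\<^sub>C formal_inner E \<rho> u v"
  unfolding formal_inner_eq complex_vector.scale_sum_right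
  by (intro trans[OF sum_keys_formal_scale] sum.cong refl) (simp_all add: scaleC_scaleC mult_ac)

lemma formal_inner_scale_left: "formal_inner E \<rho> (formal_scale k u) v = cnj k *\<^sub>C formal_inner E \<rho> u v"
  unfolding formal_inner_eq complex_vector.scale_sum_right
  by (intro trans[OF sum_keys_formal_scale] sum.cong refl) (simp_all add: scaleC_scaleC mult_ac)

lemma formal_inner_zero_right [simp]: "formal_inner E \<rho> u 0 = 0"
  and formal_inner_zero_left [simp]: "formal_inner E \<rho> 0 u = 0"
  by (simp_all add: formal_inner_eq)

lemma formal_inner_diff_right: "formal_inner E \<rho> u (v - w) = formal_inner E \<rho> u v - formal_inner E \<rho> u w"
  using formal_inner_add_right[of E \<rho> u "v - w" w] by (simp add: algebra_simps)

lemma formal_inner_symb: "formal_inner E \<rho> (symb x c) (symb y d) = star c * \<rho> (hinner E x y) d"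
  by (simp add: formal_inner_eq)

lemma formal_act_eq: "formal_act u d =
    (\<Sum>p\<in>Poly_Mapping.keys u. Poly_Mapping.single (fst p, snd p * d) (Poly_Mapping.lookup u p))"
  by (simp add: formal_act_def case_prod_unfold)

lemma formal_act_add: "formal_act (u + v) d = formal_act u d + formal_act v d"
  unfolding formal_act_eq by (intro setsum_keys_plus_distrib) (simp_all add: single_add)

lemma formal_scale_single: "formal_scale k (Poly_Mapping.single x a) = Poly_Mapping.single x (k * a)"
  by (rule poly_mapping_eqI) (simp add: lookup_formal_scale lookup_single when_def)

lemma formal_act_scale: "formal_act (formal_scale k u) d = formal_scale k (formal_act u d)"
  unfolding formal_act_eq formal_vector.scale_sum_right
  by (intro trans[OF sum_keys_formal_scale] sum.cong refl) (simp_all add: formal_scale_single)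

lemma formal_act_zero [simp]: "formal_act 0 d = 0"
  by (simp add: formal_act_eq)

lemma formal_act_diff: "formal_act (u - v) d = formal_act u d - formal_act v d"
  using formal_act_add[of "u - v" v d] by (simp add: algebra_simps)

lemma formal_act_symb: "formal_act (symb x c) d = symb x (c * d)"
  by (simp add: formal_act_eq)

lemma keys_formal_scale: "Poly_Mapping.keys (formal_scale k u) \<subseteq> Poly_Mapping.keys u"
  by (auto simp: in_keys_iff lookup_formal_scale)

lemma subspace_formal_sums: "formal_vector.subspace (formal_sums E C)"
  unfolding formal_vector.subspace_def formal_sums_def
  by (auto dest: subsetD[OF keys_add] subsetD[OF keys_formal_scale])

lemma symb_formal_sums: "x \<in> carrier E \<Longrightarrow> c \<in> C \<Longrightarrow> symb x c \<in> formal_sums E C"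
  by (simp add: formal_sums_def)

lemma formal_eq_sum: "u = (\<Sum>p\<in>Poly_Mapping.keys u. formal_scale (Poly_Mapping.lookup u p) (symb (fst p) (snd p)))"
  by (rule poly_mapping_eqI)
    (simp add: lookup_sum lookup_formal_scale lookup_single when_def in_keys_iff if_distrib cong: if_cong)

text \<open>Formal sums are spanned by symbols, so a linear statement need only be checked on
  these.\<close>

lemma formal_sums_induct [consumes 1, case_names zero symb add scale]:
  assumes "u \<in> formal_sums E C" "P 0" "\<And>x c. x \<in> carrier E \<Longrightarrow> c \<in> C \<Longrightarrow> P (symb x c)"
    "\<And>u v. u \<in> formal_sums E C \<Longrightarrow> v \<in> formal_sums E C \<Longrightarrow> P u \<Longrightarrow> P v \<Longrightarrow> P (u + v)"
    "\<And>k u. u \<in> formal_sums E C \<Longrightarrow> P u \<Longrightarrow> P (formal_scale k u)"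
  shows "P u"
proof -
  have "u \<in> formal_vector.span {symb x c |x c. x \<in> carrier E \<and> c \<in> C}"
    by (subst formal_eq_sum, intro formal_vector.span_sum formal_vector.span_scale formal_vector.span_base)
      (use assms(1) in \<open>force simp: formal_sums_def\<close>)
  moreover have "formal_vector.subspace {u \<in> formal_sums E C. P u}"
    using subspace_formal_sums[of E C] assms(2,4,5) unfolding formal_vector.subspace_def by blast
  ultimately have "u \<in> {u \<in> formal_sums E C. P u}"
    by (rule formal_vector.span_subspace_induct) (auto intro: symb_formal_sums assms(3))
  then show ?thesis by simp
qed

section \<open>Relations, inner product and module structure of the algebraic tensor product\<close>

context tensor
begin

abbreviation "FS \<equiv> formal_sums E C"
abbreviation "N \<equiv> tensor_null E \<rho> C"
abbreviation "T \<equiv> algebraic_tensor E \<rho> C"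
abbreviation "tc \<equiv> tensor_class E \<rho> C"
abbreviation "fi \<equiv> formal_inner E \<rho>"

lemmas FS_closed = formal_vector.subspace_0[OF subspace_formal_sums[of E C]]
  formal_vector.subspace_add[OF subspace_formal_sums[of E C]]
  formal_vector.subspace_diff[OF subspace_formal_sums[of E C]]
  formal_vector.subspace_scale[OF subspace_formal_sums[of E C]]
  symb_formal_sums[of _ E _ C]

lemma rho_closed: "b \<in> base E \<Longrightarrow> c \<in> C \<Longrightarrow> \<rho> b c \<in> C"
  by (simp add: rho r clC)

lemma tensor_null_induct [consumes 1, case_names zero add_left add_right scale_left scale_right act add scale]:
  assumes "n \<in> N" and "P 0"
    and "\<And>x y c. x \<in> carrier E \<Longrightarrow> y \<in> carrier E \<Longrightarrow> c \<in> C \<Longrightarrow> P (symb (x \<oplus> y) c - symb x c - symb y c)"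
    and "\<And>x c d. x \<in> carrier E \<Longrightarrow> c \<in> C \<Longrightarrow> d \<in> C \<Longrightarrow> P (symb x (c + d) - symb x c - symb x d)"
    and "\<And>k x c. x \<in> carrier E \<Longrightarrow> c \<in> C \<Longrightarrow> P (symb (hscale E k x) c - formal_scale k (symb x c))"
    and "\<And>k x c. x \<in> carrier E \<Longrightarrow> c \<in> C \<Longrightarrow> P (symb x (k *\<^sub>C c) - formal_scale k (symb x c))"
    and "\<And>x b c. x \<in> carrier E \<Longrightarrow> b \<in> base E \<Longrightarrow> c \<in> C \<Longrightarrow> P (symb (hact E x b) c - symb x (\<rho> b c))"
    and "\<And>u v. P u \<Longrightarrow> P v \<Longrightarrow> P (u + v)" and "\<And>k u. P u \<Longrightarrow> P (formal_scale k u)"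
  shows "P n"
proof -
  have "formal_vector.subspace {u. P u}" unfolding formal_vector.subspace_def using assms(2,8,9) by blast
  with assms(1)[unfolded tensor_null_def] have "n \<in> {u. P u}"
    by (rule formal_vector.span_subspace_induct) (auto intro: assms(3-7))
  then show ?thesis by simp
qed

lemma tensor_null_gens:
  "x \<in> carrier E \<Longrightarrow> y \<in> carrier E \<Longrightarrow> c \<in> C \<Longrightarrow> symb (x \<oplus> y) c - symb x c - symb y c \<in> N"
  "x \<in> carrier E \<Longrightarrow> c \<in> C \<Longrightarrow> d \<in> C \<Longrightarrow> symb x (c + d) - symb x c - symb x d \<in> N"
  "x \<in> carrier E \<Longrightarrow> c \<in> C \<Longrightarrow> symb (hscale E k x) c - formal_scale k (symb x c) \<in> N"
  "x \<in> carrier E \<Longrightarrow> c \<in> C \<Longrightarrow> symb x (k *\<^sub>C c) - formal_scale k (symb x c) \<in> N"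
  "x \<in> carrier E \<Longrightarrow> b \<in> base E \<Longrightarrow> c \<in> C \<Longrightarrow> symb (hact E x b) c - symb x (\<rho> b c) \<in> N"
  unfolding tensor_null_def by (rule formal_vector.span_base, blast)+

lemma subspace_N: "formal_vector.subspace N"
  unfolding tensor_null_def by (rule formal_vector.subspace_span)

lemmas N_closed = formal_vector.subspace_0[OF subspace_N] formal_vector.subspace_add[OF subspace_N]
  formal_vector.subspace_diff[OF subspace_N] formal_vector.subspace_scale[OF subspace_N]
  formal_vector.subspace_neg[OF subspace_N]

lemma N_subset: "n \<in> N \<Longrightarrow> n \<in> FS"
  by (induction rule: tensor_null_induct) (auto intro!: FS_closed rho_closed clC)

lemma FS_keys: "u \<in> FS \<Longrightarrow> p \<in> Poly_Mapping.keys u \<Longrightarrow> fst p \<in> carrier E"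
  "u \<in> FS \<Longrightarrow> p \<in> Poly_Mapping.keys u \<Longrightarrow> snd p \<in> C"
  by (auto simp: formal_sums_def)

lemma fi_closed: "u \<in> FS \<Longrightarrow> v \<in> FS \<Longrightarrow> fi u v \<in> C"
  unfolding formal_inner_eq
  by (intro cstar_alg_sum r clC rho_closed) (auto simp: FS_keys)

lemma star_fi:
  assumes "u \<in> FS" "v \<in> FS"
  shows "star (fi u v) = fi v u"
proof -
  have "star (star (snd p) * \<rho> (hinner E (fst p) (fst q)) (snd q)) = star (snd q) * \<rho> (hinner E (fst q) (fst p)) (snd p)"
    if "p \<in> carrier E \<times> C" "q \<in> carrier E \<times> C" for p q
    using that by (auto simp: rho star_mult star_star mult.assoc star_hinner simp flip: r(6))
  then show ?thesis
    unfolding formal_inner_eq star_sum star_scaleC using assms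
    by (subst sum.swap, intro sum.cong refl) (auto simp: formal_sums_def mult.commute subset_iff)
qed

text \<open>This lets the inner product descend to the quotient. Each generating relation is tested
  against symbols, and conjugate-linearity in the first argument gives the general case.\<close>

lemma fi_null_right: "n \<in> N \<Longrightarrow> u \<in> FS \<Longrightarrow> fi u n = 0"
proof (induction arbitrary: u rule: tensor_null_induct)
  case (add_left x y c)
  from add_left(4) show ?case
    by (induction rule: formal_sums_induct)
      (use add_left(1-3) in \<open>auto simp: formal_inner_add_left formal_inner_scale_left formal_inner_diff_right formal_inner_symb
        formal_inner_add_right rho r clB clC hinner_simps algebra_simps\<close>)
next
  case (add_right x c d)
  from add_right(4) show ?case
    by (induction rule: formal_sums_induct)
      (use add_right(1-3) in \<open>auto simp: formal_inner_add_left formal_inner_scale_left formal_inner_diff_right formal_inner_symb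
        formal_inner_add_right rho r clB clC hinner_simps algebra_simps\<close>)
next
  case (scale_left k x c)
  from scale_left(3) show ?case
    by (induction rule: formal_sums_induct)
      (use scale_left(1,2) in \<open>auto simp: formal_inner_add_left formal_inner_scale_left formal_inner_diff_right formal_inner_symb
        formal_inner_scale_right rho r clC clB hinner_simps algebra_simps mult_scaleC_left mult_scaleC_right\<close>)
next
  case (scale_right k x c)
  from scale_right(3) show ?case
    by (induction rule: formal_sums_induct)
      (use scale_right(1,2) in \<open>auto simp: formal_inner_add_left formal_inner_scale_left formal_inner_diff_right formal_inner_symb
        formal_inner_scale_right rho r clC clB hinner_simps algebra_simps mult_scaleC_left mult_scaleC_right\<close>)
next
  case (act x b c)
  from act(4) show ?case
    by (induction rule: formal_sums_induct)
      (use act(1-3) in \<open>auto simp: formal_inner_add_left formal_inner_scale_left formal_inner_diff_right formal_inner_symb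
        rho rho_closed r clC clB hinner_simps mult.assoc\<close>)
qed (simp_all add: formal_inner_add_right formal_inner_scale_right)

lemma fi_null_left: "n \<in> N \<Longrightarrow> u \<in> FS \<Longrightarrow> fi n u = 0"
  using star_fi[of u n] fi_null_right[of n u] by (simp add: N_subset)

text \<open>Absorbing the complex coefficients into the elements of \<open>C\<close> turns the inner
  square into the expression of \<open>cpos_gram\<close>.\<close>

lemma cpos_fi: "u \<in> FS \<Longrightarrow> cpos C (fi u u)"
proof -
  assume u: "u \<in> FS"
  let ?K = "Poly_Mapping.keys u" and ?l = "Poly_Mapping.lookup u"
  have "cpos C (\<Sum>p\<in>?K. \<Sum>q\<in>?K. star (?l p *\<^sub>C snd p) * r (hinner E (fst p) (fst q)) * (?l q *\<^sub>C snd q))"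
    using u by (intro cpos_gram clC) (auto simp: FS_keys)
  also have "(\<Sum>p\<in>?K. \<Sum>q\<in>?K. star (?l p *\<^sub>C snd p) * r (hinner E (fst p) (fst q)) * (?l q *\<^sub>C snd q)) = fi u u"
    unfolding formal_inner_eq using u
    by (intro sum.cong refl) (simp add: FS_keys rho star_scaleC mult_scaleC_left mult_scaleC_right scaleC_scaleC
      mult.assoc mult.commute[of "cnj _"])
  finally show ?thesis .
qed

lemma act_closed: "u \<in> FS \<Longrightarrow> d \<in> C \<Longrightarrow> formal_act u d \<in> FS"
  by (induction rule: formal_sums_induct)
    (auto simp: formal_act_symb formal_act_add formal_act_scale intro!: FS_closed clC)

text \<open>Multiplying a generating relation on the right gives another relation of the same kind,
  so the action descends to the quotient.\<close>

lemma act_null: "n \<in> N \<Longrightarrow> d \<in> C \<Longrightarrow> formal_act n d \<in> N"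
proof (induction rule: tensor_null_induct)
  case (act x b c)
  then show ?case
    using tensor_null_gens(5)[of x b "c * d"] by (simp add: formal_act_diff formal_act_symb clC rho mult.assoc)
next
  case (add_right x c d')
  then show ?case
    using tensor_null_gens(2)[of x "c * d" "d' * d"] by (simp add: formal_act_diff formal_act_symb clC distrib_right)
qed (auto simp: formal_act_diff formal_act_symb formal_act_add formal_act_scale clC mult_scaleC_left
    intro!: N_closed(1,2,4) tensor_null_gens)

lemma tc_eq_iff: "tc u = tc v \<longleftrightarrow> u - v \<in> N"
proof
  assume "tc u = tc v"
  moreover have "u \<in> tc u" using N_closed(1) by (force simp: tensor_class_def)
  ultimately obtain n where "u = v + n" "n \<in> N" by (auto simp: tensor_class_def)
  then show "u - v \<in> N" by simp
next
  assume uv: "u - v \<in> N"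
  have "(+) u ` N \<subseteq> (+) v ` N" if "u - v \<in> N" for u v :: "('e, 'c) formal"
  proof
    fix w assume "w \<in> (+) u ` N"
    then obtain n where "w = u + n" "n \<in> N" by auto
    then have "w = v + ((u - v) + n)" "(u - v) + n \<in> N" using that by (auto intro: N_closed)
    then show "w \<in> (+) v ` N" by blast
  qed
  from this[OF uv] this[of v u] N_closed(5)[OF uv] show "tc u = tc v"
    by (auto simp: tensor_class_def)
qed

lemma rep_tc: "rep (tc u) - u \<in> N"
proof -
  have "u \<in> tc u" using N_closed(1) by (force simp: tensor_class_def)
  then have "rep (tc u) \<in> tc u" unfolding rep_def by (rule someI[of "\<lambda>v. v \<in> tc u"])
  then show ?thesis by (auto simp: tensor_class_def)
qed

lemma carrier_T: "carrier T = {tc u |u. u \<in> FS}"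
  by (auto simp: algebraic_tensor_def)

lemma base_T [simp]: "base T = C"
  by (simp add: algebraic_tensor_def)

lemma T_zero: "\<zero>\<^bsub>T\<^esub> = tc 0"
  by (simp add: algebraic_tensor_def)

lemma T_add: "tc u \<oplus>\<^bsub>T\<^esub> tc v = tc (u + v)"
  using N_closed(2)[OF rep_tc[of u] rep_tc[of v]]
  by (simp add: algebraic_tensor_def tc_eq_iff algebra_simps)

lemma T_scale: "hscale T k (tc u) = tc (formal_scale k u)"
  using N_closed(4)[OF rep_tc[of u], of k]
  by (simp add: algebraic_tensor_def tc_eq_iff formal_vector.scale_right_diff_distrib)

lemma T_act: "d \<in> C \<Longrightarrow> hact T (tc u) d = tc (formal_act u d)"
  using act_null[OF rep_tc[of u], of d]
  by (simp add: algebraic_tensor_def tc_eq_iff formal_act_diff)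

lemma T_inner:
  assumes "u \<in> FS" "v \<in> FS"
  shows "hinner T (tc u) (tc v) = fi u v"
proof -
  let ?u = "rep (tc u)" and ?v = "rep (tc v)"
  have "fi ?u ?v = fi (u + (?u - u)) (v + (?v - v))" by simp
  also have "\<dots> = fi u v"
    unfolding formal_inner_add_left formal_inner_add_right
    using assms by (simp add: fi_null_left fi_null_right rep_tc N_subset)
  finally show ?thesis by (simp add: algebraic_tensor_def)
qed

lemma tc_closed: "u \<in> FS \<Longrightarrow> tc u \<in> carrier T"
  by (auto simp: carrier_T)

text \<open>Additivity in the algebra element holds only modulo the relations: acting on
  \<open>symb x d\<close> produces the single symbol \<open>symb x (d * (b + c))\<close>, not a sum
  of two.\<close>

lemma act_add_right: "u \<in> FS \<Longrightarrow> b \<in> C \<Longrightarrow> c \<in> C \<Longrightarrow> tc (formal_act u (b + c)) = tc (formal_act u b + formal_act u c)"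
proof (induction rule: formal_sums_induct)
  case (symb x d)
  then show ?case
    using tensor_null_gens(2)[of x "d * b" "d * c"] by (simp add: tc_eq_iff formal_act_symb distrib_left clC diff_diff_eq)
next
  case (add u v)
  have "formal_act (u + v) (b + c) - (formal_act (u + v) b + formal_act (u + v) c) =
      (formal_act u (b + c) - (formal_act u b + formal_act u c)) + (formal_act v (b + c) - (formal_act v b + formal_act v c))"
    by (simp add: formal_act_add)
  with add show ?case unfolding tc_eq_iff by (metis N_closed(2))
next
  case (scale k u)
  have "formal_act (formal_scale k u) (b + c) - (formal_act (formal_scale k u) b + formal_act (formal_scale k u) c) =
      formal_scale k (formal_act u (b + c) - (formal_act u b + formal_act u c))"
    by (simp add: formal_act_scale formal_vector.scale_right_diff_distrib formal_vector.scale_right_distrib)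
  with scale show ?case unfolding tc_eq_iff by (metis N_closed(4))
qed simp

lemma act_scaleC: "u \<in> FS \<Longrightarrow> b \<in> C \<Longrightarrow> tc (formal_act u (k *\<^sub>C b)) = tc (formal_scale k (formal_act u b))"
proof (induction rule: formal_sums_induct)
  case (symb x d)
  then show ?case
    using tensor_null_gens(4)[of x "d * b" k] by (simp add: tc_eq_iff formal_act_symb mult_scaleC_right clC)
next
  case (add u v)
  have "formal_act (u + v) (k *\<^sub>C b) - formal_scale k (formal_act (u + v) b) =
      (formal_act u (k *\<^sub>C b) - formal_scale k (formal_act u b)) + (formal_act v (k *\<^sub>C b) - formal_scale k (formal_act v b))"
    by (simp add: formal_act_add formal_vector.scale_right_distrib)
  with add show ?case unfolding tc_eq_iff by (metis N_closed(2))
next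
  case (scale l u)
  have "formal_act (formal_scale l u) (k *\<^sub>C b) - formal_scale k (formal_act (formal_scale l u) b) =
      formal_scale l (formal_act u (k *\<^sub>C b) - formal_scale k (formal_act u b))"
    by (simp add: formal_act_scale formal_vector.scale_right_diff_distrib mult.commute)
  with scale show ?case unfolding tc_eq_iff by (metis N_closed(4))
qed simp

lemma act_mult: "u \<in> FS \<Longrightarrow> formal_act u (b * c) = formal_act (formal_act u b) c"
  by (induction rule: formal_sums_induct) (auto simp: formal_act_symb formal_act_add formal_act_scale mult.assoc)

lemma fi_act:
  assumes "u \<in> FS" "v \<in> FS" "d \<in> C"
  shows "fi u (formal_act v d) = fi u v * d"
  using assms(1)
proof (induction rule: formal_sums_induct)
  case (symb x c)
  from assms(2) show ?case
    by (induction rule: formal_sums_induct)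
      (use symb assms(3) in \<open>auto simp: formal_act_symb formal_act_add formal_act_scale formal_inner_add_right
        formal_inner_scale_right formal_inner_symb rho clC mult.assoc distrib_right mult_scaleC_left\<close>)
qed (auto simp: formal_inner_add_left formal_inner_scale_left distrib_right mult_scaleC_left)

lemma abelian_group_T: "abelian_group T"
proof (rule abelian_groupI)
  show "\<zero>\<^bsub>T\<^esub> \<in> carrier T" by (simp add: T_zero tc_closed FS_closed)
  fix p assume "p \<in> carrier T"
  then obtain u where u: "p = tc u" "u \<in> FS" by (auto simp: carrier_T)
  show "\<zero>\<^bsub>T\<^esub> \<oplus>\<^bsub>T\<^esub> p = p" by (simp add: u T_zero T_add)
  show "\<exists>q\<in>carrier T. q \<oplus>\<^bsub>T\<^esub> p = \<zero>\<^bsub>T\<^esub>"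
    by (rule bexI[of _ "tc (0 - u)"]) (simp add: u T_zero T_add, intro tc_closed FS_closed u)
  fix q assume "q \<in> carrier T"
  then obtain v where v: "q = tc v" "v \<in> FS" by (auto simp: carrier_T)
  show "p \<oplus>\<^bsub>T\<^esub> q \<in> carrier T" by (simp add: u v T_add tc_closed FS_closed)
  show "p \<oplus>\<^bsub>T\<^esub> q = q \<oplus>\<^bsub>T\<^esub> p" by (simp add: u v T_add add.commute)
  fix r assume "r \<in> carrier T"
  then obtain w where w: "r = tc w" "w \<in> FS" by (auto simp: carrier_T)
  show "p \<oplus>\<^bsub>T\<^esub> q \<oplus>\<^bsub>T\<^esub> r = p \<oplus>\<^bsub>T\<^esub> (q \<oplus>\<^bsub>T\<^esub> r)" by (simp add: u v w T_add add.assoc)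
qed

lemma pre_hilbert_T: "pre_hilbert T"
proof (intro pre_hilbert.intro abelian_group_T pre_hilbert_axioms.intro)
  show "cstar_alg (base T)" by (simp add: r)
  fix p assume "p \<in> carrier T"
  then obtain u where u: "p = tc u" "u \<in> FS" by (auto simp: carrier_T)
  show "hscale T k p \<in> carrier T" for k
    unfolding u T_scale by (intro tc_closed FS_closed u)
  show "hscale T 1 p = p" "hscale T k (hscale T l p) = hscale T (k * l) p"
      "hscale T (k + l) p = hscale T k p \<oplus>\<^bsub>T\<^esub> hscale T l p" for k l
    by (simp_all add: u T_scale T_add formal_vector.scale_left_distrib)
  show "cpos (base T) (hinner T p p)" by (simp add: u T_inner cpos_fi)
  { fix b assume b: "b \<in> base T"
    show "hact T p b \<in> carrier T" using b by (simp add: u T_act tc_closed act_closed)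
    show "hact T (hscale T k p) b = hscale T k (hact T p b)" for k
      using b by (simp add: u T_act T_scale formal_act_scale)
    show "hact T p (k *\<^sub>C b) = hscale T k (hact T p b)" for k
      using b u by (simp add: T_act T_scale act_scaleC clC)
    fix c assume c: "c \<in> base T"
    show "hact T p (b + c) = hact T p b \<oplus>\<^bsub>T\<^esub> hact T p c"
      using b c u by (simp add: T_act T_add act_add_right clC)
    show "hact T p (b * c) = hact T (hact T p b) c"
      using b c u by (simp add: T_act act_mult clC) }
  fix q assume "q \<in> carrier T"
  then obtain v where v: "q = tc v" "v \<in> FS" by (auto simp: carrier_T)
  show "hscale T k (p \<oplus>\<^bsub>T\<^esub> q) = hscale T k p \<oplus>\<^bsub>T\<^esub> hscale T k q" for k
    by (simp add: u v T_scale T_add formal_vector.scale_right_distrib)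
  show "hinner T p q \<in> base T" "star (hinner T p q) = hinner T q p"
    using u v by (simp_all add: T_inner fi_closed star_fi)
  show "hinner T p (hscale T k q) = k *\<^sub>C hinner T p q" for k
    using u v by (simp add: T_scale T_inner FS_closed formal_inner_scale_right)
  { fix b assume b: "b \<in> base T"
    show "hact T (p \<oplus>\<^bsub>T\<^esub> q) b = hact T p b \<oplus>\<^bsub>T\<^esub> hact T q b"
      using b by (simp add: u v T_act T_add formal_act_add)
    show "hinner T p (hact T q b) = hinner T p q * b"
      using b u v by (simp add: T_act T_inner act_closed fi_act) }
  fix s assume "s \<in> carrier T"
  then obtain w where w: "s = tc w" "w \<in> FS" by (auto simp: carrier_T)
  show "hinner T p (q \<oplus>\<^bsub>T\<^esub> s) = hinner T p q + hinner T p s"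
    using u v w by (simp add: T_add T_inner FS_closed formal_inner_add_right)
qed

sublocale T: pre_hilbert "algebraic_tensor E \<rho> C"
  by (rule pre_hilbert_T)

abbreviation "D \<equiv> interior_tensor E \<rho> C"
abbreviation "dt \<equiv> dot E \<rho> C"

sublocale D: hilbert "interior_tensor E \<rho> C"
  unfolding interior_tensor_def by (rule T.hilbert_completion)

lemma base_D [simp]: "base D = C"
  by (simp add: interior_tensor_def)

lemma tc_symb_closed: "x \<in> carrier E \<Longrightarrow> c \<in> C \<Longrightarrow> tc (symb x c) \<in> carrier T"
  by (intro tc_closed FS_closed)

lemma dot_closed [simp, intro]: "x \<in> carrier E \<Longrightarrow> c \<in> C \<Longrightarrow> dt x c \<in> carrier D"
  unfolding dot_def interior_tensor_def by (intro T.cls_closed T.hCauchy_const tc_symb_closed)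

lemmas const_simps = dot_def interior_tensor_def T.completion_add T.completion_scale T.completion_act
  T.hCauchy_const tc_symb_closed

lemma dot_add_right: "x \<in> carrier E \<Longrightarrow> c \<in> C \<Longrightarrow> d \<in> C \<Longrightarrow> dt x (c + d) = dt x c \<oplus>\<^bsub>D\<^esub> dt x d"
  using tensor_null_gens(2)[of x c d, unfolded diff_diff_eq, folded tc_eq_iff] by (simp add: const_simps T_add)

lemma dot_scale_right: "x \<in> carrier E \<Longrightarrow> c \<in> C \<Longrightarrow> dt x (k *\<^sub>C c) = hscale D k (dt x c)"
  using tensor_null_gens(4)[of x c k, folded tc_eq_iff] by (simp add: const_simps T_scale)

lemma act_dot: "x \<in> carrier E \<Longrightarrow> c \<in> C \<Longrightarrow> d \<in> C \<Longrightarrow> hact D (dt x c) d = dt x (c * d)"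
  by (simp add: const_simps T_act formal_act_symb)

lemma inner_dot:
  assumes "x \<in> carrier E" "c \<in> C" "y \<in> carrier E" "d \<in> C"
  shows "hinner D (dt x c) (dt y d) = star c * r (hinner E x y) * d"
proof -
  have "(\<lambda>n. hinner T (tc (symb x c)) (tc (symb y d))) \<longlonglongrightarrow> hinner D (dt x c) (dt y d)"
    unfolding dot_def interior_tensor_def
    by (intro T.completion_inner T.hCauchy_const tc_symb_closed assms)
  then show ?thesis
    using assms by (simp add: LIMSEQ_const_iff T_inner FS_closed formal_inner_symb rho mult.assoc)
qed

text \<open>Every vector is a limit of classes of formal sums, and those are linear combinations of
  elementary tensors. This is the induction principle for the tensor product.\<close>

lemma tensor_dense:
  assumes S: "S \<subseteq> carrier D" "\<And>x c. x \<in> carrier E \<Longrightarrow> c \<in> C \<Longrightarrow> dt x c \<in> S" "\<zero>\<^bsub>D\<^esub> \<in> S"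
    "\<And>p q. p \<in> S \<Longrightarrow> q \<in> S \<Longrightarrow> p \<oplus>\<^bsub>D\<^esub> q \<in> S" "\<And>k p. p \<in> S \<Longrightarrow> hscale D k p \<in> S"
    "\<And>s p. (\<And>n::nat. s n \<in> S) \<Longrightarrow> p \<in> carrier D \<Longrightarrow> (\<lambda>n. hdist D (s n) p) \<longlonglongrightarrow> 0 \<Longrightarrow> p \<in> S"
  shows "carrier D \<subseteq> S"
proof
  fix p assume p: "p \<in> carrier D"
  then obtain s where s: "p = T.cls s" "hCauchy T s"
    by (auto simp: interior_tensor_def T.carrier_completion)
  have alg: "T.cls (\<lambda>_. tc u) \<in> S" if "u \<in> FS" for u
    using that
  proof (induction rule: formal_sums_induct)
    case zero
    then show ?case using S(3) by (simp add: interior_tensor_def T.completion_zero T_zero)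
  next
    case (symb x c)
    then show ?case using S(2)[of x c] by (simp add: dot_def)
  next
    case (add u v)
    then have "T.cls (\<lambda>_. tc u) \<oplus>\<^bsub>D\<^esub> T.cls (\<lambda>_. tc v) \<in> S" by (intro S(4))
    then show ?case using add by (simp add: interior_tensor_def T.completion_add T.hCauchy_const tc_closed T_add)
  next
    case (scale k u)
    then have "hscale D k (T.cls (\<lambda>_. tc u)) \<in> S" by (intro S(5))
    then show ?case using scale by (simp add: interior_tensor_def T.completion_scale T.hCauchy_const tc_closed T_scale)
  qed
  have 1: "T.cls (\<lambda>_. s n) \<in> S" for n
    using T.hCauchy_mem[OF s(2), of n] alg by (auto simp: carrier_T)
  have 2: "(\<lambda>n. hdist D (T.cls (\<lambda>_. s n)) p) \<longlonglongrightarrow> 0"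
    unfolding s(1) interior_tensor_def by (rule T.completion_const_dense[OF s(2)])
  show "p \<in> S" by (rule S(6)[OF 1 p 2])
qed

end

section \<open>Adjointable operators\<close>

context hilbert
begin

text \<open>The hypothesis is the expanded form of
  \<open>hinner E (x \<ominus> y) (x \<ominus> y) = 0\<close>. Two vectors can thus be identified
  from their mutual inner products alone, which suits values of \<open>V\<close>, known only as
  limits.\<close>

lemma inner_eqI:
  assumes "x \<in> carrier E" "y \<in> carrier E"
    "hinner E x x - hinner E x y - hinner E y x + hinner E y y = 0"
  shows "x = y"
proof (rule diff_eq_zeroD[OF assms(1,2)])
  show "x \<ominus> y = \<zero>"
    using assms by (intro hinner_eq_0D) (simp_all add: hinner_simps algebra_simps)
qed

lemma hinner_eqI_left:
  assumes "x \<in> carrier E" "y \<in> carrier E" "\<And>z. z \<in> carrier E \<Longrightarrow> hinner E x z = hinner E y z"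
  shows "x = y"
  by (rule inner_eqI[OF assms(1,2)]) (simp add: assms)

lemma tendsto_hinner_right:
  assumes "((\<lambda>i. hdist E (s i) y) \<longlongrightarrow> 0) F" "\<forall>\<^sub>F i in F. s i \<in> carrier E" "x \<in> carrier E" "y \<in> carrier E"
  shows "((\<lambda>i. hinner E x (s i)) \<longlongrightarrow> hinner E x y) F"
proof (rule LIM_zero_cancel, rule Lim_null_comparison)
  show "((\<lambda>i. hnorm E x * hdist E (s i) y) \<longlongrightarrow> 0) F"
    by (rule tendsto_mult_right_zero[OF assms(1)])
  show "\<forall>\<^sub>F i in F. norm (hinner E x (s i) - hinner E x y) \<le> hnorm E x * hdist E (s i) y"
    using assms(2)
  proof eventually_elim
    case (elim i)
    then show ?case using norm_hinner_diff_le[of x "s i" x y] assms(3,4) by simp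
  qed
qed

text \<open>Definiteness determines the values of an adjoint, and extensionality then determines the
  function, so the definite description can be evaluated.\<close>

lemma adjoint_of_eq:
  assumes "is_adjoint E F T S"
  shows "adjoint_of E F T = S"
  unfolding adjoint_of_def
proof (rule the_equality)
  show "is_adjoint E F T S" by (rule assms)
  fix S' assume S': "is_adjoint E F T S'"
  show "S' = S"
  proof (rule extensionalityI[of _ "carrier F"])
    show "S' \<in> extensional (carrier F)" "S \<in> extensional (carrier F)"
      using S' assms by (auto simp: is_adjoint_def PiE_def)
    fix y assume y: "y \<in> carrier F"
    then have "S' y \<in> carrier E" "S y \<in> carrier E" using S' assms by (auto simp: is_adjoint_def)
    then show "S' y = S y"
      by (rule hinner_eqI) (use y S' assms in \<open>simp add: is_adjoint_def\<close>)
  qed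
qed

end

lemma adjointableD:
  assumes "hilbert E" "T \<in> adjointable E F"
  shows "T \<in> carrier E \<rightarrow>\<^sub>E carrier F" "x \<in> carrier E \<Longrightarrow> T x \<in> carrier F"
    "adjoint_of E F T \<in> carrier F \<rightarrow>\<^sub>E carrier E" "y \<in> carrier F \<Longrightarrow> adjoint_of E F T y \<in> carrier E"
    "x \<in> carrier E \<Longrightarrow> y \<in> carrier F \<Longrightarrow> hinner F (T x) y = hinner E x (adjoint_of E F T y)"
proof -
  interpret hilbert E by (rule assms)
  show 1: "T \<in> carrier E \<rightarrow>\<^sub>E carrier F" using assms(2) by (simp add: adjointable_def)
  obtain S where S: "is_adjoint E F T S" using assms(2) by (auto simp: adjointable_def)
  have [simp]: "adjoint_of E F T = S" by (rule adjoint_of_eq[OF S])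
  show "x \<in> carrier E \<Longrightarrow> T x \<in> carrier F" using 1 by auto
  show "adjoint_of E F T \<in> carrier F \<rightarrow>\<^sub>E carrier E" "y \<in> carrier F \<Longrightarrow> adjoint_of E F T y \<in> carrier E"
    "x \<in> carrier E \<Longrightarrow> y \<in> carrier F \<Longrightarrow> hinner F (T x) y = hinner E x (adjoint_of E F T y)"
    using S by (auto simp: is_adjoint_def)
qed

lemma is_adjointI:
  assumes "S \<in> carrier F \<rightarrow>\<^sub>E carrier E"
    "\<And>x y. x \<in> carrier E \<Longrightarrow> y \<in> carrier F \<Longrightarrow> hinner F (T x) y = hinner E x (S y)"
  shows "is_adjoint E F T S"
  using assms by (simp add: is_adjoint_def)

lemma adjointableI:
  assumes "T \<in> carrier E \<rightarrow>\<^sub>E carrier F" "is_adjoint E F T S"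
  shows "T \<in> adjointable E F"
  using assms by (auto simp: adjointable_def)

lemma hinner_adjoint:
  assumes "hilbert E" "hilbert F" "T \<in> adjointable E F" "x \<in> carrier E" "y \<in> carrier F"
  shows "hinner F y (T x) = hinner E (adjoint_of E F T y) x"
proof -
  interpret E: hilbert E by (rule assms)
  interpret F: hilbert F by (rule assms)
  note T = adjointableD[OF assms(1,3)]
  have "hinner F y (T x) = star (hinner F (T x) y)"
    by (rule F.star_hinner[symmetric]) (use assms T(2) in auto)
  also have "\<dots> = star (hinner E x (adjoint_of E F T y))" using assms(4,5) by (simp add: T(5))
  also have "\<dots> = hinner E (adjoint_of E F T y) x"
    by (rule E.star_hinner) (use assms T(4) in auto)
  finally show ?thesis .
qed

text \<open>Linearity is a consequence of having an adjoint: moved to the other side of the inner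
  product, both expressions agree against every vector.\<close>

lemma adjointable_linear:
  assumes E: "hilbert E" and F: "hilbert F" and T: "T \<in> adjointable E F" and base: "base F = base E"
    and x: "x \<in> carrier E"
  shows "y \<in> carrier E \<Longrightarrow> T (x \<oplus>\<^bsub>E\<^esub> y) = T x \<oplus>\<^bsub>F\<^esub> T y"
    "T (hscale E k x) = hscale F k (T x)" "b \<in> base E \<Longrightarrow> T (hact E x b) = hact F (T x) b"
proof -
  interpret E: hilbert E by (rule E)
  interpret F: hilbert F by (rule F)
  note Td = adjointableD[OF E T]
  show "T (x \<oplus>\<^bsub>E\<^esub> y) = T x \<oplus>\<^bsub>F\<^esub> T y" if y: "y \<in> carrier E"
    by (rule F.hinner_eqI_left) (simp_all add: Td x y F.hinner_simps E.hinner_simps)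
  show "T (hscale E k x) = hscale F k (T x)"
    by (rule F.hinner_eqI_left) (simp_all add: Td x F.hinner_simps E.hinner_simps)
  show "T (hact E x b) = hact F (T x) b" if b: "b \<in> base E"
    by (rule F.hinner_eqI_left) (simp_all add: Td x b base F.hinner_simps E.hinner_simps)
qed

text \<open>Agreement on \<open>Z\<close> makes the difference of the two adjoints orthogonal to
  \<open>Z\<close>, so the adjoints coincide, and with them the operators. The descriptions of
  \<open>amplify\<close>, \<open>tensor_unit\<close> and \<open>tensor_assoc\<close> are evaluated
  in this way.\<close>

lemma adjointable_eqI:
  assumes E: "hilbert E" and F: "hilbert F" and T: "T \<in> adjointable E F" and T': "T' \<in> adjointable E F"
    and Z: "Z \<subseteq> carrier E" "\<And>x. x \<in> carrier E \<Longrightarrow> (\<And>z. z \<in> Z \<Longrightarrow> hinner E z x = 0) \<Longrightarrow> x = \<zero>\<^bsub>E\<^esub>"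
    and eq: "\<And>z. z \<in> Z \<Longrightarrow> T z = T' z"
  shows "T = T'"
proof (rule extensionalityI[of _ "carrier E"])
  interpret E: hilbert E by (rule E)
  interpret F: hilbert F by (rule F)
  note Td = adjointableD[OF E T] and Td' = adjointableD[OF E T']
  show "T \<in> extensional (carrier E)" "T' \<in> extensional (carrier E)"
    using Td(1) Td'(1) by (auto simp: PiE_def)
  have adj: "adjoint_of E F T y = adjoint_of E F T' y" if y: "y \<in> carrier F" for y
  proof (rule E.diff_eq_zeroD[OF Td(4)[OF y] Td'(4)[OF y]], rule Z(2))
    show "adjoint_of E F T y \<ominus>\<^bsub>E\<^esub> adjoint_of E F T' y \<in> carrier E" using y Td Td' by simp
    fix z assume z: "z \<in> Z"
    then have zE: "z \<in> carrier E" using Z(1) by blast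
    show "hinner E z (adjoint_of E F T y \<ominus>\<^bsub>E\<^esub> adjoint_of E F T' y) = 0"
      using zE y Td(4) Td'(4) eq[OF z] by (simp add: E.hinner_diff_right flip: Td(5) Td'(5))
  qed
  show "T x = T' x" if x: "x \<in> carrier E" for x
    by (rule F.hinner_eqI_left) (simp_all add: Td Td' x adj)
qed

lemma adjoint_of_adjointable:
  assumes "hilbert E" "hilbert F" "T \<in> adjointable E F"
  shows "adjoint_of E F T \<in> adjointable F E" "adjoint_of F E (adjoint_of E F T) = T"
proof -
  note Td = adjointableD[OF assms(1,3)]
  have *: "is_adjoint F E (adjoint_of E F T) T"
    by (rule is_adjointI[OF Td(1)]) (simp add: hinner_adjoint[OF assms])
  show "adjoint_of E F T \<in> adjointable F E" by (rule adjointableI[OF Td(3) *])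
  show "adjoint_of F E (adjoint_of E F T) = T" by (rule hilbert.adjoint_of_eq[OF assms(2) *])
qed

lemma unitary_op_isometric:
  assumes "hilbert E" "hilbert F" "unitary_op E F T" "x \<in> carrier E" "y \<in> carrier E"
  shows "hinner F (T x) (T y) = hinner E x y"
  using assms adjointableD[OF assms(1), of T F] by (simp add: unitary_op_def)

section \<open>The canonical map into the interior tensor product\<close>

context tensor
begin

lemma dot_minus: "x \<in> carrier E \<Longrightarrow> c \<in> C \<Longrightarrow> dt x (- c) = \<ominus>\<^bsub>D\<^esub> dt x c"
  using dot_scale_right[of x c "-1"] by (simp add: scaleC_minus1 D.hscale_minus1)

lemma dot_diff: "x \<in> carrier E \<Longrightarrow> c \<in> C \<Longrightarrow> d \<in> C \<Longrightarrow> dt x c \<ominus>\<^bsub>D\<^esub> dt x d = dt x (c - d)"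
  using dot_add_right[of x c "- d"] by (simp add: a_minus_def dot_minus clC)

text \<open>The inner square of \<open>dt x (c - d)\<close> is
  \<open>star (c - d) * a * (c - d)\<close>; the factor 2 bounds \<open>norm (c - d)\<close>. Hence
  the tensors \<open>dt x c\<close> are Cauchy along any contractions \<open>c\<close> for which
  \<open>a * c\<close> tends to \<open>a\<close>.\<close>

lemma hdist_dot_square_le:
  assumes x: "x \<in> carrier E" and cd: "c \<in> C" "norm c \<le> 1" "d \<in> C" "norm d \<le> 1"
  defines "a \<equiv> r (hinner E x x)"
  shows "(hdist D (dt x c) (dt x d))\<^sup>2 \<le> 2 * norm (a * c - a) + 2 * norm (a * d - a)"
proof -
  have "(hdist D (dt x c) (dt x d))\<^sup>2 = norm (star (c - d) * (a * (c - d)))"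
    using x cd by (simp add: hdist_def dot_diff D.hnorm_square inner_dot clC a_def mult.assoc)
  also have "\<dots> \<le> norm (c - d) * norm (a * (c - d))"
    using norm_mult_ineq[of "star (c - d)" "a * (c - d)"] by simp
  also have "\<dots> \<le> 2 * norm (a * (c - d))"
    using norm_triangle_ineq4[of c d] cd by (intro mult_right_mono) auto
  also have "a * (c - d) = (a * c - a) - (a * d - a)" by (simp add: algebra_simps)
  finally show ?thesis using norm_triangle_ineq4[of "a * c - a" "a * d - a"] by simp
qed

text \<open>One vector \<open>z\<close> must serve for all approximate units. It is obtained from a
  sequence of contractions \<open>u n\<close> with \<open>a * u n\<close> tending to
  \<open>a\<close>, and the resulting bound \<open>sqrt (2 * norm (a * c - a))\<close> for its
  distance to \<open>dt x c\<close> holds for every contraction \<open>c\<close> in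
  \<open>C\<close>.\<close>

lemma ex_tensor_V:
  assumes x: "x \<in> carrier E"
  shows "\<exists>z\<in>carrier D. \<forall>F. approx_unit C F \<longrightarrow> ((\<lambda>c. hdist D (dt x c) z) \<longlongrightarrow> 0) F"
proof -
  define a where "a = r (hinner E x x)"
  have aC: "a \<in> C" using x by (simp add: a_def r)
  have "\<exists>u. u \<in> C \<and> norm u \<le> 1 \<and> norm (a * u - a) < inverse (real (Suc n))" for n
    using finite_approx_unit[OF r(2), of "{a}" "inverse (real (Suc n))"] aC cpos_mem[OF r(2)] by auto
  then obtain u where u: "\<And>n. u n \<in> C" "\<And>n. norm (u n) \<le> 1"
      "\<And>n. norm (a * u n - a) < inverse (real (Suc n))" by metis
  note est = hdist_dot_square_le[OF x, folded a_def]
  have "hCauchy D (\<lambda>n. dt x (u n))"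
  proof (rule D.hCauchyI)
    show "dt x (u n) \<in> carrier D" for n by (intro dot_closed x u)
    fix e :: real assume e: "0 < e"
    then have "0 < e\<^sup>2 / 4" by simp
    then obtain N where N: "inverse (real (Suc N)) < e\<^sup>2 / 4" using reals_Archimedean by blast
    have small: "norm (a * u n - a) < e\<^sup>2 / 4" if "n \<ge> N" for n
    proof -
      have "inverse (real (Suc n)) \<le> inverse (real (Suc N))"
        by (rule le_imp_inverse_le) (use that in auto)
      then show ?thesis using u(3)[of n] N by linarith
    qed
    have "hdist D (dt x (u m)) (dt x (u n)) < e" if "m \<ge> N" "n \<ge> N" for m n
    proof -
      have "(hdist D (dt x (u m)) (dt x (u n)))\<^sup>2 < e\<^sup>2"
        using est[OF u(1,2) u(1,2), of m n] small[OF that(1)] small[OF that(2)] by linarith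
      then show ?thesis using e by (simp add: power_less_imp_less_base)
    qed
    then show "\<exists>N. \<forall>m\<ge>N. \<forall>n\<ge>N. hdist D (dt x (u m)) (dt x (u n)) < e" by blast
  qed
  then obtain z where z: "z \<in> carrier D" "(\<lambda>n. hdist D (dt x (u n)) z) \<longlonglongrightarrow> 0"
    using D.complete by blast
  have le: "hdist D (dt x c) z \<le> sqrt (2 * norm (a * c - a))" if c: "c \<in> C" "norm c \<le> 1" for c
  proof -
    have lim: "(\<lambda>n. sqrt (2 * norm (a * c - a) + 2 * inverse (real (Suc n))) + hdist D (dt x (u n)) z)
        \<longlonglongrightarrow> sqrt (2 * norm (a * c - a) + 2 * 0) + 0"
      by (intro tendsto_intros LIMSEQ_inverse_real_of_nat z)
    have "hdist D (dt x c) z \<le> sqrt (2 * norm (a * c - a) + 2 * inverse (real (Suc n))) + hdist D (dt x (u n)) z" for n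
    proof -
      have "(hdist D (dt x c) (dt x (u n)))\<^sup>2 \<le> 2 * norm (a * c - a) + 2 * inverse (real (Suc n))"
        using est[OF c u(1,2), of n] u(3)[of n] by linarith
      then have "hdist D (dt x c) (dt x (u n)) \<le> sqrt (2 * norm (a * c - a) + 2 * inverse (real (Suc n)))"
        by (rule real_le_rsqrt)
      moreover have "hdist D (dt x c) z \<le> hdist D (dt x c) (dt x (u n)) + hdist D (dt x (u n)) z"
        by (rule D.hdist_triangle) (use x c u(1) z(1) in auto)
      ultimately show ?thesis by linarith
    qed
    then have "hdist D (dt x c) z \<le> sqrt (2 * norm (a * c - a) + 2 * 0) + 0"
      using LIMSEQ_le_const[OF lim] by blast
    then show ?thesis by simp
  qed
  have "((\<lambda>c. hdist D (dt x c) z) \<longlongrightarrow> 0) F" if F: "approx_unit C F" for F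
  proof (rule Lim_null_comparison)
    have "((\<lambda>c. a * c) \<longlongrightarrow> a) F" using F aC by (simp add: approx_unit_def)
    from tendsto_diff[OF this tendsto_const]
    have "((\<lambda>c. a * c - a) \<longlongrightarrow> a - a) F" .
    from tendsto_real_sqrt[OF tendsto_mult[OF tendsto_const tendsto_norm[OF this]]]
    have "((\<lambda>c. sqrt (2 * norm (a * c - a))) \<longlongrightarrow> sqrt (2 * norm (a - a))) F" .
    then show "((\<lambda>c. sqrt (2 * norm (a * c - a))) \<longlongrightarrow> 0) F" by simp
    have "\<forall>\<^sub>F c in F. c \<in> C \<and> cpos C c \<and> norm c \<le> 1" using F by (simp add: approx_unit_def)
    then show "\<forall>\<^sub>F c in F. norm (hdist D (dt x c) z) \<le> sqrt (2 * norm (a * c - a))"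
    proof eventually_elim
      case (elim c)
      then show ?case using le[of c] by simp
    qed
  qed
  with z(1) show ?thesis by blast
qed

text \<open>Some approximate unit exists, so the limit in the definition is unique and the definite
  description denotes it.\<close>

lemma tensor_V:
  assumes x: "x \<in> carrier E"
  shows "tensor_V E \<rho> C x \<in> carrier D"
    "approx_unit C F \<Longrightarrow> ((\<lambda>c. hdist D (dt x c) (tensor_V E \<rho> C x)) \<longlongrightarrow> 0) F"
proof -
  obtain z where z: "z \<in> carrier D" "\<And>F. approx_unit C F \<Longrightarrow> ((\<lambda>c. hdist D (dt x c) z) \<longlongrightarrow> 0) F"
    using ex_tensor_V[OF x] by blast
  obtain F0 where F0: "approx_unit C F0" using ex_approx_unit[OF r(2)] by blast
  have ev: "\<forall>\<^sub>F c in F0. c \<in> C" using F0 by (auto simp: approx_unit_def elim: eventually_mono)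
  have "tensor_V E \<rho> C x = z"
    unfolding tensor_V_def restrict_apply'[OF x]
  proof (rule the_equality)
    show "z \<in> carrier D \<and> (\<forall>F. approx_unit C F \<longrightarrow> ((\<lambda>c. hdist D (dt x c) z) \<longlongrightarrow> 0) F)"
      using z by blast
    fix z' assume z': "z' \<in> carrier D \<and> (\<forall>F. approx_unit C F \<longrightarrow> ((\<lambda>c. hdist D (dt x c) z') \<longlongrightarrow> 0) F)"
    have "((\<lambda>c. hdist D (dt x c) z' + hdist D (dt x c) z) \<longlongrightarrow> 0 + 0) F0"
      using z z' F0 by (intro tendsto_add) auto
    moreover have "\<forall>\<^sub>F c in F0. hdist D z' z \<le> hdist D (dt x c) z' + hdist D (dt x c) z"
      using ev
    proof eventually_elim
      case (elim c)
      then show ?case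
        using D.hdist_triangle[of z' "dt x c" z] D.hdist_sym[of z' "dt x c"] x z z' by auto
    qed
    ultimately have "hdist D z' z \<le> 0 + 0"
      using F0 by (intro tendsto_lowerbound) (auto simp: approx_unit_def)
    then show "z' = z" using z z' D.hdist_eq_0D[of z' z] D.hdist_nonneg[of z' z] by auto
  qed
  with z show "tensor_V E \<rho> C x \<in> carrier D"
    "approx_unit C F \<Longrightarrow> ((\<lambda>c. hdist D (dt x c) (tensor_V E \<rho> C x)) \<longlongrightarrow> 0) F" by auto
qed

abbreviation "V \<equiv> tensor_V E \<rho> C"

lemmas V_closed [simp, intro] = tensor_V(1)

lemma inner_dot_V:
  assumes x: "x \<in> carrier E" "y \<in> carrier E" "d \<in> C"
  shows "hinner D (dt y d) (V x) = star d * r (hinner E y x)"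
proof -
  obtain F where F: "approx_unit C F" using ex_approx_unit[OF r(2)] by blast
  have ev: "\<forall>\<^sub>F c in F. c \<in> C" using F by (auto simp: approx_unit_def elim: eventually_mono)
  let ?a = "star d * r (hinner E y x)"
  have 1: "((\<lambda>c. hinner D (dt y d) (dt x c)) \<longlongrightarrow> hinner D (dt y d) (V x)) F"
    by (rule D.tendsto_hinner_right[OF tensor_V(2)[OF x(1) F]])
      (use ev x in \<open>auto elim!: eventually_mono\<close>)
  have "?a \<in> C" using x by (simp add: r clC)
  then have 2: "((\<lambda>c. ?a * c) \<longlongrightarrow> ?a) F" using F by (simp add: approx_unit_def)
  have "\<forall>\<^sub>F c in F. hinner D (dt y d) (dt x c) = ?a * c"
    using ev by eventually_elim (use x in \<open>simp add: inner_dot\<close>)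
  then have "((\<lambda>c. hinner D (dt y d) (dt x c)) \<longlongrightarrow> ?a) F"
    using 2 by (simp add: tendsto_cong)
  with 1 show ?thesis using F by (intro tendsto_unique) (auto simp: approx_unit_def)
qed

lemma inner_V_dot: "x \<in> carrier E \<Longrightarrow> y \<in> carrier E \<Longrightarrow> d \<in> C \<Longrightarrow> hinner D (V x) (dt y d) = r (hinner E x y) * d"
  using arg_cong[OF inner_dot_V[of x y d], of star]
  by (simp add: D.star_hinner star_mult star_star r(6)[symmetric] star_hinner)

text \<open>A further limit along an approximate unit, now in the second argument. For an
  automorphism in place of \<open>r\<close> it makes \<open>V\<close> isometric.\<close>

lemma inner_V_V:
  assumes x: "x \<in> carrier E" "y \<in> carrier E"
  shows "hinner D (V x) (V y) = r (hinner E x y)"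
proof -
  obtain F where F: "approx_unit C F" using ex_approx_unit[OF r(2)] by blast
  have ev: "\<forall>\<^sub>F c in F. c \<in> C" using F by (auto simp: approx_unit_def elim: eventually_mono)
  let ?a = "r (hinner E x y)"
  have 1: "((\<lambda>c. hinner D (V x) (dt y c)) \<longlongrightarrow> hinner D (V x) (V y)) F"
    by (rule D.tendsto_hinner_right[OF tensor_V(2)[OF x(2) F]])
      (use ev x in \<open>auto elim!: eventually_mono\<close>)
  have "?a \<in> C" using x by (simp add: r)
  then have 2: "((\<lambda>c. ?a * c) \<longlongrightarrow> ?a) F" using F by (simp add: approx_unit_def)
  have "\<forall>\<^sub>F c in F. hinner D (V x) (dt y c) = ?a * c"
    using ev by eventually_elim (use x in \<open>simp add: inner_V_dot\<close>)
  then have "((\<lambda>c. hinner D (V x) (dt y c)) \<longlongrightarrow> ?a) F"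
    using 2 by (simp add: tendsto_cong)
  with 1 show ?thesis using F by (intro tendsto_unique) (auto simp: approx_unit_def)
qed

text \<open>By definiteness, this law and the next ones reduce to inner products of values of
  \<open>V\<close>, which are images under \<open>r\<close> of inner products in
  \<open>E\<close>.\<close>

lemma V_add: "x \<in> carrier E \<Longrightarrow> y \<in> carrier E \<Longrightarrow> V (x \<oplus> y) = V x \<oplus>\<^bsub>D\<^esub> V y"
  by (rule D.inner_eqI) (simp_all add: D.hinner_simps inner_V_V hinner_simps r clB)

lemma V_scale: "x \<in> carrier E \<Longrightarrow> V (hscale E k x) = hscale D k (V x)"
  by (rule D.inner_eqI) (simp_all add: D.hinner_simps inner_V_V hinner_simps r clB)

lemma V_act: "x \<in> carrier E \<Longrightarrow> b \<in> base E \<Longrightarrow> V (hact E x b) = hact D (V x) (r b)"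
  by (rule D.inner_eqI) (simp_all add: D.hinner_simps inner_V_V hinner_simps r clB mult.assoc)

text \<open>If \<open>r\<close> is surjective onto \<open>C\<close>, every elementary tensor has the
  form on the right, so \<open>V\<close> reaches all of them; this is the source of its surjectivity
  in the twisted case.\<close>

lemma V_act_dot: "x \<in> carrier E \<Longrightarrow> b \<in> base E \<Longrightarrow> V (hact E x b) = dt x (r b)"
  by (rule D.inner_eqI)
    (simp_all add: D.hinner_simps inner_V_V inner_V_dot inner_dot_V inner_dot hinner_simps r clB mult.assoc)

lemma V_minus: "x \<in> carrier E \<Longrightarrow> V (\<ominus> x) = \<ominus>\<^bsub>D\<^esub> V x"
  using V_scale[of x "-1"] by (simp add: hscale_minus1 D.hscale_minus1)

lemma V_diff: "x \<in> carrier E \<Longrightarrow> y \<in> carrier E \<Longrightarrow> V (x \<ominus> y) = V x \<ominus>\<^bsub>D\<^esub> V y"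
  by (simp add: a_minus_def V_add V_minus)

text \<open>The vectors \<open>q\<close> with \<open>hinner D p q = 0\<close> form a closed
  subspace; as it contains the elementary tensors, it contains \<open>p\<close> itself.\<close>

lemma dot_total:
  assumes p: "p \<in> carrier D" "\<And>x c. x \<in> carrier E \<Longrightarrow> c \<in> C \<Longrightarrow> hinner D (dt x c) p = 0"
  shows "p = \<zero>\<^bsub>D\<^esub>"
proof -
  have "carrier D \<subseteq> {q \<in> carrier D. hinner D p q = 0}"
  proof (rule tensor_dense)
    show "dt x c \<in> {q \<in> carrier D. hinner D p q = 0}" if "x \<in> carrier E" "c \<in> C" for x c
      using p that D.star_hinner[of "dt x c" p] by simp
    fix s q assume s: "\<And>n::nat. s n \<in> {q \<in> carrier D. hinner D p q = 0}" "q \<in> carrier D"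
      "(\<lambda>n. hdist D (s n) q) \<longlonglongrightarrow> 0"
    then have "(\<lambda>n. hinner D p (s n)) \<longlonglongrightarrow> hinner D p q"
      using p by (intro D.tendsto_hinner_right) auto
    then have "hinner D p q = 0" using s(1) by (simp add: LIMSEQ_const_iff)
    then show "q \<in> {q \<in> carrier D. hinner D p q = 0}" using s(2) by simp
  qed (use p in \<open>auto simp: D.hinner_simps\<close>)
  then show ?thesis using p D.hinner_eq_0D by blast
qed

end

section \<open>Twisting by an automorphism\<close>

lemma star_autD:
  assumes "cstar_alg B" "\<beta> \<in> star_aut B"
  shows "star_hom_on B B \<beta>" "\<beta> \<in> Bij B"
  using assms by (auto simp: star_aut_def star_hom_def star_linear_def star_hom_on_def alg_def)

lemma star_autI:
  assumes "star_hom_on B B \<beta>" "\<beta> \<in> Bij B"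
  shows "\<beta> \<in> star_aut B"
  using assms by (auto simp: star_aut_def star_hom_def star_linear_def star_hom_on_def alg_def
      PiE_def Bij_imp_extensional)

lemma star_hom_on_inverse:
  assumes "cstar_alg B" "\<beta> \<in> star_aut B"
  shows "star_hom_on B B (inv_into B \<beta>)"
proof -
  note b = star_autD[OF assms]
  note r = star_hom_onD[OF b(1)]
  note cl = cstar_alg_closed[OF assms(1)]
  have bij: "bij_betw \<beta> B B" using b(2) by (simp add: Bij_def)
  have mem: "inv_into B \<beta> x \<in> B" if "x \<in> B" for x
    using bij that by (metis bij_betw_def inv_into_into)
  have inv: "\<beta> (inv_into B \<beta> x) = x" if "x \<in> B" for x
    using bij that by (simp add: bij_betw_inv_into_right)
  have eqI: "inv_into B \<beta> y = x" if "x \<in> B" "\<beta> x = y" for x y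
    using bij that by (simp add: bij_betw_inv_into_left flip: that(2))
  show ?thesis
    unfolding star_hom_on_def
    using assms(1) by (auto simp: mem inv r cl intro!: eqI)
qed

lemma star_aut_compose:
  assumes B: "cstar_alg B" and "\<beta> \<in> star_aut B" "\<beta>' \<in> star_aut B"
  shows "compose B \<beta> \<beta>' \<in> star_aut B"
proof (rule star_autI)
  note b = star_autD[OF B assms(2)] star_autD[OF B assms(3)]
  show "compose B \<beta> \<beta>' \<in> Bij B" by (rule compose_Bij[OF b(2) b(4)])
  show "star_hom_on B B (compose B \<beta> \<beta>')"
    using B cstar_alg_closed[OF B] star_hom_onD[OF b(1)] star_hom_onD[OF b(3)]
    by (simp add: star_hom_on_def compose_def)
qed

lemma star_aut_id:
  assumes B: "cstar_alg B"
  shows "(\<lambda>b\<in>B. b) \<in> star_aut B"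
  by (rule star_autI) (use B cstar_alg_closed[OF B] in \<open>auto simp: star_hom_on_def id_Bij\<close>)

locale twist = hilbert E
  for E :: "('b::cstar_algebra, 'e) hmodule" (structure) +
  fixes \<beta> :: "'b \<Rightarrow> 'b"
  assumes beta: "\<beta> \<in> star_aut (base E)"
begin

abbreviation "B \<equiv> base E"
abbreviation "\<gamma> \<equiv> inv_into B \<beta>"

lemma beta_bij: "bij_betw \<beta> B B"
  using star_autD(2)[OF cstar_base beta] by (simp add: Bij_def)

lemma gamma_hom: "star_hom_on B B \<gamma>"
  by (rule star_hom_on_inverse[OF cstar_base beta])

lemmas g = star_hom_onD[OF gamma_hom]

lemma beta_gamma [simp]: "b \<in> B \<Longrightarrow> \<beta> (\<gamma> b) = b"
  using beta_bij by (rule bij_betw_inv_into_right)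

lemma gamma_beta [simp]: "b \<in> B \<Longrightarrow> \<gamma> (\<beta> b) = b"
  using beta_bij by (rule bij_betw_inv_into_left)

end

sublocale twist \<subseteq> tensor E "base E" \<beta> "compose (base E) (inc (base E)) \<beta>"
proof
  show "star_hom_on (base E) (base E) \<beta>" by (rule star_autD(1)[OF cstar_base beta])
  show "compose (base E) (inc (base E)) \<beta> b c = \<beta> b * c" if "b \<in> base E" "c \<in> base E" for b c
    using that star_hom_onD(3)[OF star_autD(1)[OF cstar_base beta]] by (simp add: compose_def inc_def)
qed

context twist
begin

text \<open>Both the automorphism and its inverse are contractive.\<close>

lemma norm_beta: "b \<in> B \<Longrightarrow> norm (\<beta> b) = norm b"
  using star_hom_on_contractive[OF hom, of b] star_hom_on_contractive[OF gamma_hom, of "\<beta> b"] r(3)[of b]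
  by simp

lemma beta_inj: "b \<in> B \<Longrightarrow> c \<in> B \<Longrightarrow> \<beta> b = \<beta> c \<Longrightarrow> b = c"
  by (metis gamma_beta)

lemma hnorm_V: "x \<in> carrier E \<Longrightarrow> hnorm D (V x) = hnorm E x"
  by (simp add: hnorm_def inner_V_V norm_beta)

lemma hdist_V: "x \<in> carrier E \<Longrightarrow> y \<in> carrier E \<Longrightarrow> hdist D (V x) (V y) = hdist E x y"
  by (simp add: hdist_def hnorm_V flip: V_diff)

lemma dot_eq_V: "x \<in> carrier E \<Longrightarrow> c \<in> B \<Longrightarrow> dt x c = V (hact E x (\<gamma> c))"
  using V_act_dot[of x "\<gamma> c"] by (simp add: g)

text \<open>The image of the complete module \<open>E\<close> under the isometry \<open>V\<close> is
  closed, and it contains the elementary tensors.\<close>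

lemma V_surj: "V ` carrier E = carrier D"
proof (rule antisym)
  show "carrier D \<subseteq> V ` carrier E"
  proof (rule tensor_dense)
    show "dt x c \<in> V ` carrier E" if "x \<in> carrier E" "c \<in> B" for x c
      using that by (simp add: dot_eq_V g)
    have "V \<zero> = \<zero>\<^bsub>D\<^esub>" by (rule D.hinner_eq_0D) (simp_all add: inner_V_V r)
    then show "\<zero>\<^bsub>D\<^esub> \<in> V ` carrier E" by (metis imageI zero_closed)
    show "p \<oplus>\<^bsub>D\<^esub> q \<in> V ` carrier E" if pq: "p \<in> V ` carrier E" "q \<in> V ` carrier E" for p q
    proof -
      from pq obtain x y where "p = V x" "q = V y" "x \<in> carrier E" "y \<in> carrier E" by blast
      then show ?thesis by (simp flip: V_add)
    qed
    show "hscale D k p \<in> V ` carrier E" if p: "p \<in> V ` carrier E" for k p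
    proof -
      from p obtain x where "p = V x" "x \<in> carrier E" by blast
      then show ?thesis by (simp flip: V_scale)
    qed
    fix s p assume s: "\<And>n::nat. s n \<in> V ` carrier E" and p: "p \<in> carrier D"
      and lim: "(\<lambda>n. hdist D (s n) p) \<longlonglongrightarrow> 0"
    have "\<exists>x. x \<in> carrier E \<and> s n = V x" for n using s[of n] by blast
    then obtain x where x: "\<And>n. x n \<in> carrier E" "\<And>n. s n = V (x n)" by metis
    have "hCauchy E x"
    proof (rule hCauchyI[OF x(1)])
      fix e :: real assume "0 < e"
      then obtain M where M: "\<forall>n\<ge>M. hdist D (s n) p < e / 2"
        using order_tendstoD(2)[OF lim, of "e / 2"] by (auto simp: eventually_sequentially)
      have "hdist E (x m) (x n) < e" if "m \<ge> M" "n \<ge> M" for m n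
      proof -
        have "hdist E (x m) (x n) = hdist D (s m) (s n)" by (simp add: x hdist_V)
        also have "\<dots> \<le> hdist D (s m) p + hdist D p (s n)"
          by (rule D.hdist_triangle) (use x p in auto)
        also have "hdist D p (s n) = hdist D (s n) p" by (rule D.hdist_sym) (use x p in auto)
        finally show ?thesis using M that by (smt (verit) field_sum_of_halves)
      qed
      then show "\<exists>N. \<forall>m\<ge>N. \<forall>n\<ge>N. hdist E (x m) (x n) < e" by blast
    qed
    then obtain y where y: "y \<in> carrier E" "(\<lambda>n. hdist E (x n) y) \<longlonglongrightarrow> 0" using complete by blast
    have "V y = p"
    proof (rule D.limit_unique[where s = s and F = sequentially])
      show "(\<lambda>n. hdist D (s n) (V y)) \<longlonglongrightarrow> 0" using y x by (simp add: hdist_V)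
    qed (use x y p lim in auto)
    then show "p \<in> V ` carrier E" using y by blast
  qed (rule image_subsetI, rule V_closed)
qed (rule image_subsetI, rule V_closed)

lemma V_inj: "inj_on V (carrier E)"
proof (rule inj_onI)
  fix x y assume xy: "x \<in> carrier E" "y \<in> carrier E" "V x = V y"
  then have "hdist E x y = 0" using hdist_V[of x y] by simp
  with xy show "x = y" by (intro hdist_eq_0D)
qed

text \<open>This serves the uniqueness of \<open>twist_U\<close>, which in general is not
  adjointable in the ordinary sense. Agreement therefore extends by density and boundedness instead
  of through adjoints.\<close>

lemma bounded_maps_eqI:
  assumes u: "u \<in> bounded_maps D E" and v: "v \<in> bounded_maps D E"
    and eq: "\<And>x c. x \<in> carrier E \<Longrightarrow> c \<in> B \<Longrightarrow> u (dt x c) = v (dt x c)"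
  shows "u = v"
proof (rule extensionalityI[of _ "carrier D"])
  show "u \<in> extensional (carrier D)" "v \<in> extensional (carrier D)"
    using u v by (auto simp: bounded_maps_def PiE_def)
  have lin: "w p \<in> carrier E" "w (p \<oplus>\<^bsub>D\<^esub> q) = w p \<oplus> w q" "w (hscale D k p) = hscale E k (w p)"
    if "w \<in> bounded_maps D E" "p \<in> carrier D" "q \<in> carrier D" for w p q k
    using that by (auto simp: bounded_maps_def)
  have lip: "\<exists>K. \<forall>p\<in>carrier D. \<forall>q\<in>carrier D. hdist E (w p) (w q) \<le> K * hdist D p q" if w: "w \<in> bounded_maps D E" for w
  proof -
    obtain K where K: "\<And>p. p \<in> carrier D \<Longrightarrow> hnorm E (w p) \<le> K * hnorm D p"
      using w unfolding bounded_maps_def by blast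
    have "hdist E (w p) (w q) \<le> K * hdist D p q" if pq: "p \<in> carrier D" "q \<in> carrier D" for p q
    proof -
      have "w p \<ominus> w q = w (p \<ominus>\<^bsub>D\<^esub> q)"
        using lin[OF w] pq by (simp add: a_minus_def flip: hscale_minus1 D.hscale_minus1)
      then show ?thesis using K[of "p \<ominus>\<^bsub>D\<^esub> q"] pq by (simp add: hdist_def)
    qed
    then show ?thesis by blast
  qed
  obtain K L where KL: "\<And>p q. p \<in> carrier D \<Longrightarrow> q \<in> carrier D \<Longrightarrow> hdist E (u p) (u q) \<le> K * hdist D p q"
      "\<And>p q. p \<in> carrier D \<Longrightarrow> q \<in> carrier D \<Longrightarrow> hdist E (v p) (v q) \<le> L * hdist D p q"
    using lip[OF u] lip[OF v] by blast
  have "carrier D \<subseteq> {p \<in> carrier D. u p = v p}"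
  proof (rule tensor_dense)
    have "u (hscale D 0 \<zero>\<^bsub>D\<^esub>) = v (hscale D 0 \<zero>\<^bsub>D\<^esub>)"
      using lin[OF u D.zero_closed D.zero_closed] lin[OF v D.zero_closed D.zero_closed] by (simp only: lin(3) hscale_0)
    then show "\<zero>\<^bsub>D\<^esub> \<in> {p \<in> carrier D. u p = v p}" by simp
    fix s p assume s: "\<And>n::nat. s n \<in> {p \<in> carrier D. u p = v p}" and p: "p \<in> carrier D"
      and lim: "(\<lambda>n. hdist D (s n) p) \<longlonglongrightarrow> 0"
    have "u p = v p"
    proof (rule limit_unique[where s = "\<lambda>n. u (s n)" and F = sequentially])
      have sD: "s n \<in> carrier D" "v (s n) = u (s n)" for n using s[of n] by auto
      show "u (s n) \<in> carrier E" for n by (rule lin(1)[OF u sD(1) sD(1)])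
      show "u p \<in> carrier E" "v p \<in> carrier E" using lin(1)[OF u p p] lin(1)[OF v p p] by auto
      show "(\<lambda>n. hdist E (u (s n)) (u p)) \<longlonglongrightarrow> 0"
        by (rule Lim_null_comparison[OF _ tendsto_mult_right_zero[OF lim, of K]]) (use KL(1)[OF sD(1) p] in simp)
      show "(\<lambda>n. hdist E (u (s n)) (v p)) \<longlonglongrightarrow> 0"
        by (rule Lim_null_comparison[OF _ tendsto_mult_right_zero[OF lim, of L]]) (use KL(2)[OF sD(1) p] in \<open>simp add: sD(2)\<close>)
    qed simp
    with p show "p \<in> {p \<in> carrier D. u p = v p}" by simp
  qed (use eq lin[OF u] lin[OF v] in auto)
  then show "u p = v p" if "p \<in> carrier D" for p using that by blast
qed

abbreviation "U \<equiv> twist_U E \<beta>"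

text \<open>An elementary tensor \<open>dt x b\<close> is \<open>V\<close> of
  \<open>hact E x (\<gamma> b)\<close>, so the inverse of \<open>V\<close> has the property that
  describes \<open>twist_U\<close>.\<close>

lemma twist_U_eq: "U = (\<lambda>p\<in>carrier D. inv_into (carrier E) V p)"
proof -
  let ?u = "\<lambda>p\<in>carrier D. inv_into (carrier E) V p"
  have u: "?u p \<in> carrier E" "V (?u p) = p" if "p \<in> carrier D" for p
    using that V_surj by (auto simp: inv_into_into f_inv_into_f)
  have uV: "?u (V x) = x" if "x \<in> carrier E" for x
    using that V_inj by (simp add: inv_into_f_f)
  have "?u \<in> bounded_maps D E"
    unfolding bounded_maps_def mem_Collect_eq
  proof (intro conjI ballI allI exI[of _ 1])
    show "?u \<in> carrier D \<rightarrow>\<^sub>E carrier E" using u by (auto simp: PiE_def Pi_def)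
    fix p assume p: "p \<in> carrier D"
    show "?u (p \<oplus>\<^bsub>D\<^esub> q) = ?u p \<oplus> ?u q" if q: "q \<in> carrier D" for q
      using uV[of "?u p \<oplus> ?u q"] u[OF p] u[OF q] by (simp add: V_add del: restrict_apply)
    show "?u (hscale D k p) = hscale E k (?u p)" for k
      using uV[of "hscale E k (?u p)"] u[OF p] by (simp add: V_scale del: restrict_apply)
    show "hnorm E (?u p) \<le> 1 * hnorm D p" using hnorm_V[of "?u p"] u[OF p] by simp
  qed
  moreover have "?u (dt x b) = hact E x (\<gamma> b)" if "x \<in> carrier E" "b \<in> B" for x b
    using uV[of "hact E x (\<gamma> b)"] that by (simp add: dot_eq_V g del: restrict_apply)
  ultimately show ?thesis
    unfolding twist_U_def Let_def
    by (intro the_equality) (auto intro!: bounded_maps_eqI simp del: restrict_apply)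
qed

lemma U_PiE: "U \<in> carrier D \<rightarrow>\<^sub>E carrier E"
  unfolding twist_U_eq by (rule PiE_I) (simp_all add: inv_into_into V_surj)

lemma U_closed [simp, intro]: "p \<in> carrier D \<Longrightarrow> U p \<in> carrier E"
  using U_PiE by (rule PiE_mem)

lemma V_U [simp]: "p \<in> carrier D \<Longrightarrow> V (U p) = p"
  unfolding twist_U_eq using V_surj by (simp add: f_inv_into_f)

lemma U_V [simp]: "x \<in> carrier E \<Longrightarrow> U (V x) = x"
  unfolding twist_U_eq using V_inj by (simp add: inv_into_f_f)

lemma U_dot: "x \<in> carrier E \<Longrightarrow> c \<in> B \<Longrightarrow> U (dt x c) = hact E x (\<gamma> c)"
  by (simp add: dot_eq_V g)

lemma hinner_D: "p \<in> carrier D \<Longrightarrow> q \<in> carrier D \<Longrightarrow> hinner D p q = \<beta> (hinner E (U p) (U q))"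
  using inner_V_V[of "U p" "U q"] by simp

lemma U_add: "p \<in> carrier D \<Longrightarrow> q \<in> carrier D \<Longrightarrow> U (p \<oplus>\<^bsub>D\<^esub> q) = U p \<oplus> U q"
  using U_V[of "U p \<oplus> U q"] by (simp add: V_add)

lemma U_scale: "p \<in> carrier D \<Longrightarrow> U (hscale D k p) = hscale E k (U p)"
  using U_V[of "hscale E k (U p)"] by (simp add: V_scale)

lemma U_act: "p \<in> carrier D \<Longrightarrow> c \<in> B \<Longrightarrow> U (hact D p c) = hact E (U p) (\<gamma> c)"
  using U_V[of "hact E (U p) (\<gamma> c)"] by (simp add: V_act g)

lemma hnorm_U: "p \<in> carrier D \<Longrightarrow> hnorm E (U p) = hnorm D p"
  using hnorm_V[of "U p"] by simp

lemma U_eq_zeroD: "p \<in> carrier D \<Longrightarrow> U p = \<zero> \<Longrightarrow> p = \<zero>\<^bsub>D\<^esub>"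
  by (rule D.hinner_eq_0D) (simp_all add: hinner_D r)

lemma V_PiE: "V \<in> carrier E \<rightarrow>\<^sub>E carrier D"
  by (rule PiE_I) (rule V_closed, assumption, simp add: tensor_V_def)

end

abbreviation twisted_tensor :: "('b::cstar_algebra, 'e) hmodule \<Rightarrow> ('b \<Rightarrow> 'b) \<Rightarrow> ('b, ('e, 'b) tensor) hmodule" where
  "twisted_tensor E \<beta> \<equiv> interior_tensor E (compose (base E) (inc (base E)) \<beta>) (base E)"

abbreviation twisted_V :: "('b::cstar_algebra, 'e) hmodule \<Rightarrow> ('b \<Rightarrow> 'b) \<Rightarrow> 'e \<Rightarrow> ('e, 'b) tensor" where
  "twisted_V E \<beta> \<equiv> tensor_V E (compose (base E) (inc (base E)) \<beta>) (base E)"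

text \<open>The map on the right sends \<open>dt x c\<close> to \<open>dt (T x) c\<close> because
  \<open>T\<close> commutes with the action of the algebra, and its adjoint is obtained from that of
  \<open>T\<close> in the same way.\<close>

lemma amplify_twist:
  assumes "twist E \<beta>" "twist F \<beta>" and base: "base F = base E" and T: "T \<in> adjointable E F"
  shows "amplify E F (compose (base E) (inc (base E)) \<beta>) (base E) T =
    (\<lambda>p\<in>carrier (twisted_tensor E \<beta>). twisted_V F \<beta> (T (twist_U E \<beta> p)))" (is "_ = ?S")
proof -
  interpret E: twist E \<beta> by (rule assms)
  interpret F: twist F \<beta> by (rule assms)
  note [simp] = base
  note Td = adjointableD[OF E.hilbert_axioms T]
  note lin = adjointable_linear[OF E.hilbert_axioms F.hilbert_axioms T base]
  let ?A = "adjoint_of E F T"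
  have "?S \<in> adjointable E.D F.D"
  proof (rule adjointableI)
    show "?S \<in> carrier E.D \<rightarrow>\<^sub>E carrier F.D" using Td(2) F.V_closed by (auto simp: PiE_def Pi_def)
    show "is_adjoint E.D F.D ?S (\<lambda>q\<in>carrier F.D. twisted_V E \<beta> (?A (twist_U F \<beta> q)))"
    proof (rule is_adjointI)
      show "(\<lambda>q\<in>carrier F.D. twisted_V E \<beta> (?A (twist_U F \<beta> q))) \<in> carrier F.D \<rightarrow>\<^sub>E carrier E.D"
        using Td(4) F.U_closed by (auto simp: PiE_def Pi_def)
      fix p q assume pq: "p \<in> carrier E.D" "q \<in> carrier F.D"
      have "twisted_V F \<beta> (T (twist_U E \<beta> p)) \<in> carrier F.D"
        using F.V_closed[of "T (twist_U E \<beta> p)"] Td(2) pq by simp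
      then show "hinner F.D (?S p) q = hinner E.D p ((\<lambda>q\<in>carrier F.D. twisted_V E \<beta> (?A (twist_U F \<beta> q))) q)"
        using pq Td F.U_V F.U_closed F.hinner_D by (simp add: E.hinner_D)
    qed
  qed
  moreover have dot: "?S (E.dt x c) = F.dt (T x) c" if "x \<in> carrier E" "c \<in> base E" for x c
    using that F.dot_eq_V[of "T x" c] Td by (simp add: E.U_dot lin E.g)
  ultimately show ?thesis
    unfolding amplify_def
  proof (intro the_equality)
    fix S assume S: "S \<in> adjointable (interior_tensor E (compose (base E) (inc (base E)) \<beta>) (base E))
        (interior_tensor F (compose (base E) (inc (base E)) \<beta>) (base E)) \<and>
      (\<forall>x\<in>carrier E. \<forall>c\<in>base E. S (dot E (compose (base E) (inc (base E)) \<beta>) (base E) x c) =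
         dot F (compose (base E) (inc (base E)) \<beta>) (base E) (T x) c)"
    show "S = ?S"
    proof (rule adjointable_eqI[of E.D F.D _ _ "{E.dt x c |x c. x \<in> carrier E \<and> c \<in> base E}"])
      show "hilbert E.D" "hilbert F.D" by (rule E.D.hilbert_axioms, rule F.D.hilbert_axioms)
      show "S \<in> adjointable E.D F.D" using S by simp
      show "?S \<in> adjointable E.D F.D" by fact
      show "p = \<zero>\<^bsub>E.D\<^esub>" if "p \<in> carrier E.D"
        "\<And>z. z \<in> {E.dt x c |x c. x \<in> carrier E \<and> c \<in> base E} \<Longrightarrow> hinner E.D z p = 0" for p
        by (rule E.dot_total) (use that in auto)
      show "S z = ?S z" if "z \<in> {E.dt x c |x c. x \<in> carrier E \<and> c \<in> base E}" for z
        using that S dot by auto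
    qed auto
  qed auto
qed

section \<open>Multipliers\<close>

lemma hilbert_self_module:
  assumes B: "cstar_alg B"
  shows "hilbert (self_module B)"
proof -
  let ?M = "self_module B"
  note cl = cstar_alg_closed[OF B]
  note sm = self_module_def
  have G: "abelian_group ?M"
    by (rule abelian_groupI) (auto simp: sm cl add.assoc add.commute intro!: bexI[of _ "- _"])
  have "pre_hilbert ?M"
    by (intro pre_hilbert.intro pre_hilbert_axioms.intro G)
      (simp_all add: sm cl B complex_vector.scale_one scaleC_scaleC scaleC_add_left scaleC_add_right
        distrib_left distrib_right mult.assoc mult_scaleC_left mult_scaleC_right star_mult star_star cpos_star_mult)
  then interpret M: pre_hilbert ?M .
  have minus: "\<ominus>\<^bsub>?M\<^esub> x = - x" if "x \<in> B" for x
    by (rule M.minus_equality) (use that cl in \<open>simp_all add: sm\<close>)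
  have dist: "hdist ?M x y = norm (x - y)" if "x \<in> B" "y \<in> B" for x y
    using that by (simp add: hdist_def a_minus_def minus, simp add: sm hnorm_def cstar_identity)
  show ?thesis
  proof (intro hilbert.intro hilbert_axioms.intro M.pre_hilbert_axioms)
    fix x assume "x \<in> carrier ?M" "hinner ?M x x = 0"
    then show "x = \<zero>\<^bsub>?M\<^esub>" using cstar_identity[of x] by (simp add: sm)
  next
    fix s assume s: "hCauchy ?M s"
    have sB: "s n \<in> B" for n using M.hCauchy_mem[OF s, of n] by (simp add: sm)
    have "Cauchy s"
    proof (rule CauchyI)
      fix e :: real assume "0 < e"
      from M.hCauchyD[OF s this] show "\<exists>M. \<forall>m\<ge>M. \<forall>n\<ge>M. norm (s m - s n) < e"
        by (simp add: dist sB)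
    qed
    then obtain x where x: "s \<longlonglongrightarrow> x" by (auto simp: Cauchy_convergent_iff convergent_def)
    have xB: "x \<in> B" by (rule closed_sequentially[OF cl(1) sB x])
    have "(\<lambda>n. norm (s n - x)) \<longlonglongrightarrow> 0" by (intro tendsto_norm_zero LIM_zero x)
    then show "\<exists>x\<in>carrier ?M. (\<lambda>n. hdist ?M (s n) x) \<longlonglongrightarrow> 0"
      using xB by (intro bexI[of _ x]) (simp_all add: dist sB, simp add: sm)
  qed
qed

lemma self_module_simps [simp]:
  "carrier (self_module B) = B" "base (self_module B) = B" "hscale (self_module B) = scaleC"
  "hact (self_module B) = (\<lambda>x y. x * y)" "hinner (self_module B) x y = star x * y" "add (self_module B) = (+)"
  by (simp_all add: self_module_def)

lemma multiplier_alg_simps: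
  "carrier (multiplier_alg B) = adjointable (self_module B) (self_module B)"
  "mult (multiplier_alg B) = compose B" "add (multiplier_alg B) = (\<lambda>S T. \<lambda>x\<in>B. S x + T x)"
  "sa_scale (multiplier_alg B) = (\<lambda>k T. \<lambda>x\<in>B. k *\<^sub>C T x)"
  "sa_star (multiplier_alg B) = adjoint_of (self_module B) (self_module B)"
  by (simp_all add: multiplier_alg_def op_alg_def)

lemma is_adjoint_inc:
  assumes B: "cstar_alg B" and b: "b \<in> B"
  shows "is_adjoint (self_module B) (self_module B) (inc B b) (inc B (star b))" "inc B b \<in> adjointable (self_module B) (self_module B)"
proof -
  note cl = cstar_alg_closed[OF B]
  have PiE: "inc B c \<in> B \<rightarrow>\<^sub>E B" if "c \<in> B" for c
    using that by (auto simp: inc_def cl)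
  show adj: "is_adjoint (self_module B) (self_module B) (inc B b) (inc B (star b))"
    by (rule is_adjointI) (use PiE[of "star b"] b in \<open>simp_all add: cl inc_def star_mult mult.assoc\<close>)
  show "inc B b \<in> adjointable (self_module B) (self_module B)"
    by (rule adjointableI[OF _ adj]) (use PiE[OF b] in simp)
qed

lemma inc_twist_star_hom:
  assumes B: "cstar_alg B" and beta: "\<beta> \<in> star_aut B"
  shows "compose B (inc B) \<beta> \<in> star_hom (alg B) (multiplier_alg B)"
proof -
  note cl = cstar_alg_closed[OF B] and b = star_hom_onD[OF star_autD(1)[OF B beta]]
  have adj: "adjoint_of (self_module B) (self_module B) (inc B c) = inc B (star c)" if "c \<in> B" for c
    by (rule hilbert.adjoint_of_eq[OF hilbert_self_module[OF B] is_adjoint_inc(1)[OF B that]])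
  have "compose B (inc B) \<beta> \<in> B \<rightarrow>\<^sub>E adjointable (self_module B) (self_module B)"
    by (rule PiE_I) (simp_all add: compose_def b is_adjoint_inc(2)[OF B])
  then show ?thesis
    by (simp add: star_hom_def star_linear_def multiplier_alg_simps alg_def cl b adj compose_eq)
      (simp add: inc_def compose_def restrict_def fun_eq_iff b cl distrib_right mult_scaleC_left mult.assoc)
qed

text \<open>An element \<open>x\<close> is approximated by \<open>x * u\<close> for \<open>u\<close>
  from an approximate unit, and \<open>x * u\<close> is the value at \<open>u\<close> of the
  multiplier attached to the preimage of \<open>x\<close> under \<beta>.\<close>

lemma nondegenerate_twist:
  assumes B: "cstar_alg B" and beta: "\<beta> \<in> star_aut B"
  shows "nondegenerate B B (compose B (inc B) \<beta>)"
  unfolding nondegenerate_def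
proof
  note b = star_hom_onD[OF star_autD(1)[OF B beta]]
  note g = star_hom_onD[OF star_hom_on_inverse[OF B beta]]
  let ?X = "{compose B (inc B) \<beta> b c |b c. b \<in> B \<and> c \<in> B}"
  fix x assume x: "x \<in> B"
  have bg: "\<beta> (inv_into B \<beta> x) = x"
    using star_autD(2)[OF B beta] by (intro bij_betw_inv_into_right[OF _ x]) (simp add: Bij_def)
  show "x \<in> closure (complex_vector.span ?X)"
    unfolding closure_approachable
  proof (intro allI impI)
    fix e :: real assume "0 < e"
    with x obtain u where u: "cpos B u" "norm (x * u - x) < e"
      using finite_approx_unit[OF B, of "{x}" e] by auto
    have uB: "u \<in> B" by (rule cpos_mem[OF B u(1)])
    have "x * u = compose B (inc B) \<beta> (inv_into B \<beta> x) u"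
      using x uB bg g(3)[OF x] by (simp add: compose_def inc_def b)
    then have "x * u \<in> ?X" using uB g(3)[OF x] by blast
    then have "x * u \<in> complex_vector.span ?X" by (rule complex_vector.span_base)
    then show "\<exists>y\<in>complex_vector.span ?X. dist y x < e"
      using u(2) by (intro bexI[of _ "x * u"]) (simp_all add: dist_norm)
  qed
qed

text \<open>The extension \<sigma> conjugates a multiplier by the automorphism. For uniqueness,
  composing a multiplier \<open>T\<close> with left multiplication by \<open>x\<close> gives left
  multiplication by \<open>T x\<close>; so any extension \<tau> has \<open>\<tau> T\<close>
  determined on the range of \<beta>, which is all of \<open>B\<close>.\<close>

lemma multiplier_ext_inc:
  assumes B: "cstar_alg B" and beta: "\<beta> \<in> star_aut B" and c: "c \<in> B"
  shows "multiplier_ext B B (compose B (inc B) \<beta>) (inc B c) = inc B (\<beta> c)"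
proof -
  let ?M = "self_module B" and ?\<rho> = "compose B (inc B) \<beta>" and ?\<gamma> = "inv_into B \<beta>"
  note cl = cstar_alg_closed[OF B]
  note b = star_hom_onD[OF star_autD(1)[OF B beta]]
  note g = star_hom_onD[OF star_hom_on_inverse[OF B beta]]
  note H = hilbert_self_module[OF B]
  have bij: "bij_betw \<beta> B B" using star_autD(2)[OF B beta] by (simp add: Bij_def)
  have bg [simp]: "\<beta> (?\<gamma> x) = x" if "x \<in> B" for x using bij that by (rule bij_betw_inv_into_right)
  have gb [simp]: "?\<gamma> (\<beta> x) = x" if "x \<in> B" for x using bij that by (rule bij_betw_inv_into_left)
  define \<sigma> where "\<sigma> = (\<lambda>T\<in>adjointable ?M ?M. \<lambda>x\<in>B. \<beta> (T (?\<gamma> x)))"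
  have Tc: "T x \<in> B" if "T \<in> adjointable ?M ?M" "x \<in> B" for T x
    using adjointableD(2)[OF H that(1)] that(2) by simp
  have ext: "T \<in> extensional B" if "T \<in> adjointable ?M ?M" for T
    using adjointableD(1)[OF H that] by (auto simp: PiE_def)
  have Tact: "T (x * y) = T x * y" if "T \<in> adjointable ?M ?M" "x \<in> B" "y \<in> B" for T x y
    using adjointable_linear(3)[OF H H that(1), of x y] that by simp
  have s_adj: "is_adjoint ?M ?M (\<sigma> T) (\<sigma> (adjoint_of ?M ?M T))" "\<sigma> T \<in> adjointable ?M ?M"
    if T: "T \<in> adjointable ?M ?M" for T
  proof -
    note T' = adjoint_of_adjointable(1)[OF H H T]
    have PiE: "\<sigma> S \<in> B \<rightarrow>\<^sub>E B" if "S \<in> adjointable ?M ?M" for S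
      using that by (auto simp: \<sigma>_def b g Tc)
    show adj: "is_adjoint ?M ?M (\<sigma> T) (\<sigma> (adjoint_of ?M ?M T))"
    proof (rule is_adjointI)
      show "\<sigma> (adjoint_of ?M ?M T) \<in> carrier ?M \<rightarrow>\<^sub>E carrier ?M" using PiE[OF T'] by simp
      fix x y assume "x \<in> carrier ?M" "y \<in> carrier ?M"
      then have xy: "x \<in> B" "y \<in> B" by simp_all
      have "star (T (?\<gamma> x)) * ?\<gamma> y = star (?\<gamma> x) * adjoint_of ?M ?M T (?\<gamma> y)"
        using adjointableD(5)[OF H T, of "?\<gamma> x" "?\<gamma> y"] xy by (simp add: g)
      then have "\<beta> (star (T (?\<gamma> x)) * ?\<gamma> y) = \<beta> (star (?\<gamma> x) * adjoint_of ?M ?M T (?\<gamma> y))" by simp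
      then show "hinner ?M (\<sigma> T x) y = hinner ?M x (\<sigma> (adjoint_of ?M ?M T) y)"
        using xy T T' by (simp add: \<sigma>_def b g cl Tc)
    qed
    show "\<sigma> T \<in> adjointable ?M ?M" by (rule adjointableI[OF _ adj]) (use PiE[OF T] in simp)
  qed
  let ?P = "\<lambda>\<tau>. \<tau> \<in> star_hom (multiplier_alg B) (multiplier_alg B) \<and> (\<forall>b\<in>B. \<tau> (inc B b) = ?\<rho> b)"
  have "?P \<sigma>"
  proof (intro conjI ballI)
    have add: "(\<lambda>x\<in>B. S x + T x) \<in> adjointable ?M ?M" if "S \<in> adjointable ?M ?M" "T \<in> adjointable ?M ?M" for S T
    proof (rule adjointableI)
      note S' = adjoint_of_adjointable(1)[OF H H that(1)] and T' = adjoint_of_adjointable(1)[OF H H that(2)]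
      show "(\<lambda>x\<in>B. S x + T x) \<in> carrier ?M \<rightarrow>\<^sub>E carrier ?M" by (rule PiE_I) (simp_all add: cl Tc that)
      show "is_adjoint ?M ?M (\<lambda>x\<in>B. S x + T x) (\<lambda>x\<in>B. adjoint_of ?M ?M S x + adjoint_of ?M ?M T x)"
      proof (rule is_adjointI)
        show "(\<lambda>x\<in>B. adjoint_of ?M ?M S x + adjoint_of ?M ?M T x) \<in> carrier ?M \<rightarrow>\<^sub>E carrier ?M"
          by (rule PiE_I) (simp_all add: cl Tc S' T')
      qed (use adjointableD(5)[OF H that(1)] adjointableD(5)[OF H that(2)] in
          \<open>simp add: star_add distrib_left distrib_right\<close>)
    qed
    have scale: "(\<lambda>x\<in>B. k *\<^sub>C T x) \<in> adjointable ?M ?M" if "T \<in> adjointable ?M ?M" for T k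
    proof (rule adjointableI)
      note T' = adjoint_of_adjointable(1)[OF H H that]
      show "(\<lambda>x\<in>B. k *\<^sub>C T x) \<in> carrier ?M \<rightarrow>\<^sub>E carrier ?M" by (rule PiE_I) (simp_all add: cl Tc that)
      show "is_adjoint ?M ?M (\<lambda>x\<in>B. k *\<^sub>C T x) (\<lambda>x\<in>B. cnj k *\<^sub>C adjoint_of ?M ?M T x)"
      proof (rule is_adjointI)
        show "(\<lambda>x\<in>B. cnj k *\<^sub>C adjoint_of ?M ?M T x) \<in> carrier ?M \<rightarrow>\<^sub>E carrier ?M"
          by (rule PiE_I) (simp_all add: cl Tc T')
      qed (use adjointableD(5)[OF H that] in \<open>simp add: star_scaleC mult_scaleC_left mult_scaleC_right\<close>)
    qed
    have mult: "compose B S T \<in> adjointable ?M ?M" if "S \<in> adjointable ?M ?M" "T \<in> adjointable ?M ?M" for S T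
    proof (rule adjointableI)
      note S' = adjoint_of_adjointable(1)[OF H H that(1)] and T' = adjoint_of_adjointable(1)[OF H H that(2)]
      show "compose B S T \<in> carrier ?M \<rightarrow>\<^sub>E carrier ?M" by (rule PiE_I) (simp_all add: compose_def Tc that)
      show "is_adjoint ?M ?M (compose B S T) (compose B (adjoint_of ?M ?M T) (adjoint_of ?M ?M S))"
      proof (rule is_adjointI)
        show "compose B (adjoint_of ?M ?M T) (adjoint_of ?M ?M S) \<in> carrier ?M \<rightarrow>\<^sub>E carrier ?M"
          by (rule PiE_I) (simp_all add: compose_def Tc S' T')
      qed (use adjointableD(5)[OF H that(1)] adjointableD(5)[OF H that(2)] Tc S' T' that in
          \<open>simp add: compose_def\<close>)
    qed
    have "\<sigma> \<in> adjointable ?M ?M \<rightarrow>\<^sub>E adjointable ?M ?M"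
      by (rule PiE_I) (rule s_adj(2), assumption, simp add: \<sigma>_def)
    moreover have "\<sigma> (\<lambda>x\<in>B. S x + T x) = (\<lambda>x\<in>B. \<sigma> S x + \<sigma> T x)"
      if "S \<in> adjointable ?M ?M" "T \<in> adjointable ?M ?M" for S T
      using that add[OF that] by (simp add: \<sigma>_def g b Tc cong: restrict_cong)
    moreover have "\<sigma> (\<lambda>x\<in>B. k *\<^sub>C T x) = (\<lambda>x\<in>B. k *\<^sub>C \<sigma> T x)" if "T \<in> adjointable ?M ?M" for T k
      using that scale[OF that] by (simp add: \<sigma>_def g b Tc cong: restrict_cong)
    moreover have "\<sigma> (compose B S T) = compose B (\<sigma> S) (\<sigma> T)"
      if "S \<in> adjointable ?M ?M" "T \<in> adjointable ?M ?M" for S T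
      using that mult[OF that] by (simp add: \<sigma>_def compose_def g b Tc cong: restrict_cong)
    moreover have "\<sigma> (adjoint_of ?M ?M T) = adjoint_of ?M ?M (\<sigma> T)" if "T \<in> adjointable ?M ?M" for T
      by (rule hilbert.adjoint_of_eq[OF H s_adj(1)[OF that], symmetric])
    ultimately show "\<sigma> \<in> star_hom (multiplier_alg B) (multiplier_alg B)"
      by (simp add: star_hom_def star_linear_def multiplier_alg_simps)
    show "\<sigma> (inc B x) = ?\<rho> x" if "x \<in> B" for x
      using is_adjoint_inc(2)[OF B that] that
      by (simp add: \<sigma>_def compose_def) (simp add: inc_def g b cl cong: restrict_cong)
  qed
  moreover have "\<tau> = \<sigma>" if P: "?P \<tau>" for \<tau>
  proof (rule extensionalityI[of _ "adjointable ?M ?M"])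
    have \<tau>: "\<tau> \<in> adjointable ?M ?M \<rightarrow>\<^sub>E adjointable ?M ?M"
        "\<And>S T. S \<in> adjointable ?M ?M \<Longrightarrow> T \<in> adjointable ?M ?M \<Longrightarrow> \<tau> (compose B S T) = compose B (\<tau> S) (\<tau> T)"
        "\<And>x. x \<in> B \<Longrightarrow> \<tau> (inc B x) = inc B (\<beta> x)"
      using P by (simp_all add: star_hom_def star_linear_def multiplier_alg_simps compose_def)
    show "\<tau> \<in> extensional (adjointable ?M ?M)" using \<tau>(1) by (simp add: PiE_def)
    show "\<sigma> \<in> extensional (adjointable ?M ?M)" by (simp add: \<sigma>_def)
    fix T assume T: "T \<in> adjointable ?M ?M"
    have tT: "\<tau> T \<in> adjointable ?M ?M" using \<tau>(1) T by (rule PiE_mem)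
    have key: "\<tau> T (\<beta> x) = \<beta> (T x)" if x: "x \<in> B" for x
    proof -
      have "compose B T (inc B x) = inc B (T x)"
        using x T by (simp add: compose_def inc_def Tact Tc cong: restrict_cong)
      then have *: "compose B (\<tau> T) (inc B (\<beta> x)) = inc B (\<beta> (T x))"
        using \<tau>(2)[OF T is_adjoint_inc(2)[OF B x]] \<tau>(3)[OF x] \<tau>(3)[OF Tc[OF T x]] by simp
      \<comment> \<open>Elements of \<open>B\<close> are separated by right multiplication: against
        the adjoint of the difference one gets \<open>?d * star ?d = 0\<close>, hence
        \<open>?d = 0\<close>.\<close>
      let ?d = "\<tau> T (\<beta> x) - \<beta> (T x)"
      have dB: "?d \<in> B" using x T tT by (simp add: cl b Tc)
      have "\<tau> T (\<beta> x) * star ?d = \<beta> (T x) * star ?d"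
        using fun_cong[OF *, of "star ?d"] cl(5)[OF dB] x T tT by (simp add: compose_def inc_def Tact Tc b)
      then have "?d * star ?d = 0" by (simp add: left_diff_distrib)
      then have "?d = 0" using norm_mult_star[of ?d] by simp
      then show ?thesis by simp
    qed
    show "\<tau> T = \<sigma> T"
    proof (rule extensionalityI[OF ext[OF tT] ext[OF s_adj(2)[OF T]]])
      fix x assume x: "x \<in> B"
      show "\<tau> T x = \<sigma> T x" using key[of "?\<gamma> x"] x T by (simp add: \<sigma>_def g)
    qed
  qed
  ultimately have "multiplier_ext B B ?\<rho> = \<sigma>"
    unfolding multiplier_ext_def by (intro the_equality)
  then show ?thesis using \<open>?P \<sigma>\<close> c by (simp add: compose_def)
qed

section \<open>Morphisms twisted by automorphisms\<close>

text \<open>The inclusion is the twist by the identity automorphism, so identity morphisms fall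
  under the calculus of \<open>twist\<close>. For this automorphism \<open>U\<close> is adjointable
  in the ordinary sense, with adjoint \<open>V\<close>.\<close>

lemma tensor_unit_eq:
  assumes "hilbert E"
  shows "compose (base E) (inc (base E)) (\<lambda>b\<in>base E. b) = inc (base E)"
    "tensor_unit E = twist_U E (\<lambda>b\<in>base E. b)"
proof -
  interpret hilbert E by (rule assms)
  interpret tw: twist E "\<lambda>b\<in>base E. b"
    by (intro twist.intro twist_axioms.intro assms star_aut_id cstar_base)
  show inc: "compose (base E) (inc (base E)) (\<lambda>b\<in>base E. b) = inc (base E)"
    by (simp add: compose_def inc_def cong: restrict_cong)
  have gid: "inv_into (base E) (\<lambda>b\<in>base E. b) b = b" if "b \<in> base E" for b
    using tw.gamma_beta[OF that] that by simp
  have U: "tw.U \<in> adjointable tw.D E"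
  proof (rule adjointableI[OF tw.U_PiE])
    show "is_adjoint tw.D E tw.U tw.V"
      by (rule is_adjointI[OF tw.V_PiE]) (simp add: tw.hinner_D)
  qed
  have "tensor_unit E =
      (THE i. i \<in> adjointable tw.D E \<and> (\<forall>x\<in>carrier E. \<forall>b\<in>base E. i (tw.dt x b) = hact E x b))"
    by (simp only: tensor_unit_def Let_def inc)
  also have "\<dots> = tw.U"
  proof (rule the_equality)
    show "tw.U \<in> adjointable tw.D E \<and> (\<forall>x\<in>carrier E. \<forall>b\<in>base E. tw.U (tw.dt x b) = hact E x b)"
      using U by (simp add: tw.U_dot gid)
    fix i assume i: "i \<in> adjointable tw.D E \<and> (\<forall>x\<in>carrier E. \<forall>b\<in>base E. i (tw.dt x b) = hact E x b)"
    show "i = tw.U"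
    proof (rule adjointable_eqI[of tw.D E _ _ "{tw.dt x c |x c. x \<in> carrier E \<and> c \<in> base E}"])
      show "hilbert tw.D" "hilbert E" by (rule tw.D.hilbert_axioms, rule assms)
      show "i \<in> adjointable tw.D E" "tw.U \<in> adjointable tw.D E" using i U by simp_all
      show "p = \<zero>\<^bsub>tw.D\<^esub>" if "p \<in> carrier tw.D"
        "\<And>z. z \<in> {tw.dt x c |x c. x \<in> carrier E \<and> c \<in> base E} \<Longrightarrow> hinner tw.D z p = 0" for p
        by (rule tw.dot_total) (use that in auto)
      show "i z = tw.U z" if "z \<in> {tw.dt x c |x c. x \<in> carrier E \<and> c \<in> base E}" for z
        using that i by (auto simp: tw.U_dot gid)
    qed auto
  qed
  finally show "tensor_unit E = tw.U" .
qed

text \<open>Both modules are copies of \<open>E\<close> with inner products twisted by the same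
  automorphism, so unwrapping twice and wrapping once preserves inner products. The inverse is made
  explicit because composition of morphisms refers to \<open>inv_into\<close>.\<close>

lemma tensor_assoc_eq:
  assumes E: "hilbert E" and b1: "\<beta>\<^sub>1 \<in> star_aut (base E)" and b2: "\<beta>\<^sub>2 \<in> star_aut (base E)"
  defines "B \<equiv> base E"
  defines "\<beta> \<equiv> compose B \<beta>\<^sub>2 \<beta>\<^sub>1" and "D\<^sub>1 \<equiv> twisted_tensor E \<beta>\<^sub>1"
  shows "compose B (multiplier_ext B B (compose B (inc B) \<beta>\<^sub>2)) (compose B (inc B) \<beta>\<^sub>1) = compose B (inc B) \<beta>"
    "tensor_assoc E (compose B (inc B) \<beta>\<^sub>1) B (compose B (inc B) \<beta>\<^sub>2) B =
     (\<lambda>p\<in>carrier (twisted_tensor D\<^sub>1 \<beta>\<^sub>2). twisted_V E \<beta> (twist_U E \<beta>\<^sub>1 (twist_U D\<^sub>1 \<beta>\<^sub>2 p)))" (is "_ = ?S")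
    "q \<in> carrier (twisted_tensor E \<beta>) \<Longrightarrow>
     inv_into (carrier (twisted_tensor D\<^sub>1 \<beta>\<^sub>2))
       (tensor_assoc E (compose B (inc B) \<beta>\<^sub>1) B (compose B (inc B) \<beta>\<^sub>2) B) q =
     twisted_V D\<^sub>1 \<beta>\<^sub>2 (twisted_V E \<beta>\<^sub>1 (twist_U E \<beta> q))"
proof -
  interpret E: hilbert E by (rule E)
  note [simp] = B_def D\<^sub>1_def
  have B: "cstar_alg B" by (simp add: E.cstar_base)
  interpret t1: twist E \<beta>\<^sub>1 by (intro twist.intro twist_axioms.intro E b1)
  have base1: "base D\<^sub>1 = B" "base E = B" by simp_all
  interpret t2: twist D\<^sub>1 \<beta>\<^sub>2
    using b2 by (intro twist.intro twist_axioms.intro) (simp_all add: t1.D.hilbert_axioms)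
  have beta: "\<beta> \<in> star_aut (base E)"
    unfolding \<beta>_def using b1 b2 B by (simp add: star_aut_compose)
  interpret t: twist E \<beta> by (intro twist.intro twist_axioms.intro E beta)
  note [simp] = t2.V_closed[unfolded D\<^sub>1_def t1.base_D] t2.U_closed[unfolded D\<^sub>1_def t1.base_D]
    t2.V_U[unfolded D\<^sub>1_def t1.base_D] t2.U_V[unfolded D\<^sub>1_def t1.base_D]
  note hinner_D2 = t2.hinner_D[unfolded D\<^sub>1_def t1.base_D]
  note r1 = t1.r[simplified] and r2 = t2.r[simplified] and clB = cstar_alg_closed[OF B]
  have beta_apply: "\<beta> b = \<beta>\<^sub>2 (\<beta>\<^sub>1 b)" if "b \<in> B" for b
    using that by (simp add: \<beta>_def compose_def)
  show \<rho>: "compose B (multiplier_ext B B (compose B (inc B) \<beta>\<^sub>2)) (compose B (inc B) \<beta>\<^sub>1) = compose B (inc B) \<beta>"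
  proof (rule extensionalityI[of _ B])
    show "compose B (multiplier_ext B B (compose B (inc B) \<beta>\<^sub>2)) (compose B (inc B) \<beta>\<^sub>1) b = compose B (inc B) \<beta> b"
      if "b \<in> B" for b
      using that r1(3)[of b] multiplier_ext_inc[OF E.cstar_base b2, of "\<beta>\<^sub>1 b"] beta_apply[OF that]
      by (simp add: compose_eq)
  qed (rule compose_extensional)+
  have V1 [simp]: "twisted_V E \<beta>\<^sub>1 x \<in> carrier D\<^sub>1" if "x \<in> carrier E" for x
    using t1.V_closed[OF that] by simp
  have U1 [simp]: "twist_U E \<beta>\<^sub>1 p \<in> carrier E" "twisted_V E \<beta>\<^sub>1 (twist_U E \<beta>\<^sub>1 p) = p" if "p \<in> carrier D\<^sub>1" for p
    using t1.U_closed[of p] t1.V_U[of p] that by simp_all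
  have inner1: "hinner D\<^sub>1 p q = \<beta>\<^sub>1 (hinner E (twist_U E \<beta>\<^sub>1 p) (twist_U E \<beta>\<^sub>1 q))"
    if "p \<in> carrier D\<^sub>1" "q \<in> carrier D\<^sub>1" for p q
    using t1.hinner_D[of p q] that by simp
  let ?T = "\<lambda>q\<in>carrier t.D. twisted_V D\<^sub>1 \<beta>\<^sub>2 (twisted_V E \<beta>\<^sub>1 (twist_U E \<beta> q))"
  have S: "?S \<in> carrier t2.D \<rightarrow>\<^sub>E carrier t.D" by (rule PiE_I) simp_all
  have T: "?T \<in> carrier t.D \<rightarrow>\<^sub>E carrier t2.D" by (rule PiE_I) simp_all
  have ST: "?T (?S p) = p" if "p \<in> carrier t2.D" for p using that by simp
  have "inj_on ?S (carrier t2.D)" by (rule inj_on_inverseI[of _ ?T]) (rule ST)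
  moreover have TS: "?S (?T q) = q" if "q \<in> carrier t.D" for q using that by simp
  ultimately have inv: "inv_into (carrier (twisted_tensor D\<^sub>1 \<beta>\<^sub>2)) ?S q = twisted_V D\<^sub>1 \<beta>\<^sub>2 (twisted_V E \<beta>\<^sub>1 (twist_U E \<beta> q))"
    if "q \<in> carrier (twisted_tensor E \<beta>)" for q
    using that inv_into_f_eq[of ?S "carrier t2.D" "?T q" q] TS[OF that] PiE_mem[OF T, of q] by simp
  have adj: "?S \<in> adjointable t2.D t.D"
  proof (rule adjointableI[OF S])
    show "is_adjoint t2.D t.D ?S ?T"
    proof (rule is_adjointI[OF T])
      fix p q assume pq: "p \<in> carrier t2.D" "q \<in> carrier t.D"
      then show "hinner t.D (?S p) q = hinner t2.D p (?T q)"
        by (simp add: t.hinner_D hinner_D2 t1.hinner_D beta_apply)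
    qed
  qed
  have dot: "?S (t2.dt (t1.dt x b) c) = t.dt x (\<beta>\<^sub>2 b * c)" if x: "x \<in> carrier E" "b \<in> B" "c \<in> B" for x b c
  proof -
    let ?c = "inv_into B \<beta>\<^sub>2 c" and ?g = "inv_into B \<beta>\<^sub>1"
    have c: "?c \<in> B" "\<beta>\<^sub>2 ?c = c" using t2.g(3)[of c] t2.beta_gamma[of c] x by simp_all
    have d1: "t1.dt x b \<in> carrier D\<^sub>1" using t1.dot_closed[of x b] x by simp
    have d2: "t2.dt (t1.dt x b) c \<in> carrier t2.D" using d1 x by (intro t2.dot_closed) simp_all
    have "twist_U D\<^sub>1 \<beta>\<^sub>2 (t2.dt (t1.dt x b) c) = hact D\<^sub>1 (t1.dt x b) ?c"
      using t2.U_dot[OF d1, of c] x by simp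
    also have "\<dots> = t1.dt x (b * ?c)" using t1.act_dot[of x b ?c] x c by simp
    finally have "twist_U E \<beta>\<^sub>1 (twist_U D\<^sub>1 \<beta>\<^sub>2 (t2.dt (t1.dt x b) c)) = hact E x (?g (b * ?c))"
      using t1.U_dot[of x "b * ?c"] x c clB by simp
    moreover have "twisted_V E \<beta> (hact E x (?g (b * ?c))) = t.dt x (\<beta>\<^sub>2 b * c)"
      using t.V_act_dot[of x "?g (b * ?c)"] t1.g(3)[of "b * ?c"] t1.beta_gamma[of "b * ?c"] x c clB
      by (simp add: beta_apply r2)
    ultimately show ?thesis using d2 by simp
  qed
  have \<rho>2: "compose B (inc B) \<beta>\<^sub>2 b c = \<beta>\<^sub>2 b * c" if "b \<in> B" "c \<in> B" for b c
    using t2.rho[of b c] that by simp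
  let ?P = "\<lambda>X. X \<in> adjointable t2.D t.D \<and> (\<forall>x\<in>carrier E. \<forall>b\<in>B. \<forall>c\<in>B. X (t2.dt (t1.dt x b) c) = t.dt x (compose B (inc B) \<beta>\<^sub>2 b c))"
  have "?P ?S" using adj dot by (simp add: \<rho>2[unfolded B_def] del: restrict_apply)
  moreover have "X = ?S" if X: "?P X" for X
  proof (rule adjointable_eqI[of t2.D t.D _ _ "{t2.dt (t1.dt x b) c |x b c. x \<in> carrier E \<and> b \<in> B \<and> c \<in> B}"])
    show "hilbert t2.D" "hilbert t.D" by (rule t2.D.hilbert_axioms, rule t.D.hilbert_axioms)
    show "X \<in> adjointable t2.D t.D" "?S \<in> adjointable t2.D t.D" using X adj by simp_all
    show "{t2.dt (t1.dt x b) c |x b c. x \<in> carrier E \<and> b \<in> B \<and> c \<in> B} \<subseteq> carrier t2.D"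
      using t1.dot_closed t2.dot_closed by auto
    show "X z = ?S z" if "z \<in> {t2.dt (t1.dt x b) c |x b c. x \<in> carrier E \<and> b \<in> B \<and> c \<in> B}" for z
      using that X dot by (auto simp: \<rho>2[unfolded B_def] simp del: restrict_apply)
    fix p assume p: "p \<in> carrier t2.D"
      "\<And>z. z \<in> {t2.dt (t1.dt x b) c |x b c. x \<in> carrier E \<and> b \<in> B \<and> c \<in> B} \<Longrightarrow> hinner t2.D z p = 0"
    have "twist_U D\<^sub>1 \<beta>\<^sub>2 p = \<zero>\<^bsub>t1.D\<^esub>"
    proof (rule t1.dot_total)
      show "twist_U D\<^sub>1 \<beta>\<^sub>2 p \<in> carrier t1.D" using t2.U_closed[OF p(1)] by simp
      fix x b assume xb: "x \<in> carrier E" "b \<in> base E"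
      \<comment> \<open>To exploit orthogonality to all double tensors, the last factor is taken to
        be \<open>\<beta>\<^sub>2 a\<close> itself: the inner product becomes
        \<open>star (\<beta>\<^sub>2 a) * \<beta>\<^sub>2 a\<close>, and its vanishing gives
        \<open>a = 0\<close>.\<close>
      define a where "a = hinner D\<^sub>1 (t1.dt x b) (twist_U D\<^sub>1 \<beta>\<^sub>2 p)"
      have d1: "t1.dt x b \<in> carrier D\<^sub>1" using t1.dot_closed[OF xb] by simp
      have aB: "a \<in> B" using t2.hinner_closed[OF d1 t2.U_closed[OF p(1)]] by (simp add: a_def)
      have b2a: "\<beta>\<^sub>2 a \<in> base D\<^sub>1" using r2(3)[of a] aB by simp
      have e: "hinner t2.D (t2.dt (t1.dt x b) (\<beta>\<^sub>2 a)) p = star (\<beta>\<^sub>2 a) * \<beta>\<^sub>2 a"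
        by (rule t2.inner_dot_V[OF t2.U_closed[OF p(1)] d1 b2a, unfolded t2.V_U[OF p(1)], folded a_def])
      have "hinner t2.D (t2.dt (t1.dt x b) (\<beta>\<^sub>2 a)) p = 0"
        by (rule p(2)) (use xb b2a in auto)
      with e have "\<beta>\<^sub>2 a = 0" using cstar_identity[of "\<beta>\<^sub>2 a"] by simp
      then have "a = 0" using t2.beta_inj[of a 0] aB clB[unfolded B_def] r2(9) by simp
      then show "hinner t1.D (t1.dt x b) (twist_U D\<^sub>1 \<beta>\<^sub>2 p) = 0" by (simp add: a_def)
    qed
    then show "p = \<zero>\<^bsub>t2.D\<^esub>"
      by (intro t2.U_eq_zeroD[OF p(1)]) (simp only: D\<^sub>1_def)
  qed
  ultimately have "(THE X. ?P X) = ?S" by (rule the_equality)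
  then show assoc: "tensor_assoc E (compose B (inc B) \<beta>\<^sub>1) B (compose B (inc B) \<beta>\<^sub>2) B = ?S"
    unfolding tensor_assoc_def Let_def by (simp only: B_def D\<^sub>1_def t1.base_D \<rho>[unfolded B_def])
  show "inv_into (carrier (twisted_tensor D\<^sub>1 \<beta>\<^sub>2))
       (tensor_assoc E (compose B (inc B) \<beta>\<^sub>1) B (compose B (inc B) \<beta>\<^sub>2) B) q =
     twisted_V D\<^sub>1 \<beta>\<^sub>2 (twisted_V E \<beta>\<^sub>1 (twist_U E \<beta> q))" if "q \<in> carrier (twisted_tensor E \<beta>)"
    unfolding assoc by (rule inv[OF that])
qed

text \<open>The inverse of the associativity map ends with \<open>V\<close> of the second twist and
  the amplified map begins with the matching \<open>U\<close>; these cancel and leave maps \<eta>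
  and \<open>V\<close> in alternation.\<close>

lemma poscor_comp_twist:
  assumes E: "hilbert E" and b1: "\<beta>\<^sub>1 \<in> star_aut (base E)" and b2: "\<beta>\<^sub>2 \<in> star_aut (base E)"
    and eta: "\<eta>\<^sub>1 \<in> adjointable (twisted_tensor E \<beta>\<^sub>1) E"
  defines "B \<equiv> base E"
  defines "\<beta> \<equiv> compose B \<beta>\<^sub>2 \<beta>\<^sub>1"
  shows "poscor_comp A (E, \<phi>) (E, \<phi>) (E, \<phi>) (compose B (inc B) \<beta>\<^sub>2, \<eta>\<^sub>2, \<alpha>\<^sub>2) (compose B (inc B) \<beta>\<^sub>1, \<eta>\<^sub>1, \<alpha>\<^sub>1) =
    (compose B (inc B) \<beta>,
     (\<lambda>z\<in>carrier (twisted_tensor E \<beta>). \<eta>\<^sub>2 (twisted_V E \<beta>\<^sub>2 (\<eta>\<^sub>1 (twisted_V E \<beta>\<^sub>1 (twist_U E \<beta> z))))),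
     compose A \<alpha>\<^sub>2 \<alpha>\<^sub>1)"
proof -
  interpret E: hilbert E by (rule E)
  interpret t1: twist E \<beta>\<^sub>1 by (intro twist.intro twist_axioms.intro E b1)
  interpret e2: twist E \<beta>\<^sub>2 by (intro twist.intro twist_axioms.intro E b2)
  have beta: "\<beta> \<in> star_aut (base E)"
    unfolding \<beta>_def B_def by (rule star_aut_compose[OF E.cstar_base b2 b1])
  interpret t: twist E \<beta> by (intro twist.intro twist_axioms.intro E beta)
  let ?D = "twisted_tensor E \<beta>\<^sub>1"
  have base1: "base ?D = base E" by simp
  interpret t2: twist ?D \<beta>\<^sub>2
    using b2 by (intro twist.intro twist_axioms.intro t1.D.hilbert_axioms) simp
  note assoc = tensor_assoc_eq[OF E b1 b2, folded B_def \<beta>_def]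
  have amp: "amplify ?D E (compose B (inc B) \<beta>\<^sub>2) B \<eta>\<^sub>1 p = twisted_V E \<beta>\<^sub>2 (\<eta>\<^sub>1 (twist_U ?D \<beta>\<^sub>2 p))"
    if "p \<in> carrier (twisted_tensor ?D \<beta>\<^sub>2)" for p
    using amplify_twist[OF t2.twist_axioms e2.twist_axioms base1[symmetric] eta] that by (simp add: B_def)
  have mem: "twisted_V ?D \<beta>\<^sub>2 (twisted_V E \<beta>\<^sub>1 (twist_U E \<beta> z)) \<in> carrier (twisted_tensor ?D \<beta>\<^sub>2)"
    if "z \<in> carrier (twisted_tensor E \<beta>)" for z
    by (intro t2.V_closed t1.V_closed t.U_closed that)
  have inv: "inv_into (carrier (interior_tensor ?D (compose B (inc B) \<beta>\<^sub>2) B))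
      (tensor_assoc E (compose B (inc B) \<beta>\<^sub>1) B (compose B (inc B) \<beta>\<^sub>2) B) z =
      twisted_V ?D \<beta>\<^sub>2 (twisted_V E \<beta>\<^sub>1 (twist_U E \<beta> z))" if "z \<in> carrier (twisted_tensor E \<beta>)" for z
    using assoc(3)[of z] that by (simp add: B_def \<beta>_def)
  have UV: "twist_U ?D \<beta>\<^sub>2 (twisted_V ?D \<beta>\<^sub>2 (twisted_V E \<beta>\<^sub>1 (twist_U E \<beta> z))) = twisted_V E \<beta>\<^sub>1 (twist_U E \<beta> z)"
    if "z \<in> carrier (twisted_tensor E \<beta>)" for z
    by (intro t2.U_V t1.V_closed t.U_closed that)
  show ?thesis
    unfolding poscor_comp_def Let_def
    using inv amp mem UV by (simp add: assoc(1)[unfolded B_def \<beta>_def] B_def \<beta>_def cong: restrict_cong)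
qed

section \<open>Equivariant correspondences and functors\<close>

lemma compose_PiE: "(\<And>x. x \<in> S \<Longrightarrow> f (g x) \<in> T) \<Longrightarrow> compose S f g \<in> S \<rightarrow>\<^sub>E T"
  by (rule PiE_I) (simp_all add: compose_def)

context twist
begin

text \<open>The adjoint is \<open>V\<close> after the twisted adjoint \<open>f\<close>: the inner
  product of the tensor product is \<beta> of that of \<open>E\<close>, and this \<beta> is the one
  in the condition on \<open>f\<close>.\<close>

lemma unitary_of_twisted_unitary:
  assumes W: "twisted_unitary \<beta> E E W"
  shows "unitary_op D E (compose (carrier D) W U)"
proof -
  obtain f where f: "is_twisted_adjoint \<beta> E E W f" "\<And>x. x \<in> carrier E \<Longrightarrow> f (W x) = x"
      "\<And>y. y \<in> carrier E \<Longrightarrow> W (f y) = y"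
    using W by (auto simp: twisted_unitary_def)
  have WE: "W x \<in> carrier E" if "x \<in> carrier E" for x
    using W that by (auto simp: twisted_unitary_def twisted_linear_def bounded_maps_def)
  have fE: "f x \<in> carrier E" if "x \<in> carrier E" for x
    using f(1) that by (auto simp: is_twisted_adjoint_def twisted_linear_def bounded_maps_def)
  have inner: "hinner E (W x) y = \<beta> (hinner E x (f y))" if "x \<in> carrier E" "y \<in> carrier E" for x y
    using f(1) that by (simp add: is_twisted_adjoint_def)
  have eta: "compose (carrier D) W U \<in> carrier D \<rightarrow>\<^sub>E carrier E"
    by (rule compose_PiE) (simp add: WE)
  have adj: "is_adjoint D E (compose (carrier D) W U) (\<lambda>y\<in>carrier E. V (f y))"
  proof (rule is_adjointI)
    show "(\<lambda>y\<in>carrier E. V (f y)) \<in> carrier E \<rightarrow>\<^sub>E carrier D" by (rule PiE_I) (simp_all add: fE)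
  qed (simp add: compose_eq inner hinner_D fE)
  show ?thesis
    using adjointableI[OF eta adj]
    by (simp add: unitary_op_def D.adjoint_of_eq[OF adj] compose_eq WE fE f(2,3))
qed

text \<open>The twisted adjoint is \<open>U\<close> after the adjoint of \<eta>. All maps involved
  preserve norms, so 1 is a bound for each of them.\<close>

lemma twisted_unitary_of_unitary:
  assumes eta: "unitary_op D E \<eta>"
  shows "twisted_unitary \<beta> E E (compose (carrier E) \<eta> V)"
proof -
  have adj: "\<eta> \<in> adjointable D E" and inv: "\<And>p. p \<in> carrier D \<Longrightarrow> adjoint_of D E \<eta> (\<eta> p) = p"
    "\<And>y. y \<in> carrier E \<Longrightarrow> \<eta> (adjoint_of D E \<eta> y) = y"
    using eta by (auto simp: unitary_op_def)
  let ?s = "adjoint_of D E \<eta>"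
  note d = adjointableD[OF D.hilbert_axioms adj]
  note lin = adjointable_linear[OF D.hilbert_axioms hilbert_axioms adj base_D[symmetric]]
  note lin' = adjointable_linear[OF hilbert_axioms D.hilbert_axioms
      adjoint_of_adjointable(1)[OF D.hilbert_axioms hilbert_axioms adj] base_D]
  have n1: "hnorm E (\<eta> p) = hnorm D p" if "p \<in> carrier D" for p
    using that unitary_op_isometric[OF D.hilbert_axioms hilbert_axioms eta, of p p] by (simp add: hnorm_def)
  have n2: "hnorm D (?s y) = hnorm E y" if "y \<in> carrier E" for y
    using n1[of "?s y"] that d(4) by (simp add: inv)
  have 1: "twisted_linear \<beta> E E (compose (carrier E) \<eta> V)"
    unfolding twisted_linear_def bounded_maps_def mem_Collect_eq
  proof (intro conjI ballI allI exI[of _ 1])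
    show "compose (carrier E) \<eta> V \<in> carrier E \<rightarrow>\<^sub>E carrier E"
      by (rule compose_PiE) (simp add: d(2))
  qed (simp_all add: compose_eq V_add V_scale V_act lin n1 hnorm_V r)
  have 2: "twisted_linear \<gamma> E E (compose (carrier E) U ?s)"
    unfolding twisted_linear_def bounded_maps_def mem_Collect_eq
  proof (intro conjI ballI allI exI[of _ 1])
    show "compose (carrier E) U ?s \<in> carrier E \<rightarrow>\<^sub>E carrier E"
      by (rule compose_PiE) (simp add: d(4))
  qed (simp_all add: compose_eq U_add U_scale U_act lin' d(4) n2 hnorm_U)
  show ?thesis
    unfolding twisted_unitary_def is_twisted_adjoint_def
  proof (intro conjI 1 exI[of _ "compose (carrier E) U ?s"] 2 ballI)
    fix x y assume "x \<in> carrier E" "y \<in> carrier E"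
    then show "hinner E (compose (carrier E) \<eta> V x) y = \<beta> (hinner E x (compose (carrier E) U ?s y))"
      by (simp add: compose_eq d(4,5) hinner_D)
  qed (simp_all add: compose_eq d(2,4) inv)
qed

lemma compose_V_U: "\<eta> \<in> extensional (carrier D) \<Longrightarrow> compose (carrier D) (compose (carrier E) \<eta> V) U = \<eta>"
  by (rule extensionalityI[of _ "carrier D"]) (simp_all add: compose_eq)

lemma compose_U_V: "W \<in> extensional (carrier E) \<Longrightarrow> compose (carrier E) (compose (carrier D) W U) V = W"
  by (rule extensionalityI[of _ "carrier E"]) (simp_all add: compose_eq)

end

lemma twisted_unitary_Bij:
  assumes "twisted_unitary \<beta> E E W"
  shows "W \<in> Bij (carrier E)"
proof -
  obtain f where f: "f \<in> carrier E \<rightarrow>\<^sub>E carrier E" "\<And>x. x \<in> carrier E \<Longrightarrow> f (W x) = x"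
      "\<And>y. y \<in> carrier E \<Longrightarrow> W (f y) = y"
    using assms by (auto simp: twisted_unitary_def is_twisted_adjoint_def twisted_linear_def bounded_maps_def)
  have W: "W \<in> carrier E \<rightarrow>\<^sub>E carrier E"
    using assms by (simp add: twisted_unitary_def twisted_linear_def bounded_maps_def)
  have "bij_betw W (carrier E) (carrier E)"
    by (rule bij_betw_byWitness[where f' = f]) (use W f in auto)
  then show ?thesis using W by (simp add: Bij_def PiE_def)
qed

lemma hom_BijGroupD:
  assumes G: "group G" and f: "f \<in> hom G (BijGroup S)"
  shows "g \<in> carrier G \<Longrightarrow> f g \<in> Bij S"
    "g \<in> carrier G \<Longrightarrow> h \<in> carrier G \<Longrightarrow> f (g \<otimes>\<^bsub>G\<^esub> h) = compose S (f g) (f h)"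
    "f \<one>\<^bsub>G\<^esub> = (\<lambda>x\<in>S. x)"
proof -
  show 1: "f g \<in> Bij S" if "g \<in> carrier G" for g
    using hom_in_carrier[OF f that] by (simp add: BijGroup_def)
  show "f (g \<otimes>\<^bsub>G\<^esub> h) = compose S (f g) (f h)" if "g \<in> carrier G" "h \<in> carrier G"
    using hom_mult[OF f that] 1[OF that(1)] 1[OF that(2)] by (simp add: BijGroup_def)
  show "f \<one>\<^bsub>G\<^esub> = (\<lambda>x\<in>S. x)"
    using hom_one[OF f G group_BijGroup] by (simp add: BijGroup_def)
qed

lemma is_functor_BG:
  "is_functor (BG G) (PosCor A) (Fo, Fm) \<longleftrightarrow> Fo () \<in> Ob (PosCor A) \<and>
     Fm () () \<in> carrier G \<rightarrow>\<^sub>E poscor_hom A (Fo ()) (Fo ()) \<and> Fm () () \<one>\<^bsub>G\<^esub> = poscor_id A (Fo ()) \<and>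
     (\<forall>g\<in>carrier G. \<forall>h\<in>carrier G. Fm () () (g \<otimes>\<^bsub>G\<^esub> h) =
        poscor_comp A (Fo ()) (Fo ()) (Fo ()) (Fm () () g) (Fm () () h))"
  by (auto simp: is_functor_def BG_def PosCor_def)

locale correspondence =
  fixes A :: "'a::cstar_algebra set" and B :: "'b::cstar_algebra set"
    and G :: "('g, 'z) monoid_scheme" and \<alpha> :: "'g \<Rightarrow> 'a \<Rightarrow> 'a" and \<beta> :: "'g \<Rightarrow> 'b \<Rightarrow> 'b"
    and E :: "('b, 'e) hmodule" and \<phi> :: "'a \<Rightarrow> 'e \<Rightarrow> 'e"
  assumes sysA: "dynamical_system A G \<alpha>" and sysB: "dynamical_system B G \<beta>"
    and corr: "strict_pos_corr A B (E, \<phi>)"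
begin

lemma group_G: "group G" and cstar_A: "cstar_alg A"
  using sysA by (simp_all add: dynamical_system_def)

lemma hilbert_E: "hilbert E" and base_E: "base E = B" and phi: "a \<in> A \<Longrightarrow> \<phi> a \<in> adjointable E E"
  using corr by (auto simp: strict_pos_corr_def hilbert_module_iff completely_positive_def star_linear_def
      alg_def op_alg_def)

lemma alpha: "g \<in> carrier G \<Longrightarrow> \<alpha> g \<in> star_aut A"
    "g \<in> carrier G \<Longrightarrow> h \<in> carrier G \<Longrightarrow> \<alpha> (g \<otimes>\<^bsub>G\<^esub> h) = compose A (\<alpha> g) (\<alpha> h)"
    "\<alpha> \<one>\<^bsub>G\<^esub> = (\<lambda>a\<in>A. a)"
  using sysA hom_BijGroupD[of G \<alpha> A] by (auto simp: dynamical_system_def)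

lemma beta: "g \<in> carrier G \<Longrightarrow> \<beta> g \<in> star_aut B"
    "g \<in> carrier G \<Longrightarrow> h \<in> carrier G \<Longrightarrow> \<beta> (g \<otimes>\<^bsub>G\<^esub> h) = compose B (\<beta> g) (\<beta> h)"
    "\<beta> \<one>\<^bsub>G\<^esub> = (\<lambda>b\<in>B. b)"
  using sysB hom_BijGroupD[of G \<beta> B] by (auto simp: dynamical_system_def)

lemma twist_beta: "g \<in> carrier G \<Longrightarrow> twist E (\<beta> g)"
  by (intro twist.intro twist_axioms.intro hilbert_E) (simp add: base_E beta)

abbreviation "\<rho> g \<equiv> compose B (inc B) (\<beta> g)"
abbreviation "D g \<equiv> interior_tensor E (\<rho> g) B"
abbreviation "V g \<equiv> tensor_V E (\<rho> g) B"
abbreviation "U g \<equiv> twist_U E (\<beta> g)"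

lemma group_closed: "\<one>\<^bsub>G\<^esub> \<in> carrier G" "g \<in> carrier G \<Longrightarrow> h \<in> carrier G \<Longrightarrow> g \<otimes>\<^bsub>G\<^esub> h \<in> carrier G"
  using group_G by (simp_all add: group.is_monoid monoid.one_closed monoid.m_closed)

context
  fixes g assumes g: "g \<in> carrier G"
begin

interpretation t: twist E "\<beta> g" by (rule twist_beta[OF g])

lemmas UV [simp] = t.U_closed[unfolded base_E] t.V_closed[unfolded base_E] t.V_U[unfolded base_E] t.U_V[unfolded base_E]
lemmas UV_compose = t.compose_V_U[unfolded base_E] t.compose_U_V[unfolded base_E]
lemmas twisted_unitary_iff = t.unitary_of_twisted_unitary[unfolded base_E] t.twisted_unitary_of_unitary[unfolded base_E]
lemmas D_hilbert = t.D.hilbert_axioms[unfolded base_E]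

lemma amplify_phi: "a \<in> A \<Longrightarrow> z \<in> carrier (D g) \<Longrightarrow> amplify E E (\<rho> g) B (\<phi> a) z = V g (\<phi> a (U g z))"
  using amplify_twist[OF t.twist_axioms t.twist_axioms refl phi[of a]] by (simp add: base_E)

end

lemma phi_closed: "a \<in> A \<Longrightarrow> x \<in> carrier E \<Longrightarrow> \<phi> a x \<in> carrier E"
  by (rule adjointableD(2)[OF hilbert_E phi])

text \<open>Every vector of the tensor product is some \<open>V g x\<close>, and there the amplified
  operator yields \<open>V g (\<phi> a x)\<close>. The remaining conditions on a morphism hold
  because \<open>\<beta> g\<close> and \<open>\<alpha> g\<close> are automorphisms.\<close>

lemma poscor_hom_iff:
  assumes g: "g \<in> carrier G"
  shows "(\<rho> g, \<eta>, \<alpha> g) \<in> poscor_hom A (E, \<phi>) (E, \<phi>) \<longleftrightarrow> \<eta> \<in> adjointable (D g) E \<and>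
    (\<forall>a\<in>A. \<forall>x\<in>carrier E. \<eta> (V g (\<phi> a x)) = \<phi> (\<alpha> g a) (\<eta> (V g x)))"
proof -
  have cB: "cstar_alg B" using sysB by (simp add: dynamical_system_def)
  have sub: "\<rho> g ` B \<subseteq> inc B ` B"
    using star_hom_onD(3)[OF star_autD(1)[OF cB beta(1)[OF g]]] by (auto simp: compose_eq)
  have "(\<forall>a\<in>A. \<forall>z\<in>carrier (D g). \<phi> (\<alpha> g a) (\<eta> z) = \<eta> (amplify E E (\<rho> g) B (\<phi> a) z)) \<longleftrightarrow>
    (\<forall>a\<in>A. \<forall>x\<in>carrier E. \<eta> (V g (\<phi> a x)) = \<phi> (\<alpha> g a) (\<eta> (V g x)))" (is "?l \<longleftrightarrow> ?r")
  proof
    assume ?l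
    show ?r
    proof (intro ballI)
      fix a x assume ax: "a \<in> A" "x \<in> carrier E"
      with \<open>?l\<close> have "\<phi> (\<alpha> g a) (\<eta> (V g x)) = \<eta> (amplify E E (\<rho> g) B (\<phi> a) (V g x))" using g by simp
      then show "\<eta> (V g (\<phi> a x)) = \<phi> (\<alpha> g a) (\<eta> (V g x))" using ax g by (simp add: amplify_phi)
    qed
  next
    assume ?r
    show ?l
    proof (intro ballI)
      fix a z assume az: "a \<in> A" "z \<in> carrier (D g)"
      with \<open>?r\<close> have "\<eta> (V g (\<phi> a (U g z))) = \<phi> (\<alpha> g a) (\<eta> (V g (U g z)))" using g by simp
      then show "\<phi> (\<alpha> g a) (\<eta> z) = \<eta> (amplify E E (\<rho> g) B (\<phi> a) z)" using az g by (simp add: amplify_phi)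
    qed
  qed
  then show ?thesis
    using inc_twist_star_hom[OF cB beta(1)[OF g]] nondegenerate_twist[OF cB beta(1)[OF g]] sub alpha(1)[OF g]
    by (simp add: poscor_hom_def base_E)
qed

lemma comp_eq:
  assumes g: "g \<in> carrier G" and h: "h \<in> carrier G" and eta: "\<eta>' \<in> adjointable (D h) E"
  shows "poscor_comp A (E, \<phi>) (E, \<phi>) (E, \<phi>) (\<rho> g, \<eta>, \<alpha> g) (\<rho> h, \<eta>', \<alpha> h) =
    (\<rho> (g \<otimes>\<^bsub>G\<^esub> h), \<lambda>z\<in>carrier (D (g \<otimes>\<^bsub>G\<^esub> h)). \<eta> (V g (\<eta>' (V h (U (g \<otimes>\<^bsub>G\<^esub> h) z)))), \<alpha> (g \<otimes>\<^bsub>G\<^esub> h))"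
  using poscor_comp_twist[OF hilbert_E, of "\<beta> h" "\<beta> g" \<eta>'] beta(1)[OF g] beta(1)[OF h] eta
  by (simp add: base_E beta(2)[OF g h] alpha(2)[OF g h])

lemma id_eq: "poscor_id A (E, \<phi>) = (\<rho> \<one>\<^bsub>G\<^esub>, U \<one>\<^bsub>G\<^esub>, \<alpha> \<one>\<^bsub>G\<^esub>)"
  using tensor_unit_eq[OF hilbert_E] by (simp add: poscor_id_def base_E beta(3) alpha(3))

lemma functor_of_corr_apply:
  "functor_of_corr G \<alpha> \<beta> ((E, \<phi>), W) =
    (\<lambda>_. (E, \<phi>), \<lambda>_ _. \<lambda>g\<in>carrier G. (\<rho> g, compose (carrier (D g)) (W g) (U g), \<alpha> g))"
  by (simp add: functor_of_corr_def base_E Let_def)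

text \<open>Since \<open>?\<eta> g\<close> after \<open>V g\<close> is \<open>W g\<close>, the unit
  and composition laws of the functor are those of the homomorphism \<open>W\<close>.\<close>

lemma functor_of_equivariant:
  assumes W: "((E, \<phi>), W) \<in> equivariant_corr A B G \<alpha> \<beta>"
  shows "is_functor (BG G) (PosCor A) (functor_of_corr G \<alpha> \<beta> ((E, \<phi>), W))"
    "unitary_valued G (functor_of_corr G \<alpha> \<beta> ((E, \<phi>), W))"
    "compatible_functor A B G \<alpha> \<beta> (functor_of_corr G \<alpha> \<beta> ((E, \<phi>), W))"
    "corr_of_functor G \<beta> (functor_of_corr G \<alpha> \<beta> ((E, \<phi>), W)) = ((E, \<phi>), W)"
proof -
  let ?\<eta> = "\<lambda>g. compose (carrier (D g)) (W g) (U g)"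
  have Whom: "W \<in> hom G (BijGroup (carrier E))" and Wext: "W \<in> extensional (carrier G)"
    and Wu: "\<And>g. g \<in> carrier G \<Longrightarrow> twisted_unitary (\<beta> g) E E (W g)"
    and We: "\<And>g a x. g \<in> carrier G \<Longrightarrow> a \<in> A \<Longrightarrow> x \<in> carrier E \<Longrightarrow> W g (\<phi> a x) = \<phi> (\<alpha> g a) (W g x)"
    using W by (auto simp: equivariant_corr_def)
  note hW = hom_BijGroupD[OF group_G Whom]
  have WE: "W g x \<in> carrier E" if "g \<in> carrier G" "x \<in> carrier E" for g x
    using Bij_imp_funcset[OF hW(1)[OF that(1)]] that(2) by auto
  have un: "unitary_op (D g) E (?\<eta> g)" if "g \<in> carrier G" for g
    by (rule twisted_unitary_iff(1)[OF that Wu[OF that]])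
  then have adj: "?\<eta> g \<in> adjointable (D g) E" if "g \<in> carrier G" for g
    using that by (simp add: unitary_op_def)
  have eV: "?\<eta> g (V g x) = W g x" if "g \<in> carrier G" "x \<in> carrier E" for g x
    using that by (simp add: compose_eq)
  have hom: "(\<rho> g, ?\<eta> g, \<alpha> g) \<in> poscor_hom A (E, \<phi>) (E, \<phi>)" if "g \<in> carrier G" for g
    unfolding poscor_hom_iff[OF that] using adj[OF that] that by (simp add: eV We phi_closed)
  have one: "?\<eta> \<one>\<^bsub>G\<^esub> = U \<one>\<^bsub>G\<^esub>"
  proof (rule extensionalityI[of _ "carrier (D \<one>\<^bsub>G\<^esub>)"])
    interpret t: twist E "\<beta> \<one>\<^bsub>G\<^esub>" by (rule twist_beta[OF group_closed(1)])
    show "U \<one>\<^bsub>G\<^esub> \<in> extensional (carrier (D \<one>\<^bsub>G\<^esub>))"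
      using t.U_PiE[unfolded base_E] by (simp add: PiE_def)
  qed (simp_all add: compose_eq hW(3) group_closed)
  \<comment> \<open>Using \<open>eV\<close> twice collapses the right-hand side to
    \<open>W g (W h x)\<close>, where \<open>x\<close> is the image of \<open>z\<close> under
    \<open>U\<close> for the product of \<open>g\<close> and \<open>h\<close>.\<close>
  have mult: "?\<eta> (g \<otimes>\<^bsub>G\<^esub> h) = (\<lambda>z\<in>carrier (D (g \<otimes>\<^bsub>G\<^esub> h)). ?\<eta> g (V g (?\<eta> h (V h (U (g \<otimes>\<^bsub>G\<^esub> h) z)))))"
    if "g \<in> carrier G" "h \<in> carrier G" for g h
  proof (rule extensionalityI[of _ "carrier (D (g \<otimes>\<^bsub>G\<^esub> h))"])
    fix z assume "z \<in> carrier (D (g \<otimes>\<^bsub>G\<^esub> h))"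
    then show "?\<eta> (g \<otimes>\<^bsub>G\<^esub> h) z = (\<lambda>z\<in>carrier (D (g \<otimes>\<^bsub>G\<^esub> h)). ?\<eta> g (V g (?\<eta> h (V h (U (g \<otimes>\<^bsub>G\<^esub> h) z))))) z"
      using that group_closed(2)[OF that] by (simp add: eV WE compose_eq hW(2))
  qed simp_all
  show "is_functor (BG G) (PosCor A) (functor_of_corr G \<alpha> \<beta> ((E, \<phi>), W))"
    unfolding functor_of_corr_apply is_functor_BG
  proof (intro conjI ballI)
    show "(E, \<phi>) \<in> Ob (PosCor A)" using corr by (auto simp: PosCor_def)
    show "(\<lambda>g\<in>carrier G. (\<rho> g, ?\<eta> g, \<alpha> g)) \<in> carrier G \<rightarrow>\<^sub>E poscor_hom A (E, \<phi>) (E, \<phi>)"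
      using hom by (rule restrict_PiE_iff[THEN iffD2, rule_format])
    show "(\<lambda>g\<in>carrier G. (\<rho> g, ?\<eta> g, \<alpha> g)) \<one>\<^bsub>G\<^esub> = poscor_id A (E, \<phi>)"
      by (simp add: id_eq group_closed one)
    fix g h assume gh: "g \<in> carrier G" "h \<in> carrier G"
    then show "(\<lambda>g\<in>carrier G. (\<rho> g, ?\<eta> g, \<alpha> g)) (g \<otimes>\<^bsub>G\<^esub> h) =
      poscor_comp A (E, \<phi>) (E, \<phi>) (E, \<phi>) ((\<lambda>g\<in>carrier G. (\<rho> g, ?\<eta> g, \<alpha> g)) g) ((\<lambda>g\<in>carrier G. (\<rho> g, ?\<eta> g, \<alpha> g)) h)"
      using group_closed(2)[OF gh] by (simp only: restrict_apply' comp_eq[OF gh adj] mult[OF gh])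
  qed
  show "unitary_valued G (functor_of_corr G \<alpha> \<beta> ((E, \<phi>), W))"
    using un by (simp add: functor_of_corr_apply unitary_valued_def base_E)
  show "compatible_functor A B G \<alpha> \<beta> (functor_of_corr G \<alpha> \<beta> ((E, \<phi>), W))"
    using corr by (simp add: functor_of_corr_apply compatible_functor_def)
  have "(\<lambda>g\<in>carrier G. compose (carrier E) (?\<eta> g) (V g)) = W"
  proof (rule extensionalityI[of _ "carrier G"])
    fix g assume g: "g \<in> carrier G"
    then show "(\<lambda>g\<in>carrier G. compose (carrier E) (?\<eta> g) (V g)) g = W g"
      using UV_compose(2)[OF g Bij_imp_extensional[OF hW(1)[OF g]]] by simp
  qed (simp_all add: Wext)
  then show "corr_of_functor G \<beta> (functor_of_corr G \<alpha> \<beta> ((E, \<phi>), W)) = ((E, \<phi>), W)"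
    by (simp add: corr_of_functor_def functor_of_corr_apply Let_def base_E cong: restrict_cong)
qed

lemma equivariant_of_functor:
  assumes F: "is_functor (BG G) (PosCor A) (Fo, Fm)" and un: "unitary_valued G (Fo, Fm)"
    and comp: "compatible_functor A B G \<alpha> \<beta> (Fo, Fm)" and Fo: "Fo () = (E, \<phi>)"
  shows "corr_of_functor G \<beta> (Fo, Fm) \<in> equivariant_corr A B G \<alpha> \<beta>"
    "functor_of_corr G \<alpha> \<beta> (corr_of_functor G \<beta> (Fo, Fm)) = (Fo, Fm)"
    "fst (corr_of_functor G \<beta> (Fo, Fm)) = (E, \<phi>)"
proof -
  define \<eta> where "\<eta> g = fst (snd (Fm () () g))" for g
  define W where "W = (\<lambda>g\<in>carrier G. compose (carrier E) (\<eta> g) (V g))"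
  have Fm: "Fm () () g = (\<rho> g, \<eta> g, \<alpha> g)" if "g \<in> carrier G" for g
    using comp that by (auto simp: compatible_functor_def \<eta>_def)
  note Ff = F[unfolded is_functor_BG Fo]
  have hom: "(\<rho> g, \<eta> g, \<alpha> g) \<in> poscor_hom A (E, \<phi>) (E, \<phi>)" if "g \<in> carrier G" for g
    using Ff that Fm[OF that] by (auto simp: PiE_def Pi_def)
  have adj: "\<eta> g \<in> adjointable (D g) E" if "g \<in> carrier G" for g
    using hom[OF that] by (simp add: poscor_hom_iff[OF that])
  have uni: "unitary_op (D g) E (\<eta> g)" if "g \<in> carrier G" for g
    using un that Fm[OF that] by (auto simp: unitary_valued_def Fo base_E)
  have etaE: "\<eta> g p \<in> carrier E" if "g \<in> carrier G" "p \<in> carrier (D g)" for g p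
    by (rule adjointableD(2)[OF D_hilbert[OF that(1)] adj[OF that(1)] that(2)])
  have Wx: "W g x = \<eta> g (V g x)" if "g \<in> carrier G" "x \<in> carrier E" for g x
    using that by (simp add: W_def compose_eq)
  have cof: "corr_of_functor G \<beta> (Fo, Fm) = ((E, \<phi>), W)"
    by (simp add: corr_of_functor_def Fo W_def \<eta>_def Let_def base_E)
  then show "fst (corr_of_functor G \<beta> (Fo, Fm)) = (E, \<phi>)" by simp
  have Wu: "twisted_unitary (\<beta> g) E E (W g)" if "g \<in> carrier G" for g
    using twisted_unitary_iff(2)[OF that uni[OF that]] that by (simp add: W_def)
  have Wmult: "W (g \<otimes>\<^bsub>G\<^esub> h) = compose (carrier E) (W g) (W h)" if gh: "g \<in> carrier G" "h \<in> carrier G" for g h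
  proof (rule extensionalityI[of _ "carrier E"])
    have "(\<rho> (g \<otimes>\<^bsub>G\<^esub> h), \<eta> (g \<otimes>\<^bsub>G\<^esub> h), \<alpha> (g \<otimes>\<^bsub>G\<^esub> h)) =
        poscor_comp A (E, \<phi>) (E, \<phi>) (E, \<phi>) (\<rho> g, \<eta> g, \<alpha> g) (\<rho> h, \<eta> h, \<alpha> h)"
      using Ff gh Fm[OF gh(1)] Fm[OF gh(2)] Fm[OF group_closed(2)[OF gh]] by simp
    then have "\<eta> (g \<otimes>\<^bsub>G\<^esub> h) = (\<lambda>z\<in>carrier (D (g \<otimes>\<^bsub>G\<^esub> h)). \<eta> g (V g (\<eta> h (V h (U (g \<otimes>\<^bsub>G\<^esub> h) z)))))"
      by (simp add: comp_eq[OF gh adj[OF gh(2)]])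
    \<comment> \<open>At \<open>z = V (g \<otimes> h) x\<close> the innermost \<open>U\<close>
      cancels, and the alternating product is \<open>W g (W h x)\<close>.\<close>
    then show "W (g \<otimes>\<^bsub>G\<^esub> h) x = compose (carrier E) (W g) (W h) x" if "x \<in> carrier E" for x
      using that gh group_closed(2)[OF gh] by (simp add: Wx compose_eq etaE)
    show "W (g \<otimes>\<^bsub>G\<^esub> h) \<in> extensional (carrier E)"
      using group_closed(2)[OF gh] by (simp add: W_def)
  qed simp
  \<comment> \<open>Multiplicativity suffices for a homomorphism of groups; that each
    \<open>W g\<close> is a bijection comes from its twisted adjoint.\<close>
  have "W \<in> hom G (BijGroup (carrier E))"
    using twisted_unitary_Bij[OF Wu] Wmult by (intro homI) (simp_all add: BijGroup_def)
  moreover have "W \<in> extensional (carrier G)" by (simp add: W_def)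
  moreover have "W g (\<phi> a x) = \<phi> (\<alpha> g a) (W g x)" if "g \<in> carrier G" "a \<in> A" "x \<in> carrier E" for g a x
    using hom[OF that(1)] that by (simp add: poscor_hom_iff Wx phi_closed)
  ultimately show "corr_of_functor G \<beta> (Fo, Fm) \<in> equivariant_corr A B G \<alpha> \<beta>"
    unfolding cof equivariant_corr_def using corr Wu by simp
  have eq: "(\<rho> g, compose (carrier (D g)) (W g) (U g), \<alpha> g) = Fm () () g" if g: "g \<in> carrier G" for g
  proof -
    have "\<eta> g \<in> extensional (carrier (D g))"
      using adjointableD(1)[OF D_hilbert[OF g] adj[OF g]] by (simp add: PiE_def)
    then show ?thesis using UV_compose(1)[OF g] g by (simp add: Fm W_def)
  qed
  have "(\<lambda>g\<in>carrier G. (\<rho> g, compose (carrier (D g)) (W g) (U g), \<alpha> g)) = Fm () ()"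
    by (rule extensionalityI[of _ "carrier G"]) (use Ff eq in \<open>auto simp: PiE_def\<close>)
  then show "functor_of_corr G \<alpha> \<beta> (corr_of_functor G \<beta> (Fo, Fm)) = (Fo, Fm)"
    unfolding cof functor_of_corr_apply using Fo by (auto simp: fun_eq_iff)
qed

end

section \<open>Topologies on hom-sets and strong continuity\<close>

lemma star_hom_through_inc:
  assumes B: "cstar_alg B" and C: "cstar_alg C" and f: "f \<in> star_hom (alg B) (multiplier_alg C)"
    and sub: "f ` B \<subseteq> inc C ` C"
  shows "\<exists>r. star_hom_on B C r \<and> (\<forall>b\<in>B. f b = inc C (r b))"
proof -
  note clB = cstar_alg_closed[OF B] and clC = cstar_alg_closed[OF C]
  \<comment> \<open>A left multiplication determines its element: evaluate it on the adjoint of the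
    difference.\<close>
  have inj: "c = d" if "c \<in> C" "d \<in> C" "inc C c = inc C d" for c d
  proof -
    have s: "star (c - d) \<in> C" using that by (simp add: clC)
    have "c * star (c - d) = d * star (c - d)"
      using fun_cong[OF that(3), of "star (c - d)"] that(1,2) s by (simp add: inc_def)
    then have "(c - d) * star (c - d) = 0" by (simp add: left_diff_distrib)
    then show ?thesis using norm_mult_star[of "c - d"] by simp
  qed
  have "\<forall>b\<in>B. \<exists>c. c \<in> C \<and> f b = inc C c" using sub by blast
  then obtain r where r: "\<And>b. b \<in> B \<Longrightarrow> r b \<in> C" "\<And>b. b \<in> B \<Longrightarrow> f b = inc C (r b)" by metis
  have adj: "adjoint_of (self_module C) (self_module C) (inc C c) = inc C (star c)" if "c \<in> C" for c
    by (rule hilbert.adjoint_of_eq[OF hilbert_self_module[OF C] is_adjoint_inc(1)[OF C that]])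
  have F: "\<And>x y. x \<in> B \<Longrightarrow> y \<in> B \<Longrightarrow> f (x + y) = (\<lambda>c\<in>C. f x c + f y c)"
    "\<And>x k. x \<in> B \<Longrightarrow> f (k *\<^sub>C x) = (\<lambda>c\<in>C. k *\<^sub>C f x c)"
    "\<And>x y. x \<in> B \<Longrightarrow> y \<in> B \<Longrightarrow> f (x * y) = compose C (f x) (f y)"
    "\<And>x. x \<in> B \<Longrightarrow> f (star x) = adjoint_of (self_module C) (self_module C) (f x)"
    using f by (auto simp: star_hom_def star_linear_def multiplier_alg_simps alg_def)
  have inc_add: "(\<lambda>c\<in>C. inc C x c + inc C y c) = inc C (x + y)"
      and inc_mult: "compose C (inc C x) (inc C y) = inc C (x * y)" if "x \<in> C" "y \<in> C" for x y
    using that by (simp_all add: inc_def compose_def clC distrib_right mult.assoc cong: restrict_cong)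
  have inc_scale: "(\<lambda>c\<in>C. k *\<^sub>C inc C x c) = inc C (k *\<^sub>C x)" if "x \<in> C" for x k
    using that by (simp add: inc_def clC mult_scaleC_left cong: restrict_cong)
  have "r (x + y) = r x + r y" if "x \<in> B" "y \<in> B" for x y
  proof (rule inj)
    show "inc C (r (x + y)) = inc C (r x + r y)"
      using that F(1)[OF that] by (simp add: r clB inc_add)
  qed (use that in \<open>simp_all add: r(1) clB clC\<close>)
  moreover have "r (x * y) = r x * r y" if "x \<in> B" "y \<in> B" for x y
  proof (rule inj)
    show "inc C (r (x * y)) = inc C (r x * r y)"
      using that F(3)[OF that] by (simp add: r clB inc_mult)
  qed (use that in \<open>simp_all add: r(1) clB clC\<close>)
  moreover have "r (star x) = star (r x)" if "x \<in> B" for x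
  proof (rule inj)
    show "inc C (r (star x)) = inc C (star (r x))"
      using that F(4)[OF that] by (simp add: r clB adj)
  qed (use that in \<open>simp_all add: r(1) clB clC\<close>)
  moreover have "r (k *\<^sub>C x) = k *\<^sub>C r x" if "x \<in> B" for x k
  proof (rule inj)
    show "inc C (r (k *\<^sub>C x)) = inc C (k *\<^sub>C r x)"
      using that F(2)[OF that, of k] by (simp add: r clB inc_scale)
  qed (use that in \<open>simp_all add: r(1) clB clC\<close>)
  ultimately have "star_hom_on B C r" using B C r(1) by (simp add: star_hom_on_def)
  then show ?thesis using r(2) by blast
qed

text \<open>The supremum is attained at the normalized adjoint of the difference. The first summand
  of the pseudo-metric thereby becomes a norm in \<open>B\<close>.\<close>

lemma opnorm_inc_diff:
  assumes B: "cstar_alg B" and b: "b \<in> B" and c: "c \<in> B"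
  shows "opnorm (self_module B) (\<lambda>x\<in>B. inc B b x - inc B c x) = norm (b - c)"
proof -
  note cl = cstar_alg_closed[OF B]
  have hn: "hnorm (self_module B) x = norm x" for x by (simp add: hnorm_def cstar_identity)
  define d where "d = b - c"
  have dB: "d \<in> B" using b c by (simp add: d_def cl)
  have "(SUP x\<in>{x \<in> B. norm x \<le> 1}. norm (d * x)) = norm d"
  proof (rule cSup_eq_maximum)
    show "norm d \<in> (\<lambda>x. norm (d * x)) ` {x \<in> B. norm x \<le> 1}"
    proof (cases "d = 0")
      case True
      then show ?thesis using cl(2) by (auto intro!: image_eqI[of _ _ 0])
    next
      case False
      let ?x = "(1 / norm d) *\<^sub>R star d"
      have "norm (d * ?x) = norm d" using False by (simp add: norm_mult_star power2_eq_square)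
      moreover have "?x \<in> B" "norm ?x \<le> 1" using False dB by (simp_all add: cl)
      ultimately show ?thesis by (intro image_eqI[of _ _ ?x]) auto
    qed
    fix t assume "t \<in> (\<lambda>x. norm (d * x)) ` {x \<in> B. norm x \<le> 1}"
    then obtain x where "t = norm (d * x)" "norm x \<le> 1" by blast
    then show "t \<le> norm d" using norm_mult_ineq[of d x] mult_left_le[of "norm x" "norm d"] by simp
  qed
  moreover have "(\<lambda>x\<in>B. inc B b x - inc B c x) x = d * x" if "x \<in> B" for x
    using that b c by (simp add: inc_def d_def left_diff_distrib)
  ultimately show ?thesis
    unfolding opnorm_def hn d_def by (simp cong: SUP_cong_simp)
qed

context hilbert
begin

lemma topspace_norm_topology: "topspace (norm_topology E) = carrier E"
proof -
  have "\<Union> {{y \<in> carrier E. hdist E x y < r} |x r. x \<in> carrier E \<and> 0 < r} = carrier E"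
  proof
    show "carrier E \<subseteq> \<Union> {{y \<in> carrier E. hdist E x y < r} |x r. x \<in> carrier E \<and> 0 < r}"
    proof
      fix x assume x: "x \<in> carrier E"
      then have "x \<in> {y \<in> carrier E. hdist E x y < 1}" by simp
      with x show "x \<in> \<Union> {{y \<in> carrier E. hdist E x y < r} |x r. x \<in> carrier E \<and> 0 < r}"
        by (intro UnionI[of "{y \<in> carrier E. hdist E x y < 1}"] CollectI exI[of _ x] exI[of _ "1::real"]) simp_all
    qed
  qed auto
  then show ?thesis by (simp add: norm_topology_def)
qed

text \<open>The pseudo-metrics see vectors only through distances to a fixed one; the triangle
  inequality fits a ball around each point of a preimage.\<close>

lemma continuous_map_hdist:
  assumes x: "x \<in> carrier E"
  shows "continuous_map (norm_topology E) euclideanreal (hdist E x)"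
  unfolding continuous_map_def topspace_norm_topology
proof (intro conjI allI impI)
  fix S :: "real set" assume S: "openin euclideanreal S"
  show "openin (norm_topology E) {y \<in> carrier E. hdist E x y \<in> S}"
  proof (subst openin_subopen, intro ballI)
    fix y assume y: "y \<in> {y \<in> carrier E. hdist E x y \<in> S}"
    then obtain e where e: "e > 0" "\<And>t. \<bar>t - hdist E x y\<bar> < e \<Longrightarrow> t \<in> S"
      using S unfolding open_openin[symmetric] open_dist dist_real_def by blast
    let ?N = "{z \<in> carrier E. hdist E y z < e}"
    have "openin (norm_topology E) ?N"
      unfolding norm_topology_def using y e(1) by (intro topology_generated_by_Basis) auto
    moreover have "y \<in> ?N" using y e(1) by simp
    moreover have "?N \<subseteq> {y \<in> carrier E. hdist E x y \<in> S}"
    proof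
      fix z assume z: "z \<in> ?N"
      then have "\<bar>hdist E x z - hdist E x y\<bar> < e"
        using hdist_triangle[of x y z] hdist_triangle[of x z y] hdist_sym[of y z] x y by (simp add: abs_less_iff)
      then show "z \<in> {y \<in> carrier E. hdist E x y \<in> S}" using e(2) z by simp
    qed
    ultimately show "\<exists>T. openin (norm_topology E) T \<and> y \<in> T \<and> T \<subseteq> {y \<in> carrier E. hdist E x y \<in> S}" by blast
  qed
qed simp

end

locale continuous_correspondence = correspondence A B G \<alpha> \<beta> E \<phi>
  for A :: "'a::cstar_algebra set" and B :: "'b::cstar_algebra set"
    and G :: "('g, 'z) monoid_scheme" and \<alpha> \<beta> and E :: "('b, 'e) hmodule" and \<phi> +
  fixes \<T> :: "'g topology"
  assumes contA: "continuous_system A G \<T> \<alpha>" and contB: "continuous_system B G \<T> \<beta>"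
begin

lemma topspace_T: "topspace \<T> = carrier G"
  using contA by (simp add: continuous_system_def topological_group_def)

lemma cstar_B: "cstar_alg B"
  using sysB by (simp add: dynamical_system_def)

lemma beta_closed: "g \<in> carrier G \<Longrightarrow> b \<in> B \<Longrightarrow> \<beta> g b \<in> B"
  using star_hom_onD(3)[OF star_autD(1)[OF cstar_B beta(1)]] .

abbreviation "X \<equiv> (E, \<phi>)"

text \<open>
  The centre \<open>f\<^sub>0\<close> of a ball in the hom-set is an arbitrary morphism, not one that comes from an
  automorphism of \<open>B\<close>.
\<close>

lemma poscor_dist_eq:
  assumes f0: "f0 \<in> poscor_hom A X X" and x: "x \<in> carrier E" and b: "b \<in> B"
  shows "\<exists>b0\<in>B. \<exists>y0\<in>carrier E. \<exists>a0. \<forall>g\<in>carrier G. \<forall>\<eta>.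
    poscor_dist X X b x a f0 (\<rho> g, \<eta>, \<alpha> g) = norm (b0 - \<beta> g b) + hdist E y0 (\<eta> (V g x)) + norm (a0 - \<alpha> g a)"
proof -
  obtain \<rho>\<^sub>0 \<eta>\<^sub>0 \<alpha>\<^sub>0 where f0_eq: "f0 = (\<rho>\<^sub>0, \<eta>\<^sub>0, \<alpha>\<^sub>0)" by (cases f0)
  have h: "\<rho>\<^sub>0 \<in> star_hom (alg B) (multiplier_alg B)" "\<rho>\<^sub>0 ` B \<subseteq> inc B ` B"
      "\<eta>\<^sub>0 \<in> adjointable (interior_tensor E \<rho>\<^sub>0 B) E"
    using f0 by (auto simp: f0_eq poscor_hom_def base_E)
  obtain r where r: "star_hom_on B B r" "\<And>b. b \<in> B \<Longrightarrow> \<rho>\<^sub>0 b = inc B (r b)"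
    using star_hom_through_inc[OF cstar_B cstar_B h(1,2)] by blast
  \<comment> \<open>Here the tensor product along an arbitrary homomorphism enters; that it is a
    Hilbert module rests on \<open>cpos_gram\<close>. It is needed to place the value of
    \<open>tensor_V\<close> in the domain of the given operator.\<close>
  interpret t: tensor E B r \<rho>\<^sub>0
    using r by (intro tensor.intro tensor_axioms.intro hilbert_E) (simp_all add: base_E inc_def star_hom_onD)
  have y0: "\<eta>\<^sub>0 (tensor_V E \<rho>\<^sub>0 B x) \<in> carrier E"
    by (rule adjointableD(2)[OF t.D.hilbert_axioms h(3) t.V_closed[OF x]])
  show ?thesis
  proof (rule bexI[of _ "r b"], rule bexI[of _ "\<eta>\<^sub>0 (tensor_V E \<rho>\<^sub>0 B x)"], rule exI[of _ "\<alpha>\<^sub>0 a"], intro ballI allI)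
    show "r b \<in> B" using star_hom_onD(3)[OF r(1) b] .
    show "poscor_dist X X b x a f0 (\<rho> g, \<eta>, \<alpha> g) =
        norm (r b - \<beta> g b) + hdist E (\<eta>\<^sub>0 (tensor_V E \<rho>\<^sub>0 B x)) (\<eta> (V g x)) + norm (\<alpha>\<^sub>0 a - \<alpha> g a)"
      if g: "g \<in> carrier G" for g \<eta>
      using opnorm_inc_diff[OF cstar_B star_hom_onD(3)[OF r(1) b] beta_closed[OF g b]] b
      by (simp add: poscor_dist_def f0_eq base_E compose_eq r(2))
  qed (rule y0)
qed

text \<open>In one direction \<open>b = 0\<close> and \<open>a = 0\<close> make the pseudo-metric an
  upper bound for the distance between \<open>W g x\<close> and \<open>W h x\<close>. In the other,
  the distance of \<open>M g\<close> from a fixed centre is a sum of three continuous real functions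
  of \<open>g\<close>.\<close>

lemma continuous_iff:
  assumes hom: "\<And>g. g \<in> carrier G \<Longrightarrow> (\<rho> g, \<eta> g, \<alpha> g) \<in> poscor_hom A X X"
    and M: "\<And>g. g \<in> carrier G \<Longrightarrow> M g = (\<rho> g, \<eta> g, \<alpha> g)"
    and W: "\<And>g x. g \<in> carrier G \<Longrightarrow> x \<in> carrier E \<Longrightarrow> W g x = \<eta> g (V g x)"
  shows "continuous_map \<T> (poscor_top A X X) M \<longleftrightarrow> (\<forall>x\<in>carrier E. continuous_map \<T> (norm_topology E) (\<lambda>g. W g x))"
proof -
  interpret hilbert E by (rule hilbert_E)
  have WE: "W g x \<in> carrier E" if "g \<in> carrier G" "x \<in> carrier E" for g x
  proof -
    have "\<eta> g \<in> adjointable (D g) E" using hom[OF that(1)] by (simp add: poscor_hom_iff[OF that(1)])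
    then show ?thesis
      unfolding W[OF that] by (rule adjointableD(2)[OF D_hilbert[OF that(1)]]) (use that in simp)
  qed
  let ?S = "{{f \<in> poscor_hom A X X. poscor_dist X X b x a f0 f < r} |b x a f0 r.
        b \<in> base (fst X) \<and> x \<in> carrier (fst X) \<and> a \<in> A \<and> f0 \<in> poscor_hom A X X \<and> 0 < r}"
  have self: "poscor_dist X X b x a (\<rho> g, \<eta> g, \<alpha> g) (\<rho> h, \<eta> h, \<alpha> h) =
      norm (\<beta> g b - \<beta> h b) + hdist E (W g x) (W h x) + norm (\<alpha> g a - \<alpha> h a)"
    if "g \<in> carrier G" "h \<in> carrier G" "b \<in> B" "x \<in> carrier E" for g h b x a
    using that opnorm_inc_diff[OF cstar_B beta_closed[OF that(1,3)] beta_closed[OF that(2,3)]]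
    by (simp add: poscor_dist_def base_E compose_eq W)
  show ?thesis
  proof
    assume M_cont: "continuous_map \<T> (poscor_top A X X) M"
    show "\<forall>x\<in>carrier E. continuous_map \<T> (norm_topology E) (\<lambda>g. W g x)"
    proof
      fix x assume x: "x \<in> carrier E"
      show "continuous_map \<T> (norm_topology E) (\<lambda>g. W g x)"
        unfolding norm_topology_def continuous_on_generated_topo_iff topspace_T
      proof (intro conjI allI impI)
        have "(\<lambda>g. W g x) ` carrier G \<subseteq> topspace (norm_topology E)"
          using WE x by (auto simp: topspace_norm_topology)
        then show "(\<lambda>g. W g x) ` carrier G \<subseteq> \<Union> {{y \<in> carrier E. hdist E x y < r} |x r. x \<in> carrier E \<and> 0 < r}"
          by (simp add: norm_topology_def)
        fix N assume "N \<in> {{y \<in> carrier E. hdist E x y < r} |x r. x \<in> carrier E \<and> 0 < r}"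
        then obtain x0 r where N: "N = {y \<in> carrier E. hdist E x0 y < r}" "x0 \<in> carrier E" by blast
        show "openin \<T> ((\<lambda>g. W g x) -` N \<inter> carrier G)"
        proof (subst openin_subopen, intro ballI)
          fix g assume "g \<in> (\<lambda>g. W g x) -` N \<inter> carrier G"
          then have g: "g \<in> carrier G" "hdist E x0 (W g x) < r" by (simp_all add: N)
          \<comment> \<open>The radius is the room left around \<open>W g x\<close> in the ball
            \<open>N\<close>, so the triangle inequality keeps nearby values inside
            \<open>N\<close>.\<close>
          let ?Q = "{f \<in> poscor_hom A X X. poscor_dist X X 0 x 0 (M g) f < r - hdist E x0 (W g x)}"
          have "?Q \<in> ?S"
            using g x hom[OF g(1)] cstar_alg_closed(2)[OF cstar_A] cstar_alg_closed(2)[OF cstar_B]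
            by (intro CollectI exI[of _ 0] exI[of _ x] exI[of _ 0] exI[of _ "M g"] exI[of _ "r - hdist E x0 (W g x)"])
              (simp_all add: M base_E)
          then have "openin \<T> (M -` ?Q \<inter> carrier G)"
            using M_cont unfolding poscor_top_def continuous_on_generated_topo_iff topspace_T by blast
          moreover have "g \<in> M -` ?Q \<inter> carrier G"
            using g x hom[OF g(1)] cstar_alg_closed(2)[OF cstar_B] WE by (simp add: M self)
          moreover have "M -` ?Q \<inter> carrier G \<subseteq> (\<lambda>g. W g x) -` N \<inter> carrier G"
          proof
            fix h assume "h \<in> M -` ?Q \<inter> carrier G"
            then have h: "h \<in> carrier G" "poscor_dist X X 0 x 0 (M g) (M h) < r - hdist E x0 (W g x)" by auto
            then have "norm (\<beta> g 0 - \<beta> h 0) + hdist E (W g x) (W h x) + norm (\<alpha> g 0 - \<alpha> h 0) < r - hdist E x0 (W g x)"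
              using g x cstar_alg_closed(2)[OF cstar_B] by (simp add: M self)
            then have "hdist E (W g x) (W h x) < r - hdist E x0 (W g x)"
              using norm_ge_zero[of "\<beta> g 0 - \<beta> h 0"] norm_ge_zero[of "\<alpha> g 0 - \<alpha> h 0"] by linarith
            then have "hdist E x0 (W h x) < r"
              using hdist_triangle[of x0 "W g x" "W h x"] WE g h x N(2) by simp
            then show "h \<in> (\<lambda>g. W g x) -` N \<inter> carrier G" using h WE x by (simp add: N)
          qed
          ultimately show "\<exists>T. openin \<T> T \<and> g \<in> T \<and> T \<subseteq> (\<lambda>g. W g x) -` N \<inter> carrier G" by blast
        qed
      qed
    qed
  next
    assume W_cont: "\<forall>x\<in>carrier E. continuous_map \<T> (norm_topology E) (\<lambda>g. W g x)"
    show "continuous_map \<T> (poscor_top A X X) M"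
      unfolding poscor_top_def continuous_on_generated_topo_iff topspace_T
    proof (intro conjI allI impI)
      show "M ` carrier G \<subseteq> \<Union> ?S"
      proof
        fix f assume "f \<in> M ` carrier G"
        then obtain g where g: "g \<in> carrier G" "f = M g" by blast
        \<comment> \<open>A generated topology lives on the union of its generating sets, so each
          \<open>M g\<close> has to be placed in one of them.\<close>
        let ?Q = "{f' \<in> poscor_hom A X X. poscor_dist X X 0 \<zero>\<^bsub>E\<^esub> 0 (M g) f' < 1}"
        have "?Q \<in> ?S"
          using g hom[OF g(1)] cstar_alg_closed(2)[OF cstar_A] cstar_alg_closed(2)[OF cstar_B]
          by (intro CollectI exI[of _ 0] exI[of _ "\<zero>\<^bsub>E\<^esub>"] exI[of _ 0] exI[of _ "M g"] exI[of _ 1])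
            (simp_all add: M base_E)
        moreover have "f \<in> ?Q"
          using g hom[OF g(1)] cstar_alg_closed(2)[OF cstar_B] WE by (simp add: M self)
        ultimately show "f \<in> \<Union> ?S" by blast
      qed
      fix Q assume "Q \<in> ?S"
      then obtain b x a f0 r where Q: "Q = {f \<in> poscor_hom A X X. poscor_dist X X b x a f0 f < r}"
        "b \<in> B" "x \<in> carrier E" "a \<in> A" "f0 \<in> poscor_hom A X X" by (auto simp: base_E)
      obtain b0 y0 a0 where d: "b0 \<in> B" "y0 \<in> carrier E" "\<And>g \<eta>. g \<in> carrier G \<Longrightarrow>
        poscor_dist X X b x a f0 (\<rho> g, \<eta>, \<alpha> g) = norm (b0 - \<beta> g b) + hdist E y0 (\<eta> (V g x)) + norm (a0 - \<alpha> g a)"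
        using poscor_dist_eq[OF Q(5,3,2), of a] by blast
      define k where "k g = norm (b0 - \<beta> g b) + hdist E y0 (W g x) + norm (a0 - \<alpha> g a)" for g
      have cb: "continuous_map \<T> euclidean (\<lambda>g. \<beta> g b)" and ca: "continuous_map \<T> euclidean (\<lambda>g. \<alpha> g a)"
        using contA contB Q by (auto simp: continuous_system_def)
      have "continuous_map \<T> euclideanreal ((hdist E y0) \<circ> (\<lambda>g. W g x))"
        using W_cont Q(3) by (intro continuous_map_compose[OF _ continuous_map_hdist[OF d(2)]]) blast
      then have "continuous_map \<T> euclideanreal k"
        unfolding k_def o_def
        by (intro continuous_map_add continuous_map_norm continuous_map_diff cb ca) simp_all
      then have "openin \<T> {g \<in> topspace \<T>. k g \<in> {..<r}}"
        by (rule openin_continuous_map_preimage) simp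
      also have "{g \<in> topspace \<T>. k g \<in> {..<r}} = M -` Q \<inter> carrier G"
        using Q(3) by (auto simp: topspace_T Q(1) M hom d(3) k_def W)
      finally show "openin \<T> (M -` Q \<inter> carrier G)" .
    qed
  qed
qed

end

lemma (in continuous_correspondence) continuous_functor_iff:
  assumes F: "is_functor (BG G) (PosCor A) (Fo, Fm)"
    and comp: "compatible_functor A B G \<alpha> \<beta> (Fo, Fm)" and Fo: "Fo () = (E, \<phi>)"
  shows "continuous_map \<T> (poscor_top A X X) (Fm () ()) \<longleftrightarrow>
    (\<forall>x\<in>carrier E. continuous_map \<T> (norm_topology E) (\<lambda>g. snd (corr_of_functor G \<beta> (Fo, Fm)) g x))"
proof (rule continuous_iff)
  fix g assume g: "g \<in> carrier G"
  show Fm: "Fm () () g = (\<rho> g, fst (snd (Fm () () g)), \<alpha> g)"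
    using comp g by (auto simp: compatible_functor_def)
  have "Fm () () g \<in> poscor_hom A X X"
    using F g by (auto simp: is_functor_BG Fo PiE_def Pi_def)
  then show "(\<rho> g, fst (snd (Fm () () g)), \<alpha> g) \<in> poscor_hom A X X" by (subst (asm) Fm)
  show "snd (corr_of_functor G \<beta> (Fo, Fm)) g x = fst (snd (Fm () () g)) (V g x)" if "x \<in> carrier E" for x
    using g that by (simp add: corr_of_functor_def Fo base_E compose_eq)
qed

section \<open>The algebraic bijection and its restriction to continuous data\<close>

lemma is_topological_functor_BG:
  "is_topological_functor (BG_top G \<T>) (PosCor A) (Fo, Fm) \<longleftrightarrow>
    is_functor (BG G) (PosCor A) (Fo, Fm) \<and> continuous_map \<T> (poscor_top A (Fo ()) (Fo ())) (Fm () ())"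
proof -
  have "is_functor (BG_top G \<T>) (PosCor A) (Fo, Fm) = is_functor (BG G) (PosCor A) (Fo, Fm)"
    by (simp add: is_functor_def BG_def BG_top_def category.defs top_category.defs)
  then show ?thesis
    by (simp add: is_topological_functor_def BG_def BG_top_def category.defs top_category.defs PosCor_def)
qed

lemma functor_of_equivariant_corr:
  assumes A: "dynamical_system A G \<alpha>" and B: "dynamical_system B G \<beta>"
    and P: "P \<in> equivariant_corr A B G \<alpha> \<beta>"
  shows "is_functor (BG G) (PosCor A) (functor_of_corr G \<alpha> \<beta> P)"
    "unitary_valued G (functor_of_corr G \<alpha> \<beta> P)"
    "compatible_functor A B G \<alpha> \<beta> (functor_of_corr G \<alpha> \<beta> P)"
    "corr_of_functor G \<beta> (functor_of_corr G \<alpha> \<beta> P) = P"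
proof -
  obtain E \<phi> W where P_eq: "P = ((E, \<phi>), W)" by (metis prod.exhaust)
  interpret correspondence A B G \<alpha> \<beta> E \<phi>
    using A B P by unfold_locales (auto simp: P_eq equivariant_corr_def)
  show "is_functor (BG G) (PosCor A) (functor_of_corr G \<alpha> \<beta> P)"
    "unitary_valued G (functor_of_corr G \<alpha> \<beta> P)"
    "compatible_functor A B G \<alpha> \<beta> (functor_of_corr G \<alpha> \<beta> P)"
    "corr_of_functor G \<beta> (functor_of_corr G \<alpha> \<beta> P) = P"
    using functor_of_equivariant P unfolding P_eq by blast+
qed

lemma equivariant_corr_of_functor:
  assumes A: "dynamical_system A G \<alpha>" and B: "dynamical_system B G \<beta>"
    and F: "is_functor (BG G) (PosCor A) F" "unitary_valued G F" "compatible_functor A B G \<alpha> \<beta> F"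
  shows "corr_of_functor G \<beta> F \<in> equivariant_corr A B G \<alpha> \<beta>"
    "functor_of_corr G \<alpha> \<beta> (corr_of_functor G \<beta> F) = F"
proof -
  obtain Fo Fm where F_eq: "F = (Fo, Fm)" by (cases F)
  obtain E \<phi> where Fo: "Fo () = (E, \<phi>)" by (cases "Fo ()")
  interpret correspondence A B G \<alpha> \<beta> E \<phi>
    using A B F(3) by unfold_locales (auto simp: F_eq Fo compatible_functor_def)
  show "corr_of_functor G \<beta> F \<in> equivariant_corr A B G \<alpha> \<beta>"
    "functor_of_corr G \<alpha> \<beta> (corr_of_functor G \<beta> F) = F"
    using equivariant_of_functor(1,2)[OF F[unfolded F_eq] Fo] unfolding F_eq by blast+
qed

text \<open>A functor and its equivariant correspondence are already matched algebraically, so only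
  the two continuity conditions remain to be compared; the continuous bijection is then a
  restriction of the algebraic one.\<close>

lemma topological_functor_iff:
  assumes A: "continuous_system A G \<T> \<alpha>" and B: "continuous_system B G \<T> \<beta>"
    and F: "is_functor (BG G) (PosCor A) F" "unitary_valued G F" "compatible_functor A B G \<alpha> \<beta> F"
  shows "is_topological_functor (BG_top G \<T>) (PosCor A) F \<longleftrightarrow>
    corr_of_functor G \<beta> F \<in> continuous_equivariant_corr A B G \<T> \<alpha> \<beta>"
proof -
  obtain Fo Fm where F_eq: "F = (Fo, Fm)" by (cases F)
  obtain E \<phi> where Fo: "Fo () = (E, \<phi>)" by (cases "Fo ()")
  interpret continuous_correspondence A B G \<alpha> \<beta> E \<phi> \<T>
    using A B F(3) by unfold_locales (auto simp: F_eq Fo compatible_functor_def continuous_system_def)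
  define W where "W = snd (corr_of_functor G \<beta> F)"
  have "fst (corr_of_functor G \<beta> F) = (E, \<phi>)"
    using equivariant_of_functor(3)[OF F[unfolded F_eq] Fo] by (simp add: F_eq)
  then have c: "corr_of_functor G \<beta> F = ((E, \<phi>), W)" by (simp add: W_def prod_eq_iff)
  have W: "((E, \<phi>), W) \<in> equivariant_corr A B G \<alpha> \<beta>"
    using equivariant_of_functor(1)[OF F[unfolded F_eq] Fo] by (simp add: F_eq flip: c)
  have W': "snd (corr_of_functor G \<beta> (Fo, Fm)) = W" by (simp add: W_def flip: F_eq)
  have "is_topological_functor (BG_top G \<T>) (PosCor A) F \<longleftrightarrow> continuous_map \<T> (poscor_top A X X) (Fm () ())"
    using F(1)[unfolded F_eq] unfolding F_eq is_topological_functor_BG Fo by blast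
  also have "\<dots> \<longleftrightarrow> (\<forall>x\<in>carrier E. continuous_map \<T> (norm_topology E) (\<lambda>g. W g x))"
    by (rule continuous_functor_iff[OF F(1)[unfolded F_eq] F(3)[unfolded F_eq] Fo, unfolded W'])
  also have "\<dots> \<longleftrightarrow> ((E, \<phi>), W) \<in> continuous_equivariant_corr A B G \<T> \<alpha> \<beta>"
    using W by (simp add: continuous_equivariant_corr_def)
  finally show ?thesis unfolding c .
qed

lemma bij_betw_inverses:
  assumes "\<And>p. p \<in> S \<Longrightarrow> f p \<in> T \<and> g (f p) = p" "\<And>q. q \<in> T \<Longrightarrow> g q \<in> S \<and> f (g q) = q"
  shows "bij_betw f S T \<and> bij_betw g T S \<and> (\<forall>p\<in>S. g (f p) = p) \<and> (\<forall>q\<in>T. f (g q) = q)"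
proof (intro conjI)
  show "bij_betw f S T" by (rule bij_betw_byWitness[where f' = g]) (use assms in auto)
  show "bij_betw g T S" by (rule bij_betw_byWitness[where f' = f]) (use assms in auto)
qed (use assms in auto)

theorem theorem6p7:
  fixes A :: "'a::cstar_algebra set" and B :: "'b::cstar_algebra set"
    and G :: "('g, 'z) monoid_scheme"
    and \<alpha> :: "'g \<Rightarrow> 'a \<Rightarrow> 'a" and \<beta> :: "'g \<Rightarrow> 'b \<Rightarrow> 'b"
  shows
    "let \<Phi> = (functor_of_corr G \<alpha> \<beta>
                :: ('a, 'b, 'e) corr \<times> ('g \<Rightarrow> 'e \<Rightarrow> 'e) \<Rightarrow> ('a, 'b, 'e, 'g) poscor_functor);
         \<Psi> = (corr_of_functor G \<beta>
                :: ('a, 'b, 'e, 'g) poscor_functor \<Rightarrow> ('a, 'b, 'e) corr \<times> ('g \<Rightarrow> 'e \<Rightarrow> 'e))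
     in
     (\<forall>\<T>. continuous_system A G \<T> \<alpha> \<and> continuous_system B G \<T> \<beta> \<longrightarrow>
        (let \<E> = continuous_equivariant_corr A B G \<T> \<alpha> \<beta>;
             \<F> = {F. is_topological_functor (BG_top G \<T>) (PosCor A) F \<and>
                     unitary_valued G F \<and> compatible_functor A B G \<alpha> \<beta> F}
         in bij_betw \<Phi> \<E> \<F> \<and> bij_betw \<Psi> \<F> \<E> \<and>
            (\<forall>P\<in>\<E>. \<Psi> (\<Phi> P) = P) \<and> (\<forall>F\<in>\<F>. \<Phi> (\<Psi> F) = F)))
     \<and>
     (dynamical_system A G \<alpha> \<and> dynamical_system B G \<beta> \<longrightarrow>
        (let \<E> = equivariant_corr A B G \<alpha> \<beta>;
             \<F> = {F. is_functor (BG G) (PosCor A) F \<and>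
                     unitary_valued G F \<and> compatible_functor A B G \<alpha> \<beta> F}
         in bij_betw \<Phi> \<E> \<F> \<and> bij_betw \<Psi> \<F> \<E> \<and>
            (\<forall>P\<in>\<E>. \<Psi> (\<Phi> P) = P) \<and> (\<forall>F\<in>\<F>. \<Phi> (\<Psi> F) = F)))"
  unfolding Let_def
\<comment> \<open>Only the outer conjunction is split; the instantiated pattern leaves the
  conjunctions inside the two cases intact.\<close>
proof (intro conjI[of "\<forall>\<T>. _ \<T> \<longrightarrow> _ \<T>"] allI impI, goal_cases)
  case (1 \<T>)
  then have A: "continuous_system A G \<T> \<alpha>" and B: "continuous_system B G \<T> \<beta>" by simp_all
  then have A': "dynamical_system A G \<alpha>" and B': "dynamical_system B G \<beta>"
    by (simp_all add: continuous_system_def)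
  show ?case
  proof (rule bij_betw_inverses)
    fix P :: "('a, 'b, 'e) corr \<times> ('g \<Rightarrow> 'e \<Rightarrow> 'e)"
    assume P: "P \<in> continuous_equivariant_corr A B G \<T> \<alpha> \<beta>"
    then have P': "P \<in> equivariant_corr A B G \<alpha> \<beta>" by (auto simp: continuous_equivariant_corr_def)
    note F = functor_of_equivariant_corr[OF A' B' P']
    show "functor_of_corr G \<alpha> \<beta> P \<in> {F. is_topological_functor (BG_top G \<T>) (PosCor A) F \<and>
        unitary_valued G F \<and> compatible_functor A B G \<alpha> \<beta> F} \<and> corr_of_functor G \<beta> (functor_of_corr G \<alpha> \<beta> P) = P"
      \<comment> \<open>Since the round trip returns \<open>P\<close>, the equivalence derives
        continuity of the functor from that of \<open>P\<close>.\<close>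
      using P F topological_functor_iff[OF A B F(1-3)] by simp
  next
    fix F :: "('a, 'b, 'e, 'g) poscor_functor"
    assume F: "F \<in> {F. is_topological_functor (BG_top G \<T>) (PosCor A) F \<and>
        unitary_valued G F \<and> compatible_functor A B G \<alpha> \<beta> F}"
    then have F1: "is_functor (BG G) (PosCor A) F" by (cases F) (simp add: is_topological_functor_BG)
    have F2: "unitary_valued G F" "compatible_functor A B G \<alpha> \<beta> F" using F by simp_all
    show "corr_of_functor G \<beta> F \<in> continuous_equivariant_corr A B G \<T> \<alpha> \<beta> \<and>
        functor_of_corr G \<alpha> \<beta> (corr_of_functor G \<beta> F) = F"
      using F topological_functor_iff[OF A B F1 F2] equivariant_corr_of_functor(2)[OF A' B' F1 F2] by simp
  qed
next
  case 2
  then have A: "dynamical_system A G \<alpha>" and B: "dynamical_system B G \<beta>" by simp_all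
  show ?case
    by (rule bij_betw_inverses)
      (use functor_of_equivariant_corr[OF A B] equivariant_corr_of_functor[OF A B] in auto)
qed

end
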